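(* Let $(M,\varphi,\xi,\eta,g)$ be a $(2n+1)$-dimensional paracontact metric manifold. Then the following assertions are equivalent: 1) $Q\xi=-2n\,\xi$; 2) $\xi$ is an infinitesimal harmonic transformation (equivalently, $1$-harmonic); 3) $M$ is $H$-paracontact and $\mathrm{tr}\,h^2=0$.
   Context: All manifolds are smooth and connected. A $(2n+1)$-dimensional contact manifold is a manifold $M^{2n+1}$ with a global 1-form $\eta$ such that $\eta\wedge(d\eta)^n\neq 0$ everywhere; its Reeb vector field $\xi$ is the unique vector field with $\eta(\xi)=1$, $d\eta(\xi,\cdot)=0$. A paracontact metric structure $(\varphi,\xi,\eta,g)$ on $M$ consists of such $\eta,\xi$, a semi-Riemannian metric $g$ and a $(1,1)$-tensor $\varphi$ with $\eta=g(\xi,\cdot)$, $d\eta(\cdot,\cdot)=g(\cdot,\varphi\,\cdot)$, $\varphi^2=I-\eta\otimes\xi$ (here $2\,d\eta(X,Y)=X\eta(Y)-Y\eta(X)-\eta([X,Y])$). $\nabla$ is the Levi-Civita connection, $\varrho$ the usual Ricci tensor, $Q$ the Ricci operator, $g(QX,Y)=\varrho(X,Y)$, and $h=\frac12\mathcal L_\xi\varphi$. A vector field $V$ on a semi-Riemannian manifold is an infinitesimal harmonic transformation (also called $1$-harmonic) if $\mathrm{tr}(L_V\nabla)=0$, where $L_V\nabla$ is the Lie derivative of the Levi-Civita connection and the trace is with respect to $g$; equivalently, $\bar\Delta V=QV$, where $\bar\Delta V=-\mathrm{tr}\,\nabla^2V=\sum_i\varepsilon_i(\nabla_{\nabla_{E_i}E_i}V-\nabla_{E_i}\nabla_{E_i}V)$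 for a local pseudo-orthonormal frame $\{E_i\}$, $\varepsilon_i=g(E_i,E_i)=\pm1$. A paracontact metric manifold is $H$-paracontact if $\xi$ is a harmonic vector field. Here the energy of a vector field $V$ is the energy of the map $V:(M,g)\to(TM,g^s)$, $g^s$ the Sasaki metric (over relatively compact domains if $M$ is non-compact); a vector field $V$ of constant length $g(V,V)=r\neq0$ is harmonic if it is a critical point of the energy restricted to vector fields of the same constant length $r$; equivalently, $\bar\Delta V$ is collinear to $V$. *)

theory Defs
  imports "HOL-Analysis.Analysis" "HOL-Library.Function_Algebras"
begin

section \<open>Smooth manifolds\<close>

fun Ck_on :: "nat \<Rightarrow> 'a::real_normed_vector set \<Rightarrow> ('a \<Rightarrow> 'b::real_normed_vector) \<Rightarrow> bool" where
  "Ck_on 0 S f \<longleftrightarrow> continuous_on S f"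
| "Ck_on (Suc k) S f \<longleftrightarrow> (\<forall>x\<in>S. f differentiable at x) \<and>
     (\<forall>v. Ck_on k S (\<lambda>x. frechet_derivative f (at x) v))"

text \<open>Only used for open \<open>S\<close>.\<close>
definition smooth_on :: "'a::real_normed_vector set \<Rightarrow> ('a \<Rightarrow> 'b::real_normed_vector) \<Rightarrow> bool" where
  "smooth_on S f \<longleftrightarrow> (\<forall>k. Ck_on k S f)"

text \<open>A chart is a domain together with a coordinate map, whose values outside the domain
  are irrelevant.\<close>
type_synonym ('m, 'd) chart = "'m set \<times> ('m \<Rightarrow> real ^ 'd)"

definition chart_inv :: "('m, 'd) chart \<Rightarrow> real ^ 'd \<Rightarrow> 'm" where
  "chart_inv c = inv_into (fst c) (snd c)"

text \<open>The manifold is the whole type \<open>'m\<close>; its dimension is \<open>CARD('d)\<close>.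
  The atlas need not be maximal.\<close>
definition smooth_manifold ::
  "('m::{t2_space, second_countable_topology}, 'd::finite) chart set \<Rightarrow> bool" where
  "smooth_manifold A \<longleftrightarrow>
     connected (UNIV :: 'm set) \<and>
     (\<Union>c\<in>A. fst c) = UNIV \<and>
     (\<forall>c\<in>A. open (fst c) \<and> open (snd c ` fst c) \<and>
        homeomorphism (fst c) (snd c ` fst c) (snd c) (chart_inv c)) \<and>
     (\<forall>c\<in>A. \<forall>d\<in>A. smooth_on (snd c ` (fst c \<inter> fst d)) (snd d \<circ> chart_inv c))"

definition smooth_fun ::
  "('m::topological_space, 'd::finite) chart set \<Rightarrow> 'm set \<Rightarrow> ('m \<Rightarrow> real) \<Rightarrow> bool" where
  "smooth_fun A U f \<longleftrightarrow> (\<forall>c\<in>A. smooth_on (snd c ` (U \<inter> fst c)) (f \<circ> chart_inv c))"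

definition smooth_near ::
  "('m::topological_space, 'd::finite) chart set \<Rightarrow> 'm \<Rightarrow> ('m \<Rightarrow> real) \<Rightarrow> bool" where
  "smooth_near A p f \<longleftrightarrow> (\<exists>U. open U \<and> p \<in> U \<and> smooth_fun A U f)"

section \<open>Tangent vectors, vector fields and tensors\<close>

text \<open>A tangent vector at \<open>p\<close> is identified with its directional derivative, which acts on the
  functions that are smooth near \<open>p\<close> and is extended by \<open>0\<close> to all other functions.
  Addition and zero are the pointwise ones.\<close>
type_synonym 'm tvec = "('m \<Rightarrow> real) \<Rightarrow> real"
type_synonym 'm vfield = "'m \<Rightarrow> 'm tvec"

definition vscale :: "real \<Rightarrow> 'm tvec \<Rightarrow> 'm tvec" (infixr \<open>*\<^sub>v\<close> 75) where
  "a *\<^sub>v v = (\<lambda>f. a * v f)"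

text \<open>The vector with components \<open>v\<close> with respect to the chart \<open>c\<close>.\<close>
definition coord_vec ::
  "('m::topological_space, 'd::finite) chart set \<Rightarrow> ('m, 'd) chart \<Rightarrow> 'm \<Rightarrow> real ^ 'd \<Rightarrow> 'm tvec" where
  "coord_vec A c p v =
     (\<lambda>f. if smooth_near A p f then frechet_derivative (f \<circ> chart_inv c) (at (snd c p)) v else 0)"

definition tangent_space ::
  "('m::topological_space, 'd::finite) chart set \<Rightarrow> 'm \<Rightarrow> 'm tvec set" where
  "tangent_space A p = {coord_vec A c p v | c v. c \<in> A \<and> p \<in> fst c}"

definition smooth_vf ::
  "('m::topological_space, 'd::finite) chart set \<Rightarrow> 'm set \<Rightarrow> 'm vfield \<Rightarrow> bool" where
  "smooth_vf A U X \<longleftrightarrow>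
     (\<forall>p\<in>U. X p \<in> tangent_space A p) \<and>
     (\<forall>W f. open W \<and> W \<subseteq> U \<and> smooth_fun A W f \<longrightarrow> smooth_fun A W (\<lambda>p. X p f))"

definition lie_bracket ::
  "('m::topological_space, 'd::finite) chart set \<Rightarrow> 'm vfield \<Rightarrow> 'm vfield \<Rightarrow> 'm vfield" where
  "lie_bracket A X Y =
     (\<lambda>p f. if smooth_near A p f then X p (\<lambda>q. Y q f) - Y p (\<lambda>q. X q f) else 0)"

definition one_form ::
  "('m::topological_space, 'd::finite) chart set \<Rightarrow> ('m \<Rightarrow> 'm tvec \<Rightarrow> real) \<Rightarrow> bool" where
  "one_form A \<eta> \<longleftrightarrow>
     (\<forall>p. \<forall>v\<in>tangent_space A p. \<forall>w\<in>tangent_space A p. \<forall>a b.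
        \<eta> p (a *\<^sub>v v + b *\<^sub>v w) = a * \<eta> p v + b * \<eta> p w) \<and>
     (\<forall>U X. open U \<and> smooth_vf A U X \<longrightarrow> smooth_fun A U (\<lambda>p. \<eta> p (X p)))"

definition tensor11 ::
  "('m::topological_space, 'd::finite) chart set \<Rightarrow> ('m \<Rightarrow> 'm tvec \<Rightarrow> 'm tvec) \<Rightarrow> bool" where
  "tensor11 A \<phi> \<longleftrightarrow>
     (\<forall>p. \<forall>v\<in>tangent_space A p. \<forall>w\<in>tangent_space A p. \<forall>a b.
        \<phi> p (a *\<^sub>v v + b *\<^sub>v w) = a *\<^sub>v \<phi> p v + b *\<^sub>v \<phi> p w) \<and>
     (\<forall>U X. open U \<and> smooth_vf A U X \<longrightarrow> smooth_vf A U (\<lambda>p. \<phi> p (X p)))"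

text \<open>On a connected manifold the index of such a \<open>g\<close> is automatically constant.\<close>
definition semi_riemannian_metric ::
  "('m::topological_space, 'd::finite) chart set \<Rightarrow> ('m \<Rightarrow> 'm tvec \<Rightarrow> 'm tvec \<Rightarrow> real) \<Rightarrow> bool" where
  "semi_riemannian_metric A g \<longleftrightarrow>
     (\<forall>p. \<forall>u\<in>tangent_space A p. \<forall>v\<in>tangent_space A p. \<forall>w\<in>tangent_space A p. \<forall>a b.
        g p (a *\<^sub>v u + b *\<^sub>v v) w = a * g p u w + b * g p v w) \<and>
     (\<forall>p. \<forall>v\<in>tangent_space A p. \<forall>w\<in>tangent_space A p. g p v w = g p w v) \<and>
     (\<forall>p. \<forall>v\<in>tangent_space A p. (\<forall>w\<in>tangent_space A p. g p v w = 0) \<longrightarrow> v = 0) \<and>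
     (\<forall>U X Y. open U \<and> smooth_vf A U X \<and> smooth_vf A U Y \<longrightarrow>
        smooth_fun A U (\<lambda>p. g p (X p) (Y p)))"

definition local_extension ::
  "('m::topological_space, 'd::finite) chart set \<Rightarrow> 'm \<Rightarrow> 'm tvec \<Rightarrow> 'm vfield \<Rightarrow> bool" where
  "local_extension A p v X \<longleftrightarrow> (\<exists>U. open U \<and> p \<in> U \<and> smooth_vf A U X) \<and> X p = v"

text \<open>An operator on local vector fields that is linear over the smooth functions defines a
  tensor: its value at \<open>p\<close> depends only on the values at \<open>p\<close> of the fields it is applied to.\<close>
definition tensor_at1 ::
  "('m::topological_space, 'd::finite) chart set \<Rightarrow> ('m vfield \<Rightarrow> 'm \<Rightarrow> 'r) \<Rightarrow>
   'm \<Rightarrow> 'm tvec \<Rightarrow> 'r" where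
  "tensor_at1 A F p u = (THE r. \<forall>X. local_extension A p u X \<longrightarrow> F X p = r)"

definition tensor_at2 ::
  "('m::topological_space, 'd::finite) chart set \<Rightarrow> ('m vfield \<Rightarrow> 'm vfield \<Rightarrow> 'm \<Rightarrow> 'r) \<Rightarrow>
   'm \<Rightarrow> 'm tvec \<Rightarrow> 'm tvec \<Rightarrow> 'r" where
  "tensor_at2 A F p u v =
     (THE r. \<forall>X Y. local_extension A p u X \<and> local_extension A p v Y \<longrightarrow> F X Y p = r)"

definition tensor_at3 ::
  "('m::topological_space, 'd::finite) chart set \<Rightarrow>
   ('m vfield \<Rightarrow> 'm vfield \<Rightarrow> 'm vfield \<Rightarrow> 'm \<Rightarrow> 'r) \<Rightarrow>
   'm \<Rightarrow> 'm tvec \<Rightarrow> 'm tvec \<Rightarrow> 'm tvec \<Rightarrow> 'r" where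
  "tensor_at3 A F p u v w =
     (THE r. \<forall>X Y Z. local_extension A p u X \<and> local_extension A p v Y \<and> local_extension A p w Z
        \<longrightarrow> F X Y Z p = r)"

text \<open>The trace of an endomorphism of the tangent space at \<open>p\<close>, computed as
  \<open>\<Sum>i. dx\<^sup>i (L \<partial>\<^sub>i)\<close>; it does not depend on the chart.\<close>
definition endo_trace ::
  "('m::topological_space, 'd::finite) chart set \<Rightarrow> 'm \<Rightarrow> ('m tvec \<Rightarrow> 'm tvec) \<Rightarrow> real" where
  "endo_trace A p L =
     (let c = (SOME c. c \<in> A \<and> p \<in> fst c)
      in \<Sum>i\<in>UNIV. L (coord_vec A c p (axis i 1)) (\<lambda>q. snd c q $ i))"

definition pseudo_orthonormal ::
  "('m::topological_space, 'd::finite) chart set \<Rightarrow> ('m \<Rightarrow> 'm tvec \<Rightarrow> 'm tvec \<Rightarrow> real) \<Rightarrow>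
   'm \<Rightarrow> ('d \<Rightarrow> 'm tvec) \<Rightarrow> bool" where
  "pseudo_orthonormal A g p E \<longleftrightarrow>
     (\<forall>i. E i \<in> tangent_space A p) \<and>
     (\<forall>i j. i \<noteq> j \<longrightarrow> g p (E i) (E j) = 0) \<and>
     (\<forall>i. g p (E i) (E i) = 1 \<or> g p (E i) (E i) = - 1)"

text \<open>The trace of a bilinear form with respect to \<open>g\<close>; it does not depend on the
  pseudo-orthonormal basis.\<close>
definition metric_trace ::
  "('m::topological_space, 'd::finite) chart set \<Rightarrow> ('m \<Rightarrow> 'm tvec \<Rightarrow> 'm tvec \<Rightarrow> real) \<Rightarrow>
   'm \<Rightarrow> ('m tvec \<Rightarrow> 'm tvec \<Rightarrow> real) \<Rightarrow> real" where
  "metric_trace A g p B =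
     (let E = (SOME E. pseudo_orthonormal A g p E)
      in \<Sum>i\<in>UNIV. g p (E i) (E i) * B (E i) (E i))"

section \<open>Contact and paracontact metric structures\<close>

text \<open>The convention is \<open>2 d\<eta>(X,Y) = X \<eta>(Y) - Y \<eta>(X) - \<eta>([X,Y])\<close>.\<close>
definition ext_deriv ::
  "('m::topological_space, 'd::finite) chart set \<Rightarrow> ('m \<Rightarrow> 'm tvec \<Rightarrow> real) \<Rightarrow>
   'm \<Rightarrow> 'm tvec \<Rightarrow> 'm tvec \<Rightarrow> real" where
  "ext_deriv A \<eta> = tensor_at2 A (\<lambda>X Y p.
     (X p (\<lambda>q. \<eta> q (Y q)) - Y p (\<lambda>q. \<eta> q (X q)) - \<eta> p (lie_bracket A X Y p)) / 2)"

text \<open>Exterior products of alternating forms on a vector space. A \<open>k\<close>-form takes a sequence of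
  vectors of which only the first \<open>k\<close> matter. The factor \<open>1/(k+l)!\<close> matches the factor \<open>1/2\<close>
  in the convention for \<open>d\<eta>\<close>.\<close>
definition wedge ::
  "nat \<Rightarrow> nat \<Rightarrow> ((nat \<Rightarrow> 'v) \<Rightarrow> real) \<Rightarrow> ((nat \<Rightarrow> 'v) \<Rightarrow> real) \<Rightarrow> (nat \<Rightarrow> 'v) \<Rightarrow> real" where
  "wedge k l \<alpha> \<beta> v =
     (\<Sum>\<sigma> | \<sigma> permutes {..<k + l}.
        of_int (sign \<sigma>) * \<alpha> (\<lambda>i. v (\<sigma> i)) * \<beta> (\<lambda>i. v (\<sigma> (k + i)))) / fact (k + l)"

fun wedge_power2 :: "((nat \<Rightarrow> 'v) \<Rightarrow> real) \<Rightarrow> nat \<Rightarrow> (nat \<Rightarrow> 'v) \<Rightarrow> real" where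
  "wedge_power2 \<omega> 0 = (\<lambda>v. 1)"
| "wedge_power2 \<omega> (Suc k) = wedge 2 (2 * k) \<omega> (wedge_power2 \<omega> k)"

definition contact_form ::
  "('m::topological_space, 'd::finite) chart set \<Rightarrow> nat \<Rightarrow> ('m \<Rightarrow> 'm tvec \<Rightarrow> real) \<Rightarrow> bool" where
  "contact_form A n \<eta> \<longleftrightarrow> one_form A \<eta> \<and>
     (\<forall>p. \<exists>v. (\<forall>i. v i \<in> tangent_space A p) \<and>
        wedge 1 (2 * n) (\<lambda>u. \<eta> p (u 0))
          (wedge_power2 (\<lambda>u. ext_deriv A \<eta> p (u 0) (u 1)) n) v \<noteq> 0)"

definition reeb_field ::
  "('m::topological_space, 'd::finite) chart set \<Rightarrow> ('m \<Rightarrow> 'm tvec \<Rightarrow> real) \<Rightarrow> 'm vfield \<Rightarrow> bool" where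
  "reeb_field A \<eta> \<xi> \<longleftrightarrow> smooth_vf A UNIV \<xi> \<and>
     (\<forall>p. \<eta> p (\<xi> p) = 1 \<and> (\<forall>v\<in>tangent_space A p. ext_deriv A \<eta> p (\<xi> p) v = 0))"

definition paracontact_metric_structure ::
  "('m::topological_space, 'd::finite) chart set \<Rightarrow> nat \<Rightarrow> ('m \<Rightarrow> 'm tvec \<Rightarrow> 'm tvec) \<Rightarrow>
   'm vfield \<Rightarrow> ('m \<Rightarrow> 'm tvec \<Rightarrow> real) \<Rightarrow> ('m \<Rightarrow> 'm tvec \<Rightarrow> 'm tvec \<Rightarrow> real) \<Rightarrow> bool" where
  "paracontact_metric_structure A n \<phi> \<xi> \<eta> g \<longleftrightarrow>
     contact_form A n \<eta> \<and> reeb_field A \<eta> \<xi> \<and> semi_riemannian_metric A g \<and> tensor11 A \<phi> \<and>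
     (\<forall>p. \<forall>v\<in>tangent_space A p. \<eta> p v = g p (\<xi> p) v) \<and>
     (\<forall>p. \<forall>v\<in>tangent_space A p. \<forall>w\<in>tangent_space A p. ext_deriv A \<eta> p v w = g p v (\<phi> p w)) \<and>
     (\<forall>p. \<forall>v\<in>tangent_space A p. \<phi> p (\<phi> p v) = v - \<eta> p v *\<^sub>v \<xi> p)"

text \<open>\<open>h = \<onehalf> L\<^sub>\<xi> \<phi>\<close>\<close>
definition paracontact_h ::
  "('m::topological_space, 'd::finite) chart set \<Rightarrow> ('m \<Rightarrow> 'm tvec \<Rightarrow> 'm tvec) \<Rightarrow> 'm vfield \<Rightarrow>
   'm \<Rightarrow> 'm tvec \<Rightarrow> 'm tvec" where
  "paracontact_h A \<phi> \<xi> = tensor_at1 A (\<lambda>X p.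
     (1/2) *\<^sub>v (lie_bracket A \<xi> (\<lambda>q. \<phi> q (X q)) p - \<phi> p (lie_bracket A \<xi> X p)))"

section \<open>Levi-Civita connection and curvature\<close>

text \<open>A connection is an operator on vector fields that are only required to be smooth on some open
  set. Its values there are determined by the conditions below, and its values
  elsewhere are irrelevant.\<close>
definition levi_civita ::
  "('m::topological_space, 'd::finite) chart set \<Rightarrow> ('m \<Rightarrow> 'm tvec \<Rightarrow> 'm tvec \<Rightarrow> real) \<Rightarrow>
   ('m vfield \<Rightarrow> 'm vfield \<Rightarrow> 'm vfield) \<Rightarrow> bool" where
  "levi_civita A g nabla \<longleftrightarrow> (\<forall>U X Y Z f.
     open U \<and> smooth_vf A U X \<and> smooth_vf A U Y \<and> smooth_vf A U Z \<and> smooth_fun A U f \<longrightarrow>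
     smooth_vf A U (nabla X Y) \<and>
     (\<forall>p\<in>U.
        nabla (X + Y) Z p = nabla X Z p + nabla Y Z p \<and>
        nabla (\<lambda>q. f q *\<^sub>v X q) Y p = f p *\<^sub>v nabla X Y p \<and>
        nabla X (Y + Z) p = nabla X Y p + nabla X Z p \<and>
        nabla X (\<lambda>q. f q *\<^sub>v Y q) p = X p f *\<^sub>v Y p + f p *\<^sub>v nabla X Y p \<and>
        nabla X Y p - nabla Y X p = lie_bracket A X Y p \<and>
        X p (\<lambda>q. g q (Y q) (Z q)) = g p (nabla X Y p) (Z p) + g p (Y p) (nabla X Z p)))"

definition riemann ::
  "('m::topological_space, 'd::finite) chart set \<Rightarrow> ('m vfield \<Rightarrow> 'm vfield \<Rightarrow> 'm vfield) \<Rightarrow>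
   'm \<Rightarrow> 'm tvec \<Rightarrow> 'm tvec \<Rightarrow> 'm tvec \<Rightarrow> 'm tvec" where
  "riemann A nabla = tensor_at3 A (\<lambda>X Y Z p.
     nabla X (nabla Y Z) p - nabla Y (nabla X Z) p - nabla (lie_bracket A X Y) Z p)"

definition ricci ::
  "('m::topological_space, 'd::finite) chart set \<Rightarrow> ('m vfield \<Rightarrow> 'm vfield \<Rightarrow> 'm vfield) \<Rightarrow>
   'm \<Rightarrow> 'm tvec \<Rightarrow> 'm tvec \<Rightarrow> real" where
  "ricci A nabla p v w = endo_trace A p (\<lambda>u. riemann A nabla p u v w)"

definition ricci_operator ::
  "('m::topological_space, 'd::finite) chart set \<Rightarrow> ('m \<Rightarrow> 'm tvec \<Rightarrow> 'm tvec \<Rightarrow> real) \<Rightarrow>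
   ('m vfield \<Rightarrow> 'm vfield \<Rightarrow> 'm vfield) \<Rightarrow> 'm \<Rightarrow> 'm tvec \<Rightarrow> 'm tvec" where
  "ricci_operator A g nabla p v =
     (THE u. u \<in> tangent_space A p \<and> (\<forall>w\<in>tangent_space A p. g p u w = ricci A nabla p v w))"

section \<open>Infinitesimal harmonic transformations\<close>

text \<open>\<open>(L\<^sub>V \<nabla>)(X,Y) = [V, \<nabla>\<^sub>X Y] - \<nabla>\<^bsub>[V,X]\<^esub> Y - \<nabla>\<^sub>X [V,Y]\<close>\<close>
definition lie_deriv_connection ::
  "('m::topological_space, 'd::finite) chart set \<Rightarrow> ('m vfield \<Rightarrow> 'm vfield \<Rightarrow> 'm vfield) \<Rightarrow>
   'm vfield \<Rightarrow> 'm \<Rightarrow> 'm tvec \<Rightarrow> 'm tvec \<Rightarrow> 'm tvec" where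
  "lie_deriv_connection A nabla V = tensor_at2 A (\<lambda>X Y p.
     lie_bracket A V (nabla X Y) p - nabla (lie_bracket A V X) Y p - nabla X (lie_bracket A V Y) p)"

text \<open>The trace is a tangent vector, here evaluated on an arbitrary function \<open>f\<close>.\<close>
definition infinitesimal_harmonic ::
  "('m::topological_space, 'd::finite) chart set \<Rightarrow> ('m \<Rightarrow> 'm tvec \<Rightarrow> 'm tvec \<Rightarrow> real) \<Rightarrow>
   ('m vfield \<Rightarrow> 'm vfield \<Rightarrow> 'm vfield) \<Rightarrow> 'm vfield \<Rightarrow> bool" where
  "infinitesimal_harmonic A g nabla V \<longleftrightarrow> smooth_vf A UNIV V \<and>
     (\<forall>p f. metric_trace A g p (\<lambda>v w. lie_deriv_connection A nabla V p v w f) = 0)"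

section \<open>Harmonic vector fields\<close>

text \<open>The semi-Riemannian volume measure \<open>\<surd>|det (g\<^sub>i\<^sub>j)| dx\<close>. These conditions determine it
  uniquely, since countably many charts cover the manifold.\<close>
definition volume_measure ::
  "('m::topological_space, 'd::finite) chart set \<Rightarrow> ('m \<Rightarrow> 'm tvec \<Rightarrow> 'm tvec \<Rightarrow> real) \<Rightarrow>
   'm measure \<Rightarrow> bool" where
  "volume_measure A g \<mu> \<longleftrightarrow> sets \<mu> = sets borel \<and>
     (\<forall>c\<in>A. \<forall>S\<in>sets borel. S \<subseteq> fst c \<longrightarrow>
        emeasure \<mu> S = (\<integral>\<^sup>+ x\<in>snd c ` S.
          ennreal (sqrt \<bar>det (\<chi> i j. g (chart_inv c x)
            (coord_vec A c (chart_inv c x) (axis i 1))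
            (coord_vec A c (chart_inv c x) (axis j 1)))\<bar>) \<partial>lborel))"

definition cov_deriv_at ::
  "('m::topological_space, 'd::finite) chart set \<Rightarrow> ('m vfield \<Rightarrow> 'm vfield \<Rightarrow> 'm vfield) \<Rightarrow>
   'm vfield \<Rightarrow> 'm \<Rightarrow> 'm tvec \<Rightarrow> 'm tvec" where
  "cov_deriv_at A nabla V = tensor_at1 A (\<lambda>X p. nabla X V p)"

text \<open>The pullback \<open>V\<^sup>* g\<^sup>s\<close> of the Sasaki metric under \<open>V : M \<rightarrow> TM\<close>. By definition,
  \<open>g\<^sup>s(a,b) = g(\<pi>\<^sub>* a, \<pi>\<^sub>* b) + g(K a, K b)\<close> for the bundle projection \<open>\<pi>\<close> and the connection
  map \<open>K\<close>; moreover \<open>\<pi>\<^sub>* (V\<^sub>* v) = v\<close> and \<open>K (V\<^sub>* v) = \<nabla>\<^sub>v V\<close>.\<close>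
definition sasaki_pullback ::
  "('m::topological_space, 'd::finite) chart set \<Rightarrow> ('m \<Rightarrow> 'm tvec \<Rightarrow> 'm tvec \<Rightarrow> real) \<Rightarrow>
   ('m vfield \<Rightarrow> 'm vfield \<Rightarrow> 'm vfield) \<Rightarrow> 'm vfield \<Rightarrow> 'm \<Rightarrow> 'm tvec \<Rightarrow> 'm tvec \<Rightarrow> real" where
  "sasaki_pullback A g nabla V p v w =
     g p v w + g p (cov_deriv_at A nabla V p v) (cov_deriv_at A nabla V p w)"

text \<open>The energy \<open>\<onehalf> \<integral>\<^sub>D tr\<^sub>g (V\<^sup>* g\<^sup>s) d\<mu>\<close> of \<open>V : (M,g) \<rightarrow> (TM,g\<^sup>s)\<close> over the domain \<open>D\<close>.\<close>
definition energy ::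
  "('m::topological_space, 'd::finite) chart set \<Rightarrow> ('m \<Rightarrow> 'm tvec \<Rightarrow> 'm tvec \<Rightarrow> real) \<Rightarrow>
   ('m vfield \<Rightarrow> 'm vfield \<Rightarrow> 'm vfield) \<Rightarrow> 'm measure \<Rightarrow> 'm set \<Rightarrow> 'm vfield \<Rightarrow> real" where
  "energy A g nabla \<mu> D V =
     (1/2) * set_lebesgue_integral \<mu> D (\<lambda>p. metric_trace A g p (sasaki_pullback A g nabla V p))"

text \<open>A variation \<open>W t\<close>, \<open>\<bar>t\<bar> < \<epsilon>\<close>, of \<open>V\<close> through smooth fields of constant length \<open>r\<close>, jointly
  smooth in the parameter and the point, and fixed outside \<open>K\<close>.\<close>
definition length_variation ::
  "('m::topological_space, 'd::finite) chart set \<Rightarrow> ('m \<Rightarrow> 'm tvec \<Rightarrow> 'm tvec \<Rightarrow> real) \<Rightarrow>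
   real \<Rightarrow> 'm set \<Rightarrow> real \<Rightarrow> 'm vfield \<Rightarrow> (real \<Rightarrow> 'm vfield) \<Rightarrow> bool" where
  "length_variation A g r K \<epsilon> V W \<longleftrightarrow>
     W 0 = V \<and>
     (\<forall>t\<in>{-\<epsilon><..<\<epsilon>}. smooth_vf A UNIV (W t) \<and> (\<forall>p. g p (W t p) (W t p) = r) \<and>
        (\<forall>p. p \<notin> K \<longrightarrow> W t p = V p)) \<and>
     (\<forall>c\<in>A. \<forall>U f. open U \<and> smooth_fun A U f \<longrightarrow>
        smooth_on ({-\<epsilon><..<\<epsilon>} \<times> snd c ` (U \<inter> fst c)) (\<lambda>(t, x). W t (chart_inv c x) f))"

text \<open>If \<open>M\<close> is compact, \<open>D = K = UNIV\<close> is allowed and all variations through fields of the same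
  length are considered.\<close>
definition harmonic_vf ::
  "('m::topological_space, 'd::finite) chart set \<Rightarrow> ('m \<Rightarrow> 'm tvec \<Rightarrow> 'm tvec \<Rightarrow> real) \<Rightarrow>
   ('m vfield \<Rightarrow> 'm vfield \<Rightarrow> 'm vfield) \<Rightarrow> 'm measure \<Rightarrow> 'm vfield \<Rightarrow> bool" where
  "harmonic_vf A g nabla \<mu> V \<longleftrightarrow> smooth_vf A UNIV V \<and>
     (\<exists>r. r \<noteq> 0 \<and> (\<forall>p. g p (V p) (V p) = r) \<and>
        (\<forall>D K \<epsilon> W. open D \<and> compact (closure D) \<and> compact K \<and> K \<subseteq> D \<and> \<epsilon> > 0 \<and>
           length_variation A g r K \<epsilon> V W \<longrightarrow>
           ((\<lambda>t. energy A g nabla \<mu> D (W t)) has_real_derivative 0) (at 0)))"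

definition H_paracontact ::
  "('m::topological_space, 'd::finite) chart set \<Rightarrow> ('m \<Rightarrow> 'm tvec \<Rightarrow> 'm tvec \<Rightarrow> real) \<Rightarrow>
   ('m vfield \<Rightarrow> 'm vfield \<Rightarrow> 'm vfield) \<Rightarrow> 'm measure \<Rightarrow> 'm vfield \<Rightarrow> bool" where
  "H_paracontact A g nabla \<mu> \<xi> \<longleftrightarrow> harmonic_vf A g nabla \<mu> \<xi>"

end

theory Submission
  imports Defs
begin

text \<open>Write \<open>\<nabla>\<xi> = S - \<phi>\<close>, where \<open>S\<close> is symmetric and \<open>\<phi>\<close> is skew. The paracontact identities give
  \<open>S\<phi> = -\<phi>S\<close>, \<open>\<nabla>\<^sub>\<xi>\<phi> = 0\<close>, \<open>h = \<phi>S\<close> and, since \<open>d(d\<eta>) = 0\<close>, \<open>div \<phi> = 2n\<eta>\<close>. Contracting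
  \<open>R(u,v)\<xi> = (\<nabla>\<^sub>u\<nabla>\<xi>)v - (\<nabla>\<^sub>v\<nabla>\<xi>)u\<close> then yields
  \<open>\<rho>(\<xi>,\<cdot>) = div S - 2n\<eta>\<close>, \<open>tr(L\<^sub>\<xi>\<nabla>) = 2 div S\<close> (up to the metric duality), and
  \<open>(div S)(\<xi>) = tr h\<^sup>2\<close>. By the divergence theorem the first variation of the energy at \<open>\<xi>\<close> in the
  direction of \<open>w \<bottom> \<xi>\<close> is \<open>-\<integral> (div S)(w)\<close>, so \<open>\<xi>\<close> is a harmonic vector field if and only if
  \<open>div S\<close> vanishes on \<open>ker \<eta>\<close>. All three assertions therefore say that \<open>div S = 0\<close>.\<close>

section \<open>Calculus of smooth maps\<close>

text \<open>Variations of fixed length see only a part of the problem: their velocity is orthogonal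
  to \<xi>, so criticality says nothing about the value of the 1-form \<open>div S\<close> at \<xi>,
  and \<open>tr h^2\<close> is exactly that value. The metric is indefinite; null vectors therefore
  obstruct Gram-Schmidt, and the test field for the converse is chosen by the sign of the 1-form on
  a fixed vector rather than as its metric dual. The invariant notions are descriptions over all
  local extensions, or rest on a chosen chart or frame. Each is first evaluated in an arbitrary
  chart, and all tensor identities are proved for ordinary functions on an open subset of
  \<open>real ^ 'd\<close>. The common 1-form is introduced as the Ricci expression
  \<open>delta\<close>, which refers to no particular coordinates and is recognised as
  \<open>div S\<close> only in a chart. Traces are rewritten from the chosen frame to the coordinate
  basis and its metric dual, since the chosen frame need not vary smoothly with the point.\<close>

definition dd :: "('a::real_normed_vector \<Rightarrow> 'b::real_normed_vector) \<Rightarrow> 'a \<Rightarrow> 'a \<Rightarrow> 'b" where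
  "dd f v x = frechet_derivative f (at x) v"

lemma dd_eq: "(f has_derivative f') (at x) \<Longrightarrow> dd f v x = f' v"
  unfolding dd_def using frechet_derivative_at by metis

lemma has_derivative_dd: "f differentiable at x \<Longrightarrow> (f has_derivative (\<lambda>v. dd f v x)) (at x)"
  unfolding dd_def using frechet_derivative_works by fastforce

lemma dd_cong:
  assumes "open S" "x \<in> S" "\<And>y. y \<in> S \<Longrightarrow> f y = g y"
  shows "dd f v x = dd g v x"
proof (cases "f differentiable at x")
  case True
  then show ?thesis
    unfolding dd_def using frechet_derivative_transform_within_open[OF True assms] by simp
next
  case False
  \<comment> \<open>Where no derivative exists, \<open>frechet_derivative\<close> is an arbitrary
    choice; it is the same choice for both functions because the same maps qualify.\<close>
  have "(f has_derivative D) (at x) \<longleftrightarrow> (g has_derivative D) (at x)" for D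
    using has_derivative_transform_within_open[of f D x UNIV S g]
      has_derivative_transform_within_open[of g D x UNIV S f] assms by auto
  then show ?thesis
    unfolding dd_def frechet_derivative_def by simp
qed

section \<open>Functions of class \<open>C^k\<close> on open sets\<close>

lemma Ck_on_Suc_dd:
  "Ck_on (Suc k) S f \<longleftrightarrow> (\<forall>x\<in>S. f differentiable at x) \<and> (\<forall>v. Ck_on k S (dd f v))"
  by (simp add: dd_def[abs_def])

declare Ck_on.simps(2)[simp del]

lemma Ck_on_mono: "Ck_on k S f \<Longrightarrow> T \<subseteq> S \<Longrightarrow> Ck_on k T f"
proof (induction k arbitrary: f)
  case 0
  then show ?case by (auto intro: continuous_on_subset)
next
  case (Suc k)
  then show ?case unfolding Ck_on_Suc_dd by blast
qed

lemma Ck_on_Suc_imp: "Ck_on (Suc k) S f \<Longrightarrow> Ck_on k S f"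
proof (induction k arbitrary: f)
  case 0
  then show ?case
    unfolding Ck_on_Suc_dd by (auto intro!: continuous_at_imp_continuous_on differentiable_imp_continuous_within)
next
  case (Suc k)
  then show ?case unfolding Ck_on_Suc_dd[of "Suc k"] Ck_on_Suc_dd[of k] by blast
qed

lemma Ck_on_cong:
  assumes "open S" "\<And>x. x \<in> S \<Longrightarrow> f x = g x" "Ck_on k S f"
  shows "Ck_on k S g"
  using assms(2,3)
proof (induction k arbitrary: f g)
  case 0
  then show ?case using continuous_on_cong[of S S f g] by simp
next
  case (Suc k)
  have "g differentiable at x" if "x \<in> S" for x
    using Suc.prems that unfolding Ck_on_Suc_dd differentiable_def
    by (metis has_derivative_transform_within_open assms(1))
  moreover have "Ck_on k S (dd g v)" for v
    using Suc.IH[of "dd f v" "dd g v"] Suc.prems dd_cong[OF assms(1), of _ f g v]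
    unfolding Ck_on_Suc_dd by blast
  ultimately show ?case unfolding Ck_on_Suc_dd by blast
qed

lemma Ck_on_local:
  assumes "\<And>x. x \<in> S \<Longrightarrow> \<exists>T. open T \<and> x \<in> T \<and> Ck_on k T f"
  shows "Ck_on k S f"
  using assms
proof (induction k arbitrary: f)
  case 0
  have "isCont f x" if x: "x \<in> S" for x
  proof -
    obtain T where T: "open T" "x \<in> T" "continuous_on T f" using "0"[OF x] by auto
    then show ?thesis using continuous_on_eq_continuous_at[OF T(1), of f] by simp
  qed
  then show ?case by (simp add: continuous_at_imp_continuous_on)
next
  case (Suc k)
  show ?case unfolding Ck_on_Suc_dd
  proof (intro conjI ballI allI)
    fix x assume "x \<in> S"
    from Suc.prems[OF this] show "f differentiable at x" unfolding Ck_on_Suc_dd by blast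
  next
    fix v show "Ck_on k S (dd f v)"
    proof (rule Suc.IH)
      fix x assume "x \<in> S"
      from Suc.prems[OF this] show "\<exists>T. open T \<and> x \<in> T \<and> Ck_on k T (dd f v)"
        unfolding Ck_on_Suc_dd by blast
    qed
  qed
qed

text \<open>The derivative may be given by any formula \<open>f'\<close> valid on the open set. Each
  closure property below thus becomes an induction on the order, driven by its own differentiation
  rule.\<close>

lemma Ck_on_SucI:
  assumes "open S" "\<And>x. x \<in> S \<Longrightarrow> (f has_derivative (\<lambda>v. f' v x)) (at x)"
    "\<And>v. Ck_on k S (f' v)"
  shows "Ck_on (Suc k) S f"
  unfolding Ck_on_Suc_dd
proof (intro conjI ballI allI)
  fix x assume "x \<in> S"
  then show "f differentiable at x" using assms(2) differentiable_def by blast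
next
  fix v
  show "Ck_on k S (dd f v)"
    using Ck_on_cong[OF assms(1) _ assms(3)[of v], of "dd f v"] dd_eq[OF assms(2)] by simp
qed

lemma Ck_on_SucD:
  "Ck_on (Suc k) S f \<Longrightarrow> x \<in> S \<Longrightarrow> (f has_derivative (\<lambda>v. dd f v x)) (at x)"
  "Ck_on (Suc k) S f \<Longrightarrow> Ck_on k S (dd f v)"
  unfolding Ck_on_Suc_dd by (auto intro: has_derivative_dd)

lemma Ck_on_const: "open S \<Longrightarrow> Ck_on k S (\<lambda>x. c)"
proof (induction k arbitrary: c)
  case (Suc k)
  show ?case by (rule Ck_on_SucI[where f' = "\<lambda>_ _. 0"]) (use Suc in auto)
qed auto

lemma Ck_on_ident: "open S \<Longrightarrow> Ck_on k S (\<lambda>x. x)"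
proof (cases k)
  case (Suc k)
  assume "open S"
  then show ?thesis unfolding Suc by (intro Ck_on_SucI[where f' = "\<lambda>v _. v"]) (auto simp: Ck_on_const)
qed auto

lemma Ck_on_bounded_linear:
  assumes "bounded_linear L" "open S" "Ck_on k S f"
  shows "Ck_on k S (\<lambda>x. L (f x))"
  using assms(3)
proof (induction k arbitrary: f)
  case 0
  then show ?case using assms(1) by (simp add: bounded_linear.continuous_on)
next
  case (Suc k)
  show ?case
    by (rule Ck_on_SucI[where f' = "\<lambda>v x. L (dd f v x)", OF assms(2)
        bounded_linear.has_derivative[OF assms(1) Ck_on_SucD(1)[OF Suc.prems]] Suc.IH[OF Ck_on_SucD(2)[OF Suc.prems]]])
qed

lemma Ck_on_add:
  assumes "open S" "Ck_on k S f" "Ck_on k S g"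
  shows "Ck_on k S (\<lambda>x. f x + g x)"
  using assms(2,3)
proof (induction k arbitrary: f g)
  case 0
  then show ?case by (simp add: continuous_on_add)
next
  case (Suc k)
  show ?case
    by (rule Ck_on_SucI[where f' = "\<lambda>v x. dd f v x + dd g v x", OF assms(1)
        has_derivative_add[OF Ck_on_SucD(1)[OF Suc.prems(1)] Ck_on_SucD(1)[OF Suc.prems(2)]]
        Suc.IH[OF Ck_on_SucD(2)[OF Suc.prems(1)] Ck_on_SucD(2)[OF Suc.prems(2)]]])
qed

lemma Ck_on_bounded_bilinear:
  assumes "bounded_bilinear B" "open S" "Ck_on k S f" "Ck_on k S g"
  shows "Ck_on k S (\<lambda>x. B (f x) (g x))"
  using assms(3,4)
proof (induction k arbitrary: f g)
  case 0
  then show ?case using assms(1) by (simp add: bounded_bilinear.continuous_on)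
next
  case (Suc k)
  show ?case
    by (rule Ck_on_SucI[where f' = "\<lambda>v x. B (f x) (dd g v x) + B (dd f v x) (g x)", OF assms(2)
        bounded_bilinear.FDERIV[OF assms(1) Ck_on_SucD(1)[OF Suc.prems(1)] Ck_on_SucD(1)[OF Suc.prems(2)]]
        Ck_on_add[OF assms(2) Suc.IH[OF Ck_on_Suc_imp[OF Suc.prems(1)] Ck_on_SucD(2)[OF Suc.prems(2)]]
          Suc.IH[OF Ck_on_SucD(2)[OF Suc.prems(1)] Ck_on_Suc_imp[OF Suc.prems(2)]]]])
qed

lemma Ck_on_sum:
  assumes "open S" "\<And>i. i \<in> I \<Longrightarrow> Ck_on k S (f i)"
  shows "Ck_on k S (\<lambda>x. \<Sum>i\<in>I. f i x)"
  using assms(2)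
  by (induction I rule: infinite_finite_induct) (auto intro: Ck_on_const Ck_on_add assms(1))

lemma Ck_on_compose:
  fixes f :: "'b::euclidean_space \<Rightarrow> 'c::real_normed_vector"
  assumes "open S" "open T" "g ` S \<subseteq> T" "Ck_on k S g" "Ck_on k T f"
  shows "Ck_on k S (\<lambda>x. f (g x))"
  using assms(4,5)
proof (induction k arbitrary: f)
  case 0
  then show ?case using assms(3) by (auto intro: continuous_on_compose2)
next
  case (Suc k)
  \<comment> \<open>The direction \<open>dd g v x\<close> in the chain rule moves with
    \<open>x\<close>, while the induction hypothesis is about derivatives of \<open>f\<close> in
    fixed directions; expansion in the basis reduces the former to the latter.\<close>
  have lin: "dd f w (g x) = (\<Sum>b\<in>Basis. (w \<bullet> b) *\<^sub>R dd f b (g x))" if "x \<in> S" for x w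
  proof -
    have gx: "g x \<in> T" using assms(3) that by auto
    have "linear (\<lambda>v. dd f v (g x))"
      by (rule has_derivative_linear[OF Ck_on_SucD(1)[OF Suc.prems(2) gx]])
    then have "dd f (\<Sum>b\<in>Basis. (w \<bullet> b) *\<^sub>R b) (g x) = (\<Sum>b\<in>Basis. (w \<bullet> b) *\<^sub>R dd f b (g x))"
      by (subst linear_sum[of "\<lambda>v. dd f v (g x)"]) (auto simp: linear_scale[of "\<lambda>v. dd f v (g x)"])
    then show ?thesis by (simp add: euclidean_representation)
  qed
  show ?case
  proof (rule Ck_on_SucI[where f' = "\<lambda>v x. \<Sum>b\<in>Basis. (dd g v x \<bullet> b) *\<^sub>R dd f b (g x)"])
    fix x assume x: "x \<in> S"
    have gx: "g x \<in> T" using assms(3) x by auto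
    have "((\<lambda>x. f (g x)) has_derivative (\<lambda>v. dd f (dd g v x) (g x))) (at x)"
      by (rule has_derivative_compose[OF Ck_on_SucD(1)[OF Suc.prems(1) x] Ck_on_SucD(1)[OF Suc.prems(2) gx]])
    then show "((\<lambda>x. f (g x)) has_derivative (\<lambda>v. \<Sum>b\<in>Basis. (dd g v x \<bullet> b) *\<^sub>R dd f b (g x))) (at x)"
      by (rule has_derivative_eq_rhs) (rule ext, rule lin[OF x])
  next
    fix v
    show "Ck_on k S (\<lambda>x. \<Sum>b\<in>Basis. (dd g v x \<bullet> b) *\<^sub>R dd f b (g x))"
      by (intro Ck_on_sum assms(1) Ck_on_bounded_bilinear[OF bounded_bilinear_scaleR]
          Ck_on_bounded_linear[OF bounded_linear_inner_left] Ck_on_SucD(2)[OF Suc.prems(1)]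
          Suc.IH[OF Ck_on_Suc_imp[OF Suc.prems(1)] Ck_on_SucD(2)[OF Suc.prems(2)]])
  qed (use assms in auto)
qed

text \<open>The exponent is kept general because differentiation lowers it. The values needed later
  are \<open>1/4\<close> for the volume density and \<open>- 1/2\<close> for normalising a vector
  field.\<close>

lemma Ck_on_powr: "Ck_on k {0<..} (\<lambda>x::real. x powr a)"
proof (induction k arbitrary: a)
  case 0
  show ?case by (auto intro!: continuous_intros)
next
  case (Suc k)
  show ?case
  proof (rule Ck_on_SucI[where f' = "\<lambda>v x. (v * a) * x powr (a - 1)"])
    fix x :: real assume "x \<in> {0<..}"
    then show "((\<lambda>x. x powr a) has_derivative (\<lambda>v. v * a * x powr (a - 1))) (at x)"
      by (auto intro!: derivative_eq_intros simp: powr_diff field_simps)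
  qed (auto intro!: Suc Ck_on_bounded_linear[OF bounded_linear_mult_right])
qed

lemma Ck_on_inverse: "Ck_on k (- {0}) (inverse :: real \<Rightarrow> real)"
proof (induction k)
  case 0
  show ?case by (auto intro!: continuous_intros)
next
  case (Suc k)
  show ?case
  proof (rule Ck_on_SucI[where f' = "\<lambda>v x. (- v) * (inverse x * inverse x)"])
    fix x :: real assume "x \<in> - {0}"
    then show "(inverse has_derivative (\<lambda>v. - v * (inverse x * inverse x))) (at x)"
      by (auto intro!: derivative_eq_intros)
  next
    show "Ck_on k (- {0}) (\<lambda>x. - v * (inverse x * inverse x))" for v :: real
      by (intro Suc Ck_on_bounded_linear[OF bounded_linear_mult_right]
          Ck_on_bounded_bilinear[OF bounded_bilinear_mult]) auto
  qed auto
qed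

section \<open>Smooth maps and the rules for directional derivatives\<close>

lemma smooth_on_mono: "smooth_on S f \<Longrightarrow> T \<subseteq> S \<Longrightarrow> smooth_on T f"
  unfolding smooth_on_def using Ck_on_mono by blast

lemma smooth_on_cong:
  "smooth_on S f \<Longrightarrow> open S \<Longrightarrow> (\<And>x. x \<in> S \<Longrightarrow> f x = g x) \<Longrightarrow> smooth_on S g"
  unfolding smooth_on_def using Ck_on_cong by blast

lemma smooth_on_local:
  "(\<And>x. x \<in> S \<Longrightarrow> \<exists>T. open T \<and> x \<in> T \<and> smooth_on T f) \<Longrightarrow> smooth_on S f"
  unfolding smooth_on_def using Ck_on_local by metis

lemma smooth_on_has_derivative:
  "smooth_on S f \<Longrightarrow> x \<in> S \<Longrightarrow> (f has_derivative (\<lambda>v. dd f v x)) (at x)"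
  unfolding smooth_on_def by (metis Ck_on_SucD(1))

lemma smooth_on_dd: "smooth_on S f \<Longrightarrow> smooth_on S (dd f v)"
  unfolding smooth_on_def using Ck_on_SucD(2) by blast

lemma smooth_on_continuous: "smooth_on S f \<Longrightarrow> continuous_on S f"
  unfolding smooth_on_def using Ck_on.simps(1) by blast

lemma smooth_on_linear_dd: "smooth_on S f \<Longrightarrow> x \<in> S \<Longrightarrow> linear (\<lambda>v. dd f v x)"
  by (rule has_derivative_linear[OF smooth_on_has_derivative])

lemma smooth_on_const: "open S \<Longrightarrow> smooth_on S (\<lambda>x. c)"
  unfolding smooth_on_def using Ck_on_const by blast

lemma smooth_on_ident: "open S \<Longrightarrow> smooth_on S (\<lambda>x. x)"
  unfolding smooth_on_def using Ck_on_ident by blast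

lemma smooth_on_bounded_linear:
  "bounded_linear L \<Longrightarrow> open S \<Longrightarrow> smooth_on S f \<Longrightarrow> smooth_on S (\<lambda>x. L (f x))"
  unfolding smooth_on_def using Ck_on_bounded_linear[where L=L and S=S and f=f] by blast

lemma smooth_on_bounded_bilinear:
  "bounded_bilinear B \<Longrightarrow> open S \<Longrightarrow> smooth_on S f \<Longrightarrow> smooth_on S g \<Longrightarrow> smooth_on S (\<lambda>x. B (f x) (g x))"
  unfolding smooth_on_def using Ck_on_bounded_bilinear[where B=B and S=S and f=f and g=g] by blast

lemma smooth_on_add:
  "open S \<Longrightarrow> smooth_on S f \<Longrightarrow> smooth_on S g \<Longrightarrow> smooth_on S (\<lambda>x. f x + g x)"
  unfolding smooth_on_def using Ck_on_add[where S=S and f=f and g=g] by blast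

lemma smooth_on_minus: "open S \<Longrightarrow> smooth_on S f \<Longrightarrow> smooth_on S (\<lambda>x. - f x)"
  by (rule smooth_on_bounded_linear[OF bounded_linear_minus[OF bounded_linear_ident]])

lemma smooth_on_diff:
  "open S \<Longrightarrow> smooth_on S f \<Longrightarrow> smooth_on S g \<Longrightarrow> smooth_on S (\<lambda>x. f x - g x)"
  using smooth_on_add[of S f "\<lambda>x. - g x"] smooth_on_minus[of S g] by simp

lemma smooth_on_sum:
  "open S \<Longrightarrow> (\<And>i. i \<in> I \<Longrightarrow> smooth_on S (f i)) \<Longrightarrow> smooth_on S (\<lambda>x. \<Sum>i\<in>I. f i x)"
  unfolding smooth_on_def using Ck_on_sum[where S=S and f=f and I=I] by blast

lemma smooth_on_mult:
  fixes f g :: "'a::real_normed_vector \<Rightarrow> real"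
  shows "open S \<Longrightarrow> smooth_on S f \<Longrightarrow> smooth_on S g \<Longrightarrow> smooth_on S (\<lambda>x. f x * g x)"
  by (rule smooth_on_bounded_bilinear[OF bounded_bilinear_mult])

lemma smooth_on_scaleR:
  "open S \<Longrightarrow> smooth_on S f \<Longrightarrow> smooth_on S g \<Longrightarrow> smooth_on S (\<lambda>x. f x *\<^sub>R g x)"
  by (rule smooth_on_bounded_bilinear[OF bounded_bilinear_scaleR])

lemma smooth_on_prod:
  fixes f :: "'i \<Rightarrow> 'a::real_normed_vector \<Rightarrow> real"
  shows "open S \<Longrightarrow> (\<And>i. i \<in> I \<Longrightarrow> smooth_on S (f i)) \<Longrightarrow> smooth_on S (\<lambda>x. \<Prod>i\<in>I. f i x)"
  by (induction I rule: infinite_finite_induct) (auto intro: smooth_on_const smooth_on_mult)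

lemma smooth_on_compose:
  fixes f :: "'b::euclidean_space \<Rightarrow> 'c::real_normed_vector"
  shows "smooth_on T f \<Longrightarrow> smooth_on S g \<Longrightarrow> open S \<Longrightarrow> open T \<Longrightarrow> (\<And>x. x \<in> S \<Longrightarrow> g x \<in> T) \<Longrightarrow>
    smooth_on S (\<lambda>x. f (g x))"
  unfolding smooth_on_def using Ck_on_compose[where S=S and T=T and f=f and g=g] by blast

lemma smooth_on_powr:
  "open S \<Longrightarrow> smooth_on S f \<Longrightarrow> (\<And>x. x \<in> S \<Longrightarrow> f x > 0) \<Longrightarrow> smooth_on S (\<lambda>x. f x powr (a::real))"
  by (rule smooth_on_compose[where T = "{0<..}" and f = "\<lambda>x. x powr a"]) (auto simp: smooth_on_def Ck_on_powr)

lemma smooth_on_divide: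
  fixes f g :: "'a::real_normed_vector \<Rightarrow> real"
  assumes "open S" "smooth_on S f" "smooth_on S g" "\<And>x. x \<in> S \<Longrightarrow> g x \<noteq> 0"
  shows "smooth_on S (\<lambda>x. f x / g x)"
proof -
  have "smooth_on S (\<lambda>x. inverse (g x))"
    by (rule smooth_on_compose[where T = "- {0}"]) (use assms in \<open>auto simp: smooth_on_def Ck_on_inverse\<close>)
  then show ?thesis using smooth_on_mult assms by (simp add: divide_inverse)
qed

lemma smooth_on_vec_nth:
  "open S \<Longrightarrow> smooth_on S f \<Longrightarrow> smooth_on S (\<lambda>x. f x $ i)"
  by (rule smooth_on_bounded_linear[OF bounded_linear_vec_nth])

lemma vec_lambda_axis_sum: "(\<chi> i. c i) = (\<Sum>i\<in>UNIV. c i *\<^sub>R (axis i 1 :: real^'n::finite))"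
  by (simp add: vec_eq_iff axis_def if_distrib cong: if_cong)

lemma vec_axis_sum: "(v::real^'n::finite) = (\<Sum>i\<in>UNIV. (v $ i) *\<^sub>R axis i 1)"
  using vec_lambda_axis_sum[of "\<lambda>i. v $ i"] by simp

lemma smooth_on_vec_lambda:
  assumes "open S" "\<And>i. smooth_on S (\<lambda>x. f x i)"
  shows "smooth_on S (\<lambda>x. (\<chi> i. f x i) :: real^'n::finite)"
  unfolding vec_lambda_axis_sum using assms
  by (intro smooth_on_sum smooth_on_scaleR smooth_on_const) auto

lemma dd_linear_combination:
  assumes "smooth_on S f" "x \<in> S"
  shows "dd f (u + w) x = dd f u x + dd f w x" "dd f (a *\<^sub>R u) x = a *\<^sub>R dd f u x" "dd f 0 x = 0"
    "dd f (- u) x = - dd f u x" "dd f (u - w) x = dd f u x - dd f w x"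
  using linear_add[OF smooth_on_linear_dd[OF assms]] linear_scale[OF smooth_on_linear_dd[OF assms]]
    linear_0[OF smooth_on_linear_dd[OF assms]] linear_neg[OF smooth_on_linear_dd[OF assms]]
    linear_diff[OF smooth_on_linear_dd[OF assms]] by simp_all

lemma dd_add: "smooth_on S f \<Longrightarrow> smooth_on S g \<Longrightarrow> x \<in> S \<Longrightarrow> dd (\<lambda>y. f y + g y) v x = dd f v x + dd g v x"
  by (rule dd_eq[OF has_derivative_add[OF smooth_on_has_derivative[of S f x] smooth_on_has_derivative[of S g x]]])

lemma dd_diff: "smooth_on S f \<Longrightarrow> smooth_on S g \<Longrightarrow> x \<in> S \<Longrightarrow> dd (\<lambda>y. f y - g y) v x = dd f v x - dd g v x"
  by (rule dd_eq[OF has_derivative_diff[OF smooth_on_has_derivative[of S f x] smooth_on_has_derivative[of S g x]]])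

lemma dd_bounded_linear: "bounded_linear L \<Longrightarrow> smooth_on S f \<Longrightarrow> x \<in> S \<Longrightarrow> dd (\<lambda>y. L (f y)) v x = L (dd f v x)"
  by (rule dd_eq[OF bounded_linear.has_derivative[of L, OF _ smooth_on_has_derivative[of S f x]]])

lemma dd_bounded_bilinear:
  "bounded_bilinear B \<Longrightarrow> smooth_on S f \<Longrightarrow> smooth_on S g \<Longrightarrow> x \<in> S \<Longrightarrow>
    dd (\<lambda>y. B (f y) (g y)) v x = B (f x) (dd g v x) + B (dd f v x) (g x)"
  by (rule dd_eq[OF bounded_bilinear.FDERIV[of B, OF _ smooth_on_has_derivative[of S f x] smooth_on_has_derivative[of S g x]]])

lemma dd_vec_nth: "smooth_on S f \<Longrightarrow> x \<in> S \<Longrightarrow> dd (\<lambda>y. f y $ i) v x = dd f v x $ i"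
  by (rule dd_bounded_linear[OF bounded_linear_vec_nth])

lemma dd_sum:
  "(\<And>i. i \<in> I \<Longrightarrow> smooth_on S (f i)) \<Longrightarrow> x \<in> S \<Longrightarrow> dd (\<lambda>y. \<Sum>i\<in>I. f i y) v x = (\<Sum>i\<in>I. dd (f i) v x)"
  by (rule dd_eq[OF has_derivative_sum[OF smooth_on_has_derivative[of S]]])

lemma dd_const: "dd (\<lambda>y. c) v x = 0"
  using dd_eq[OF has_derivative_const] .

lemma dd_ident: "dd (\<lambda>y. y) v x = v"
  using dd_eq[OF has_derivative_ident] .

lemma dd_compose:
  assumes "smooth_on S g" "x \<in> S" "smooth_on T f" "g x \<in> T"
  shows "dd (\<lambda>y. f (g y)) v x = dd f (dd g v x) (g x)"
  using dd_eq[OF has_derivative_compose[OF smooth_on_has_derivative[OF assms(1,2)]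
        smooth_on_has_derivative[OF assms(3,4)]]] .

text \<open>Christoffel symbols, endomorphism fields and, slot by slot, the metric are families of
  linear maps whose smoothness is known at fixed vectors only. Expanding the moving argument in the
  basis gives smoothness and the Leibniz rule for the evaluation.\<close>

lemma
  fixes F :: "'a::real_normed_vector \<Rightarrow> 'u::euclidean_space \<Rightarrow> 'c::real_normed_vector"
  assumes S: "open S" and lin: "\<And>y. y \<in> S \<Longrightarrow> linear (F y)"
    and F: "\<And>u. smooth_on S (\<lambda>y. F y u)" and Y: "smooth_on S Y"
  shows smooth_on_apply: "smooth_on S (\<lambda>y. F y (Y y))"
    and dd_apply: "x \<in> S \<Longrightarrow> dd (\<lambda>y. F y (Y y)) v x = dd (\<lambda>y. F y (Y x)) v x + F x (dd Y v x)"
proof -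
  have exp: "F y u = (\<Sum>b\<in>Basis. (u \<bullet> b) *\<^sub>R F y b)" if "y \<in> S" for y u
  proof -
    have "F y (\<Sum>b\<in>Basis. (u \<bullet> b) *\<^sub>R b) = (\<Sum>b\<in>Basis. (u \<bullet> b) *\<^sub>R F y b)"
      using lin[OF that] by (simp add: linear_sum linear_scale)
    then show ?thesis by (simp add: euclidean_representation)
  qed
  have sm: "smooth_on S (\<lambda>y. (Y y \<bullet> b) *\<^sub>R F y b)" for b
    by (intro smooth_on_scaleR smooth_on_bounded_linear[OF bounded_linear_inner_left] S F Y)
  show "smooth_on S (\<lambda>y. F y (Y y))"
    by (rule smooth_on_cong[OF smooth_on_sum[OF S] S, of Basis "\<lambda>b y. (Y y \<bullet> b) *\<^sub>R F y b"]) (auto simp: sm exp[symmetric])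
  assume x: "x \<in> S"
  have 1: "dd (\<lambda>y. F y (Y y)) v x = dd (\<lambda>y. \<Sum>b\<in>Basis. (Y y \<bullet> b) *\<^sub>R F y b) v x"
    by (rule dd_cong[OF S x]) (rule exp)
  have 2: "dd (\<lambda>y. F y (Y x)) v x = dd (\<lambda>y. \<Sum>b\<in>Basis. (Y x \<bullet> b) *\<^sub>R F y b) v x"
    by (rule dd_cong[OF S x]) (rule exp)
  have 3: "\<dots> = (\<Sum>b\<in>Basis. (Y x \<bullet> b) *\<^sub>R dd (\<lambda>y. F y b) v x)"
    by (subst dd_sum[OF _ x])
      (auto intro!: smooth_on_scaleR smooth_on_const S F sum.cong dd_bounded_linear[OF bounded_linear_scaleR_right] x)
  have 4: "dd (\<lambda>y. (Y y \<bullet> b) *\<^sub>R F y b) v x = (Y x \<bullet> b) *\<^sub>R dd (\<lambda>y. F y b) v x + (dd Y v x \<bullet> b) *\<^sub>R F x b" for b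
    using dd_bounded_bilinear[OF bounded_bilinear_scaleR smooth_on_bounded_linear[OF bounded_linear_inner_left S Y] F x, where v = v]
      dd_bounded_linear[OF bounded_linear_inner_left Y x, where v = v] by simp
  show "dd (\<lambda>y. F y (Y y)) v x = dd (\<lambda>y. F y (Y x)) v x + F x (dd Y v x)"
    unfolding 1 2 3 using dd_sum[of Basis S "\<lambda>b y. (Y y \<bullet> b) *\<^sub>R F y b" x v, OF sm x]
    by (simp add: 4 sum.distrib exp[OF x, symmetric])
qed

lemma smooth_on_dd_apply:
  fixes f :: "'a::euclidean_space \<Rightarrow> 'b::real_normed_vector"
  assumes "open S" "smooth_on S f" "smooth_on S Y"
  shows "smooth_on S (\<lambda>y. dd f (Y y) y)"
  using smooth_on_apply[of S "\<lambda>y u. dd f u y" Y] assms smooth_on_linear_dd smooth_on_dd by blast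

lemma dd_dd_apply:
  fixes f :: "'a::euclidean_space \<Rightarrow> 'b::real_normed_vector"
  assumes "open S" "smooth_on S f" "smooth_on S Y" "x \<in> S"
  shows "dd (\<lambda>y. dd f (Y y) y) v x = dd (dd f (Y x)) v x + dd f (dd Y v x) x"
  using dd_apply[of S "\<lambda>y u. dd f u y" Y x v] assms smooth_on_linear_dd smooth_on_dd by fastforce

lemma
  fixes B :: "'a::real_normed_vector \<Rightarrow> 'u::euclidean_space \<Rightarrow> 'w::euclidean_space \<Rightarrow> 'c::real_normed_vector"
  assumes S: "open S" and lin: "\<And>y w. y \<in> S \<Longrightarrow> linear (\<lambda>u. B y u w)" "\<And>y u. y \<in> S \<Longrightarrow> linear (B y u)"
    and B: "\<And>u w. smooth_on S (\<lambda>y. B y u w)" and X: "smooth_on S X" and Y: "smooth_on S Y"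
  shows smooth_on_apply2: "smooth_on S (\<lambda>y. B y (X y) (Y y))"
    and dd_apply2: "x \<in> S \<Longrightarrow> dd (\<lambda>y. B y (X y) (Y y)) v x =
      dd (\<lambda>y. B y (X x) (Y x)) v x + B x (dd X v x) (Y x) + B x (X x) (dd Y v x)"
proof -
  have 1: "smooth_on S (\<lambda>y. B y u (Y y))" for u
    using smooth_on_apply[of S "\<lambda>y. B y u" Y] S lin B Y by blast
  show "smooth_on S (\<lambda>y. B y (X y) (Y y))"
    using smooth_on_apply[of S "\<lambda>y u. B y u (Y y)" X] S lin 1 X by blast
  assume x: "x \<in> S"
  show "dd (\<lambda>y. B y (X y) (Y y)) v x =
      dd (\<lambda>y. B y (X x) (Y x)) v x + B x (dd X v x) (Y x) + B x (X x) (dd Y v x)"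
    using dd_apply[of S "\<lambda>y u. B y u (Y y)" X x v, OF S _ _ X x] dd_apply[of S "\<lambda>y. B y (X x)" Y x v, OF S _ _ Y x]
      lin B 1 by simp
qed

section \<open>Symmetry of second derivatives\<close>

lemma dd_line:
  assumes "smooth_on S f" "x + s *\<^sub>R u \<in> S"
  shows "((\<lambda>s. f (x + s *\<^sub>R u)) has_derivative (\<lambda>h. h *\<^sub>R dd f u (x + s *\<^sub>R u))) (at s)"
proof -
  have "((\<lambda>s. x + s *\<^sub>R u) has_derivative (\<lambda>h. h *\<^sub>R u)) (at s)"
    by (auto intro!: derivative_eq_intros)
  from has_derivative_compose[OF this smooth_on_has_derivative[OF assms]]
  show ?thesis by (simp add: dd_linear_combination(2)[OF assms])
qed

lemma dd_line_real:
  fixes f :: "'a::real_normed_vector \<Rightarrow> real"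
  assumes "smooth_on S f" "x + s *\<^sub>R u \<in> S"
  shows "((\<lambda>s. f (x + s *\<^sub>R u)) has_real_derivative dd f u (x + s *\<^sub>R u)) (at s)"
  using dd_line[OF assms] by (simp add: has_field_derivative_def mult.commute[of _ "dd _ _ _"])

text \<open>The mean value theorem, applied twice to the second difference of \<open>f\<close>.\<close>
lemma second_difference_mvt:
  fixes f :: "'a::real_normed_vector \<Rightarrow> real"
  assumes f: "smooth_on S f" and h: "h > 0"
    and seg: "\<And>s t. 0 \<le> s \<Longrightarrow> s \<le> h \<Longrightarrow> 0 \<le> t \<Longrightarrow> t \<le> h \<Longrightarrow> x + s *\<^sub>R u + t *\<^sub>R v \<in> S"
  shows "\<exists>s t. 0 < s \<and> s < h \<and> 0 < t \<and> t < h \<and>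
    f (x + h *\<^sub>R u + h *\<^sub>R v) - f (x + h *\<^sub>R u) - f (x + h *\<^sub>R v) + f x = h * h * dd (dd f u) v (x + s *\<^sub>R u + t *\<^sub>R v)"
proof -
  define k where "k s = f ((x + h *\<^sub>R v) + s *\<^sub>R u) - f (x + s *\<^sub>R u)" for s
  have in1: "(x + h *\<^sub>R v) + s *\<^sub>R u \<in> S" "x + s *\<^sub>R u \<in> S" if "0 \<le> s" "s \<le> h" for s
    using seg[of s h] seg[of s 0] that h by (auto simp: algebra_simps)
  have "(k has_real_derivative (dd f u ((x + h *\<^sub>R v) + s *\<^sub>R u) - dd f u (x + s *\<^sub>R u))) (at s)"
    if "0 \<le> s" "s \<le> h" for s
    unfolding k_def by (intro DERIV_diff dd_line_real[OF f] in1 that)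
  then obtain s where s: "0 < s" "s < h" "k h - k 0 = h * (dd f u ((x + h *\<^sub>R v) + s *\<^sub>R u) - dd f u (x + s *\<^sub>R u))"
    using MVT2[OF h, of k "\<lambda>s. dd f u ((x + h *\<^sub>R v) + s *\<^sub>R u) - dd f u (x + s *\<^sub>R u)"] by auto
  have "((\<lambda>t. dd f u ((x + s *\<^sub>R u) + t *\<^sub>R v)) has_real_derivative dd (dd f u) v ((x + s *\<^sub>R u) + t *\<^sub>R v)) (at t)"
    if "0 \<le> t" "t \<le> h" for t
    by (intro dd_line_real[OF smooth_on_dd[OF f]] seg) (use s that in auto)
  then obtain t where t: "0 < t" "t < h" "dd f u ((x + s *\<^sub>R u) + h *\<^sub>R v) - dd f u ((x + s *\<^sub>R u) + 0 *\<^sub>R v)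
      = h * dd (dd f u) v ((x + s *\<^sub>R u) + t *\<^sub>R v)"
    using MVT2[OF h, of "\<lambda>t. dd f u ((x + s *\<^sub>R u) + t *\<^sub>R v)" "\<lambda>t. dd (dd f u) v ((x + s *\<^sub>R u) + t *\<^sub>R v)"] by auto
  have "k h - k 0 = h * h * dd (dd f u) v (x + s *\<^sub>R u + t *\<^sub>R v)"
    using s(3) t(3) by (simp add: algebra_simps)
  then show ?thesis using s(1,2) t(1,2) unfolding k_def by (intro exI[of _ s] exI[of _ t]) (simp add: algebra_simps)
qed

text \<open>The second difference over the parallelogram with sides \<open>h u\<close> and
  \<open>h v\<close> is symmetric in \<open>u\<close> and \<open>v\<close>. It equals
  \<open>h * h\<close> times either mixed derivative, taken at some point near \<open>x\<close>, so
  continuity excludes a gap between the two.\<close>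

lemma dd_commute_real:
  fixes f :: "'a::real_normed_vector \<Rightarrow> real"
  assumes S: "open S" and f: "smooth_on S f" and x: "x \<in> S"
  shows "dd (dd f u) v x = dd (dd f v) u x"
proof (rule ccontr)
  assume ne: "dd (dd f u) v x \<noteq> dd (dd f v) u x"
  define e where "e = \<bar>dd (dd f u) v x - dd (dd f v) u x\<bar> / 2"
  have e: "e > 0" using ne by (simp add: e_def)
  have "isCont (dd (dd f u) v) x" "isCont (dd (dd f v) u) x"
    using smooth_on_continuous[OF smooth_on_dd[OF smooth_on_dd[OF f]]] S x continuous_on_eq_continuous_at by blast+
  then obtain d1 d2 where d: "d1 > 0" "\<And>y. dist y x < d1 \<Longrightarrow> dist (dd (dd f u) v y) (dd (dd f u) v x) < e"
      "d2 > 0" "\<And>y. dist y x < d2 \<Longrightarrow> dist (dd (dd f v) u y) (dd (dd f v) u x) < e"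
    using e unfolding continuous_at_eps_delta by metis
  obtain d3 where d3: "d3 > 0" "ball x d3 \<subseteq> S" using S x open_contains_ball by blast
  define r where "r = min d1 (min d2 d3)"
  have r: "r > 0" using d d3 by (simp add: r_def)
  \<comment> \<open>So small that the whole parallelogram stays within distance \<open>r\<close> of
    \<open>x\<close>; the summand 1 keeps the denominator positive when both vectors vanish.\<close>
  define h where "h = r / (2 * (norm u + norm v + 1))"
  have h: "h > 0" using r by (simp add: h_def add_nonneg_pos)
  have near: "dist (x + s *\<^sub>R u + t *\<^sub>R v) x < r" if "0 \<le> s" "s \<le> h" "0 \<le> t" "t \<le> h" for s t
  proof -
    have "dist (x + s *\<^sub>R u + t *\<^sub>R v) x = norm (s *\<^sub>R u + t *\<^sub>R v)" by (simp add: dist_norm algebra_simps)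
    also have "\<dots> \<le> s * norm u + t * norm v" using norm_triangle_ineq[of "s *\<^sub>R u" "t *\<^sub>R v"] that by simp
    also have "\<dots> \<le> h * norm u + h * norm v" by (intro add_mono mult_right_mono) (use that in auto)
    also have "\<dots> < h * (2 * (norm u + norm v + 1))"
    proof -
      have "0 < h * (norm u + norm v + 2)" using h by (intro mult_pos_pos add_nonneg_pos) auto
      then show ?thesis by (simp add: algebra_simps)
    qed
    also have "\<dots> = r"
      using norm_ge_zero[of u] norm_ge_zero[of v] by (simp add: h_def field_simps add_nonneg_eq_0_iff)
    finally show ?thesis .
  qed
  have inS: "x + s *\<^sub>R u + t *\<^sub>R v \<in> S" if "0 \<le> s" "s \<le> h" "0 \<le> t" "t \<le> h" for s t
    using near[OF that] d3 by (auto simp: r_def dist_commute)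
  obtain s t where st: "0 < s" "s < h" "0 < t" "t < h" "f (x + h *\<^sub>R u + h *\<^sub>R v) - f (x + h *\<^sub>R u) - f (x + h *\<^sub>R v) + f x = h * h * dd (dd f u) v (x + s *\<^sub>R u + t *\<^sub>R v)"
    using second_difference_mvt[OF f h, of x u v] inS by blast
  have inS': "x + s *\<^sub>R v + t *\<^sub>R u \<in> S" if "0 \<le> s" "s \<le> h" "0 \<le> t" "t \<le> h" for s t
    using inS[OF that(3,4,1,2)] by (simp add: algebra_simps)
  obtain s' t' where st': "0 < s'" "s' < h" "0 < t'" "t' < h" "f (x + h *\<^sub>R v + h *\<^sub>R u) - f (x + h *\<^sub>R v) - f (x + h *\<^sub>R u) + f x = h * h * dd (dd f v) u (x + s' *\<^sub>R v + t' *\<^sub>R u)"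
    using second_difference_mvt[OF f h, of x v u] inS' by blast
  have "h * h * dd (dd f u) v (x + s *\<^sub>R u + t *\<^sub>R v) = h * h * dd (dd f v) u (x + t' *\<^sub>R u + s' *\<^sub>R v)"
    using st(5) st'(5) by (simp add: algebra_simps)
  then have eq: "dd (dd f u) v (x + s *\<^sub>R u + t *\<^sub>R v) = dd (dd f v) u (x + t' *\<^sub>R u + s' *\<^sub>R v)"
    using h by simp
  have "dist (dd (dd f u) v (x + s *\<^sub>R u + t *\<^sub>R v)) (dd (dd f u) v x) < e"
    "dist (dd (dd f v) u (x + t' *\<^sub>R u + s' *\<^sub>R v)) (dd (dd f v) u x) < e"
    using near[of s t] near[of t' s'] st st' by (auto intro!: d simp: r_def)
  then have "dist (dd (dd f u) v x) (dd (dd f v) u x) < e + e"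
    using eq by (metis dist_commute dist_triangle_less_add)
  then show False unfolding e_def dist_real_def by simp
qed

lemma dd_commute:
  fixes f :: "'a::real_normed_vector \<Rightarrow> 'b::euclidean_space"
  assumes S: "open S" and f: "smooth_on S f" and x: "x \<in> S"
  shows "dd (dd f u) v x = dd (dd f v) u x"
proof (rule euclidean_eqI)
  fix b :: 'b
  have fb: "smooth_on S (\<lambda>x. f x \<bullet> b)" by (rule smooth_on_bounded_linear[OF bounded_linear_inner_left S f])
  have 1: "dd (dd f u) v x \<bullet> b = dd (dd (\<lambda>x. f x \<bullet> b) u) v x" for u v
  proof -
    have "dd (dd (\<lambda>x. f x \<bullet> b) u) v x = dd (\<lambda>x. dd f u x \<bullet> b) v x"
      by (rule dd_cong[OF S x]) (rule dd_bounded_linear[OF bounded_linear_inner_left f])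
    then show ?thesis using dd_bounded_linear[OF bounded_linear_inner_left smooth_on_dd[OF f] x] by simp
  qed
  show "dd (dd f u) v x \<bullet> b = dd (dd f v) u x \<bullet> b"
    unfolding 1 by (rule dd_commute_real[OF S fb x])
qed

section \<open>Smooth cutoff functions\<close>

text \<open>Polynomials in \<open>1 / x\<close> times \<open>exp (- 1 / x)\<close>, continued by 0,
  form a class closed under differentiation, so one induction over all \<open>p\<close> proves
  smoothness; \<open>flat 1\<close> is the standard smooth function that vanishes to infinite order
  at 0.\<close>

definition flat :: "real poly \<Rightarrow> real \<Rightarrow> real" where
  "flat p x = (if x > 0 then poly p (1 / x) * exp (- (1 / x)) else 0)"

lemma poly_times_exp_tendsto_0: "((\<lambda>y::real. poly p y * exp (- y)) \<longlongrightarrow> 0) at_top"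
proof -
  have "((\<lambda>y. \<Sum>i\<le>degree p. coeff p i * (y ^ i / exp y)) \<longlongrightarrow> (\<Sum>i\<le>degree p. coeff p i * 0)) at_top"
    by (intro tendsto_sum tendsto_mult tendsto_const tendsto_power_div_exp_0)
  moreover have "(\<Sum>i\<le>degree p. coeff p i * (y ^ i / exp y)) = poly p y * exp (- y)" for y :: real
    by (simp add: poly_altdef sum_distrib_right exp_minus divide_inverse mult.assoc)
  ultimately show ?thesis by simp
qed

lemma flat_tendsto_0: "(flat p \<longlongrightarrow> 0) (at 0)"
proof (rule filterlim_split_at)
  have "eventually (\<lambda>x. 0 = flat p x) (at_left 0)"
    by (rule eventually_at_leftI[of "-1"]) (auto simp: flat_def)
  then show "(flat p \<longlongrightarrow> 0) (at_left 0)"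
    by (rule Lim_transform_eventually[OF tendsto_const])
  have 1: "((\<lambda>x::real. poly p (inverse x) * exp (- inverse x)) \<longlongrightarrow> 0) (at_right 0)"
    by (rule filterlim_compose[OF poly_times_exp_tendsto_0 filterlim_inverse_at_top_right])
  have "eventually (\<lambda>x. poly p (inverse x) * exp (- inverse x) = flat p x) (at_right 0)"
    by (rule eventually_at_rightI[of _ 1]) (auto simp: flat_def inverse_eq_divide)
  then show "(flat p \<longlongrightarrow> 0) (at_right 0)"
    by (rule Lim_transform_eventually[OF 1])
qed

text \<open>With \<open>y = 1 / x\<close>, the derivative in \<open>x\<close> is
  \<open>- y^2\<close> times that in \<open>y\<close>, which sends \<open>p(y) exp(-y)\<close> to
  \<open>y^2 (p - p')(y) exp(-y)\<close>.\<close>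

lemma flat_has_derivative:
  "(flat p has_real_derivative flat ([:0, 0, 1:] * (p - pderiv p)) x) (at x)"
proof -
  consider "x > 0" | "x < 0" | "x = 0" by linarith
  then show ?thesis
  proof cases
    case 1
    have "((\<lambda>x. poly p (1 / x) * exp (- (1 / x))) has_real_derivative flat ([:0, 0, 1:] * (p - pderiv p)) x) (at x)"
      using 1 by (auto intro!: derivative_eq_intros DERIV_chain'[where f = "\<lambda>x. 1 / x", OF _ poly_DERIV]
          simp: flat_def field_simps power2_eq_square)
    then show ?thesis
      by (rule has_field_derivative_transform_within_open[where S = "{0<..}"]) (use 1 in \<open>auto simp: flat_def\<close>)
  next
    case 2
    have "((\<lambda>x. 0) has_real_derivative flat ([:0, 0, 1:] * (p - pderiv p)) x) (at x)"
      using 2 by (simp add: flat_def)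
    then show ?thesis
      by (rule has_field_derivative_transform_within_open[where S = "{..<0}"]) (use 2 in \<open>auto simp: flat_def\<close>)
  next
    case 3
    \<comment> \<open>At 0 the difference quotient is again a flat function: dividing by
      \<open>h\<close> multiplies the polynomial in \<open>1 / h\<close> by its variable.\<close>
    have "eventually (\<lambda>h. flat (pCons 0 p) h = (flat p (0 + h) - flat p 0) / h) (at 0)"
      by (rule eventually_at_topological[THEN iffD2]) (auto simp: flat_def field_simps)
    then show ?thesis
      unfolding 3 DERIV_def using Lim_transform_eventually[OF flat_tendsto_0[of "pCons 0 p"]]
      by (simp add: flat_def)
  qed
qed

lemma smooth_on_flat: "smooth_on UNIV (flat p)"
proof -
  have "Ck_on k UNIV (flat p)" for k
  proof (induction k arbitrary: p)
    case 0
    show ?case using DERIV_isCont[OF flat_has_derivative] by (simp add: continuous_at_imp_continuous_on)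
  next
    case (Suc k)
    show ?case
    proof (rule Ck_on_SucI[where f' = "\<lambda>v x. v * flat ([:0, 0, 1:] * (p - pderiv p)) x"])
      show "(flat p has_derivative (\<lambda>v. v * flat ([:0, 0, 1:] * (p - pderiv p)) x)) (at x)" for x
        using flat_has_derivative[of p x] by (simp add: has_field_derivative_def mult.commute[of _ "flat _ _"])
    qed (auto intro!: Ck_on_bounded_linear[OF bounded_linear_mult_right] Suc)
  qed
  then show ?thesis by (simp add: smooth_on_def)
qed

lemma flat_1_pos: "flat 1 x > 0 \<longleftrightarrow> x > 0"
  by (simp add: flat_def)

lemma flat_1_nonneg: "flat 1 x \<ge> 0"
  by (simp add: flat_def)

text \<open>The squared distance is used because the norm is not smooth at \<open>z\<close>;
  \<open>4 r^2\<close> and \<open>r^2\<close> belong to the outer and the inner radius. The two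
  summands of the denominator never vanish together.\<close>

definition cutoff :: "'a::euclidean_space \<Rightarrow> real \<Rightarrow> 'a \<Rightarrow> real" where
  "cutoff z r y = flat 1 (4 * r\<^sup>2 - (y - z) \<bullet> (y - z)) /
     (flat 1 (4 * r\<^sup>2 - (y - z) \<bullet> (y - z)) + flat 1 ((y - z) \<bullet> (y - z) - r\<^sup>2))"

lemma cutoff_denominator:
  assumes "r > 0"
  shows "flat 1 (4 * r\<^sup>2 - s) + flat 1 (s - r\<^sup>2) > 0"
proof (cases "s < 4 * r\<^sup>2")
  case True
  then show ?thesis using flat_1_pos[of "4 * r\<^sup>2 - s"] flat_1_nonneg[of "s - r\<^sup>2"] by linarith
next
  case False
  moreover have "r\<^sup>2 > 0" using assms by simp
  ultimately have "s - r\<^sup>2 > 0" by linarith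
  then show ?thesis using flat_1_pos[of "s - r\<^sup>2"] flat_1_nonneg[of "4 * r\<^sup>2 - s"] by linarith
qed

lemma smooth_on_cutoff:
  assumes "r > 0"
  shows "smooth_on UNIV (cutoff z r)"
proof -
  have q: "smooth_on UNIV (\<lambda>y. (y - z) \<bullet> (y - z))"
    by (intro smooth_on_bounded_bilinear[OF bounded_bilinear_inner] smooth_on_diff smooth_on_ident smooth_on_const) auto
  have 1: "smooth_on UNIV (\<lambda>y. flat 1 (4 * r\<^sup>2 - (y - z) \<bullet> (y - z)))"
    by (rule smooth_on_compose[OF smooth_on_flat]) (intro smooth_on_diff smooth_on_const q, auto)
  have 2: "smooth_on UNIV (\<lambda>y. flat 1 ((y - z) \<bullet> (y - z) - r\<^sup>2))"
    by (rule smooth_on_compose[OF smooth_on_flat]) (intro smooth_on_diff smooth_on_const q, auto)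
  have "cutoff z r = (\<lambda>y. flat 1 (4 * r\<^sup>2 - (y - z) \<bullet> (y - z)) /
     (flat 1 (4 * r\<^sup>2 - (y - z) \<bullet> (y - z)) + flat 1 ((y - z) \<bullet> (y - z) - r\<^sup>2)))"
    by (simp add: cutoff_def fun_eq_iff)
  then show ?thesis
    using cutoff_denominator[OF assms] by (auto intro!: smooth_on_divide smooth_on_add 1 2 simp: less_imp_neq[symmetric])
qed

lemma inner_self_dist: "(y - z) \<bullet> (y - z) = (dist z y)\<^sup>2"
  by (simp add: dist_norm power2_norm_eq_inner norm_minus_commute)

lemma cutoff_nonneg: "cutoff z r y \<ge> 0"
  by (simp add: cutoff_def flat_1_nonneg)

lemma cutoff_eq_1: "r > 0 \<Longrightarrow> y \<in> ball z r \<Longrightarrow> cutoff z r y = 1"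
proof -
  assume r: "r > 0" and y: "y \<in> ball z r"
  have "(dist z y)\<^sup>2 < r\<^sup>2" using y by (simp add: power_strict_mono)
  then have "flat 1 ((dist z y)\<^sup>2 - r\<^sup>2) = 0" by (simp add: flat_def)
  moreover have "4 * r\<^sup>2 - (dist z y)\<^sup>2 > 0" using \<open>(dist z y)\<^sup>2 < r\<^sup>2\<close> zero_le_power2[of r] by linarith
  ultimately show ?thesis using flat_1_pos[of "4 * r\<^sup>2 - (dist z y)\<^sup>2"] by (simp add: cutoff_def inner_self_dist)
qed

lemma cutoff_eq_0: "r > 0 \<Longrightarrow> y \<notin> ball z (2 * r) \<Longrightarrow> cutoff z r y = 0"
proof -
  assume r: "r > 0" and y: "y \<notin> ball z (2 * r)"
  have "(2 * r)\<^sup>2 \<le> (dist z y)\<^sup>2" using y r by (intro power_mono) auto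
  then show ?thesis by (simp add: cutoff_def inner_self_dist flat_def)
qed

section \<open>Indefinite inner products\<close>

definition tr :: "(real ^ 'd \<Rightarrow> real ^ 'd) \<Rightarrow> real" where
  "tr L = (\<Sum>i\<in>UNIV. L (axis i 1) $ i)"

lemma tr_add: "tr (\<lambda>u. K u + L u) = tr K + tr L"
  by (simp add: tr_def sum.distrib)

lemma tr_diff: "tr (\<lambda>u. K u - L u) = tr K - tr L"
  by (simp add: tr_def sum_subtractf)

lemma tr_minus: "tr (\<lambda>u. - L u) = - tr L"
  by (simp add: tr_def sum_negf)

lemma tr_scaleR: "tr (\<lambda>u. c *\<^sub>R L u) = c * tr L"
  by (simp add: tr_def sum_distrib_left)

lemma tr_ident: "tr (\<lambda>u::real^'d::finite. u) = CARD('d)"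
  by (simp add: tr_def)

lemma tr_comp_commute:
  fixes K L :: "real ^ 'd::finite \<Rightarrow> real ^ 'd"
  assumes "linear K" "linear L"
  shows "tr (\<lambda>u. K (L u)) = tr (\<lambda>u. L (K u))"
proof -
  have exp: "M v $ i = (\<Sum>j\<in>UNIV. v $ j * M (axis j 1) $ i)"
    if "linear M" for M :: "real^'d \<Rightarrow> real^'d" and v i
  proof -
    have "M (\<Sum>j\<in>UNIV. (v $ j) *\<^sub>R axis j 1) = (\<Sum>j\<in>UNIV. (v $ j) *\<^sub>R M (axis j 1))"
      using that by (simp add: linear_sum linear_scale)
    then show ?thesis by (simp add: vec_axis_sum[symmetric])
  qed
  have "tr (\<lambda>u. K (L u)) = (\<Sum>i\<in>UNIV. \<Sum>j\<in>UNIV. L (axis i 1) $ j * K (axis j 1) $ i)"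
    unfolding tr_def by (rule sum.cong[OF refl]) (rule exp[OF assms(1)])
  also have "\<dots> = (\<Sum>j\<in>UNIV. \<Sum>i\<in>UNIV. K (axis j 1) $ i * L (axis i 1) $ j)"
    by (subst sum.swap) (simp add: mult.commute)
  also have "\<dots> = tr (\<lambda>u. L (K u))"
    unfolding tr_def by (rule sum.cong[OF refl]) (rule exp[OF assms(2), symmetric])
  finally show ?thesis .
qed

locale indef_inner =
  fixes b :: "real ^ 'd::finite \<Rightarrow> real ^ 'd \<Rightarrow> real"
  assumes lin1: "linear (\<lambda>u. b u v)"
    and sym: "b u v = b v u"
    and nondegenerate: "(\<And>v. b u v = 0) \<Longrightarrow> u = 0"
begin

lemma lin2: "linear (b u)"
  using lin1[of u] sym[of u] by presburger

lemma left_simps: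
  "b (u + u') v = b u v + b u' v" "b (u - u') v = b u v - b u' v" "b (- u) v = - b u v"
  "b (c *\<^sub>R u) v = c * b u v" "b 0 v = 0"
  using linear_add[OF lin1] linear_diff[OF lin1] linear_neg[OF lin1] linear_scale[OF lin1] linear_0[OF lin1]
  by simp_all

lemma right_simps:
  "b v (u + u') = b v u + b v u'" "b v (u - u') = b v u - b v u'" "b v (- u) = - b v u"
  "b v (c *\<^sub>R u) = c * b v u" "b v 0 = 0"
  using left_simps by (simp_all add: sym[of v])

lemmas bsimps = left_simps right_simps

lemma left_sum: "b (\<Sum>i\<in>I. f i) v = (\<Sum>i\<in>I. b (f i) v)"
  by (rule linear_sum[OF lin1])

lemma right_sum: "b v (\<Sum>i\<in>I. f i) = (\<Sum>i\<in>I. b v (f i))"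
  by (rule linear_sum[OF lin2])

lemma eqI: "(\<And>v. b u v = b w v) \<Longrightarrow> u = w"
  using nondegenerate[of "u - w"] by (simp add: bsimps)

definition orthonormal :: "('d \<Rightarrow> real ^ 'd) \<Rightarrow> bool" where
  "orthonormal E \<longleftrightarrow> (\<forall>i j. i \<noteq> j \<longrightarrow> b (E i) (E j) = 0) \<and> (\<forall>i. b (E i) (E i) = 1 \<or> b (E i) (E i) = - 1)"

text \<open>Gram-Schmidt fails on null vectors. If every vector orthogonal to the chosen ones were
  null, polarisation would make any two of them orthogonal to each other; a nonzero projected vector
  \<open>P v\<close> would then be orthogonal to everything, against nondegeneracy.\<close>

lemma orthonormal_extend:
  fixes I :: "'d set"
  assumes fin: "finite I" and sub: "I \<noteq> UNIV"
    and E: "\<And>i j. i \<in> I \<Longrightarrow> j \<in> I \<Longrightarrow> i \<noteq> j \<Longrightarrow> b (E i) (E j) = 0"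
      "\<And>i. i \<in> I \<Longrightarrow> b (E i) (E i) = 1 \<or> b (E i) (E i) = - 1"
  shows "\<exists>u. (\<forall>i\<in>I. b u (E i) = 0) \<and> (b u u = 1 \<or> b u u = - 1)"
proof -
  \<comment> \<open>The orthogonal projection onto the complement of the chosen vectors; the factor
    \<open>b (E i) (E i)\<close> is its own inverse, being 1 or -1.\<close>
  define P where "P v = v - (\<Sum>i\<in>I. (b (E i) (E i) * b v (E i)) *\<^sub>R E i)" for v
  have orth: "b (P v) (E j) = 0" if j: "j \<in> I" for v j
  proof -
    have "(\<Sum>i\<in>I. b (E i) (E i) * b v (E i) * b (E i) (E j)) = (\<Sum>i\<in>{j}. b (E i) (E i) * b v (E i) * b (E i) (E j))"
      using fin j E(1) by (intro sum.mono_neutral_right) auto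
    then show ?thesis
      using E(2)[OF j] by (auto simp: P_def bsimps left_sum)
  qed
  have "dim (E ` I) < DIM(real^'d)"
  proof -
    have "dim (E ` I) \<le> card (E ` I)" using fin by (intro dim_le_card') auto
    also have "\<dots> \<le> card I" using fin by (rule card_image_le)
    also have "\<dots> < CARD('d)" using sub psubset_card_mono[of "UNIV :: 'd set" I] by auto
    finally show ?thesis by simp
  qed
  then have "span (E ` I) \<noteq> UNIV" by (metis dim_UNIV dim_span less_irrefl)
  then obtain v where v: "v \<notin> span (E ` I)" by auto
  have Pv: "P v \<noteq> 0"
  proof
    assume "P v = 0"
    then have "v = (\<Sum>i\<in>I. (b (E i) (E i) * b v (E i)) *\<^sub>R E i)" by (simp add: P_def)
    also have "\<dots> \<in> span (E ` I)" by (intro span_sum span_scale span_base imageI)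
    finally show False using v by simp
  qed
  have "\<exists>u. (\<forall>i\<in>I. b u (E i) = 0) \<and> b u u \<noteq> 0"
  proof (rule ccontr)
    assume "\<not> ?thesis"
    then have null: "b u u = 0" if "\<And>i. i \<in> I \<Longrightarrow> b u (E i) = 0" for u using that by blast
    have "b (P v) w = 0" for w
    proof -
      have "b (P v + P w) (P v + P w) = 0" "b (P v) (P v) = 0" "b (P w) (P w) = 0"
        by (intro null; simp add: bsimps orth)+
      then have "b (P v) (P w) = 0" using sym[of "P v" "P w"] by (simp add: bsimps)
      moreover have "b (P v) (P w) = b (P v) w"
        using orth by (simp add: P_def[of w] bsimps right_sum)
      ultimately show ?thesis by simp
    qed
    then show False using nondegenerate Pv by blast
  qed
  then obtain u where u: "\<And>i. i \<in> I \<Longrightarrow> b u (E i) = 0" "b u u \<noteq> 0" by blast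
  define w where "w = (1 / sqrt \<bar>b u u\<bar>) *\<^sub>R u"
  have "b w w = b u u / \<bar>b u u\<bar>" using u(2) by (simp add: w_def bsimps)
  then have "b w w = 1 \<or> b w w = - 1" using u(2) by (auto simp: abs_if)
  moreover have "\<forall>i\<in>I. b w (E i) = 0" using u(1) by (simp add: w_def bsimps)
  ultimately show ?thesis by blast
qed

lemma orthonormal_exists: "\<exists>E. orthonormal E"
proof -
  have "\<exists>E. (\<forall>i\<in>I. \<forall>j\<in>I. i \<noteq> j \<longrightarrow> b (E i) (E j) = 0) \<and> (\<forall>i\<in>I. b (E i) (E i) = 1 \<or> b (E i) (E i) = - 1)"
    if "finite I" for I :: "'d set"
    using that
  proof (induction I)
    case (insert k I)
    then obtain E where E: "\<And>i j. i \<in> I \<Longrightarrow> j \<in> I \<Longrightarrow> i \<noteq> j \<Longrightarrow> b (E i) (E j) = 0"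
      "\<And>i. i \<in> I \<Longrightarrow> b (E i) (E i) = 1 \<or> b (E i) (E i) = - 1" by metis
    have "I \<noteq> UNIV" using insert by auto
    then obtain u where u: "\<forall>i\<in>I. b u (E i) = 0" "b u u = 1 \<or> b u u = - 1"
      using orthonormal_extend[of I E, OF insert(1) _ E] by blast
    show ?case
      by (rule exI[of _ "E(k := u)"]) (use u E insert(2) sym in auto)
  qed auto
  from this[of UNIV] show ?thesis unfolding orthonormal_def by simp
qed

context
  fixes E assumes E: "orthonormal E"
begin

lemma E_orth: "i \<noteq> j \<Longrightarrow> b (E i) (E j) = 0"
  using E by (auto simp: orthonormal_def)

lemma E_sign: "b (E i) (E i) * b (E i) (E i) = 1"
  using E unfolding orthonormal_def by (metis mult_1 square_eq_1_iff power2_eq_square mult_minus1 minus_minus)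

lemma E_coefficient: "b (\<Sum>i\<in>UNIV. c i *\<^sub>R E i) (E j) = c j * b (E j) (E j)"
proof -
  have "(\<Sum>i\<in>UNIV. c i * b (E i) (E j)) = (\<Sum>i\<in>{j}. c i * b (E i) (E j))"
    by (intro sum.mono_neutral_right) (auto simp: E_orth)
  then show ?thesis by (simp add: left_sum bsimps)
qed

lemma span_E: "span (range E) = UNIV"
proof -
  have inj: "inj E"
  proof (rule injI)
    fix i j assume "E i = E j"
    then show "i = j" using E_orth[of i j] E_sign[of i] by (cases "i = j") auto
  qed
  have "independent (range E)"
  proof (rule independent_if_scalars_zero)
    fix f x assume s: "(\<Sum>y\<in>range E. f y *\<^sub>R y) = 0" and "x \<in> range E"
    then obtain j where j: "x = E j" by auto
    have "(\<Sum>i\<in>UNIV. f (E i) *\<^sub>R E i) = 0" using s inj by (simp add: sum.reindex)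
    then show "f x = 0" using E_coefficient[of "\<lambda>i. f (E i)" j] E_sign[of j] j by (auto simp: bsimps)
  qed auto
  moreover have "card (range E) = DIM(real^'d)" using inj by (simp add: card_image)
  ultimately show ?thesis by (metis card_eq_dim dim_UNIV finite_imageI finite_code order_refl subset_UNIV top.extremum_uniqueI)
qed

text \<open>The remainder is orthogonal to each frame vector, hence to their span, which is the
  whole space by a dimension count; nondegeneracy makes it vanish.\<close>

lemma E_expansion: "v = (\<Sum>i\<in>UNIV. (b (E i) (E i) * b v (E i)) *\<^sub>R E i)"
proof -
  define u where "u = v - (\<Sum>i\<in>UNIV. (b (E i) (E i) * b v (E i)) *\<^sub>R E i)"
  have "b u (E j) = 0" for j
    using E_sign[of j] by (simp add: u_def bsimps E_coefficient algebra_simps)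
  moreover have "subspace {w. b u w = 0}" by (auto simp: subspace_def bsimps)
  ultimately have "span (range E) \<subseteq> {w. b u w = 0}" by (intro span_minimal) auto
  then have "b u w = 0" for w using span_E by auto
  then have "u = 0" by (rule nondegenerate)
  then show ?thesis by (simp add: u_def)
qed

lemma tr_orthonormal:
  assumes L: "linear L"
  shows "tr L = (\<Sum>i\<in>UNIV. b (E i) (E i) * b (L (E i)) (E i))"
proof -
  have 1: "L (axis i 1) = (\<Sum>j\<in>UNIV. (b (E j) (E j) * b (axis i 1) (E j)) *\<^sub>R L (E j))" for i
    by (subst E_expansion[of "axis i 1"]) (simp add: linear_sum[OF L] linear_scale[OF L])
  have "tr L = (\<Sum>i\<in>UNIV. \<Sum>j\<in>UNIV. b (E j) (E j) * b (axis i 1) (E j) * L (E j) $ i)"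
    unfolding tr_def by (subst 1) simp
  also have "\<dots> = (\<Sum>j\<in>UNIV. b (E j) (E j) * b (\<Sum>i\<in>UNIV. (L (E j) $ i) *\<^sub>R axis i 1) (E j))"
    by (subst sum.swap) (simp add: left_sum bsimps sum_distrib_left algebra_simps)
  finally show ?thesis by (simp add: vec_axis_sum[symmetric])
qed

end

lemma tr_adjoint:
  assumes "linear K" "linear L" "\<And>u v. b (K u) v = b u (L v)"
  shows "tr K = tr L"
proof -
  obtain E where E: "orthonormal E" using orthonormal_exists by blast
  show ?thesis unfolding tr_orthonormal[OF E assms(1)] tr_orthonormal[OF E assms(2)] assms(3)
    by (simp add: sym[of "E _" "L _"])
qed

lemma tr_skew:
  assumes "linear K" "\<And>u v. b (K u) v = - b u (K v)"
  shows "tr K = 0"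
proof -
  have "tr K = tr (\<lambda>u. - K u)"
    by (rule tr_adjoint) (use assms in \<open>auto simp: bsimps linear_compose_neg\<close>)
  then show ?thesis by (simp add: tr_minus)
qed

lemma tr_rank_one: "tr (\<lambda>u. b w u *\<^sub>R v) = b w v"
proof -
  have "tr (\<lambda>u. b w u *\<^sub>R v) = b w (\<Sum>i\<in>UNIV. (v $ i) *\<^sub>R axis i 1)"
    by (simp add: tr_def right_sum bsimps mult.commute)
  then show ?thesis by (simp add: vec_axis_sum[symmetric])
qed

text \<open>The metric dual of the coordinate form \<open>dx^j\<close>, that is, a column of the
  inverse Gram matrix. It allows metric traces to be taken over the coordinate basis, so that they
  depend smoothly on the point.\<close>

definition dual :: "'d \<Rightarrow> real ^ 'd" where
  "dual j = (THE u. \<forall>v. b u v = v $ j)"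

lemma dual_apply: "b (dual j) v = v $ j"
proof -
  obtain E where E: "orthonormal E" using orthonormal_exists by blast
  have "\<forall>v. b (\<Sum>i\<in>UNIV. (b (E i) (E i) * E i $ j) *\<^sub>R E i) v = v $ j"
  proof
    fix v
    have "v $ j = (\<Sum>i\<in>UNIV. (b (E i) (E i) * b v (E i)) *\<^sub>R E i) $ j"
      by (subst E_expansion[OF E, of v]) simp
    then show "b (\<Sum>i\<in>UNIV. (b (E i) (E i) * E i $ j) *\<^sub>R E i) v = v $ j"
      by (simp add: left_sum bsimps sym[of "E _" v] algebra_simps)
  qed
  moreover have "u = w" if "\<forall>v. b u v = v $ j" "\<forall>v. b w v = v $ j" for u w
    by (rule eqI) (simp add: that)
  ultimately have "\<exists>!u. \<forall>v. b u v = v $ j" by blast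
  from theI'[OF this] show ?thesis unfolding dual_def by blast
qed

text \<open>Both sides contract \<open>B\<close> with the inverse Gram matrix, whose entries are the
  sums over \<open>k\<close> of \<open>b (E k) (E k) * E k $ i * E k $ j\<close>.\<close>

lemma metric_trace_dual:
  assumes E: "orthonormal E" and B: "\<And>v. linear (\<lambda>u. B u v)" "\<And>u. linear (B u)"
  shows "(\<Sum>i\<in>UNIV. b (E i) (E i) * B (E i) (E i)) = (\<Sum>j\<in>UNIV. B (dual j) (axis j 1))"
proof -
  have d: "dual j = (\<Sum>i\<in>UNIV. (b (E i) (E i) * E i $ j) *\<^sub>R E i)" for j
    by (subst E_expansion[OF E, of "dual j"]) (simp add: dual_apply)
  have "B (E i) (E i) = (\<Sum>j\<in>UNIV. E i $ j * B (E i) (axis j 1))" for i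
    by (subst (2) vec_axis_sum[of "E i"]) (simp add: linear_sum[OF B(2)] linear_scale[OF B(2)])
  then have "(\<Sum>i\<in>UNIV. b (E i) (E i) * B (E i) (E i)) = (\<Sum>j\<in>UNIV. \<Sum>i\<in>UNIV. b (E i) (E i) * E i $ j * B (E i) (axis j 1))"
    by (simp add: sum_distrib_left algebra_simps) (rule sum.swap)
  also have "\<dots> = (\<Sum>j\<in>UNIV. B (dual j) (axis j 1))"
    by (simp add: d linear_sum[OF B(1)] linear_scale[OF B(1)])
  finally show ?thesis .
qed

lemma representation: "linear f \<Longrightarrow> b (\<Sum>j\<in>UNIV. f (axis j 1) *\<^sub>R dual j) v = f v"
  by (subst (2) vec_axis_sum[of v]) (simp add: left_sum bsimps dual_apply linear_sum linear_scale mult.commute)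

end

text \<open>Jacobi's formula; each row of the derivative is expanded in the rows of the matrix.\<close>
lemma det_row_replacement:
  fixes M :: "real^'n^'n" and C :: "real^'n^'n"
  shows "det (\<chi> i. if i = k then (\<Sum>j\<in>UNIV. C $ i $ j *\<^sub>R row j M) else row i M) = C $ k $ k * det M"
proof -
  have "(\<chi> i. if i = k then (\<Sum>j\<in>UNIV. C $ i $ j *\<^sub>R row j M) else row i M) =
    (\<chi> i. if i = k then (\<Sum>j\<in>UNIV. (C $ k) $ j *s row j M) else row i M)"
    by (simp add: vec_eq_iff scalar_mult_eq_scaleR)
  then show ?thesis using cramer_lemma_transpose[of k "C $ k" M] by simp
qed

lemma has_derivative_det:
  fixes M :: "'a::real_normed_vector \<Rightarrow> real^'n::finite^'n"
  assumes M: "\<And>i j. ((\<lambda>y. M y $ i $ j) has_derivative (\<lambda>v. D v $ i $ j)) (at x)"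
  shows "((\<lambda>y. det (M y)) has_derivative (\<lambda>v. \<Sum>k\<in>UNIV. det (\<chi> i. if i = k then D v $ i else M x $ i))) (at x)"
proof -
  have prod: "((\<lambda>y. \<Prod>i\<in>UNIV. M y $ i $ p i) has_derivative
      (\<lambda>v. \<Sum>k\<in>UNIV. \<Prod>i\<in>UNIV. (if i = k then D v $ i else M x $ i) $ p i)) (at x)" for p
  proof -
    have "((\<lambda>y. \<Prod>i\<in>UNIV. M y $ i $ p i) has_derivative
      (\<lambda>v. \<Sum>k\<in>UNIV. D v $ k $ p k * (\<Prod>i\<in>UNIV - {k}. M x $ i $ p i))) (at x)"
      by (rule has_derivative_prod) (rule M)
    moreover have "D v $ k $ p k * (\<Prod>i\<in>UNIV - {k}. M x $ i $ p i) = (\<Prod>i\<in>UNIV. (if i = k then D v $ i else M x $ i) $ p i)" for v k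
      by (subst prod.remove[of UNIV k]) auto
    ultimately show ?thesis by simp
  qed
  have "((\<lambda>y. \<Sum>p | p permutes UNIV. of_int (sign p) * (\<Prod>i\<in>UNIV. M y $ i $ p i)) has_derivative
      (\<lambda>v. \<Sum>p | p permutes UNIV. of_int (sign p) * (\<Sum>k\<in>UNIV. \<Prod>i\<in>UNIV. (if i = k then D v $ i else M x $ i) $ p i))) (at x)"
    by (intro has_derivative_sum has_derivative_mult_right prod)
  moreover have "(\<Sum>p | p permutes UNIV. of_int (sign p) * (\<Sum>k\<in>UNIV. \<Prod>i\<in>UNIV. (if i = k then D v $ i else M x $ i) $ p i))
    = (\<Sum>k\<in>UNIV. det (\<chi> i. if i = k then D v $ i else M x $ i))" for v
    unfolding det_def sum_distrib_left by (subst sum.swap) simp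
  ultimately show ?thesis unfolding det_def[abs_def] by simp
qed

text \<open>The derivative of the matrix is prescribed in the form \<open>C M\<close>, which avoids
  the inverse of \<open>M\<close>: replacing a row by its derivative multiplies the determinant by
  one diagonal entry of \<open>C\<close>.\<close>

lemma has_derivative_det_trace:
  fixes M :: "'a::real_normed_vector \<Rightarrow> real^'n::finite^'n"
  assumes "\<And>i j. ((\<lambda>y. M y $ i $ j) has_derivative (\<lambda>v. (\<Sum>k\<in>UNIV. C v $ i $ k * M x $ k $ j))) (at x)"
  shows "((\<lambda>y. det (M y)) has_derivative (\<lambda>v. trace (C v) * det (M x))) (at x)"
proof -
  have "((\<lambda>y. det (M y)) has_derivative (\<lambda>v. \<Sum>k\<in>UNIV. det (\<chi> i. if i = k then (C v ** M x) $ i else M x $ i))) (at x)"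
    by (rule has_derivative_det) (simp add: matrix_matrix_mult_def assms)
  moreover have "det (\<chi> i. if i = k then (C v ** M x) $ i else M x $ i) = C v $ k $ k * det (M x)" for v k
  proof -
    have "(\<chi> i. if i = k then (C v ** M x) $ i else M x $ i) =
      (\<chi> i. if i = k then (\<Sum>j\<in>UNIV. C v $ i $ j *\<^sub>R row j (M x)) else row i (M x))"
      by (simp add: vec_eq_iff matrix_matrix_mult_def row_def)
    then show ?thesis using det_row_replacement[of k "C v" "M x"] by simp
  qed
  ultimately show ?thesis by (simp add: trace_def sum_distrib_right)
qed

lemma smooth_on_det:
  assumes "open S" "\<And>i j. smooth_on S (\<lambda>y. M y $ i $ j)"
  shows "smooth_on S (\<lambda>y. det (M y :: real^'n::finite^'n))"
  unfolding det_def by (intro smooth_on_sum smooth_on_mult smooth_on_const smooth_on_prod assms)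

section \<open>Gram determinants and smooth dependence of the dual basis\<close>

definition gram :: "(real ^ 'd \<Rightarrow> real ^ 'd \<Rightarrow> real) \<Rightarrow> real ^ 'd ^ 'd" where
  "gram b = (\<chi> i j. b (axis i 1) (axis j 1))"

context indef_inner
begin

lemma gram_mult: "(gram b *v u) $ i = b (axis i 1) u"
  by (subst (2) vec_axis_sum[of u]) (simp add: gram_def matrix_vector_mult_def right_sum bsimps mult.commute)

lemma det_gram_nonzero: "det (gram b) \<noteq> 0"
proof
  assume "det (gram b) = 0"
  then have "\<not> invertible (gram b)" by (simp add: invertible_det_nz)
  then obtain u where u: "gram b *v u = 0" "u \<noteq> 0"
    using matrix_left_invertible_ker[of "gram b"] invertible_left_inverse[of "gram b"] by blast
  have "b (axis i 1) u = 0" for i using gram_mult[of u i] u(1) by simp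
  then have "b u v = 0" for v
    by (subst vec_axis_sum[of v]) (simp add: right_sum bsimps sym[of u])
  then show False using nondegenerate u(2) by blast
qed

text \<open>Cramer's rule turns a vector given by a description into a quotient of determinants in
  the Gram entries, from which smooth dependence on a parameter can be read off.\<close>

lemma dual_cramer:
  "dual k = (\<chi> l. det (\<chi> i j. if j = l then (axis k 1 :: real^'d) $ i else gram b $ i $ j) / det (gram b))"
proof -
  have "gram b *v dual k = axis k 1"
    unfolding vec_eq_iff
  proof
    show "(gram b *v dual k) $ i = axis k 1 $ i" for i
      using sym[of "axis i 1" "dual k"] by (simp add: gram_mult dual_apply) (simp add: axis_def)
  qed
  then show ?thesis using cramer[OF det_gram_nonzero] by blast
qed

end

lemma smooth_on_dual:
  fixes b :: "'a::real_normed_vector \<Rightarrow> real^'d::finite \<Rightarrow> real^'d \<Rightarrow> real"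
  assumes S: "open S" and b: "\<And>y. y \<in> S \<Longrightarrow> indef_inner (b y)"
    and sm: "\<And>u v. smooth_on S (\<lambda>y. b y u v)"
  shows "smooth_on S (\<lambda>y. indef_inner.dual (b y) k)"
proof -
  have g: "smooth_on S (\<lambda>y. gram (b y) $ i $ j)" for i j using sm by (simp add: gram_def)
  have "smooth_on S (\<lambda>y. \<chi> l. det (\<chi> i j. if j = l then (axis k 1 :: real^'d) $ i else gram (b y) $ i $ j) / det (gram (b y)))"
  proof (intro smooth_on_vec_lambda smooth_on_divide smooth_on_det S)
    show "smooth_on S (\<lambda>y. (\<chi> i j. if j = l then (axis k 1 :: real^'d) $ i else gram (b y) $ i $ j) $ i $ j)" for l i j
      using g smooth_on_const[OF S] by (cases "j = l") auto
  qed (use g indef_inner.det_gram_nonzero[OF b] in auto)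
  then show ?thesis
    by (rule smooth_on_cong[OF _ S]) (rule indef_inner.dual_cramer[OF b, symmetric])
qed

section \<open>Tensor calculus in a coordinate patch\<close>

lemma linear_dd_param:
  assumes "open S" "x \<in> S" "\<And>y. y \<in> S \<Longrightarrow> linear (F y)" "\<And>v. smooth_on S (\<lambda>y. F y v)"
  shows "linear (\<lambda>v. dd (\<lambda>y. F y v) w x)"
proof (rule linearI)
  fix u v
  have "dd (\<lambda>y. F y (u + v)) w x = dd (\<lambda>y. F y u + F y v) w x"
    by (rule dd_cong[OF assms(1,2)]) (rule linear_add[OF assms(3)])
  then show "dd (\<lambda>y. F y (u + v)) w x = dd (\<lambda>y. F y u) w x + dd (\<lambda>y. F y v) w x"
    using dd_add[OF assms(4) assms(4) assms(2)] by simp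
next
  fix c v
  have "dd (\<lambda>y. F y (c *\<^sub>R v)) w x = dd (\<lambda>y. c *\<^sub>R F y v) w x"
    by (rule dd_cong[OF assms(1,2)]) (rule linear_scale[OF assms(3)])
  then show "dd (\<lambda>y. F y (c *\<^sub>R v)) w x = c *\<^sub>R dd (\<lambda>y. F y v) w x"
    using dd_bounded_linear[OF bounded_linear_scaleR_right assms(4) assms(2)] by simp
qed

lemma tr_functional: "linear f \<Longrightarrow> tr (\<lambda>u. f u *\<^sub>R w) = f w"
proof -
  assume f: "linear f"
  have "f (\<Sum>i\<in>UNIV. (w $ i) *\<^sub>R axis i 1) = (\<Sum>i\<in>UNIV. w $ i * f (axis i 1))"
    by (simp add: linear_sum[OF f] linear_scale[OF f])
  then show ?thesis by (simp add: tr_def mult.commute vec_axis_sum[symmetric])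
qed

text \<open>A Levi-Civita connection in one chart: \<open>G\<close> is the metric and
  \<open>Gam\<close> the Christoffel symbols, kept as a bilinear map instead of an array of indices.
  Linearity of \<open>Gam\<close> in its first argument follows from that in the second by
  symmetry.\<close>

locale coord_metric =
  fixes N :: "(real ^ 'd::finite) set"
    and G :: "real ^ 'd \<Rightarrow> real ^ 'd \<Rightarrow> real ^ 'd \<Rightarrow> real"
    and Gam :: "real ^ 'd \<Rightarrow> real ^ 'd \<Rightarrow> real ^ 'd \<Rightarrow> real ^ 'd"
  assumes open_N: "open N"
    and G_inner: "y \<in> N \<Longrightarrow> indef_inner (G y)"
    and G_smooth: "smooth_on N (\<lambda>y. G y u v)"
    and Gam_smooth: "smooth_on N (\<lambda>y. Gam y u v)"
    and Gam_linear2: "y \<in> N \<Longrightarrow> linear (Gam y u)"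
    and Gam_sym: "y \<in> N \<Longrightarrow> Gam y u v = Gam y v u"
    and compat: "y \<in> N \<Longrightarrow> dd (\<lambda>z. G z u v) w y = G y (Gam y w u) v + G y u (Gam y w v)"
begin

lemma Gam_linear1: "y \<in> N \<Longrightarrow> linear (\<lambda>u. Gam y u v)"
  using Gam_linear2[of y v] Gam_sym[of y _ v] by simp

lemma Gam_simps:
  assumes "y \<in> N"
  shows "Gam y (u + u') v = Gam y u v + Gam y u' v" "Gam y (u - u') v = Gam y u v - Gam y u' v"
    "Gam y (c *\<^sub>R u) v = c *\<^sub>R Gam y u v" "Gam y (- u) v = - Gam y u v" "Gam y 0 v = 0"
    "Gam y v (u + u') = Gam y v u + Gam y v u'" "Gam y v (u - u') = Gam y v u - Gam y v u'"
    "Gam y v (c *\<^sub>R u) = c *\<^sub>R Gam y v u" "Gam y v (- u) = - Gam y v u" "Gam y v 0 = 0"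
  using linear_add[OF Gam_linear1[OF assms]] linear_diff[OF Gam_linear1[OF assms]]
    linear_scale[OF Gam_linear1[OF assms]] linear_neg[OF Gam_linear1[OF assms]] linear_0[OF Gam_linear1[OF assms]]
    linear_add[OF Gam_linear2[OF assms]] linear_diff[OF Gam_linear2[OF assms]]
    linear_scale[OF Gam_linear2[OF assms]] linear_neg[OF Gam_linear2[OF assms]] linear_0[OF Gam_linear2[OF assms]]
  by simp_all

lemma G_linear: "y \<in> N \<Longrightarrow> linear (\<lambda>u. G y u v)" "y \<in> N \<Longrightarrow> linear (G y u)"
  using indef_inner.lin1[OF G_inner] indef_inner.lin2[OF G_inner] by blast+

definition nab :: "(real ^ 'd \<Rightarrow> real ^ 'd) \<Rightarrow> (real ^ 'd \<Rightarrow> real ^ 'd) \<Rightarrow> real ^ 'd \<Rightarrow> real ^ 'd" where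
  "nab X Y y = dd Y (X y) y + Gam y (X y) (Y y)"

definition bracket :: "(real ^ 'd \<Rightarrow> real ^ 'd) \<Rightarrow> (real ^ 'd \<Rightarrow> real ^ 'd) \<Rightarrow> real ^ 'd \<Rightarrow> real ^ 'd" where
  "bracket X Y y = dd Y (X y) y - dd X (Y y) y"

text \<open>The curvature evaluated on constant fields, whose brackets vanish.\<close>

definition curv :: "real ^ 'd \<Rightarrow> real ^ 'd \<Rightarrow> real ^ 'd \<Rightarrow> real ^ 'd \<Rightarrow> real ^ 'd" where
  "curv y u v w = dd (\<lambda>z. Gam z v w) u y - dd (\<lambda>z. Gam z u w) v y
     + Gam y u (Gam y v w) - Gam y v (Gam y u w)"

definition ric :: "real ^ 'd \<Rightarrow> real ^ 'd \<Rightarrow> real ^ 'd \<Rightarrow> real" where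
  "ric y v w = tr (\<lambda>u. curv y u v w)"

definition covd :: "(real ^ 'd \<Rightarrow> real ^ 'd \<Rightarrow> real ^ 'd) \<Rightarrow> real ^ 'd \<Rightarrow> real ^ 'd \<Rightarrow> real ^ 'd \<Rightarrow> real ^ 'd" where
  "covd F y w v = dd (\<lambda>z. F z v) w y + Gam y w (F y v) - F y (Gam y w v)"

text \<open>The divergence as a 1-form, contracting the direction of differentiation with the value
  of the derivative and leaving its argument free. For self-adjoint \<open>F\<close> this is the
  metric dual of the signed sum of \<open>(\<nabla>_e F) e\<close> over a frame.\<close>

definition dv :: "(real ^ 'd \<Rightarrow> real ^ 'd \<Rightarrow> real ^ 'd) \<Rightarrow> real ^ 'd \<Rightarrow> real ^ 'd \<Rightarrow> real" where
  "dv F y v = tr (\<lambda>u. covd F y u v)"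

text \<open>Not the gradient of a function but the endomorphism that sends \<open>u\<close> to
  \<open>\<nabla>_u X\<close>.\<close>

definition grad :: "(real ^ 'd \<Rightarrow> real ^ 'd) \<Rightarrow> real ^ 'd \<Rightarrow> real ^ 'd \<Rightarrow> real ^ 'd" where
  "grad X y u = dd X u y + Gam y u (X y)"

definition efield :: "(real ^ 'd \<Rightarrow> real ^ 'd \<Rightarrow> real ^ 'd) \<Rightarrow> bool" where
  "efield F \<longleftrightarrow> (\<forall>y\<in>N. linear (F y)) \<and> (\<forall>v. smooth_on N (\<lambda>y. F y v))"

lemma efieldD: "efield F \<Longrightarrow> y \<in> N \<Longrightarrow> linear (F y)" "efield F \<Longrightarrow> smooth_on N (\<lambda>y. F y v)"
  by (auto simp: efield_def)

context
  fixes U assumes U: "open U" "U \<subseteq> N"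
begin

lemma smooth_on_Gam:
  assumes "smooth_on U X" "smooth_on U Y"
  shows "smooth_on U (\<lambda>y. Gam y (X y) (Y y))"
  by (rule smooth_on_apply2[OF U(1) _ _ smooth_on_mono[OF Gam_smooth U(2)] assms])
    (use Gam_linear1 Gam_linear2 U(2) in blast)+

lemma dd_Gam:
  assumes "smooth_on U X" "smooth_on U Y" "x \<in> U"
  shows "dd (\<lambda>y. Gam y (X y) (Y y)) v x = dd (\<lambda>y. Gam y (X x) (Y x)) v x
    + Gam x (dd X v x) (Y x) + Gam x (X x) (dd Y v x)"
  by (rule dd_apply2[OF U(1) _ _ smooth_on_mono[OF Gam_smooth U(2)] assms])
    (use Gam_linear1 Gam_linear2 U(2) in blast)+

lemma smooth_on_G:
  assumes "smooth_on U X" "smooth_on U Y"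
  shows "smooth_on U (\<lambda>y. G y (X y) (Y y))"
  by (rule smooth_on_apply2[OF U(1) _ _ smooth_on_mono[OF G_smooth U(2)] assms])
    (use G_linear U(2) in blast)+

lemma dd_G:
  assumes "smooth_on U X" "smooth_on U Y" "x \<in> U"
  shows "dd (\<lambda>y. G y (X y) (Y y)) v x = G x (grad X x v) (Y x) + G x (X x) (grad Y x v)"
proof -
  have x: "x \<in> N" using assms(3) U(2) by blast
  interpret G: indef_inner "G x" by (rule G_inner[OF x])
  have "dd (\<lambda>y. G y (X y) (Y y)) v x = dd (\<lambda>y. G y (X x) (Y x)) v x + G x (dd X v x) (Y x) + G x (X x) (dd Y v x)"
    by (rule dd_apply2[OF U(1) _ _ smooth_on_mono[OF G_smooth U(2)] assms]) (use G_linear U(2) in blast)+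
  then show ?thesis by (simp add: compat[OF x] grad_def G.bsimps)
qed

lemma smooth_on_grad:
  assumes "smooth_on U X" "smooth_on U Y"
  shows "smooth_on U (\<lambda>y. grad X y (Y y))"
  unfolding grad_def by (intro smooth_on_add U(1) smooth_on_dd_apply smooth_on_Gam assms)

lemma smooth_on_nab:
  assumes "smooth_on U X" "smooth_on U Y"
  shows "smooth_on U (nab X Y)"
  using smooth_on_grad[OF assms(2,1)] by (simp add: grad_def nab_def[abs_def])

lemma smooth_on_bracket:
  assumes "smooth_on U X" "smooth_on U Y"
  shows "smooth_on U (bracket X Y)"
  unfolding bracket_def[abs_def] by (intro smooth_on_diff U(1) smooth_on_dd_apply assms)

lemma bracket_nab: "x \<in> U \<Longrightarrow> bracket X Y x = nab X Y x - nab Y X x"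
  using U(2) Gam_sym[of x "X x" "Y x"] by (auto simp: bracket_def nab_def)

lemma dd_nab:
  assumes "smooth_on U Y" "smooth_on U Z" "x \<in> U"
  shows "dd (nab Y Z) w x = dd (dd Z (Y x)) w x + dd Z (dd Y w x) x + dd (\<lambda>y. Gam y (Y x) (Z x)) w x
    + Gam x (dd Y w x) (Z x) + Gam x (Y x) (dd Z w x)"
  unfolding nab_def[abs_def]
  by (simp add: dd_add[OF smooth_on_dd_apply[OF U(1) assms(2,1)] smooth_on_Gam[OF assms(1,2)] assms(3)]
      dd_dd_apply[OF U(1) assms(2,1,3)] dd_Gam[OF assms])

text \<open>The second derivatives of \<open>Z\<close> cancel by symmetry, and the derivatives of
  \<open>X\<close> and \<open>Y\<close> cancel against the bracket term; what is left depends only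
  on the values at \<open>x\<close>.\<close>

lemma curv_nab:
  assumes X: "smooth_on U X" and Y: "smooth_on U Y" and Z: "smooth_on U Z" and x: "x \<in> U"
  shows "nab X (nab Y Z) x - nab Y (nab X Z) x - nab (bracket X Y) Z x = curv x (X x) (Y x) (Z x)"
proof -
  have N: "x \<in> N" using x U(2) by blast
  have c: "dd (dd Z (Y x)) (X x) x = dd (dd Z (X x)) (Y x) x" by (rule dd_commute[OF U(1) Z x])
  have n: "nab V W x = dd W (V x) x + Gam x (V x) (W x)" for V W by (simp add: nab_def)
  show ?thesis
    unfolding n[of X "nab Y Z"] n[of Y "nab X Z"] n[of "bracket X Y" Z] dd_nab[OF Y Z x] dd_nab[OF X Z x]
    by (simp add: n bracket_def curv_def c dd_linear_combination[OF Z x] Gam_simps[OF N])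
qed

lemma nab_apply:
  assumes F: "efield F" and X: "smooth_on U X" and x: "x \<in> U"
  shows "grad (\<lambda>y. F y (X y)) x w = covd F x w (X x) + F x (grad X x w)"
proof -
  have N: "x \<in> N" using x U(2) by blast
  have F': "linear (F y)" "smooth_on U (\<lambda>y. F y v)" if "y \<in> U" for y v
    using efieldD[OF F] that U(2) smooth_on_mono by blast+
  have "dd (\<lambda>y. F y (X y)) w x = dd (\<lambda>y. F y (X x)) w x + F x (dd X w x)"
    by (rule dd_apply[OF U(1) _ _ X x]) (use F' x in blast)+
  then show ?thesis by (simp add: grad_def covd_def linear_add[OF F'(1)[OF x]])
qed

end

section \<open>Symmetries of the curvature\<close>

lemma open_N_N: "open N" "N \<subseteq> N" using open_N by auto

lemma curv_antisym: "curv x u v w = - curv x v u w"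
  by (simp add: curv_def)

lemma curv_linear:
  assumes x: "x \<in> N"
  shows "linear (\<lambda>u. curv x u v w)" "linear (\<lambda>v. curv x u v w)" "linear (curv x u v)"
proof -
  note lin = linear_dd_param[OF open_N x Gam_linear1 Gam_smooth] linear_dd_param[OF open_N x Gam_linear2 Gam_smooth]
    smooth_on_linear_dd[OF Gam_smooth x]
  show 1: "linear (\<lambda>u. curv x u v w)" for v w
    unfolding curv_def using lin
    by (auto intro!: linearI simp: Gam_simps[OF x] linear_add linear_scale
        linear_add[OF lin(1)] linear_add[OF lin(3)] linear_scale[OF lin(1)] linear_scale[OF lin(3)] scaleR_right_diff_distrib scaleR_add_right)
  show "linear (\<lambda>v. curv x u v w)"
    using linear_compose_neg[OF 1[of u w]] curv_antisym[of x u _ w] by simp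
  show "linear (curv x u v)"
    unfolding curv_def
    by (auto intro!: linearI simp: Gam_simps[OF x] linear_add[OF lin(2)] linear_scale[OF lin(2)]
        scaleR_right_diff_distrib scaleR_add_right)
qed

text \<open>Symmetry of \<open>Gam\<close> makes both the derivative terms and the quadratic terms
  of the cyclic sum cancel in pairs.\<close>

lemma bianchi:
  assumes x: "x \<in> N"
  shows "curv x u v w + curv x v w u + curv x w u v = 0"
proof -
  have "dd (\<lambda>z. Gam z a b) c x = dd (\<lambda>z. Gam z b a) c x" for a b c
    by (rule dd_cong[OF open_N x]) (rule Gam_sym)
  from this[of v w u] this[of w u v] this[of u v w] show ?thesis
    by (simp add: curv_def Gam_sym[OF x, of v w] Gam_sym[OF x, of w u] Gam_sym[OF x, of u v])
qed

text \<open>Metric compatibility, applied twice, expresses the second derivatives of the coefficient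
  \<open>G z a c\<close>. They commute, and the mixed products of Christoffel terms are symmetric in
  \<open>u\<close> and \<open>v\<close>, so only the two curvature terms remain.\<close>

lemma curv_skew:
  assumes x: "x \<in> N"
  shows "G x (curv x u v a) c = - G x a (curv x u v c)"
proof -
  interpret G: indef_inner "G x" by (rule G_inner[OF x])
  have k: "smooth_on N (\<lambda>z. d)" for d :: "real^'d" by (rule smooth_on_const[OF open_N])
  have 1: "dd (dd (\<lambda>z. G z a c) v) u x =
      G x (dd (\<lambda>z. Gam z v a) u x + Gam x u (Gam x v a)) c + G x (Gam x v a) (Gam x u c)
    + G x (Gam x u a) (Gam x v c) + G x a (dd (\<lambda>z. Gam z v c) u x + Gam x u (Gam x v c))" for u v
  proof -
    have "dd (dd (\<lambda>z. G z a c) v) u x = dd (\<lambda>z. G z (Gam z v a) c + G z a (Gam z v c)) u x"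
      by (rule dd_cong[OF open_N x]) (rule compat)
    also have "\<dots> = dd (\<lambda>z. G z (Gam z v a) c) u x + dd (\<lambda>z. G z a (Gam z v c)) u x"
      by (rule dd_add[OF smooth_on_G[OF open_N_N Gam_smooth k] smooth_on_G[OF open_N_N k Gam_smooth] x])
    finally show ?thesis
      by (simp add: dd_G[OF open_N_N Gam_smooth k x] dd_G[OF open_N_N k Gam_smooth x] grad_def dd_const)
  qed
  show ?thesis
    using dd_commute[OF open_N G_smooth x, of a c u v]
    unfolding 1 by (simp add: curv_def G.bsimps)
qed

text \<open>By the Bianchi identity the difference of the two sides is, up to sign, the trace of
  \<open>curv x v w\<close>, a skew endomorphism.\<close>

lemma ric_sym:
  assumes x: "x \<in> N"
  shows "ric x v w = ric x w v"
proof -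
  interpret G: indef_inner "G x" by (rule G_inner[OF x])
  have "curv x u v w - curv x u w v = - curv x v w u" for u
    unfolding curv_antisym[of x u w v] using bianchi[OF x, of u v w] by (simp add: eq_neg_iff_add_eq_0 add_ac)
  then have "ric x v w - ric x w v = - tr (curv x v w)"
    unfolding ric_def tr_diff[symmetric] tr_minus[symmetric] by simp
  moreover have "tr (curv x v w) = 0"
    by (rule G.tr_skew[OF curv_linear(3)[OF x]]) (rule curv_skew[OF x])
  ultimately show ?thesis by simp
qed

section \<open>Covariant derivatives of endomorphism fields\<close>

lemma covd_linear:
  assumes F: "efield F" and x: "x \<in> N"
  shows "linear (\<lambda>w. covd F x w v)" "linear (covd F x w)"
proof -
  note lin = smooth_on_linear_dd[OF efieldD(2)[OF F] x] linear_dd_param[OF open_N x efieldD[OF F]] efieldD(1)[OF F x]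
  show "linear (\<lambda>w. covd F x w v)" "linear (covd F x w)"
    unfolding covd_def
    by (auto intro!: linearI simp: Gam_simps[OF x] linear_add[OF lin(1)] linear_scale[OF lin(1)] linear_add[OF lin(2)] linear_scale[OF lin(2)]
        linear_add[OF lin(3)] linear_scale[OF lin(3)] scaleR_right_diff_distrib scaleR_add_right)
qed

text \<open>The metric is parallel, so taking adjoints commutes with covariant
  differentiation.\<close>

lemma covd_adjoint:
  assumes F: "efield F" and F': "efield F'" and adj: "\<And>y u v. y \<in> N \<Longrightarrow> G y (F y u) v = G y u (F' y v)"
    and x: "x \<in> N"
  shows "G x (covd F x w u) v = G x u (covd F' x w v)"
proof -
  interpret G: indef_inner "G x" by (rule G_inner[OF x])
  have k: "smooth_on N (\<lambda>z. d)" for d :: "real^'d" by (rule smooth_on_const[OF open_N])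
  have "dd (\<lambda>y. G y (F y u) v) w x = dd (\<lambda>y. G y u (F' y v)) w x"
    by (rule dd_cong[OF open_N x]) (rule adj)
  then show ?thesis
    using adj[OF x, of "Gam x w u" v] adj[OF x, of u "Gam x w v"]
    by (simp add: dd_G[OF open_N_N efieldD(2)[OF F] k x] dd_G[OF open_N_N k efieldD(2)[OF F'] x]
        grad_def dd_const covd_def G.bsimps)
qed

lemma covd_compose:
  assumes F: "efield F" and H: "efield H" and x: "x \<in> N"
  shows "covd (\<lambda>y v. F y (H y v)) x w v = covd F x w (H x v) + F x (covd H x w v)"
  using nab_apply[OF open_N_N F efieldD(2)[OF H] x, of v w] linear_diff[OF efieldD(1)[OF F x]]
  by (simp add: covd_def grad_def algebra_simps)

lemma covd_add:
  assumes F: "efield F" and H: "efield H" and x: "x \<in> N"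
  shows "covd (\<lambda>y v. F y v + H y v) x w v = covd F x w v + covd H x w v"
  by (simp add: covd_def dd_add[OF efieldD(2)[OF F] efieldD(2)[OF H] x] Gam_simps[OF x])

lemma covd_minus:
  assumes F: "efield F" and x: "x \<in> N"
  shows "covd (\<lambda>y v. - F y v) x w v = - covd F x w v"
  by (simp add: covd_def dd_bounded_linear[OF bounded_linear_minus[OF bounded_linear_ident] efieldD(2)[OF F] x] Gam_simps[OF x])

lemma covd_cong:
  assumes "\<And>y v. y \<in> N \<Longrightarrow> F y v = H y v" "x \<in> N"
  shows "covd F x w v = covd H x w v"
  using dd_cong[OF open_N assms(2), of "\<lambda>y. F y v" "\<lambda>y. H y v" w] assms by (simp add: covd_def)

lemma efield_add: "efield F \<Longrightarrow> efield H \<Longrightarrow> efield (\<lambda>y v. F y v + H y v)"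
  unfolding efield_def by (auto intro: linear_compose_add smooth_on_add open_N)

lemma efield_minus: "efield F \<Longrightarrow> efield (\<lambda>y v. - F y v)"
  unfolding efield_def by (auto intro: linear_compose_neg smooth_on_minus open_N)

text \<open>The connection contributes the commutator of \<open>Gam x w\<close> with
  \<open>F x\<close>, which has trace 0.\<close>

lemma tr_covd:
  assumes F: "efield F" and x: "x \<in> N"
  shows "tr (covd F x w) = dd (\<lambda>y. tr (F y)) w x"
proof -
  have "tr (covd F x w) = tr (\<lambda>v. dd (\<lambda>z. F z v) w x) + tr (\<lambda>v. Gam x w (F x v)) - tr (\<lambda>v. F x (Gam x w v))"
    unfolding covd_def tr_diff[symmetric] tr_add[symmetric] ..
  also have "tr (\<lambda>v. Gam x w (F x v)) = tr (\<lambda>v. F x (Gam x w v))"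
    by (rule tr_comp_commute[OF Gam_linear2[OF x] efieldD(1)[OF F x]])
  also have "tr (\<lambda>v. dd (\<lambda>z. F z v) w x) = dd (\<lambda>y. tr (F y)) w x"
    unfolding tr_def using smooth_on_vec_nth[OF open_N efieldD(2)[OF F]]
    by (subst dd_sum[OF _ x]) (auto simp: dd_vec_nth[OF efieldD(2)[OF F] x])
  finally show ?thesis by simp
qed

lemma efield_grad:
  assumes "smooth_on N X"
  shows "efield (grad X)"
  unfolding efield_def
proof (intro conjI ballI allI)
  fix y assume y: "y \<in> N"
  show "linear (grad X y)"
    unfolding grad_def by (intro linear_compose_add smooth_on_linear_dd[OF assms y] Gam_linear1[OF y])
next
  fix v show "smooth_on N (\<lambda>y. grad X y v)"
    by (rule smooth_on_grad[OF open_N_N assms smooth_on_const[OF open_N]])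
qed

text \<open>\<open>covd (grad X)\<close> is the second covariant derivative of \<open>X\<close>. Its
  second partial derivatives and the term with \<open>Gam x u v\<close> are symmetric in
  \<open>u\<close> and \<open>v\<close>, so antisymmetrising leaves only curvature.\<close>

lemma curv_grad:
  assumes X: "smooth_on N X" and x: "x \<in> N"
  shows "curv x u v (X x) = covd (grad X) x u v - covd (grad X) x v u"
proof -
  have 1: "covd (grad X) x u v = dd (dd X v) u x + (dd (\<lambda>z. Gam z v (X x)) u x + Gam x v (dd X u x))
     + Gam x u (grad X x v) - grad X x (Gam x u v)" for u v
  proof -
    have "dd (\<lambda>z. grad X z v) u x = dd (dd X v) u x + dd (\<lambda>z. Gam z v (X z)) u x"
      unfolding grad_def
      by (rule dd_add[OF smooth_on_dd[OF X] smooth_on_Gam[OF open_N_N smooth_on_const[OF open_N] X] x])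
    also have "dd (\<lambda>z. Gam z v (X z)) u x = dd (\<lambda>z. Gam z v (X x)) u x + Gam x v (dd X u x)"
      using dd_Gam[OF open_N_N smooth_on_const[OF open_N] X x] by (simp add: dd_const Gam_simps[OF x])
    finally show ?thesis by (simp add: covd_def)
  qed
  show ?thesis
    unfolding 1 using dd_commute[OF open_N X x, of u v] Gam_sym[OF x, of u v]
    by (simp add: curv_def grad_def Gam_simps[OF x])
qed

lemma nab_cong:
  assumes "open U" "x \<in> U" "\<And>y. y \<in> U \<Longrightarrow> X y = X' y" "\<And>y. y \<in> U \<Longrightarrow> Y y = Y' y"
  shows "nab X Y x = nab X' Y' x" "bracket X Y x = bracket X' Y' x"
proof -
  have "dd Y v x = dd Y' v x" "dd X v x = dd X' v x" for v
    using dd_cong[OF assms(1,2)] assms(3,4) by metis+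
  then show "nab X Y x = nab X' Y' x" "bracket X Y x = bracket X' Y' x"
    using assms by (simp_all add: nab_def bracket_def)
qed

text \<open>Once every bracket is written as a difference of covariant derivatives, three of the
  terms form the curvature, and the others form
  \<open>\<nabla>_X \<nabla>_Y V - \<nabla>_Z V\<close> with \<open>Z = \<nabla>_X Y\<close>, the
  second covariant derivative of \<open>V\<close>. In particular the expression is tensorial in
  \<open>X\<close> and \<open>Y\<close>.\<close>

lemma lie_derivative_nab:
  assumes V: "smooth_on N V" and U: "open U" "U \<subseteq> N" and X: "smooth_on U X" and Y: "smooth_on U Y" and x: "x \<in> U"
  shows "bracket V (nab X Y) x - nab (bracket V X) Y x - nab X (bracket V Y) x =
    curv x (V x) (X x) (Y x) + covd (grad V) x (X x) (Y x)"
proof -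
  have VU: "smooth_on U V" by (rule smooth_on_mono[OF V U(2)])
  have xN: "x \<in> N" using x U(2) by blast
  note sVY = smooth_on_nab[OF U VU Y] and sYV = smooth_on_nab[OF U Y VU]
  have "nab X (bracket V Y) x = nab X (\<lambda>y. nab V Y y - nab Y V y) x"
    by (rule nab_cong(1)[OF U(1) x refl]) (rule bracket_nab[OF U])
  also have "\<dots> = nab X (nab V Y) x - nab X (nab Y V) x"
    unfolding nab_def[of X] by (simp add: dd_diff[OF sVY sYV x] Gam_simps[OF xN])
  finally have 1: "nab X (bracket V Y) x = nab X (nab V Y) x - nab X (nab Y V) x" .
  have 2: "bracket V (nab X Y) x = nab V (nab X Y) x - nab (nab X Y) V x"
    by (rule bracket_nab[OF U x])
  have g: "nab W Z y = grad Z y (W y)" for W Z y by (simp add: nab_def grad_def)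
  have "nab X (nab Y V) x = grad (\<lambda>y. grad V y (Y y)) x (X x)"
    by (simp add: g[of X] g[of Y, abs_def])
  also have "\<dots> = covd (grad V) x (X x) (Y x) + grad V x (grad Y x (X x))"
    by (rule nab_apply[OF U efield_grad[OF V] Y x])
  finally have 3: "nab X (nab Y V) x - nab (nab X Y) V x = covd (grad V) x (X x) (Y x)"
    by (simp add: g[of "nab X Y"] g[of X Y])
  show ?thesis
    unfolding curv_nab[OF U VU X Y x, symmetric] 3[symmetric] 1 2 by simp
qed

text \<open>Skewness of the curvature in both pairs of arguments turns its part of the sum into the
  trace that defines \<open>ric\<close>. The adjoint \<open>F'\<close> enters because
  \<open>dv\<close> contracts the direction of differentiation with the value, whereas here it is
  contracted with the argument.\<close>

lemma contracted_lie_derivative: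
  assumes E: "indef_inner.orthonormal (G x) E" and x: "x \<in> N"
    and F: "efield F" and F': "efield F'" and adj: "\<And>y u v. y \<in> N \<Longrightarrow> G y (F y u) v = G y u (F' y v)"
  shows "(\<Sum>i\<in>UNIV. G x (E i) (E i) * G x (curv x a (E i) (E i) + covd F x (E i) (E i)) w) = ric x a w + dv F' x w"
proof -
  interpret G: indef_inner "G x" by (rule G_inner[OF x])
  have "G x (curv x a e e) w = G x (curv x e a w) e" for e
    using curv_skew[OF x, of a e e w] G.sym[of e "curv x a e w"] curv_antisym[of x a e w] by (simp add: G.bsimps)
  moreover have "G x (covd F x e e) w = G x (covd F' x e w) e" for e
    using covd_adjoint[OF F F' adj x, of e e w] G.sym[of e "covd F' x e w"] by simp
  ultimately show ?thesis
    unfolding ric_def dv_def G.tr_orthonormal[OF E curv_linear(1)[OF x]] G.tr_orthonormal[OF E covd_linear(1)[OF F' x]]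
    by (simp add: G.bsimps distrib_left sum.distrib)
qed

end

section \<open>Paracontact metric structures in a coordinate patch\<close>

locale coord_paracontact = coord_metric N G Gam
  for N :: "(real ^ 'd::finite) set" and G Gam +
  fixes xi :: "real ^ 'd \<Rightarrow> real ^ 'd" and phi :: "real ^ 'd \<Rightarrow> real ^ 'd \<Rightarrow> real ^ 'd"
  assumes xi_smooth: "smooth_on N xi" and phi_efield: "efield phi"
    and xi_unit: "y \<in> N \<Longrightarrow> G y (xi y) (xi y) = 1"
    and d_eta: "y \<in> N \<Longrightarrow> G y u (phi y v) = (dd (\<lambda>z. G z (xi z) v) u y - dd (\<lambda>z. G z (xi z) u) v y) / 2"
    and reeb: "y \<in> N \<Longrightarrow> G y (xi y) (phi y v) = 0"
    and phi_phi: "y \<in> N \<Longrightarrow> phi y (phi y v) = v - G y (xi y) v *\<^sub>R xi y"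
begin

text \<open>\<open>\<nabla>\<xi> = S - \<phi>\<close> splits \<open>\<nabla>\<xi>\<close> into its symmetric and its skew part.\<close>

definition S :: "real ^ 'd \<Rightarrow> real ^ 'd \<Rightarrow> real ^ 'd" where
  "S y v = grad xi y v + phi y v"

text \<open>The adjoint of \<open>grad xi = S - phi\<close>, since \<open>S\<close> is symmetric and
  \<open>phi\<close> is skew; equivalently \<open>grad xi + 2 phi\<close>.\<close>

definition grad_adj :: "real ^ 'd \<Rightarrow> real ^ 'd \<Rightarrow> real ^ 'd" where
  "grad_adj y v = S y v + phi y v"

lemma S_efield: "efield S"
  using efield_add[OF efield_grad[OF xi_smooth] phi_efield] by (simp add: S_def[abs_def])

lemma grad_adj_efield: "efield grad_adj"
  using efield_add[OF S_efield phi_efield] by (simp add: grad_adj_def[abs_def])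

context
  fixes x assumes x: "x \<in> N"
begin

interpretation G: indef_inner "G x" by (rule G_inner[OF x])

lemmas phi_simps = linear_add[OF efieldD(1)[OF phi_efield x]] linear_diff[OF efieldD(1)[OF phi_efield x]]
  linear_neg[OF efieldD(1)[OF phi_efield x]] linear_scale[OF efieldD(1)[OF phi_efield x]] linear_0[OF efieldD(1)[OF phi_efield x]]

lemmas S_simps = linear_add[OF efieldD(1)[OF S_efield x]] linear_diff[OF efieldD(1)[OF S_efield x]]
  linear_neg[OF efieldD(1)[OF S_efield x]] linear_scale[OF efieldD(1)[OF S_efield x]] linear_0[OF efieldD(1)[OF S_efield x]]

lemma dd_eta: "dd (\<lambda>z. G z (xi z) v) u x = G x (grad xi x u) v + G x (xi x) (Gam x u v)"
  using dd_G[OF open_N_N xi_smooth smooth_on_const[OF open_N] x] by (simp add: grad_def dd_const)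

text \<open>The factor 2 compensates the 1/2 in the convention for \<open>d\<eta>\<close>. Since
  \<open>phi\<close> acts on the second argument of the metric, the skew part of
  \<open>grad xi\<close> comes out as \<open>- phi\<close>.\<close>

lemma grad_skew_part: "2 * G x u (phi x v) = G x (grad xi x u) v - G x (grad xi x v) u"
  by (simp add: d_eta[OF x] dd_eta Gam_sym[OF x, of u v])

lemma phi_skew: "G x u (phi x v) = - G x (phi x u) v"
  using grad_skew_part[of u v] grad_skew_part[of v u] G.sym[of v "phi x u"] by simp

lemma phi_xi: "phi x (xi x) = 0"
  by (rule G.nondegenerate) (use phi_skew[of "xi x"] reeb[OF x] in simp)

lemma grad_xi_perp: "G x (grad xi x u) (xi x) = 0" "G x (xi x) (grad xi x u) = 0"
proof -
  have "dd (\<lambda>z. G z (xi z) (xi z)) u x = dd (\<lambda>z. 1) u x"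
    by (rule dd_cong[OF open_N x]) (rule xi_unit)
  then show "G x (grad xi x u) (xi x) = 0" "G x (xi x) (grad xi x u) = 0"
    using dd_G[OF open_N_N xi_smooth xi_smooth x] G.sym[of "xi x" "grad xi x u"] by (simp_all add: dd_const)
qed

lemma grad_xi_xi: "grad xi x (xi x) = 0"
  by (rule G.nondegenerate) (use grad_skew_part[of "xi x"] reeb[OF x] grad_xi_perp in simp)

lemma S_symmetric: "G x (S x u) v = G x u (S x v)"
  using grad_skew_part[of u v] phi_skew[of u v] G.sym[of "grad xi x v" u]
  by (simp add: S_def G.bsimps)

lemma S_xi: "S x (xi x) = 0"
  by (simp add: S_def phi_xi grad_xi_xi)

lemma S_perp: "G x (xi x) (S x u) = 0"
  using S_symmetric[of "xi x" u] by (simp add: S_xi G.bsimps)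

lemma grad_xi_eq: "grad xi x u = S x u - phi x u"
  by (simp add: S_def)

lemma grad_adjoint: "G x (grad xi x u) v = G x u (grad_adj x v)"
  using S_symmetric[of u v] phi_skew[of u v] by (simp add: grad_xi_eq grad_adj_def G.bsimps)

text \<open>\<open>d(d\<eta>) = 0\<close>\<close>
lemma covd_phi_closed:
  "G x u (covd phi x w v) + G x v (covd phi x u w) + G x w (covd phi x v u) = 0"
proof -
  have k: "smooth_on N (\<lambda>z. d)" for d :: "real^'d" by (rule smooth_on_const[OF open_N])
  have eta: "smooth_on N (\<lambda>z. G z (xi z) v)" for v by (rule smooth_on_G[OF open_N_N xi_smooth k])
  have 1: "G x u (covd phi x w v) = (dd (dd (\<lambda>z. G z (xi z) v) u) w x - dd (dd (\<lambda>z. G z (xi z) u) v) w x) / 2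
    - G x (Gam x w u) (phi x v) - G x u (phi x (Gam x w v))" for u v w
  proof -
    have "dd (\<lambda>z. G z u (phi z v)) w x = dd (\<lambda>z. (dd (\<lambda>z. G z (xi z) v) u z - dd (\<lambda>z. G z (xi z) u) v z) / 2) w x"
      by (rule dd_cong[OF open_N x]) (rule d_eta)
    also have "\<dots> = (dd (dd (\<lambda>z. G z (xi z) v) u) w x - dd (dd (\<lambda>z. G z (xi z) u) v) w x) / 2"
      using dd_bounded_linear[OF bounded_linear_divide[of 2] smooth_on_diff[OF open_N smooth_on_dd[OF eta] smooth_on_dd[OF eta]] x]
        dd_diff[OF smooth_on_dd[OF eta] smooth_on_dd[OF eta] x] by simp
    finally show ?thesis
      by (simp add: dd_G[OF open_N_N k efieldD(2)[OF phi_efield] x] covd_def grad_def dd_const G.bsimps)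
        (simp add: field_simps)
  qed
  have c: "dd (dd (\<lambda>z. G z (xi z) a) b) c x = dd (dd (\<lambda>z. G z (xi z) a) c) b x" for a b c
    by (rule dd_commute[OF open_N eta x])
  have s: "G x a (phi x (Gam x b c)) = - G x (Gam x c b) (phi x a)" for a b c
    using phi_skew[of a "Gam x b c"] G.sym[of "phi x a" "Gam x b c"] Gam_sym[OF x, of b c] by simp
  show ?thesis
    unfolding 1 s using c[of v u w] c[of w v u] c[of u w v] by (simp add: field_simps)
qed

lemma covd_phi_skew: "G x (covd phi x w u) v = - G x u (covd phi x w v)"
proof -
  have "G x (covd phi x w u) v = G x u (covd (\<lambda>y v. - phi y v) x w v)"
  proof (rule covd_adjoint[OF phi_efield efield_minus[OF phi_efield] _ x])
    fix y u v assume y: "y \<in> N"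
    interpret Gy: indef_inner "G y" by (rule G_inner[OF y])
    have "2 * G y u (phi y v) = - 2 * G y v (phi y u)" by (simp add: d_eta[OF y])
    then show "G y (phi y u) v = G y u (- phi y v)" using Gy.sym[of v "phi y u"] by (simp add: Gy.bsimps)
  qed
  then show ?thesis by (simp add: covd_minus[OF phi_efield x] G.bsimps)
qed

text \<open>Covariant differentiation of \<open>\<phi>^2 = I - \<eta> \<otimes> \<xi>\<close>, where
  the derivative of \<eta> is the metric dual of that of \<xi>.\<close>

lemma covd_phi_phi:
  "covd phi x w (phi x v) + phi x (covd phi x w v) = - (G x (grad xi x w) v *\<^sub>R xi x + G x (xi x) v *\<^sub>R grad xi x w)"
proof -
  have eta: "smooth_on N (\<lambda>z. G z (xi z) v)" by (rule smooth_on_G[OF open_N_N xi_smooth smooth_on_const[OF open_N]])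
  have "covd (\<lambda>y v. phi y (phi y v)) x w v = covd (\<lambda>y v. v - G y (xi y) v *\<^sub>R xi y) x w v"
    by (rule covd_cong[OF _ x]) (rule phi_phi)
  moreover have "dd (\<lambda>y. v - G y (xi y) v *\<^sub>R xi y) w x =
      - ((G x (grad xi x w) v + G x (xi x) (Gam x w v)) *\<^sub>R xi x + G x (xi x) v *\<^sub>R dd xi w x)"
    using dd_diff[OF smooth_on_const[OF open_N] smooth_on_scaleR[OF open_N eta xi_smooth] x, of v w]
      dd_bounded_bilinear[OF bounded_bilinear_scaleR eta xi_smooth x, of w]
    by (simp add: dd_const dd_eta)
  ultimately show ?thesis
    unfolding covd_compose[OF phi_efield phi_efield x, of w v, symmetric]
    by (simp add: covd_def Gam_simps[OF x] grad_def algebra_simps)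
qed

lemma covd_on_xi:
  assumes F: "efield F" and "\<And>y. y \<in> N \<Longrightarrow> F y (xi y) = 0"
  shows "covd F x w (xi x) = - F x (grad xi x w)"
proof -
  have "grad (\<lambda>y. F y (xi y)) x w = grad (\<lambda>y. 0) x w"
    using dd_cong[OF open_N x, of "\<lambda>y. F y (xi y)" "\<lambda>y. 0" w] assms(2) x by (simp add: grad_def)
  then show ?thesis
    using nab_apply[OF open_N_N F xi_smooth x, of w] by (simp add: grad_def dd_const Gam_simps[OF x] eq_neg_iff_add_eq_0)
qed

end

lemma covd_phi_xi: "x \<in> N \<Longrightarrow> covd phi x w (xi x) = - phi x (grad xi x w)"
  by (rule covd_on_xi[OF _ phi_efield phi_xi])

lemma covd_S_xi: "x \<in> N \<Longrightarrow> covd S x w (xi x) = - S x (grad xi x w)"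
  by (rule covd_on_xi[OF _ S_efield S_xi])

context
  fixes x assumes x: "x \<in> N"
begin

interpretation G: indef_inner "G x" by (rule G_inner[OF x])

text \<open>With \<xi> as one argument of the closedness condition, the two other terms are
  evaluated by differentiating \<open>\<phi> \<xi> = 0\<close>. The contributions of
  \<open>\<phi>^2\<close> cancel and the anticommutator of \<open>S\<close> and \<phi> is
  left.\<close>

lemma nabla_xi_phi_S: "covd phi x (xi x) v = - S x (phi x v) - phi x (S x v)"
proof (rule G.eqI)
  fix u
  have "G x (covd phi x (xi x) v) u = - G x v (covd phi x u (xi x)) - G x (xi x) (covd phi x v u)"
    using covd_phi_closed[OF x, of u "xi x" v] G.sym[of u "covd phi x (xi x) v"] by simp
  also have "G x (xi x) (covd phi x v u) = G x (phi x (grad xi x v)) u"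
    using covd_phi_skew[OF x, of v "xi x" u] by (simp add: covd_phi_xi[OF x] G.bsimps)
  also have "- G x v (covd phi x u (xi x)) = - G x (phi x v) (grad xi x u)"
    using phi_skew[OF x, of v "grad xi x u"] by (simp add: covd_phi_xi[OF x] G.bsimps)
  finally have "G x (covd phi x (xi x) v) u = - G x (phi x v) (grad xi x u) - G x (phi x (grad xi x v)) u" .
  moreover have "G x (phi x v) (grad xi x u) = G x (S x (phi x v)) u + G x (phi x (phi x v)) u"
    using S_symmetric[OF x, of "phi x v" u] phi_skew[OF x, of "phi x v" u] by (simp add: grad_xi_eq[OF x] G.bsimps)
  ultimately show "G x (covd phi x (xi x) v) u = G x (- S x (phi x v) - phi x (S x v)) u"
    by (simp add: grad_xi_eq[OF x] G.bsimps phi_simps[OF x])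
qed

lemma phi_phi_S: "phi x (phi x (S x v)) = S x v"
  by (simp add: phi_phi[OF x] S_perp[OF x])

text \<open>Because \<open>\<nabla>_\<xi> \<xi> = 0\<close>, the derivative of
  \<open>\<phi>^2\<close> along \<xi> vanishes, so \<open>\<nabla>_\<xi> \<phi>\<close> anticommutes
  with \<phi>. Inserting the anticommutator found for \<open>\<nabla>_\<xi> \<phi>\<close> gives
  \<open>2 (S + \<phi> S \<phi>) = 0\<close>; one more application of \<phi> yields the
  claim.\<close>

lemma S_phi: "S x (phi x v) = - phi x (S x v)"
proof -
  have "covd phi x (xi x) (phi x v) + phi x (covd phi x (xi x) v) = 0"
    using covd_phi_phi[OF x, of "xi x" v] by (simp add: grad_xi_xi[OF x] G.bsimps)
  moreover have "S x (phi x (phi x v)) = S x v"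
    by (simp add: phi_phi[OF x] S_simps[OF x] S_xi[OF x])
  ultimately have "2 *\<^sub>R (S x v + phi x (S x (phi x v))) = 0"
    by (simp add: nabla_xi_phi_S phi_phi_S phi_simps[OF x] scaleR_2 algebra_simps) (metis add.commute add.assoc add.right_inverse minus_add_distrib)
  then have "S x v + phi x (S x (phi x v)) = 0" by simp
  then have "phi x (S x v + phi x (S x (phi x v))) = phi x 0" by simp
  then have "phi x (S x v) + S x (phi x v) = 0" by (simp add: phi_simps[OF x] phi_phi_S)
  then show ?thesis by (simp add: eq_neg_iff_add_eq_0 add.commute)
qed

lemma covd_phi_along_xi: "covd phi x (xi x) v = 0"
  by (simp add: nabla_xi_phi_S S_phi)

text \<open>The left side is half the Lie derivative of \<phi> along \<xi>, with brackets expressed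
  by the connection. The two occurrences of \<open>\<phi>^2\<close> cancel, and the two terms with
  \<open>S\<close> coincide by anticommutation.\<close>

lemma h_coordinates:
  "(1 / 2) *\<^sub>R (covd phi x (xi x) v - grad xi x (phi x v) + phi x (grad xi x v)) = phi x (S x v)"
  by (simp add: covd_phi_along_xi grad_xi_eq[OF x] S_phi phi_simps[OF x] scaleR_2[symmetric])

section \<open>Traces and the divergence of \<phi>\<close>

lemmas linear_facts = efieldD(1)[OF phi_efield x] efieldD(1)[OF S_efield x]

text \<open>Since \<open>S = \<phi>^2 S\<close>, cyclicity of the trace followed by anticommutation
  turns the trace into its negative.\<close>

lemma tr_S: "tr (S x) = 0"
proof -
  have "tr (S x) = tr (\<lambda>v. phi x (phi x (S x v)))" by (simp add: phi_phi_S)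
  also have "\<dots> = tr (\<lambda>v. phi x (S x (phi x v)))"
    using tr_comp_commute[of "phi x" "\<lambda>v. phi x (S x v)"] linear_compose[OF linear_facts(2,1)] linear_facts by (simp add: o_def)
  also have "\<dots> = - tr (S x)" by (simp add: S_phi phi_simps[OF x] phi_phi_S tr_minus)
  finally show ?thesis by simp
qed

lemma tr_phi_S: "tr (\<lambda>v. phi x (S x v)) = 0" "tr (\<lambda>v. S x (phi x v)) = 0"
proof -
  have "tr (\<lambda>v. phi x (S x v)) = tr (\<lambda>v. S x (phi x v))" by (rule tr_comp_commute[OF linear_facts])
  then show "tr (\<lambda>v. phi x (S x v)) = 0" "tr (\<lambda>v. S x (phi x v)) = 0" by (simp_all add: S_phi tr_minus)
qed

lemma tr_phi: "tr (phi x) = 0"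
  by (rule G.tr_skew[OF linear_facts(1)]) (use phi_skew[OF x] in simp)

text \<open>Take the trace of the derivative of \<open>\<phi>^2\<close>: its two terms agree by
  cyclicity, and the rank-one terms contribute
  \<open>g(\<nabla>_v \<xi>, \<xi>) = 0\<close>.\<close>

lemma tr_phi_covd_phi_fixed: "tr (\<lambda>u. phi x (covd phi x v u)) = 0"
proof -
  have "tr (\<lambda>u. covd phi x v (phi x u) + phi x (covd phi x v u)) =
      tr (\<lambda>u. - (G x (grad xi x v) u *\<^sub>R xi x + G x (xi x) u *\<^sub>R grad xi x v))"
    by (simp add: covd_phi_phi[OF x])
  also have "\<dots> = 0"
    unfolding tr_minus tr_add by (simp add: G.tr_rank_one grad_xi_perp[OF x])
  finally have "tr (\<lambda>u. covd phi x v (phi x u)) + tr (\<lambda>u. phi x (covd phi x v u)) = 0"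
    by (simp add: tr_add)
  moreover have "tr (\<lambda>u. covd phi x v (phi x u)) = tr (\<lambda>u. phi x (covd phi x v u))"
    by (rule tr_comp_commute[OF covd_linear(2)[OF phi_efield x] linear_facts(1)])
  ultimately show ?thesis by simp
qed

text \<open>In the contraction of the closedness condition with the skew matrix of \<open>\<phi>\<close> only the trace of
  \<open>\<phi> \<circ> \<nabla>\<^sub>v\<phi>\<close> survives.\<close>
lemma tr_phi_covd_phi: "tr (\<lambda>u. phi x (covd phi x u v)) = 0"
proof -
  obtain E where E: "G.orthonormal E" using G.orthonormal_exists by blast
  define \<epsilon> where "\<epsilon> i = G x (E i) (E i)" for i
  \<comment> \<open>The components of \<phi> in the frame with both indices raised by the signs.
    This matrix is skew, so only the skew part of \<open>c\<close> contributes, and closedness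
    expresses that part by the derivative of \<phi> in the fixed direction \<open>v\<close>.\<close>
  define m where "m i j = \<epsilon> i * \<epsilon> j * G x (phi x (E i)) (E j)" for i j
  define c where "c i j = G x (covd phi x (E i) v) (E j)" for i j
  have m_skew: "m i j = - m j i" for i j
    using phi_skew[OF x, of "E j" "E i"] G.sym[of "E j" "phi x (E i)"] by (simp add: m_def)
  have m_eq: "m i j = - (\<epsilon> i * \<epsilon> j * G x (phi x (E j)) (E i))" for i j
    by (subst m_skew) (simp add: m_def mult.commute)
  have c_diff: "c i j - c j i = - G x (E i) (covd phi x v (E j))" for i j
    using covd_phi_closed[OF x, of "E i" v "E j"] covd_phi_skew[OF x, of "E i" "E j" v]
      covd_phi_skew[OF x, of "E i" v "E j"] covd_phi_skew[OF x, of "E j" v "E i"] G.sym[of "E j" "covd phi x (E i) v"] G.sym[of "E i" "covd phi x (E j) v"]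
    by (simp add: c_def)
  have exp: "phi x (E i) = (\<Sum>j\<in>UNIV. (\<epsilon> j * G x (phi x (E i)) (E j)) *\<^sub>R E j)" for i
    unfolding \<epsilon>_def by (rule G.E_expansion[OF E])
  have "tr (\<lambda>u. phi x (covd phi x u v)) = (\<Sum>i\<in>UNIV. \<epsilon> i * G x (phi x (covd phi x (E i) v)) (E i))"
    unfolding \<epsilon>_def using linear_compose[OF covd_linear(1)[OF phi_efield x] linear_facts(1)]
    by (intro G.tr_orthonormal[OF E]) (simp add: o_def)
  also have "\<dots> = - (\<Sum>i\<in>UNIV. \<epsilon> i * G x (covd phi x (E i) v) (phi x (E i)))"
    by (simp add: phi_skew[OF x, of "covd phi x _ v"] sum_negf)
  also have "\<dots> = - (\<Sum>i\<in>UNIV. \<Sum>j\<in>UNIV. m i j * c i j)"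
    by (subst exp) (simp add: G.right_sum G.bsimps sum_distrib_left m_def c_def algebra_simps)
  finally have t: "tr (\<lambda>u. phi x (covd phi x u v)) = - (\<Sum>i\<in>UNIV. \<Sum>j\<in>UNIV. m i j * c i j)" .
  have "(\<Sum>i\<in>UNIV. \<Sum>j\<in>UNIV. m i j * c i j) = (\<Sum>i\<in>UNIV. \<Sum>j\<in>UNIV. m j i * c j i)"
    by (rule sum.swap)
  also have "\<dots> = - (\<Sum>i\<in>UNIV. \<Sum>j\<in>UNIV. m i j * c j i)"
    by (subst m_skew) (simp add: sum_negf)
  finally have "2 * (\<Sum>i\<in>UNIV. \<Sum>j\<in>UNIV. m i j * c i j) = (\<Sum>i\<in>UNIV. \<Sum>j\<in>UNIV. m i j * (c i j - c j i))"
    by (simp add: right_diff_distrib sum_subtractf)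
  also have "\<dots> = (\<Sum>j\<in>UNIV. \<epsilon> j * G x (\<Sum>i\<in>UNIV. (\<epsilon> i * G x (phi x (E j)) (E i)) *\<^sub>R E i) (covd phi x v (E j)))"
    unfolding c_diff
    by (subst sum.swap) (simp add: m_eq G.left_sum G.bsimps sum_distrib_left mult_ac)
  also have "\<dots> = (\<Sum>j\<in>UNIV. \<epsilon> j * G x (phi x (E j)) (covd phi x v (E j)))"
    by (simp add: exp[symmetric])
  also have "\<dots> = - (\<Sum>j\<in>UNIV. \<epsilon> j * G x (phi x (covd phi x v (E j))) (E j))"
    using phi_skew[OF x, of "E _" "covd phi x v (E _)"] G.sym[of "E _" "phi x _"] by (simp add: sum_negf[symmetric])
  also have "\<dots> = - tr (\<lambda>u. phi x (covd phi x v u))"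
    unfolding \<epsilon>_def using linear_compose[OF covd_linear(2)[OF phi_efield x] linear_facts(1)]
    by (subst G.tr_orthonormal[OF E]) (simp_all add: o_def)
  finally show ?thesis using t tr_phi_covd_phi_fixed by simp
qed

lemma tr_grad_xi: "tr (grad xi x) = 0"
proof -
  have "tr (grad xi x) = tr (\<lambda>u. S x u - phi x u)" by (simp flip: grad_xi_eq[OF x])
  then show ?thesis by (simp add: tr_diff tr_S tr_phi)
qed

lemma linear_grad_xi: "linear (grad xi x)"
  using efieldD(1)[OF efield_grad[OF xi_smooth] x] .

text \<open>Every vector is \<open>\<phi>^2 v + \<eta>(v) \<xi>\<close>. On the image of \<phi> the
  divergence vanishes by the traces above. At \<xi>, differentiating \<open>\<phi> \<xi> = 0\<close>
  leaves the trace of \<open>\<phi>^2\<close>, the identity minus a projection of rank one.\<close>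

lemma dv_phi: "dv phi x v = (real CARD('d) - 1) * G x (xi x) v"
proof -
  have 1: "dv phi x (phi x v) = 0" for v
  proof -
    have e: "covd phi x u (phi x v) = - phi x (covd phi x u v) - (G x (grad xi x u) v *\<^sub>R xi x + G x (xi x) v *\<^sub>R grad xi x u)" for u
      using covd_phi_phi[OF x, of u v] by (simp add: algebra_simps eq_neg_iff_add_eq_0)
    have l: "linear (\<lambda>u. G x (grad xi x u) v)"
      using linear_compose[OF linear_grad_xi G.lin1] by (simp add: o_def)
    show ?thesis
      unfolding dv_def e tr_diff tr_minus tr_add tr_scaleR tr_phi_covd_phi tr_grad_xi tr_functional[OF l]
      by (simp add: grad_xi_xi[OF x] G.bsimps)
  qed
  have 2: "dv phi x (xi x) = real CARD('d) - 1"
  proof -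
    have "dv phi x (xi x) = tr (\<lambda>u. (u - G x (xi x) u *\<^sub>R xi x) - phi x (S x u))"
      unfolding dv_def by (simp add: covd_phi_xi[OF x] grad_xi_eq[OF x] phi_simps[OF x] phi_phi[OF x])
    also have "\<dots> = real CARD('d) - 1"
      unfolding tr_diff tr_ident G.tr_rank_one by (simp add: tr_phi_S xi_unit[OF x])
    finally show ?thesis .
  qed
  have lin: "linear (covd phi x u)" for u by (rule covd_linear(2)[OF phi_efield x])
  have "covd phi x u v = covd phi x u (phi x (phi x v)) + G x (xi x) v *\<^sub>R covd phi x u (xi x)" for u
    by (simp add: phi_phi[OF x] linear_diff[OF lin] linear_scale[OF lin])
  then have "dv phi x v = dv phi x (phi x (phi x v)) + G x (xi x) v * dv phi x (xi x)"
    unfolding dv_def by (simp add: tr_add tr_scaleR)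
  then show ?thesis by (simp add: 1 2)
qed

end

text \<open>The commutation formula for second derivatives has \<xi> in the last slot of the
  curvature, which is why symmetry of \<open>ric\<close> is applied first. The traces with
  \<open>w\<close> as direction of differentiation vanish: \<open>S\<close> is trace-free
  everywhere, and the derivative of \<phi> is skew.\<close>

lemma ric_xi:
  assumes x: "x \<in> N"
  shows "ric x (xi x) w = dv S x w - (real CARD('d) - 1) * G x (xi x) w"
proof -
  interpret G: indef_inner "G x" by (rule G_inner[OF x])
  have T: "covd (grad xi) x u v = covd S x u v - covd phi x u v" for u v
    using covd_add[OF efield_grad[OF xi_smooth] phi_efield x, of u v] by (simp add: S_def[abs_def])
  have "ric x (xi x) w = tr (\<lambda>u. covd (grad xi) x u w - covd (grad xi) x w u)"
    unfolding ric_sym[OF x, of "xi x" w] unfolding ric_def curv_grad[OF xi_smooth x] ..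
  also have "\<dots> = dv S x w - dv phi x w - (tr (covd S x w) - tr (covd phi x w))"
    unfolding T tr_diff dv_def ..
  also have "tr (covd phi x w) = 0"
    by (rule G.tr_skew[OF covd_linear(2)[OF phi_efield x]]) (rule covd_phi_skew[OF x])
  also have "tr (covd S x w) = 0"
    unfolding tr_covd[OF S_efield x] using dd_cong[OF open_N x, of "\<lambda>y. tr (S y)" "\<lambda>y. 0" w] tr_S
    by (simp add: dd_const)
  finally show ?thesis by (simp add: dv_phi[OF x])
qed

lemma dv_grad_adj:
  assumes x: "x \<in> N"
  shows "dv grad_adj x w = dv S x w + (real CARD('d) - 1) * G x (xi x) w"
proof -
  have "dv grad_adj x w = dv S x w + dv phi x w"
    unfolding dv_def tr_add[symmetric] using covd_add[OF S_efield phi_efield x] by (simp add: grad_adj_def[abs_def])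
  then show ?thesis by (simp add: dv_phi[OF x])
qed

text \<open>Differentiating \<open>S \<xi> = 0\<close> gives the trace of \<open>- S^2\<close>, and
  \<open>- S^2 = (\<phi> S)^2\<close> by anticommutation. This sign is what makes the value equal to
  \<open>tr h^2\<close>.\<close>

lemma dv_S_xi:
  assumes x: "x \<in> N"
  shows "dv S x (xi x) = tr (\<lambda>v. phi x (S x (phi x (S x v))))"
proof -
  have "dv S x (xi x) = tr (\<lambda>u. S x (phi x u) - S x (S x u))"
    unfolding dv_def by (simp add: covd_S_xi[OF x] grad_xi_eq[OF x] S_simps[OF x])
  also have "\<dots> = tr (\<lambda>v. - S x (S x v))"
    unfolding tr_diff tr_minus by (simp add: tr_phi_S[OF x])
  also have "\<dots> = tr (\<lambda>v. phi x (S x (phi x (S x v))))"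
    by (simp add: S_phi[OF x] phi_simps[OF x] phi_phi_S[OF x])
  finally show ?thesis .
qed

end

section \<open>Vector fields in charts\<close>

text \<open>The coordinate functions have irrelevant values outside the chart domain; a tangent
  vector at a point of the domain sees only their germ there.\<close>

definition tcoords :: "('m, 'd) chart \<Rightarrow> 'm tvec \<Rightarrow> real ^ 'd::finite" where
  "tcoords c v = (\<chi> i. v (\<lambda>q. snd c q $ i))"

definition coords :: "('m, 'd) chart \<Rightarrow> 'm vfield \<Rightarrow> real ^ 'd \<Rightarrow> real ^ 'd::finite" where
  "coords c X y = tcoords c (X (chart_inv c y))"

lemma tcoords_simps:
  "tcoords c (u + v) = tcoords c u + tcoords c v" "tcoords c (a *\<^sub>v v) = a *\<^sub>R tcoords c v"
  "tcoords c (u - v) = tcoords c u - tcoords c v" "tcoords c 0 = 0"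
  by (simp_all add: tcoords_def vec_eq_iff vscale_def fun_diff_def)

locale smooth_mfd =
  fixes A :: "('m::{t2_space, second_countable_topology}, 'd::finite) chart set"
  assumes manifold: "smooth_manifold A"
begin

lemma ex_chart: "\<exists>c\<in>A. p \<in> fst c"
  using manifold unfolding smooth_manifold_def by blast

text \<open>Inverse to \<open>coords\<close> on the chart domain. The value 0 elsewhere keeps the
  field tangent everywhere.\<close>

definition cfield :: "('m, 'd) chart \<Rightarrow> (real ^ 'd \<Rightarrow> real ^ 'd) \<Rightarrow> 'm vfield" where
  "cfield c w = (\<lambda>q. if q \<in> fst c then coord_vec A c q (w (snd c q)) else 0)"

context
  fixes c assumes c: "c \<in> A"
begin

lemma open_dom: "open (fst c)" and open_img: "open (snd c ` fst c)"
  and homeo: "homeomorphism (fst c) (snd c ` fst c) (snd c) (chart_inv c)"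
  using manifold c unfolding smooth_manifold_def by auto

lemma chart_inv_left: "p \<in> fst c \<Longrightarrow> chart_inv c (snd c p) = p"
  using homeo by (simp add: homeomorphism_def)

lemma chart_inv_right: "y \<in> snd c ` fst c \<Longrightarrow> snd c (chart_inv c y) = y"
  and chart_inv_in: "y \<in> snd c ` fst c \<Longrightarrow> chart_inv c y \<in> fst c"
  using homeo unfolding homeomorphism_def by blast+

lemma continuous_on_chart: "continuous_on (fst c) (snd c)"
  and continuous_on_chart_inv: "continuous_on (snd c ` fst c) (chart_inv c)"
  using homeo by (auto simp: homeomorphism_def)

lemma open_image:
  assumes "open U" "U \<subseteq> fst c"
  shows "open (snd c ` U)"
proof -
  have "openin (top_of_set (fst c)) U" using assms open_dom by (simp add: openin_open_eq)
  then have "openin (top_of_set (snd c ` fst c)) (snd c ` U)"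
    by (rule homeomorphism_imp_open_map[OF homeo])
  then show ?thesis using open_img by (simp add: openin_open_eq)
qed

lemma open_preimage:
  assumes "open M" "M \<subseteq> snd c ` fst c"
  shows "open (chart_inv c ` M)" "chart_inv c ` M \<subseteq> fst c" "snd c ` (chart_inv c ` M) = M"
proof -
  have "openin (top_of_set (snd c ` fst c)) M" using assms open_img by (simp add: openin_open_eq)
  then have "openin (top_of_set (fst c)) (chart_inv c ` M)"
    by (rule homeomorphism_imp_open_map[OF homeo[THEN homeomorphism_symD]])
  then show "open (chart_inv c ` M)" using open_dom by (simp add: openin_open_eq)
  show "chart_inv c ` M \<subseteq> fst c" using chart_inv_in assms(2) by auto
  show "snd c ` (chart_inv c ` M) = M" using chart_inv_right assms(2) by (force simp: image_image)
qed

text \<open>The transition maps are smooth, so a single chart containing \<open>U\<close>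
  decides.\<close>

lemma smooth_fun_chart:
  assumes U: "open U" "U \<subseteq> fst c"
  shows "smooth_fun A U f \<longleftrightarrow> smooth_on (snd c ` U) (f \<circ> chart_inv c)"
proof
  assume "smooth_fun A U f"
  then show "smooth_on (snd c ` U) (f \<circ> chart_inv c)"
    using c U(2) unfolding smooth_fun_def by (metis inf.absorb1)
next
  assume f: "smooth_on (snd c ` U) (f \<circ> chart_inv c)"
  show "smooth_fun A U f"
    unfolding smooth_fun_def
  proof
    fix d assume d: "d \<in> A"
    have hd: "homeomorphism (fst d) (snd d ` fst d) (snd d) (chart_inv d)" "open (fst d)" "open (snd d ` fst d)"
      using manifold d unfolding smooth_manifold_def by auto
    have inv: "chart_inv d y \<in> U \<inter> fst d" if "y \<in> snd d ` (U \<inter> fst d)" for y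
      using that hd(1) by (auto simp: homeomorphism_def)
    have "openin (top_of_set (snd d ` fst d)) (snd d ` (U \<inter> fst d))"
      using hd U(1) by (intro homeomorphism_imp_open_map[OF hd(1)]) (auto simp: openin_open_eq)
    then have op: "open (snd d ` (U \<inter> fst d))" using hd(3) by (simp add: openin_open_eq)
    have "smooth_on (snd d ` (fst d \<inter> fst c)) (snd c \<circ> chart_inv d)"
      using manifold c d unfolding smooth_manifold_def by blast
    then have t: "smooth_on (snd d ` (U \<inter> fst d)) (snd c \<circ> chart_inv d)"
      by (rule smooth_on_mono) (use U(2) in auto)
    have "smooth_on (snd d ` (U \<inter> fst d)) (\<lambda>y. (f \<circ> chart_inv c) ((snd c \<circ> chart_inv d) y))"
      by (rule smooth_on_compose[OF f t op open_image[OF U]]) (use inv in auto)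
    then show "smooth_on (snd d ` (U \<inter> fst d)) (f \<circ> chart_inv d)"
      by (rule smooth_on_cong[OF _ op]) (simp add: chart_inv_left subsetD[OF U(2)] IntD1[OF inv])
  qed
qed

end

lemma smooth_fun_mono: "smooth_fun A U f \<Longrightarrow> V \<subseteq> U \<Longrightarrow> smooth_fun A V f"
  unfolding smooth_fun_def by (meson Int_mono image_mono order_refl smooth_on_mono)

lemma smooth_fun_local:
  assumes "\<And>p. p \<in> U \<Longrightarrow> \<exists>V. open V \<and> p \<in> V \<and> smooth_fun A V f"
  shows "smooth_fun A U f"
  unfolding smooth_fun_def
proof
  fix c assume c: "c \<in> A"
  show "smooth_on (snd c ` (U \<inter> fst c)) (f \<circ> chart_inv c)"
  proof (rule smooth_on_local)
    fix y assume "y \<in> snd c ` (U \<inter> fst c)"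
    then obtain p where p: "p \<in> U" "p \<in> fst c" "y = snd c p" by auto
    obtain V where V: "open V" "p \<in> V" "smooth_fun A V f" using assms p by blast
    have "open (snd c ` (V \<inter> fst c))" using open_image[OF c] open_dom[OF c] V(1) by auto
    moreover have "smooth_on (snd c ` (V \<inter> fst c)) (f \<circ> chart_inv c)"
      using V(3) c unfolding smooth_fun_def by blast
    ultimately show "\<exists>T. open T \<and> y \<in> T \<and> smooth_on T (f \<circ> chart_inv c)" using p V(2) by blast
  qed
qed

lemma smooth_fun_cong:
  assumes "smooth_fun A U f" "open U" "\<And>p. p \<in> U \<Longrightarrow> f p = g p"
  shows "smooth_fun A U g"
  unfolding smooth_fun_def
proof
  fix c assume c: "c \<in> A"
  have o: "open (snd c ` (U \<inter> fst c))" using open_image[OF c] open_dom[OF c] assms(2) by auto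
  have f: "smooth_on (snd c ` (U \<inter> fst c)) (f \<circ> chart_inv c)"
    using assms(1) c unfolding smooth_fun_def by blast
  show "smooth_on (snd c ` (U \<inter> fst c)) (g \<circ> chart_inv c)"
    by (rule smooth_on_cong[OF f o]) (use chart_inv_left[OF c] assms(3) in auto)
qed

lemma smooth_near_chart:
  assumes "c \<in> A" "p \<in> fst c" "smooth_near A p f"
  obtains U where "open U" "p \<in> U" "U \<subseteq> fst c" "smooth_fun A U f" "smooth_on (snd c ` U) (f \<circ> chart_inv c)"
proof -
  obtain V where V: "open V" "p \<in> V" "smooth_fun A V f" using assms(3) unfolding smooth_near_def by blast
  have o: "open (V \<inter> fst c)" using V open_dom[OF assms(1)] by auto
  have f: "smooth_fun A (V \<inter> fst c) f" using smooth_fun_mono[OF V(3)] by auto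
  have "smooth_on (snd c ` (V \<inter> fst c)) (f \<circ> chart_inv c)"
    using f smooth_fun_chart[OF assms(1) o] by simp
  then show ?thesis using that[OF o _ _ f] V assms by auto
qed

section \<open>Tangent vectors in coordinates\<close>

lemma coord_vec_dd:
  "coord_vec A c p v f = (if smooth_near A p f then dd (f \<circ> chart_inv c) v (snd c p) else 0)"
  by (simp add: coord_vec_def dd_def)

context
  fixes c assumes c: "c \<in> A"
begin

lemma smooth_fun_coordinate: "smooth_fun A (fst c) (\<lambda>q. snd c q $ i)"
  unfolding smooth_fun_chart[OF c open_dom[OF c] order_refl]
  by (rule smooth_on_cong[OF smooth_on_vec_nth[OF open_img[OF c] smooth_on_ident[OF open_img[OF c]]] open_img[OF c]])
    (simp add: chart_inv_right[OF c])

lemma smooth_near_coordinate: "p \<in> fst c \<Longrightarrow> smooth_near A p (\<lambda>q. snd c q $ i)"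
  unfolding smooth_near_def using smooth_fun_coordinate open_dom[OF c] by blast

lemma tcoords_coord_vec:
  assumes p: "p \<in> fst c"
  shows "tcoords c (coord_vec A c p v) = v"
proof -
  have "dd ((\<lambda>q. snd c q $ i) \<circ> chart_inv c) v (snd c p) = v $ i" for i
  proof -
    have "dd ((\<lambda>q. snd c q $ i) \<circ> chart_inv c) v (snd c p) = dd (\<lambda>y. y $ i) v (snd c p)"
      by (rule dd_cong[OF open_img[OF c]]) (use p chart_inv_right[OF c] in auto)
    then show ?thesis
      using dd_vec_nth[OF smooth_on_ident[OF open_UNIV], of "snd c p" i v] by (simp add: dd_ident)
  qed
  then show ?thesis
    by (simp add: tcoords_def vec_eq_iff coord_vec_dd smooth_near_coordinate[OF p])
qed

lemma coord_vec_linear: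
  assumes p: "p \<in> fst c"
  shows "coord_vec A c p (u + v) = coord_vec A c p u + coord_vec A c p v"
    "coord_vec A c p (a *\<^sub>R v) = a *\<^sub>v coord_vec A c p v"
    "coord_vec A c p (u - v) = coord_vec A c p u - coord_vec A c p v"
    "coord_vec A c p 0 = 0"
proof -
  have *: "linear (\<lambda>v. coord_vec A c p v f)" for f
  proof (cases "smooth_near A p f")
    case True
    obtain U where U: "p \<in> U" "smooth_on (snd c ` U) (f \<circ> chart_inv c)"
      using smooth_near_chart[OF c p True] by metis
    show ?thesis using True smooth_on_linear_dd[OF U(2)] U(1) by (simp add: coord_vec_dd)
  qed (simp add: coord_vec_dd linear_zero)
  show "coord_vec A c p (u + v) = coord_vec A c p u + coord_vec A c p v"
    "coord_vec A c p (a *\<^sub>R v) = a *\<^sub>v coord_vec A c p v"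
    "coord_vec A c p (u - v) = coord_vec A c p u - coord_vec A c p v"
    "coord_vec A c p 0 = 0"
    using linear_add[OF *] linear_scale[OF *] linear_diff[OF *] linear_0[OF *]
    by (simp_all add: fun_eq_iff vscale_def)
qed

lemma coord_vec_change:
  assumes d: "d \<in> A" and p: "p \<in> fst c" "p \<in> fst d"
  shows "coord_vec A d p v = coord_vec A c p (dd (snd c \<circ> chart_inv d) v (snd d p))"
proof
  fix f
  show "coord_vec A d p v f = coord_vec A c p (dd (snd c \<circ> chart_inv d) v (snd d p)) f"
  proof (cases "smooth_near A p f")
    case True
    obtain U where U: "open U" "p \<in> U" "U \<subseteq> fst c" "smooth_fun A U f" "smooth_on (snd c ` U) (f \<circ> chart_inv c)"
      using smooth_near_chart[OF c p(1) True] by metis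
    have t: "smooth_on (snd d ` (fst d \<inter> fst c)) (snd c \<circ> chart_inv d)"
      using manifold c d unfolding smooth_manifold_def by blast
    have op: "open (snd d ` (U \<inter> fst d))" using open_image[OF d] open_dom[OF d] U(1) by auto
    have "dd (f \<circ> chart_inv d) v (snd d p) = dd (\<lambda>y. (f \<circ> chart_inv c) ((snd c \<circ> chart_inv d) y)) v (snd d p)"
      by (rule dd_cong[OF op]) (use U p chart_inv_left[OF d] chart_inv_left[OF c] in auto)
    also have "\<dots> = dd (f \<circ> chart_inv c) (dd (snd c \<circ> chart_inv d) v (snd d p)) ((snd c \<circ> chart_inv d) (snd d p))"
      by (rule dd_compose[OF t _ U(5)]) (use p U chart_inv_left[OF d] in auto)
    finally show ?thesis using True chart_inv_left[OF d] p by (simp add: coord_vec_dd)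
  qed (simp add: coord_vec_dd)
qed

lemma tangent_space_chart: "p \<in> fst c \<Longrightarrow> tangent_space A p = range (coord_vec A c p)"
proof -
  assume p: "p \<in> fst c"
  have "coord_vec A d p v \<in> range (coord_vec A c p)" if "d \<in> A" "p \<in> fst d" for d v
    unfolding coord_vec_change[OF that(1) p that(2)] by simp
  then show ?thesis using c p unfolding tangent_space_def by blast
qed

lemma tangent_coords: "p \<in> fst c \<Longrightarrow> v \<in> tangent_space A p \<Longrightarrow> coord_vec A c p (tcoords c v) = v"
  using tangent_space_chart tcoords_coord_vec by auto

lemma coord_vec_tangent: "p \<in> fst c \<Longrightarrow> coord_vec A c p v \<in> tangent_space A p"
  using tangent_space_chart by auto

lemma tangent_eqI:
  "p \<in> fst c \<Longrightarrow> u \<in> tangent_space A p \<Longrightarrow> v \<in> tangent_space A p \<Longrightarrow> tcoords c u = tcoords c v \<Longrightarrow> u = v"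
  using tangent_coords by metis

lemma tangent_apply:
  assumes "p \<in> fst c" "v \<in> tangent_space A p"
  shows "v f = (if smooth_near A p f then dd (f \<circ> chart_inv c) (tcoords c v) (snd c p) else 0)"
  using coord_vec_dd[of c p "tcoords c v" f] tangent_coords[OF assms] by simp

end

lemma tangent_closed:
  "u \<in> tangent_space A p \<Longrightarrow> v \<in> tangent_space A p \<Longrightarrow> u + v \<in> tangent_space A p"
  "u \<in> tangent_space A p \<Longrightarrow> a *\<^sub>v u \<in> tangent_space A p"
  "u \<in> tangent_space A p \<Longrightarrow> v \<in> tangent_space A p \<Longrightarrow> u - v \<in> tangent_space A p"
  "0 \<in> tangent_space A p"
proof -
  obtain c where c: "c \<in> A" "p \<in> fst c" using ex_chart by blast
  note t = tangent_space_chart[OF c(1), OF c(2)]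
  note l = coord_vec_linear[OF c(1), OF c(2)]
  show "u \<in> tangent_space A p \<Longrightarrow> v \<in> tangent_space A p \<Longrightarrow> u + v \<in> tangent_space A p"
    unfolding t by (auto simp: l(1)[symmetric])
  show "u \<in> tangent_space A p \<Longrightarrow> a *\<^sub>v u \<in> tangent_space A p"
    unfolding t by (auto simp: l(2)[symmetric])
  show "u \<in> tangent_space A p \<Longrightarrow> v \<in> tangent_space A p \<Longrightarrow> u - v \<in> tangent_space A p"
    unfolding t by (auto simp: l(3)[symmetric])
  show "0 \<in> tangent_space A p"
    unfolding t l(4)[symmetric] by auto
qed

section \<open>Smooth vector fields and Lie brackets in coordinates\<close>

lemma smooth_vf_mono: "smooth_vf A U X \<Longrightarrow> V \<subseteq> U \<Longrightarrow> smooth_vf A V X"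
  unfolding smooth_vf_def by (meson order_trans subsetD)

lemma smooth_vf_tangent: "smooth_vf A U X \<Longrightarrow> p \<in> U \<Longrightarrow> X p \<in> tangent_space A p"
  unfolding smooth_vf_def by blast

lemma smooth_vf_local:
  assumes "\<And>p. p \<in> U \<Longrightarrow> \<exists>V. open V \<and> p \<in> V \<and> smooth_vf A V X"
  shows "smooth_vf A U X"
  unfolding smooth_vf_def
proof (intro conjI ballI allI impI)
  fix p assume "p \<in> U"
  then show "X p \<in> tangent_space A p" using assms smooth_vf_tangent by metis
next
  fix W f assume W: "open W \<and> W \<subseteq> U \<and> smooth_fun A W f"
  show "smooth_fun A W (\<lambda>p. X p f)"
  proof (rule smooth_fun_local)
    fix p assume p: "p \<in> W"
    obtain V where V: "open V" "p \<in> V" "smooth_vf A V X" using assms p W by blast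
    have "smooth_fun A (V \<inter> W) f" using W smooth_fun_mono by blast
    then have "smooth_fun A (V \<inter> W) (\<lambda>p. X p f)"
      using V(3) W V(1) unfolding smooth_vf_def by blast
    then show "\<exists>V. open V \<and> p \<in> V \<and> smooth_fun A V (\<lambda>p. X p f)" using p V W by blast
  qed
qed

lemma smooth_vf_cong:
  assumes "smooth_vf A U X" "\<And>p. p \<in> U \<Longrightarrow> X p = Y p"
  shows "smooth_vf A U Y"
  unfolding smooth_vf_def
proof (intro conjI ballI allI impI)
  fix p assume "p \<in> U"
  then show "Y p \<in> tangent_space A p" using assms smooth_vf_tangent by metis
next
  fix W f assume W: "open W \<and> W \<subseteq> U \<and> smooth_fun A W f"
  then have "smooth_fun A W (\<lambda>p. X p f)" using assms(1) unfolding smooth_vf_def by blast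
  then show "smooth_fun A W (\<lambda>p. Y p f)"
    by (rule smooth_fun_cong) (use W assms(2) in auto)
qed

lemma open_chart_image: "c \<in> A \<Longrightarrow> open U \<Longrightarrow> open (snd c ` (U \<inter> fst c))"
  by (rule open_image) (simp_all add: open_Int open_dom)

lemma smooth_fun_const: "open U \<Longrightarrow> smooth_fun A U (\<lambda>p. a)"
  unfolding smooth_fun_def by (auto simp: o_def intro!: smooth_on_const open_chart_image)

lemma smooth_fun_add: "open U \<Longrightarrow> smooth_fun A U f \<Longrightarrow> smooth_fun A U h \<Longrightarrow> smooth_fun A U (\<lambda>p. f p + h p)"
  unfolding smooth_fun_def o_def by (simp add: smooth_on_add open_chart_image)

lemma smooth_fun_mult: "open U \<Longrightarrow> smooth_fun A U f \<Longrightarrow> smooth_fun A U h \<Longrightarrow> smooth_fun A U (\<lambda>p. f p * h p)"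
  unfolding smooth_fun_def o_def by (simp add: smooth_on_mult open_chart_image)

lemma smooth_vf_zero: "open U \<Longrightarrow> smooth_vf A U (\<lambda>p. 0)"
  unfolding smooth_vf_def using tangent_closed(4) smooth_fun_const by auto

lemma smooth_vf_add:
  assumes "smooth_vf A U X" "smooth_vf A U Y"
  shows "smooth_vf A U (X + Y)"
  using assms tangent_closed(1) smooth_fun_add unfolding smooth_vf_def by auto

lemma smooth_vf_scale:
  assumes "smooth_fun A U f" "smooth_vf A U X"
  shows "smooth_vf A U (\<lambda>p. f p *\<^sub>v X p)"
  unfolding smooth_vf_def
proof (intro conjI ballI allI impI)
  fix W h assume W: "open W \<and> W \<subseteq> U \<and> smooth_fun A W h"
  then have "smooth_fun A W f" "smooth_fun A W (\<lambda>p. X p h)"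
    using assms smooth_fun_mono unfolding smooth_vf_def by blast+
  then show "smooth_fun A W (\<lambda>p. (f p *\<^sub>v X p) h)"
    using smooth_fun_mult W by (simp add: vscale_def)
qed (use assms smooth_vf_tangent tangent_closed(2) in blast)

context
  fixes c U assumes c: "c \<in> A" and U: "open U" "U \<subseteq> fst c"
begin

lemma smooth_vf_chart:
  "smooth_vf A U X \<longleftrightarrow> (\<forall>p\<in>U. X p \<in> tangent_space A p) \<and> smooth_on (snd c ` U) (coords c X)"
proof (intro iffI conjI)
  assume X: "smooth_vf A U X"
  then show "\<forall>p\<in>U. X p \<in> tangent_space A p" using smooth_vf_tangent by blast
  have "smooth_on (snd c ` U) (\<lambda>y. X (chart_inv c y) (\<lambda>q. snd c q $ i))" for i
  proof -
    have "smooth_fun A U (\<lambda>p. X p (\<lambda>q. snd c q $ i))"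
      using X U smooth_fun_mono[OF smooth_fun_coordinate[OF c] U(2)] unfolding smooth_vf_def by blast
    then show ?thesis using smooth_fun_chart[OF c U] by (simp add: o_def)
  qed
  then show "smooth_on (snd c ` U) (coords c X)"
    unfolding coords_def[abs_def] tcoords_def by (intro smooth_on_vec_lambda open_image[OF c U]) auto
next
  assume X: "(\<forall>p\<in>U. X p \<in> tangent_space A p) \<and> smooth_on (snd c ` U) (coords c X)"
  show "smooth_vf A U X"
    unfolding smooth_vf_def
  proof (intro conjI allI impI)
    show "\<forall>p\<in>U. X p \<in> tangent_space A p" using X by blast
    fix W f assume W: "open W \<and> W \<subseteq> U \<and> smooth_fun A W f"
    then have W': "open W" "W \<subseteq> fst c" using U by auto
    note o = open_image[OF c W']
    have f: "smooth_on (snd c ` W) (f \<circ> chart_inv c)" using W smooth_fun_chart[OF c W'] by blast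
    have "smooth_on (snd c ` W) (coords c X)" using X smooth_on_mono W by (meson image_mono)
    from smooth_on_dd_apply[OF o f this]
    have "smooth_on (snd c ` W) ((\<lambda>p. X p f) \<circ> chart_inv c)"
    proof (rule smooth_on_cong[OF _ o])
      fix y assume "y \<in> snd c ` W"
      then obtain p where p: "p \<in> W" "y = snd c p" by auto
      then have "smooth_near A p f" "p \<in> fst c" "X p \<in> tangent_space A p"
        using W W' X U unfolding smooth_near_def by auto
      then show "dd (f \<circ> chart_inv c) (coords c X y) y = ((\<lambda>p. X p f) \<circ> chart_inv c) y"
        using p tangent_apply[OF c, of p "X p" f] by (simp add: coords_def chart_inv_left[OF c])
    qed
    then show "smooth_fun A W (\<lambda>p. X p f)" using smooth_fun_chart[OF c W'] by blast
  qed
qed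

lemma smooth_coords: "smooth_vf A U X \<Longrightarrow> smooth_on (snd c ` U) (coords c X)"
  using smooth_vf_chart by blast

lemma coords_at: "p \<in> fst c \<Longrightarrow> coords c X (snd c p) = tcoords c (X p)"
  by (simp add: coords_def chart_inv_left[OF c])

lemma coords_cfield: "y \<in> snd c ` fst c \<Longrightarrow> coords c (cfield c w) y = w y"
  using chart_inv_in[OF c] chart_inv_right[OF c] by (simp add: coords_def cfield_def tcoords_coord_vec[OF c])

lemma smooth_cfield:
  assumes "smooth_on (snd c ` U) w"
  shows "smooth_vf A U (cfield c w)"
  unfolding smooth_vf_chart
proof
  show "\<forall>p\<in>U. cfield c w p \<in> tangent_space A p"
    using U coord_vec_tangent[OF c] by (auto simp: cfield_def)
  show "smooth_on (snd c ` U) (coords c (cfield c w))"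
    by (rule smooth_on_cong[OF assms open_image[OF c U]]) (use U coords_cfield in auto)
qed

lemma cfield_coords: "smooth_vf A U X \<Longrightarrow> p \<in> U \<Longrightarrow> cfield c (coords c X) p = X p"
  using U coords_at tangent_coords[OF c] smooth_vf_tangent by (auto simp: cfield_def)

lemma vf_apply_coords:
  assumes X: "smooth_vf A U X" and f: "smooth_fun A U f" and y: "y \<in> snd c ` U"
  shows "X (chart_inv c y) f = dd (f \<circ> chart_inv c) (coords c X y) y"
proof -
  obtain p where p: "p \<in> U" "y = snd c p" using y by auto
  have "smooth_near A p f" using f U p unfolding smooth_near_def by blast
  then show ?thesis
    using tangent_apply[OF c, of p "X p" f] p U smooth_vf_tangent[OF X] chart_inv_left[OF c]
    by (auto simp: coords_def)
qed

text \<open>Both \<open>X (Y f)\<close> and \<open>Y (X f)\<close> contain the second derivative of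
  \<open>f\<close> along the two component vectors. These terms cancel by symmetry, and an operator
  of first order, hence a tangent vector, is left.\<close>

lemma lie_bracket_coords:
  assumes X: "smooth_vf A U X" and Y: "smooth_vf A U Y" and p: "p \<in> U"
  shows "lie_bracket A X Y p = coord_vec A c p (dd (coords c Y) (coords c X (snd c p)) (snd c p)
    - dd (coords c X) (coords c Y (snd c p)) (snd c p))"
proof
  fix f
  have pc: "p \<in> fst c" using p U by blast
  show "lie_bracket A X Y p f = coord_vec A c p (dd (coords c Y) (coords c X (snd c p)) (snd c p)
    - dd (coords c X) (coords c Y (snd c p)) (snd c p)) f"
  proof (cases "smooth_near A p f")
    case True
    obtain V0 where V0: "open V0" "p \<in> V0" "V0 \<subseteq> fst c" "smooth_fun A V0 f"
      using smooth_near_chart[OF c pc True] by metis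
    define V where "V = V0 \<inter> U"
    have V: "open V" "p \<in> V" "V \<subseteq> fst c" "V \<subseteq> U" "smooth_fun A V f"
      using V0 U p smooth_fun_mono unfolding V_def by auto
    define y where "y = snd c p"
    have y: "y \<in> snd c ` V" using V y_def by auto
    note o = open_image[OF c V(1,3)]
    define F where "F = f \<circ> chart_inv c"
    have F: "smooth_on (snd c ` V) F" using V smooth_fun_chart[OF c V(1,3)] F_def by blast
    have XV: "smooth_on (snd c ` V) (coords c X)" and YV: "smooth_on (snd c ` V) (coords c Y)"
      using smooth_on_mono[OF smooth_coords] X Y V by (meson image_mono)+
    have key: "Z p (\<lambda>q. Z' q f) = dd (dd F (coords c Z' y)) (coords c Z y) y + dd F (dd (coords c Z') (coords c Z y) y) y"
      if Z: "smooth_vf A U Z" and Z': "smooth_vf A U Z'" for Z Z'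
    proof -
      have Z'f: "smooth_fun A V (\<lambda>q. Z' q f)" using Z' V unfolding smooth_vf_def by blast
      have Z'V: "smooth_on (snd c ` V) (coords c Z')"
        using smooth_on_mono[OF smooth_coords[OF Z']] V by (meson image_mono)
      have near: "smooth_near A p (\<lambda>q. Z' q f)" using Z'f V unfolding smooth_near_def by blast
      have "Z p (\<lambda>q. Z' q f) = dd ((\<lambda>q. Z' q f) \<circ> chart_inv c) (coords c Z y) y"
        using tangent_apply[OF c pc smooth_vf_tangent[OF Z p], of "\<lambda>q. Z' q f"] near
        by (simp add: y_def coords_at[OF pc])
      also have "\<dots> = dd (\<lambda>y. dd F (coords c Z' y) y) (coords c Z y) y"
      proof (rule dd_cong[OF o y])
        fix z assume "z \<in> snd c ` V"
        then obtain q where q: "q \<in> V" "z = snd c q" by auto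
        have "smooth_near A q f" using V q unfolding smooth_near_def by blast
        then show "((\<lambda>q. Z' q f) \<circ> chart_inv c) z = dd F (coords c Z' z) z"
          using tangent_apply[OF c _ smooth_vf_tangent[OF Z'], of q f] q subsetD[OF V(3) q(1)] subsetD[OF V(4) q(1)]
          by (simp add: F_def chart_inv_left[OF c] coords_at)
      qed
      also have "\<dots> = dd (dd F (coords c Z' y)) (coords c Z y) y + dd F (dd (coords c Z') (coords c Z y) y) y"
        by (rule dd_dd_apply[OF o F Z'V y])
      finally show ?thesis .
    qed
    have "dd (dd F (coords c Y y)) (coords c X y) y = dd (dd F (coords c X y)) (coords c Y y) y"
      by (rule dd_commute[OF o F y])
    then show ?thesis
      unfolding lie_bracket_def using True key[OF X Y] key[OF Y X]
      by (simp add: coord_vec_dd y_def[symmetric] F_def[symmetric] dd_linear_combination[OF F y])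
  qed (simp add: lie_bracket_def coord_vec_dd)
qed

end

section \<open>Evaluation of tensors given through local extensions\<close>

lemma ex_smooth_nbhd:
  assumes "c \<in> A" "p \<in> fst c" "local_extension A p u X"
  obtains U where "open U" "p \<in> U" "U \<subseteq> fst c" "smooth_vf A U X" "X p = u"
proof -
  obtain V where V: "open V" "p \<in> V" "smooth_vf A V X" "X p = u"
    using assms(3) unfolding local_extension_def by blast
  show ?thesis
    by (rule that[of "V \<inter> fst c"]) (use V assms(1,2) open_dom[OF assms(1)] smooth_vf_mono[OF V(3)] in auto)
qed

lemma ex_local_extension:
  assumes "u \<in> tangent_space A p"
  shows "\<exists>X. local_extension A p u X"
proof -
  obtain c where c: "c \<in> A" "p \<in> fst c" using ex_chart by blast
  have "smooth_vf A (fst c) (cfield c (\<lambda>_. tcoords c u))"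
    by (rule smooth_cfield[OF c(1) open_dom[OF c(1)] order_refl smooth_on_const[OF open_img[OF c(1)]]])
  then have "local_extension A p u (cfield c (\<lambda>_. tcoords c u))"
    unfolding local_extension_def using c open_dom[OF c(1)] tangent_coords[OF c assms] by (auto simp: cfield_def)
  then show ?thesis by blast
qed

text \<open>The description has a unique solution once all extensions give one common value and at
  least one extension exists, namely the field with constant components in a chart. Only
  neighbourhoods inside one chart have to be examined.\<close>

lemma tensor_at1_eqI:
  assumes "c \<in> A" "p \<in> fst c" "u \<in> tangent_space A p"
    and F: "\<And>X U. open U \<Longrightarrow> p \<in> U \<Longrightarrow> U \<subseteq> fst c \<Longrightarrow> smooth_vf A U X \<Longrightarrow> X p = u \<Longrightarrow> F X p = r"
  shows "tensor_at1 A F p u = r"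
  unfolding tensor_at1_def
proof (rule the_equality)
  show "\<forall>X. local_extension A p u X \<longrightarrow> F X p = r"
    using ex_smooth_nbhd[OF assms(1,2)] F by metis
next
  fix s assume "\<forall>X. local_extension A p u X \<longrightarrow> F X p = s"
  moreover obtain X where "local_extension A p u X" using ex_local_extension[OF assms(3)] by blast
  ultimately show "s = r" using ex_smooth_nbhd[OF assms(1,2)] F by metis
qed

lemma tensor_at2_eqI:
  assumes c: "c \<in> A" "p \<in> fst c" and uv: "u \<in> tangent_space A p" "v \<in> tangent_space A p"
    and F: "\<And>X Y U. open U \<Longrightarrow> p \<in> U \<Longrightarrow> U \<subseteq> fst c \<Longrightarrow> smooth_vf A U X \<Longrightarrow> smooth_vf A U Y \<Longrightarrow>
      X p = u \<Longrightarrow> Y p = v \<Longrightarrow> F X Y p = r"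
  shows "tensor_at2 A F p u v = r"
proof -
  have *: "F X Y p = r" if ext: "local_extension A p u X" "local_extension A p v Y" for X Y
  proof -
    obtain U where U: "open U" "p \<in> U" "U \<subseteq> fst c" "smooth_vf A U X" "X p = u"
      by (rule ex_smooth_nbhd[OF c ext(1)])
    obtain V where V: "open V" "p \<in> V" "V \<subseteq> fst c" "smooth_vf A V Y" "Y p = v"
      by (rule ex_smooth_nbhd[OF c ext(2)])
    show ?thesis
      by (rule F[of "U \<inter> V"]) (use U V smooth_vf_mono[OF U(4)] smooth_vf_mono[OF V(4)] in auto)
  qed
  show ?thesis
    unfolding tensor_at2_def
  proof (rule the_equality)
    fix s assume "\<forall>X Y. local_extension A p u X \<and> local_extension A p v Y \<longrightarrow> F X Y p = s"
    then show "s = r" using * ex_local_extension[OF uv(1)] ex_local_extension[OF uv(2)] by metis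
  qed (use * in blast)
qed

lemma tensor_at3_eqI:
  assumes c: "c \<in> A" "p \<in> fst c"
    and uvw: "u \<in> tangent_space A p" "v \<in> tangent_space A p" "w \<in> tangent_space A p"
    and F: "\<And>X Y Z U. open U \<Longrightarrow> p \<in> U \<Longrightarrow> U \<subseteq> fst c \<Longrightarrow> smooth_vf A U X \<Longrightarrow> smooth_vf A U Y \<Longrightarrow>
      smooth_vf A U Z \<Longrightarrow> X p = u \<Longrightarrow> Y p = v \<Longrightarrow> Z p = w \<Longrightarrow> F X Y Z p = r"
  shows "tensor_at3 A F p u v w = r"
proof -
  have *: "F X Y Z p = r" if ext: "local_extension A p u X" "local_extension A p v Y" "local_extension A p w Z" for X Y Z
  proof -
    obtain U where U: "open U" "p \<in> U" "U \<subseteq> fst c" "smooth_vf A U X" "X p = u"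
      by (rule ex_smooth_nbhd[OF c ext(1)])
    obtain V where V: "open V" "p \<in> V" "V \<subseteq> fst c" "smooth_vf A V Y" "Y p = v"
      by (rule ex_smooth_nbhd[OF c ext(2)])
    obtain W where W: "open W" "p \<in> W" "W \<subseteq> fst c" "smooth_vf A W Z" "Z p = w"
      by (rule ex_smooth_nbhd[OF c ext(3)])
    show ?thesis
      by (rule F[of "U \<inter> (V \<inter> W)"])
        (use U V W in \<open>auto intro!: smooth_vf_mono[OF U(4)] smooth_vf_mono[OF V(4)] smooth_vf_mono[OF W(4)]\<close>)
  qed
  show ?thesis
    unfolding tensor_at3_def
  proof (rule the_equality)
    fix s assume "\<forall>X Y Z. local_extension A p u X \<and> local_extension A p v Y \<and> local_extension A p w Z \<longrightarrow> F X Y Z p = s"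
    then show "s = r"
      using * ex_local_extension[OF uvw(1)] ex_local_extension[OF uvw(2)] ex_local_extension[OF uvw(3)] by metis
  qed (use * in blast)
qed

end

section \<open>The Levi-Civita connection in charts\<close>

lemma linear_axis_sum: "linear f \<Longrightarrow> f v = (\<Sum>i\<in>UNIV. v $ i *\<^sub>R f (axis i 1))"
  by (subst vec_axis_sum[of v]) (simp add: linear_sum linear_scale)

lemma coords_eqI: "X (chart_inv c y) = Y (chart_inv c y) \<Longrightarrow> coords c X y = coords c Y y"
  by (simp add: coords_def)

locale lc_mfd = smooth_mfd A for A :: "('m::{t2_space, second_countable_topology}, 'd::finite) chart set" +
  fixes g :: "'m \<Rightarrow> 'm tvec \<Rightarrow> 'm tvec \<Rightarrow> real"
    and nabla :: "'m vfield \<Rightarrow> 'm vfield \<Rightarrow> 'm vfield"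
  assumes metric: "semi_riemannian_metric A g"
    and connection: "levi_civita A g nabla"
begin

context
  fixes U X Y assumes U: "open U" and X: "smooth_vf A U X" and Y: "smooth_vf A U Y"
begin

lemma nabla_smooth: "smooth_vf A U (nabla X Y)"
  using connection U X Y smooth_fun_const[OF U] unfolding levi_civita_def by blast

context
  fixes p assumes p: "p \<in> U"
begin

lemma nabla_add1: "smooth_vf A U Z \<Longrightarrow> nabla (X + Y) Z p = nabla X Z p + nabla Y Z p"
  and nabla_add2: "smooth_vf A U Z \<Longrightarrow> nabla Z (X + Y) p = nabla Z X p + nabla Z Y p"
  and nabla_metric: "smooth_vf A U Z \<Longrightarrow>
    Z p (\<lambda>q. g q (X q) (Y q)) = g p (nabla Z X p) (Y p) + g p (X p) (nabla Z Y p)"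
  using connection U X Y p smooth_fun_const[OF U] unfolding levi_civita_def by blast+

lemma nabla_scale1: "smooth_fun A U f \<Longrightarrow> nabla (\<lambda>q. f q *\<^sub>v X q) Y p = f p *\<^sub>v nabla X Y p"
  and nabla_scale2: "smooth_fun A U f \<Longrightarrow> nabla X (\<lambda>q. f q *\<^sub>v Y q) p = X p f *\<^sub>v Y p + f p *\<^sub>v nabla X Y p"
  using connection U X Y p unfolding levi_civita_def by blast+

lemma nabla_torsion: "nabla X Y p - nabla Y X p = lie_bracket A X Y p"
  using connection U X Y p smooth_fun_const[OF U] unfolding levi_civita_def by blast

end

end

lemma vscale_simps: "0 *\<^sub>v v = 0" "1 *\<^sub>v v = v" "a *\<^sub>v 0 = 0"
  by (auto simp: vscale_def fun_eq_iff)

text \<open>A field that vanishes on \<open>U\<close> equals its product with the indicator function of the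
  complement of \<open>U\<close>; hence a connection is a local operator.\<close>
lemma
  assumes U: "open U" and X: "smooth_vf A U X" and Z: "smooth_vf A U Z"
    and zero: "\<And>q. q \<in> U \<Longrightarrow> Z q = 0" and p: "p \<in> U"
  shows nabla_zero1: "nabla Z X p = 0" and nabla_zero2: "nabla X Z p = 0"
proof -
  define f where "f q = (if q \<in> U then 0 else 1 :: real)" for q
  have f: "smooth_fun A U f"
    by (rule smooth_fun_cong[OF smooth_fun_const[OF U, of 0] U]) (simp add: f_def)
  have fZ: "(\<lambda>q. f q *\<^sub>v Z q) = Z"
    using zero by (auto simp: f_def fun_eq_iff vscale_def)
  show "nabla Z X p = 0"
    using nabla_scale1[OF U Z X p f] p unfolding fZ by (simp add: f_def vscale_simps)
  show "nabla X Z p = 0"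
    using nabla_scale2[OF U X Z p f] p zero unfolding fZ by (simp add: f_def vscale_simps)
qed

text \<open>The difference of two fields that agree on \<open>U\<close> vanishes there, so by
  additivity the vanishing case settles each argument in turn.\<close>

lemma nabla_cong:
  assumes U: "open U" and X: "smooth_vf A U X" and Y: "smooth_vf A U Y"
    and eq: "\<And>q. q \<in> U \<Longrightarrow> X q = X' q" "\<And>q. q \<in> U \<Longrightarrow> Y q = Y' q" and p: "p \<in> U"
  shows "nabla X Y p = nabla X' Y' p"
proof -
  have X': "smooth_vf A U X'" and Y': "smooth_vf A U Y'"
    using smooth_vf_cong[OF X] smooth_vf_cong[OF Y] eq by blast+
  define Z where "Z = (\<lambda>q. X q - X' q)"
  define W where "W = (\<lambda>q. Y q - Y' q)"
  have 0: "Z q = 0" "W q = 0" if "q \<in> U" for q using eq that by (auto simp: Z_def W_def)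
  have Z: "smooth_vf A U Z" and W: "smooth_vf A U W"
    using smooth_vf_cong[OF smooth_vf_zero[OF U]] 0 by metis+
  have XZ: "X = X' + Z" "Y = Y' + W" by (auto simp: Z_def W_def fun_eq_iff)
  have "nabla X Y p = nabla X' Y p" unfolding XZ(1)
    using nabla_add1[OF U X' Z p Y] nabla_zero1[OF U Y Z 0(1) p] by simp
  also have "\<dots> = nabla X' Y' p" unfolding XZ(2)
    using nabla_add2[OF U Y' W p X'] nabla_zero2[OF U X' W 0(2) p] by simp
  finally show ?thesis .
qed

lemma metric_linear: "\<forall>p. \<forall>u\<in>tangent_space A p. \<forall>v\<in>tangent_space A p. \<forall>w\<in>tangent_space A p. \<forall>a b.
        g p (a *\<^sub>v u + b *\<^sub>v v) w = a * g p u w + b * g p v w"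
  and metric_sym: "\<forall>p. \<forall>v\<in>tangent_space A p. \<forall>w\<in>tangent_space A p. g p v w = g p w v"
  and metric_nondegenerate: "\<forall>p. \<forall>v\<in>tangent_space A p. (\<forall>w\<in>tangent_space A p. g p v w = 0) \<longrightarrow> v = 0"
  and metric_smooth: "\<forall>U X Y. open U \<and> smooth_vf A U X \<and> smooth_vf A U Y \<longrightarrow> smooth_fun A U (\<lambda>p. g p (X p) (Y p))"
  using metric unfolding semi_riemannian_metric_def by - (elim conjE, assumption)+

lemma
  assumes "u \<in> tangent_space A p" "v \<in> tangent_space A p" "w \<in> tangent_space A p"
  shows g_add: "g p (u + v) w = g p u w + g p v w" and g_scale: "g p (a *\<^sub>v u) w = a * g p u w"
    and g_sym: "g p u v = g p v u"
proof -
  have lin: "g p (a *\<^sub>v u + b *\<^sub>v v) w = a * g p u w + b * g p v w" for a b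
    using metric_linear assms by simp
  from lin[of 1 1] show "g p (u + v) w = g p u w + g p v w" by (simp add: vscale_simps)
  from lin[of a 0] show "g p (a *\<^sub>v u) w = a * g p u w" by (simp add: vscale_simps)
  show "g p u v = g p v u"
    using metric_sym assms by simp
qed

lemma g_nondegenerate:
  "u \<in> tangent_space A p \<Longrightarrow> (\<And>w. w \<in> tangent_space A p \<Longrightarrow> g p u w = 0) \<Longrightarrow> u = 0"
  using metric_nondegenerate by simp

lemma g_smooth: "open U \<Longrightarrow> smooth_vf A U X \<Longrightarrow> smooth_vf A U Y \<Longrightarrow> smooth_fun A U (\<lambda>p. g p (X p) (Y p))"
  using metric_smooth by simp

definition cG :: "('m, 'd) chart \<Rightarrow> real ^ 'd \<Rightarrow> real ^ 'd \<Rightarrow> real ^ 'd \<Rightarrow> real" where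
  "cG c y u v = g (chart_inv c y) (coord_vec A c (chart_inv c y) u) (coord_vec A c (chart_inv c y) v)"

text \<open>The Christoffel symbols: components of the covariant derivative of one field with
  constant components along another.\<close>

definition cGam :: "('m, 'd) chart \<Rightarrow> real ^ 'd \<Rightarrow> real ^ 'd \<Rightarrow> real ^ 'd \<Rightarrow> real ^ 'd" where
  "cGam c y u v = coords c (nabla (cfield c (\<lambda>_. u)) (cfield c (\<lambda>_. v))) y"

context
  fixes c assumes c: "c \<in> A"
begin

lemma cfield_simps:
  "cfield c (\<lambda>y. a y + b y) = cfield c a + cfield c b"
  "cfield c (\<lambda>y. f y *\<^sub>R a y) = (\<lambda>q. f (snd c q) *\<^sub>v cfield c a q)"
  by (auto simp: cfield_def fun_eq_iff coord_vec_linear[OF c] vscale_def)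

lemma cfield_const_smooth: "smooth_vf A (fst c) (cfield c (\<lambda>_. u))"
  by (rule smooth_cfield[OF c open_dom[OF c] order_refl smooth_on_const[OF open_img[OF c]]])

context
  fixes U assumes U: "open U" "U \<subseteq> fst c"
begin

lemma smooth_fun_pullback: "smooth_on (snd c ` U) f \<Longrightarrow> smooth_fun A U (\<lambda>q. f (snd c q))"
  unfolding smooth_fun_chart[OF c U]
  by (erule smooth_on_cong[OF _ open_image[OF c U]]) (use U chart_inv_left[OF c] in auto)

lemma cfield_const_smooth': "smooth_vf A U (cfield c (\<lambda>_. u))"
  using cfield_const_smooth smooth_vf_mono U(2) by blast

lemma coords_nabla_scale2:
  assumes X: "smooth_vf A U X" and a: "smooth_on (snd c ` U) a" and f: "smooth_on (snd c ` U) f" and y: "y \<in> snd c ` U"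
  shows "coords c (nabla X (cfield c (\<lambda>y. f y *\<^sub>R a y))) y =
    dd f (coords c X y) y *\<^sub>R a y + f y *\<^sub>R coords c (nabla X (cfield c a)) y"
proof -
  obtain p where p: "p \<in> U" "y = snd c p" using y by auto
  have pc: "p \<in> fst c" and yi: "chart_inv c y = p" using p U chart_inv_left[OF c] by auto
  note F = smooth_fun_pullback[OF f]
  have "X p (\<lambda>q. f (snd c q)) = dd ((\<lambda>q. f (snd c q)) \<circ> chart_inv c) (coords c X y) y"
    using vf_apply_coords[OF c U X F y] yi by simp
  also have "\<dots> = dd f (coords c X y) y"
    by (rule dd_cong[OF open_image[OF c U] y]) (use U chart_inv_left[OF c] in auto)
  finally have "nabla X (cfield c (\<lambda>y. f y *\<^sub>R a y)) p = dd f (coords c X y) y *\<^sub>v cfield c a p + f y *\<^sub>v nabla X (cfield c a) p"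
    unfolding cfield_simps using nabla_scale2[OF U(1) X smooth_cfield[OF c U a] p(1) F] p(2) by simp
  moreover have "cfield c a p = coord_vec A c p (a (snd c p))" using pc by (simp add: cfield_def)
  ultimately show ?thesis
    using pc p(2) by (simp add: coords_def chart_inv_left[OF c] tcoords_simps tcoords_coord_vec[OF c])
qed

lemma coords_nabla_add2:
  assumes X: "smooth_vf A U X" and a: "smooth_on (snd c ` U) a" and b: "smooth_on (snd c ` U) b" and y: "y \<in> snd c ` U"
  shows "coords c (nabla X (cfield c (\<lambda>y. a y + b y))) y = coords c (nabla X (cfield c a)) y + coords c (nabla X (cfield c b)) y"
proof -
  have "chart_inv c y \<in> U" using y U chart_inv_left[OF c] by auto
  then show ?thesis
    unfolding cfield_simps coords_def
    by (simp add: nabla_add2[OF U(1) smooth_cfield[OF c U a] smooth_cfield[OF c U b] _ X] tcoords_simps)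
qed

lemma coords_nabla_scale1:
  assumes X: "smooth_vf A U X" and a: "smooth_on (snd c ` U) a" and f: "smooth_on (snd c ` U) f" and y: "y \<in> snd c ` U"
  shows "coords c (nabla (cfield c (\<lambda>y. f y *\<^sub>R a y)) X) y = f y *\<^sub>R coords c (nabla (cfield c a) X) y"
proof -
  have "chart_inv c y \<in> U" "snd c (chart_inv c y) = y" using y U chart_inv_left[OF c] by auto
  then show ?thesis
    unfolding cfield_simps coords_def
    by (simp add: nabla_scale1[OF U(1) smooth_cfield[OF c U a] X _ smooth_fun_pullback[OF f]] tcoords_simps)
qed

lemma coords_nabla_add1:
  assumes X: "smooth_vf A U X" and a: "smooth_on (snd c ` U) a" and b: "smooth_on (snd c ` U) b" and y: "y \<in> snd c ` U"
  shows "coords c (nabla (cfield c (\<lambda>y. a y + b y)) X) y = coords c (nabla (cfield c a) X) y + coords c (nabla (cfield c b) X) y"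
proof -
  have "chart_inv c y \<in> U" using y U chart_inv_left[OF c] by auto
  then show ?thesis
    unfolding cfield_simps coords_def
    by (simp add: nabla_add1[OF U(1) smooth_cfield[OF c U a] smooth_cfield[OF c U b] _ X] tcoords_simps)
qed

text \<open>The axioms of a connection speak of sums of two fields and of products with functions,
  so the expansion in coordinate fields goes by induction on the set of indices.\<close>

lemma coords_nabla_cfield1:
  assumes X: "smooth_vf A U X" and a: "smooth_on (snd c ` U) a" and y: "y \<in> snd c ` U"
  shows "coords c (nabla (cfield c a) X) y = (\<Sum>i\<in>UNIV. a y $ i *\<^sub>R coords c (nabla (cfield c (\<lambda>_. axis i 1)) X) y)"
proof -
  note o = open_image[OF c U]
  have ai: "smooth_on (snd c ` U) (\<lambda>y. a y $ i)" for i by (rule smooth_on_vec_nth[OF o a])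
  have ax: "smooth_on (snd c ` U) (\<lambda>y. axis i 1 :: real^'d)" for i by (rule smooth_on_const[OF o])
  have zero: "coords c (nabla (cfield c (\<lambda>y. 0)) X) y = 0"
    using coords_nabla_scale1[OF X smooth_on_const[OF o] smooth_on_const[OF o] y, of 0 0] by simp
  have "coords c (nabla (cfield c (\<lambda>y. \<Sum>i\<in>I. a y $ i *\<^sub>R axis i 1)) X) y =
    (\<Sum>i\<in>I. a y $ i *\<^sub>R coords c (nabla (cfield c (\<lambda>_. axis i 1)) X) y)" if "finite I" for I
    using that
  proof (induction I)
    case (insert i I)
    have s1: "smooth_on (snd c ` U) (\<lambda>y. a y $ i *\<^sub>R (axis i 1 :: real^'d))" for i
      by (rule smooth_on_scaleR[OF o ai ax])
    have s2: "smooth_on (snd c ` U) (\<lambda>y. \<Sum>i\<in>I. a y $ i *\<^sub>R (axis i 1 :: real^'d))"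
      by (rule smooth_on_sum[OF o s1])
    show ?case
      using insert coords_nabla_add1[OF X s1 s2 y, of i] coords_nabla_scale1[OF X ax ai y, of i i] by simp
  qed (use zero in simp)
  from this[of UNIV] show ?thesis by (simp add: vec_axis_sum[symmetric])
qed

lemma coords_nabla_cfield2:
  assumes X: "smooth_vf A U X" and a: "smooth_on (snd c ` U) a" and y: "y \<in> snd c ` U"
  shows "coords c (nabla X (cfield c a)) y = dd a (coords c X y) y +
    (\<Sum>i\<in>UNIV. a y $ i *\<^sub>R coords c (nabla X (cfield c (\<lambda>_. axis i 1))) y)"
proof -
  note o = open_image[OF c U]
  have ai: "smooth_on (snd c ` U) (\<lambda>y. a y $ i)" for i by (rule smooth_on_vec_nth[OF o a])
  have ax: "smooth_on (snd c ` U) (\<lambda>y. axis i 1 :: real^'d)" for i by (rule smooth_on_const[OF o])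
  have zero: "coords c (nabla X (cfield c (\<lambda>y. 0))) y = 0"
    using coords_nabla_scale2[OF X smooth_on_const[OF o] smooth_on_const[OF o] y, of 0 0] by (simp add: dd_const)
  have "coords c (nabla X (cfield c (\<lambda>y. \<Sum>i\<in>I. a y $ i *\<^sub>R axis i 1))) y =
    (\<Sum>i\<in>I. dd (\<lambda>y. a y $ i) (coords c X y) y *\<^sub>R axis i 1 + a y $ i *\<^sub>R coords c (nabla X (cfield c (\<lambda>_. axis i 1))) y)"
    if "finite I" for I
    using that
  proof (induction I)
    case (insert i I)
    have s1: "smooth_on (snd c ` U) (\<lambda>y. a y $ i *\<^sub>R (axis i 1 :: real^'d))" for i
      by (rule smooth_on_scaleR[OF o ai ax])
    have s2: "smooth_on (snd c ` U) (\<lambda>y. \<Sum>i\<in>I. a y $ i *\<^sub>R (axis i 1 :: real^'d))"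
      by (rule smooth_on_sum[OF o s1])
    show ?case
      using insert coords_nabla_add2[OF X s1 s2 y, of i] coords_nabla_scale2[OF X ax ai y, of i i] by simp
  qed (use zero in simp)
  from this[of UNIV] show ?thesis
    by (simp add: vec_axis_sum[symmetric] sum.distrib dd_vec_nth[OF a y])
qed

end

lemma cG_inner:
  assumes y: "y \<in> snd c ` fst c"
  shows "indef_inner (cG c y)"
proof -
  define p where "p = chart_inv c y"
  have p: "p \<in> fst c" using chart_inv_in[OF c y] by (simp add: p_def)
  note t = coord_vec_tangent[OF c p]
  show ?thesis
    unfolding indef_inner_def
  proof (intro conjI allI impI)
    show "linear (\<lambda>u. cG c y u v)" for v
      unfolding cG_def p_def[symmetric]
      by (rule linearI) (simp_all add: coord_vec_linear[OF c p] g_add[OF t t t] g_scale[OF t t t])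
    show "cG c y u v = cG c y v u" for u v
      unfolding cG_def p_def[symmetric] by (rule g_sym[OF t t t])
    fix u assume *: "\<forall>v. cG c y u v = 0"
    show "u = 0"
    proof -
      have "coord_vec A c p u = 0"
      proof (rule g_nondegenerate[OF t])
        fix w assume "w \<in> tangent_space A p"
        then show "g p (coord_vec A c p u) w = 0"
          using *[rule_format, of "tcoords c w"] tangent_coords[OF c p] by (simp add: cG_def p_def)
      qed
      then show "u = 0" using tcoords_coord_vec[OF c p, of u] by (simp add: tcoords_simps)
    qed
  qed
qed

lemma cG_coords:
  assumes "p \<in> fst c" "u \<in> tangent_space A p" "v \<in> tangent_space A p"
  shows "g p u v = cG c (snd c p) (tcoords c u) (tcoords c v)"
  using assms by (simp add: cG_def chart_inv_left[OF c] tangent_coords[OF c])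

lemma cG_smooth: "smooth_on (snd c ` fst c) (\<lambda>y. cG c y u v)"
proof -
  have "smooth_fun A (fst c) (\<lambda>p. g p (cfield c (\<lambda>_. u) p) (cfield c (\<lambda>_. v) p))"
    by (rule g_smooth[OF open_dom[OF c] cfield_const_smooth cfield_const_smooth])
  then show ?thesis
    unfolding smooth_fun_chart[OF c open_dom[OF c] order_refl]
    by (rule smooth_on_cong[OF _ open_img[OF c]]) (simp add: cfield_def cG_def chart_inv_in[OF c])
qed

lemma cGam_smooth: "smooth_on (snd c ` fst c) (\<lambda>y. cGam c y u v)"
  unfolding cGam_def
  using smooth_coords[OF c open_dom[OF c] order_refl nabla_smooth[OF open_dom[OF c] cfield_const_smooth cfield_const_smooth]]
  by simp

lemma cGam_linear:
  assumes y: "y \<in> snd c ` fst c"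
  shows "linear (cGam c y u)"
proof (rule linearI)
  note k = smooth_on_const[OF open_img[OF c]]
  show "cGam c y u (v + w) = cGam c y u v + cGam c y u w" for v w
    unfolding cGam_def by (rule coords_nabla_add2[OF open_dom[OF c] order_refl cfield_const_smooth k k y])
  show "cGam c y u (a *\<^sub>R v) = a *\<^sub>R cGam c y u v" for a v
    unfolding cGam_def
    using coords_nabla_scale2[OF open_dom[OF c] order_refl cfield_const_smooth k k y, of u a v] by (simp add: dd_const)
qed

lemma cGam_sym:
  assumes y: "y \<in> snd c ` fst c"
  shows "cGam c y u v = cGam c y v u"
proof -
  define p where "p = chart_inv c y"
  have p: "p \<in> fst c" "snd c p = y" using chart_inv_in[OF c y] chart_inv_right[OF c y] by (auto simp: p_def)
  have k: "dd (coords c (cfield c (\<lambda>_. u))) v y = 0" for u v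
    using dd_cong[OF open_img[OF c] y, of "coords c (cfield c (\<lambda>_. u))" "\<lambda>_. u" v]
      coords_cfield[OF c open_dom[OF c] order_refl] by (simp add: dd_const)
  have "nabla (cfield c (\<lambda>_. u)) (cfield c (\<lambda>_. v)) p - nabla (cfield c (\<lambda>_. v)) (cfield c (\<lambda>_. u)) p = 0"
    unfolding nabla_torsion[OF open_dom[OF c] cfield_const_smooth cfield_const_smooth p(1)]
      lie_bracket_coords[OF c open_dom[OF c] order_refl cfield_const_smooth cfield_const_smooth p(1)]
    by (simp add: p k coord_vec_linear[OF c p(1)])
  then show ?thesis by (simp add: cGam_def coords_def p_def)
qed

lemma cGam_compat:
  assumes y: "y \<in> snd c ` fst c"
  shows "dd (\<lambda>z. cG c z u v) w y = cG c y (cGam c y w u) v + cG c y u (cGam c y w v)"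
proof -
  define p where "p = chart_inv c y"
  have p: "p \<in> fst c" "snd c p = y" using chart_inv_in[OF c y] chart_inv_right[OF c y] by (auto simp: p_def)
  let ?u = "cfield c (\<lambda>_. u)" and ?v = "cfield c (\<lambda>_. v)" and ?w = "cfield c (\<lambda>_. w)"
  note sm = cfield_const_smooth
  have t: "nabla ?w X p \<in> tangent_space A p" if "smooth_vf A (fst c) X" for X
    by (rule smooth_vf_tangent[OF nabla_smooth[OF open_dom[OF c] sm that] p(1)])
  have "dd (\<lambda>z. cG c z u v) w y = dd ((\<lambda>q. g q (?u q) (?v q)) \<circ> chart_inv c) (coords c ?w y) y"
    unfolding coords_cfield[OF c open_dom[OF c] order_refl y]
    by (rule dd_cong[OF open_img[OF c] y]) (simp add: cfield_def cG_def chart_inv_in[OF c])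
  also have "\<dots> = ?w p (\<lambda>q. g q (?u q) (?v q))"
    using vf_apply_coords[OF c open_dom[OF c] order_refl sm g_smooth[OF open_dom[OF c] sm sm] y] by (simp add: p_def)
  also have "\<dots> = g p (nabla ?w ?u p) (?v p) + g p (?u p) (nabla ?w ?v p)"
    by (rule nabla_metric[OF open_dom[OF c] sm sm p(1) sm])
  finally show ?thesis
    using p t[OF sm] coord_vec_tangent[OF c p(1)]
    by (simp add: cG_coords[OF p(1)] cfield_def tcoords_coord_vec[OF c p(1)] cGam_def coords_def p_def[symmetric])
qed

text \<open>The bridge from the abstract connection to the tensor calculus on an open set: every
  chart yields an instance of that locale.\<close>

lemma coord_metric: "coord_metric (snd c ` fst c) (cG c) (cGam c)"
  by (rule coord_metric.intro)
    (assumption | rule open_img[OF c] cG_inner cG_smooth cGam_smooth cGam_linear cGam_sym cGam_compat)+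

interpretation C: coord_metric "snd c ` fst c" "cG c" "cGam c"
  by (rule coord_metric)

lemma coords_nabla:
  assumes U: "open U" "U \<subseteq> fst c" and X: "smooth_vf A U X" and Y: "smooth_vf A U Y" and y: "y \<in> snd c ` U"
  shows "coords c (nabla X Y) y = C.nab (coords c X) (coords c Y) y"
proof -
  have yc: "y \<in> snd c ` fst c" and pU: "chart_inv c y \<in> U" using y U chart_inv_left[OF c] by auto
  note sX = smooth_coords[OF c U X] and sY = smooth_coords[OF c U Y]
  note k = smooth_on_const[OF open_image[OF c U]]
  have X': "smooth_vf A U (cfield c (coords c X))" by (rule smooth_cfield[OF c U sX])
  have K: "coords c (nabla (cfield c (coords c X)) (cfield c (\<lambda>_. w))) y = cGam c y (coords c X y) w" for w
    unfolding coords_nabla_cfield1[OF U cfield_const_smooth'[OF U] sX y] cGam_def[symmetric]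
    by (rule linear_axis_sum[OF C.Gam_linear1[OF yc], symmetric])
  \<comment> \<open>The fields rebuilt from components agree with \<open>X\<close> and
    \<open>Y\<close> only on \<open>U\<close>; locality of the connection permits the
    replacement.\<close>
  have "coords c (nabla X Y) y = coords c (nabla (cfield c (coords c X)) (cfield c (coords c Y))) y"
    by (rule coords_eqI, rule nabla_cong[OF U(1) X Y _ _ pU]) (simp_all add: cfield_coords[OF c U] X Y)
  also have "\<dots> = dd (coords c Y) (coords c X y) y +
    (\<Sum>i\<in>UNIV. coords c Y y $ i *\<^sub>R cGam c y (coords c X y) (axis i 1))"
    unfolding coords_nabla_cfield2[OF U X' sY y] K coords_cfield[OF c U yc] ..
  also have "(\<Sum>i\<in>UNIV. coords c Y y $ i *\<^sub>R cGam c y (coords c X y) (axis i 1)) = cGam c y (coords c X y) (coords c Y y)"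
    by (rule linear_axis_sum[OF cGam_linear[OF yc], symmetric])
  finally show ?thesis by (simp add: C.nab_def)
qed

lemma coords_lie_bracket:
  assumes U: "open U" "U \<subseteq> fst c" and X: "smooth_vf A U X" and Y: "smooth_vf A U Y" and y: "y \<in> snd c ` U"
  shows "coords c (lie_bracket A X Y) y = C.bracket (coords c X) (coords c Y) y"
proof -
  obtain p where p: "p \<in> U" "y = snd c p" using y by auto
  then show ?thesis
    using lie_bracket_coords[OF c U X Y p(1)] U chart_inv_left[OF c]
    by (auto simp: coords_def[of c "lie_bracket A X Y"] C.bracket_def tcoords_coord_vec[OF c])
qed

lemma lie_bracket_smooth:
  assumes U: "open U" "U \<subseteq> fst c" and X: "smooth_vf A U X" and Y: "smooth_vf A U Y"
  shows "smooth_vf A U (lie_bracket A X Y)"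
  unfolding smooth_vf_chart[OF c U]
proof
  show "\<forall>p\<in>U. lie_bracket A X Y p \<in> tangent_space A p"
    using lie_bracket_coords[OF c U X Y] coord_vec_tangent[OF c] U by auto
  have "snd c ` U \<subseteq> snd c ` fst c" using U by auto
  from C.smooth_on_bracket[OF open_image[OF c U] this smooth_coords[OF c U X] smooth_coords[OF c U Y]]
  show "smooth_on (snd c ` U) (coords c (lie_bracket A X Y))"
    by (rule smooth_on_cong[OF _ open_image[OF c U]]) (rule coords_lie_bracket[OF U X Y, symmetric])
qed

context
  fixes p assumes p: "p \<in> fst c"
begin

lemma tangent_tcoords_eqI: "v \<in> tangent_space A p \<Longrightarrow> tcoords c v = w \<Longrightarrow> v = coord_vec A c p w"
  using tangent_coords[OF c p, of v] by simp

lemma tcoords_coords: "tcoords c (X p) = coords c X (snd c p)"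
  by (simp add: coords_def chart_inv_left[OF c p])

lemma riemann_coords:
  "riemann A nabla p (coord_vec A c p u) (coord_vec A c p v) (coord_vec A c p w) =
    coord_vec A c p (C.curv (snd c p) u v w)"
  unfolding riemann_def
proof (rule tensor_at3_eqI[OF c p])
  fix X Y Z U
  assume U: "open U" "p \<in> U" "U \<subseteq> fst c" and X: "smooth_vf A U X" and Y: "smooth_vf A U Y" and Z: "smooth_vf A U Z"
    and eq: "X p = coord_vec A c p u" "Y p = coord_vec A c p v" "Z p = coord_vec A c p w"
  have y: "snd c p \<in> snd c ` U" using U by auto
  have sub: "snd c ` U \<subseteq> snd c ` fst c" using U by auto
  note o = open_image[OF c U(1,3)]
  note YZ = nabla_smooth[OF U(1) Y Z] and XZ = nabla_smooth[OF U(1) X Z] and XY = lie_bracket_smooth[OF U(1,3) X Y]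
  note n = coords_nabla[OF U(1,3)]
  have "tcoords c (nabla X (nabla Y Z) p - nabla Y (nabla X Z) p - nabla (lie_bracket A X Y) Z p) =
    C.nab (coords c X) (C.nab (coords c Y) (coords c Z)) (snd c p) - C.nab (coords c Y) (C.nab (coords c X) (coords c Z)) (snd c p)
    - C.nab (C.bracket (coords c X) (coords c Y)) (coords c Z) (snd c p)"
    unfolding tcoords_simps tcoords_coords n[OF X YZ y] n[OF Y XZ y] n[OF XY Z y]
    using C.nab_cong(1)[OF o y refl n[OF Y Z]] C.nab_cong(1)[OF o y refl n[OF X Z]]
      C.nab_cong(1)[OF o y coords_lie_bracket[OF U(1,3) X Y] refl] by simp
  also have "\<dots> = C.curv (snd c p) u v w"
    unfolding C.curv_nab[OF o sub smooth_coords[OF c U(1,3) X] smooth_coords[OF c U(1,3) Y] smooth_coords[OF c U(1,3) Z] y]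
    by (simp add: tcoords_coords[symmetric] eq tcoords_coord_vec[OF c p])
  finally show "nabla X (nabla Y Z) p - nabla Y (nabla X Z) p - nabla (lie_bracket A X Y) Z p =
    coord_vec A c p (C.curv (snd c p) u v w)"
    by (rule tangent_tcoords_eqI[rotated])
      (intro tangent_closed smooth_vf_tangent[OF nabla_smooth[OF U(1)] U(2)] X Y Z XY YZ XZ)
qed (rule coord_vec_tangent[OF c p])+

lemma lie_deriv_connection_coords:
  assumes V: "smooth_vf A UNIV V"
  shows "lie_deriv_connection A nabla V p (coord_vec A c p u) (coord_vec A c p v) =
    coord_vec A c p (C.curv (snd c p) (tcoords c (V p)) u v + C.covd (C.grad (coords c V)) (snd c p) u v)"
  unfolding lie_deriv_connection_def
proof (rule tensor_at2_eqI[OF c p])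
  fix X Y U
  assume U: "open U" "p \<in> U" "U \<subseteq> fst c" and X: "smooth_vf A U X" and Y: "smooth_vf A U Y"
    and eq: "X p = coord_vec A c p u" "Y p = coord_vec A c p v"
  have y: "snd c p \<in> snd c ` U" using U by auto
  have sub: "snd c ` U \<subseteq> snd c ` fst c" using U by auto
  have VU: "smooth_vf A U V" and VN: "smooth_vf A (fst c) V" using smooth_vf_mono[OF V] by auto
  note o = open_image[OF c U(1,3)]
  note XY = nabla_smooth[OF U(1) X Y] and VX = lie_bracket_smooth[OF U(1,3) VU X] and VY = lie_bracket_smooth[OF U(1,3) VU Y]
  note VXY = lie_bracket_smooth[OF U(1,3) VU XY]
  note n = coords_nabla[OF U(1,3)] and l = coords_lie_bracket[OF U(1,3)]
  have "tcoords c (lie_bracket A V (nabla X Y) p - nabla (lie_bracket A V X) Y p - nabla X (lie_bracket A V Y) p) =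
    C.bracket (coords c V) (C.nab (coords c X) (coords c Y)) (snd c p) - C.nab (C.bracket (coords c V) (coords c X)) (coords c Y) (snd c p)
    - C.nab (coords c X) (C.bracket (coords c V) (coords c Y)) (snd c p)"
    unfolding tcoords_simps tcoords_coords l[OF VU XY y] n[OF VX Y y] n[OF X VY y]
    using C.nab_cong(2)[OF o y refl n[OF X Y]] C.nab_cong(1)[OF o y l[OF VU X] refl]
      C.nab_cong(1)[OF o y refl l[OF VU Y]] by simp
  also have "\<dots> = C.curv (snd c p) (tcoords c (V p)) u v + C.covd (C.grad (coords c V)) (snd c p) u v"
    unfolding C.lie_derivative_nab[OF smooth_coords[OF c open_dom[OF c] order_refl VN] o sub
        smooth_coords[OF c U(1,3) X] smooth_coords[OF c U(1,3) Y] y]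
    by (simp add: tcoords_coords[symmetric] eq tcoords_coord_vec[OF c p])
  finally show "lie_bracket A V (nabla X Y) p - nabla (lie_bracket A V X) Y p - nabla X (lie_bracket A V Y) p =
    coord_vec A c p (C.curv (snd c p) (tcoords c (V p)) u v + C.covd (C.grad (coords c V)) (snd c p) u v)"
    by (rule tangent_tcoords_eqI[rotated])
      (intro tangent_closed smooth_vf_tangent[OF nabla_smooth[OF U(1)] U(2)] smooth_vf_tangent[OF VXY U(2)] X Y VX VY)
qed (rule coord_vec_tangent[OF c p])+

lemma cov_deriv_at_coords:
  assumes V: "smooth_vf A UNIV V"
  shows "cov_deriv_at A nabla V p (coord_vec A c p u) = coord_vec A c p (C.grad (coords c V) (snd c p) u)"
  unfolding cov_deriv_at_def
proof (rule tensor_at1_eqI[OF c p])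
  fix X U
  assume U: "open U" "p \<in> U" "U \<subseteq> fst c" and X: "smooth_vf A U X" and eq: "X p = coord_vec A c p u"
  have y: "snd c p \<in> snd c ` U" using U by auto
  have VU: "smooth_vf A U V" using smooth_vf_mono[OF V] by auto
  have "tcoords c (nabla X V p) = C.grad (coords c V) (snd c p) u"
    unfolding tcoords_coords coords_nabla[OF U(1,3) X VU y]
    by (simp add: C.nab_def C.grad_def tcoords_coords[symmetric] eq tcoords_coord_vec[OF c p])
  then show "nabla X V p = coord_vec A c p (C.grad (coords c V) (snd c p) u)"
    by (rule tangent_tcoords_eqI[rotated]) (rule smooth_vf_tangent[OF nabla_smooth[OF U(1) X VU] U(2)])
qed (rule coord_vec_tangent[OF c p])

end

end

text \<open>The definition takes the trace in a chosen chart \<open>d\<close>. The coordinate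
  changes \<open>J\<close> and \<open>J'\<close> between \<open>d\<close> and \<open>c\<close>
  satisfy \<open>J (J' v) = v\<close>, so cyclicity of the trace moves it to
  \<open>c\<close>.\<close>

lemma endo_trace_chart:
  assumes c: "c \<in> A" "p \<in> fst c"
    and L: "\<And>v. v \<in> tangent_space A p \<Longrightarrow> L v \<in> tangent_space A p"
    and lin: "linear (\<lambda>u. tcoords c (L (coord_vec A c p u)))"
  shows "endo_trace A p L = tr (\<lambda>u. tcoords c (L (coord_vec A c p u)))"
proof -
  define d where "d = (SOME c. c \<in> A \<and> p \<in> fst c)"
  have "d \<in> A \<and> p \<in> fst d"
    unfolding d_def by (rule someI[of _ c]) (use c in simp)
  then have d: "d \<in> A" "p \<in> fst d" by auto
  define J where "J v = tcoords c (coord_vec A d p v)" for v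
  define J' where "J' v = tcoords d (coord_vec A c p v)" for v
  have linJ: "linear J" "linear J'"
    unfolding J_def J'_def
    by (auto intro!: linearI simp: coord_vec_linear[OF c(1), OF c(2)] coord_vec_linear[OF d(1), OF d(2)] tcoords_simps)
  have JJ': "J (J' v) = v" for v
    unfolding J_def J'_def using tangent_coords[OF d(1), OF d(2) coord_vec_tangent[OF c(1), OF c(2)]]
    by (simp add: tcoords_coord_vec[OF c(1), OF c(2)])
  have M: "tcoords d (L (coord_vec A d p u)) = J' (tcoords c (L (coord_vec A c p (J u))))" for u
    unfolding J_def J'_def
    by (simp add: tangent_coords[OF c(1), OF c(2)] coord_vec_tangent[OF d(1), OF d(2)] L)
  have "endo_trace A p L = tr (\<lambda>u. tcoords d (L (coord_vec A d p u)))"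
    by (simp add: endo_trace_def Let_def d_def[symmetric] tr_def tcoords_def)
  also have "\<dots> = tr (\<lambda>u. (\<lambda>u. tcoords c (L (coord_vec A c p (J u)))) (J' u))"
    unfolding M by (rule tr_comp_commute[OF linJ(2)])
      (use linear_compose[OF linJ(1) lin] in \<open>simp add: o_def\<close>)
  finally show ?thesis by (simp add: JJ')
qed

text \<open>The frame behind \<open>metric_trace\<close> is chosen independently of
  \<open>B\<close>, so one frame serves all bilinear forms at the point. Existence of
  pseudo-orthonormal frames is what gives the choice its properties.\<close>

lemma metric_trace_frame:
  assumes c: "c \<in> A" "p \<in> fst c"
  obtains E where "indef_inner.orthonormal (cG c (snd c p)) E"
    "\<And>B. metric_trace A g p B = (\<Sum>i\<in>UNIV. cG c (snd c p) (E i) (E i) * B (coord_vec A c p (E i)) (coord_vec A c p (E i)))"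
proof -
  interpret G: indef_inner "cG c (snd c p)" by (rule cG_inner[OF c(1)]) (use c in auto)
  have on: "pseudo_orthonormal A g p E \<longleftrightarrow> (\<forall>i. E i \<in> tangent_space A p) \<and> G.orthonormal (\<lambda>i. tcoords c (E i))" for E
    unfolding pseudo_orthonormal_def G.orthonormal_def using cG_coords[OF c] by auto
  obtain E0 where "G.orthonormal E0" using G.orthonormal_exists by blast
  then have "pseudo_orthonormal A g p (\<lambda>i. coord_vec A c p (E0 i))"
    unfolding on by (simp add: coord_vec_tangent[OF c(1), OF c(2)] tcoords_coord_vec[OF c(1), OF c(2)])
  then have E: "pseudo_orthonormal A g p (SOME E. pseudo_orthonormal A g p E)"
    by (rule someI[of "pseudo_orthonormal A g p"])
  define E where "E = (SOME E. pseudo_orthonormal A g p E)"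
  have "pseudo_orthonormal A g p E" using E by (simp only: E_def)
  then have E': "E i \<in> tangent_space A p" "G.orthonormal (\<lambda>i. tcoords c (E i))" for i
    unfolding on by auto
  show ?thesis
  proof (rule that[OF E'(2)])
    show "metric_trace A g p B = (\<Sum>i\<in>UNIV. cG c (snd c p) (tcoords c (E i)) (tcoords c (E i)) *
        B (coord_vec A c p (tcoords c (E i))) (coord_vec A c p (tcoords c (E i))))" for B
      by (simp add: metric_trace_def Let_def E_def[symmetric] cG_coords[OF c E'(1) E'(1)] tangent_coords[OF c(1), OF c(2) E'(1)])
  qed
qed

lemma metric_trace_chart:
  assumes c: "c \<in> A" "p \<in> fst c"
    and B: "\<And>v. linear (\<lambda>u. B (coord_vec A c p u) (coord_vec A c p v))" "\<And>u. linear (\<lambda>v. B (coord_vec A c p u) (coord_vec A c p v))"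
  shows "metric_trace A g p B = (\<Sum>j\<in>UNIV. B (coord_vec A c p (indef_inner.dual (cG c (snd c p)) j)) (coord_vec A c p (axis j 1)))"
proof -
  interpret G: indef_inner "cG c (snd c p)" by (rule cG_inner[OF c(1)]) (use c in auto)
  obtain E where E: "G.orthonormal E"
    "\<And>B. metric_trace A g p B = (\<Sum>i\<in>UNIV. cG c (snd c p) (E i) (E i) * B (coord_vec A c p (E i)) (coord_vec A c p (E i)))"
    by (rule metric_trace_frame[OF c]) blast
  show ?thesis unfolding E(2)
    by (rule G.metric_trace_dual[OF E(1), of "\<lambda>u v. B (coord_vec A c p u) (coord_vec A c p v)", OF B])
qed

lemma riemann_tangent:
  assumes "u \<in> tangent_space A p" "v \<in> tangent_space A p" "w \<in> tangent_space A p"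
  shows "riemann A nabla p u v w \<in> tangent_space A p"
proof -
  obtain c where c: "c \<in> A" "p \<in> fst c" using ex_chart by blast
  show ?thesis
    using riemann_coords[OF c, of "tcoords c u" "tcoords c v" "tcoords c w"] assms
    by (simp add: tangent_coords[OF c(1), OF c(2)] coord_vec_tangent[OF c(1), OF c(2)])
qed

lemma ricci_coords:
  assumes c: "c \<in> A" "p \<in> fst c"
  shows "ricci A nabla p (coord_vec A c p v) (coord_vec A c p w) = coord_metric.ric (cGam c) (snd c p) v w"
proof -
  interpret C: coord_metric "snd c ` fst c" "cG c" "cGam c" by (rule coord_metric[OF c(1)])
  have y: "snd c p \<in> snd c ` fst c" using c by auto
  have *: "tcoords c (riemann A nabla p (coord_vec A c p u) (coord_vec A c p v) (coord_vec A c p w)) = C.curv (snd c p) u v w" for u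
    by (simp add: riemann_coords[OF c] tcoords_coord_vec[OF c(1), OF c(2)])
  show ?thesis
    unfolding ricci_def C.ric_def
    by (subst endo_trace_chart[OF c])
      (use riemann_tangent coord_vec_tangent[OF c(1), OF c(2)] C.curv_linear(1)[OF y] in \<open>auto simp: *\<close>)
qed

text \<open>Nondegeneracy of the metric makes the described vector unique, and the metric duals of
  the coordinate forms produce it.\<close>

lemma ricci_operator_eq_iff:
  assumes v: "v \<in> tangent_space A p" and u: "u \<in> tangent_space A p"
  shows "ricci_operator A g nabla p v = u \<longleftrightarrow> (\<forall>w\<in>tangent_space A p. g p u w = ricci A nabla p v w)"
proof -
  obtain c where c: "c \<in> A" "p \<in> fst c" using ex_chart by blast
  interpret C: coord_metric "snd c ` fst c" "cG c" "cGam c" by (rule coord_metric[OF c(1)])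
  have y: "snd c p \<in> snd c ` fst c" using c by auto
  interpret G: indef_inner "cG c (snd c p)" by (rule cG_inner[OF c(1) y])
  let ?P = "\<lambda>u. u \<in> tangent_space A p \<and> (\<forall>w\<in>tangent_space A p. g p u w = ricci A nabla p v w)"
  have unique: "u1 = u2" if "?P u1" "?P u2" for u1 u2
  proof (rule tangent_eqI[OF c(1), OF c(2)])
    show "tcoords c u1 = tcoords c u2"
    proof (rule G.eqI)
      fix w
      show "cG c (snd c p) (tcoords c u1) w = cG c (snd c p) (tcoords c u2) w"
        using that cG_coords[OF c, of u1 "coord_vec A c p w"] cG_coords[OF c, of u2 "coord_vec A c p w"]
        by (simp add: coord_vec_tangent[OF c(1), OF c(2)] tcoords_coord_vec[OF c(1), OF c(2)])
    qed
  qed (use that in auto)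
  have "linear (C.ric (snd c p) (tcoords c v))"
    unfolding C.ric_def
    by (auto intro!: linearI simp: tr_add[symmetric] tr_scaleR[symmetric] linear_add[OF C.curv_linear(3)[OF y]] linear_scale[OF C.curv_linear(3)[OF y]])
  note rep = G.representation[OF this]
  define u0 where "u0 = coord_vec A c p (\<Sum>j\<in>UNIV. C.ric (snd c p) (tcoords c v) (axis j 1) *\<^sub>R G.dual j)"
  have ex: "?P u0"
  proof (intro conjI ballI)
    show t: "u0 \<in> tangent_space A p" by (simp add: u0_def coord_vec_tangent[OF c(1), OF c(2)])
    fix w assume w: "w \<in> tangent_space A p"
    have "g p u0 w = C.ric (snd c p) (tcoords c v) (tcoords c w)"
      unfolding cG_coords[OF c t w] by (simp add: u0_def tcoords_coord_vec[OF c(1), OF c(2)] rep)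
    then show "g p u0 w = ricci A nabla p v w"
      using ricci_coords[OF c, of "tcoords c v" "tcoords c w"] v w by (simp add: tangent_coords[OF c(1), OF c(2)])
  qed
  have "(THE u. ?P u) = u0" by (rule the_equality) (use ex unique in blast)+
  then have "ricci_operator A g nabla p v = u0" by (simp add: ricci_operator_def)
  then show ?thesis using ex unique u by blast
qed

end

section \<open>The divergence theorem\<close>

lemma integrable_continuous_compact_support:
  fixes f :: "'a::{t2_space, second_countable_topology} \<Rightarrow> real"
  assumes "sets M = sets borel" and f: "continuous_on UNIV f" and K: "compact K" "emeasure M K < \<infinity>"
    and zero: "\<And>x. x \<notin> K \<Longrightarrow> f x = 0"
  shows "integrable M f"
proof -
  have "bounded (f ` K)" using compact_continuous_image[OF continuous_on_subset[OF f] K(1)] compact_imp_bounded by auto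
  then obtain B where B: "\<And>x. x \<in> K \<Longrightarrow> norm (f x) \<le> B" unfolding bounded_iff by auto
  show ?thesis
  proof (rule integrableI_bounded_set)
    show "K \<in> sets M" using K(1) assms(1) by (simp add: borel_compact)
    show "f \<in> borel_measurable M"
      using borel_measurable_continuous_onI[OF f] measurable_cong_sets[OF assms(1) refl] by blast
    show "emeasure M K < \<infinity>" by (rule K(2))
    show "AE x in M. x \<in> K \<longrightarrow> norm (f x) \<le> B" "AE x in M. x \<notin> K \<longrightarrow> f x = 0"
      using B zero by auto
  qed
qed

lemma dd_zero_outside:
  fixes h :: "'a::euclidean_space \<Rightarrow> 'b::real_normed_vector"
  assumes "closed K" "\<And>x. x \<notin> K \<Longrightarrow> h x = 0" "y \<notin> K"
  shows "dd h v y = 0"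
  using dd_cong[of "- K" y h "\<lambda>_. 0" v] assms by (auto simp: dd_const)

text \<open>Lebesgue measure is translation invariant, so each difference quotient
  \<open>q n\<close> in direction \<open>v\<close> has integral 0. The quotients are bounded by a
  bound for the derivative and supported in one bounded set; dominated convergence passes to the
  derivative.\<close>

lemma
  fixes h :: "'a::euclidean_space \<Rightarrow> real"
  assumes h: "smooth_on UNIV h" and K: "compact K" and zero: "\<And>x. x \<notin> K \<Longrightarrow> h x = 0"
  shows integrable_dd_compact_support: "integrable lborel (dd h v)"
    and integral_dd_compact_support: "integral\<^sup>L lborel (dd h v) = 0"
proof -
  have dd0: "dd h v y = 0" if "y \<notin> K" for y
    by (rule dd_zero_outside[OF compact_imp_closed[OF K] zero that])
  have cd: "continuous_on UNIV (dd h v)" by (rule smooth_on_continuous[OF smooth_on_dd[OF h]])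
  have ch: "continuous_on UNIV h" by (rule smooth_on_continuous[OF h])
  have fin: "emeasure lborel K < \<infinity>" using K emeasure_compact_finite by blast
  show "integrable lborel (dd h v)"
    by (rule integrable_continuous_compact_support[OF _ cd K fin dd0]) auto
  have ih: "integrable lborel h"
    by (rule integrable_continuous_compact_support[OF _ ch K fin zero]) auto
  have "bounded (dd h v ` K)" using compact_continuous_image[OF continuous_on_subset[OF cd] K] compact_imp_bounded by auto
  then obtain B0 where B0: "\<And>x. x \<in> K \<Longrightarrow> norm (dd h v x) \<le> B0" unfolding bounded_iff by auto
  define B where "B = max B0 0"
  have B: "\<bar>dd h v y\<bar> \<le> B" for y
    using B0[of y] dd0[of y] unfolding B_def by (cases "y \<in> K") auto
  obtain R where R: "\<And>x. x \<in> K \<Longrightarrow> norm x \<le> R" using compact_imp_bounded[OF K] unfolding bounded_iff by auto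
  \<comment> \<open>The steps \<open>s n\<close> are at most 1, so this ball contains
    \<open>K\<close> and all the translates of \<open>K\<close> that occur in the quotients.\<close>
  define C where "C = cball (0::'a) (R + norm v)"
  define s where "s n = 1 / real (Suc n)" for n
  have s: "0 < s n" "s n \<le> 1" for n by (auto simp: s_def)
  define q where "q n y = (h (y + s n *\<^sub>R v) - h y) / s n" for n y
  have mvt: "\<bar>q n y\<bar> \<le> B" for n y
  proof -
    have "((\<lambda>t. h (y + t *\<^sub>R v)) has_real_derivative dd h v (y + t *\<^sub>R v)) (at t)" for t
      by (rule dd_line_real[OF h]) simp
    then obtain t where "h (y + s n *\<^sub>R v) - h (y + 0 *\<^sub>R v) = (s n - 0) * dd h v (y + t *\<^sub>R v)"
      using MVT2[OF s(1)[of n], of "\<lambda>t. h (y + t *\<^sub>R v)" "\<lambda>t. dd h v (y + t *\<^sub>R v)"] by blast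
    then have "q n y = dd h v (y + t *\<^sub>R v)" using s(1)[of n] by (simp add: q_def)
    then show ?thesis using B by simp
  qed
  have q0: "q n y = 0" if "y \<notin> C" for n y
  proof -
    have "norm y > R + norm v" using that by (simp add: C_def)
    then have 1: "y \<notin> K" using R[of y] norm_ge_zero[of v] by auto
    have "norm y \<le> norm (y + s n *\<^sub>R v) + norm (s n *\<^sub>R v)"
      using norm_triangle_ineq4[of "y + s n *\<^sub>R v" "s n *\<^sub>R v"] by simp
    also have "norm (s n *\<^sub>R v) \<le> norm v" using s[of n] by (simp add: mult_left_le_one_le)
    finally have "norm (y + s n *\<^sub>R v) > R" using \<open>norm y > R + norm v\<close> by simp
    then have "y + s n *\<^sub>R v \<notin> K" using R by force
    then show ?thesis using 1 zero by (simp add: q_def)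
  qed
  have iq: "integral\<^sup>L lborel (q n) = 0" for n
  proof -
    have "integral\<^sup>L lborel h = integral\<^sup>L (distr lborel borel ((+) (s n *\<^sub>R v))) h"
      by (simp add: lborel_distr_plus)
    also have "\<dots> = integral\<^sup>L lborel (\<lambda>y. h (s n *\<^sub>R v + y))"
      by (rule integral_distr) (use borel_measurable_integrable[OF ih] in auto)
    finally have 1: "integral\<^sup>L lborel (\<lambda>y. h (y + s n *\<^sub>R v)) = integral\<^sup>L lborel h" by (simp add: add.commute)
    have ct: "continuous_on UNIV (\<lambda>y. h (y + s n *\<^sub>R v))"
      by (rule continuous_on_compose2[OF ch]) (auto intro!: continuous_intros)
    have cK: "compact ((\<lambda>y. y - s n *\<^sub>R v) ` K)"
      by (rule compact_continuous_image[OF _ K]) (auto intro!: continuous_intros)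
    have "integrable lborel (\<lambda>y. h (y + s n *\<^sub>R v))"
    proof (rule integrable_continuous_compact_support[OF _ ct cK])
      show "emeasure lborel ((\<lambda>y. y - s n *\<^sub>R v) ` K) < \<infinity>"
        using cK emeasure_compact_finite by blast
      show "h (x + s n *\<^sub>R v) = 0" if "x \<notin> (\<lambda>y. y - s n *\<^sub>R v) ` K" for x
        by (rule zero) (use that in force)
    qed auto
    then show ?thesis unfolding q_def using 1 ih by simp
  qed
  have "(\<lambda>n. integral\<^sup>L lborel (q n)) \<longlonglongrightarrow> integral\<^sup>L lborel (dd h v)"
  proof (rule integral_dominated_convergence[where w = "\<lambda>y. B * indicator C y"])
    show "dd h v \<in> borel_measurable lborel" using borel_measurable_continuous_onI[OF cd] by simp
    show "q n \<in> borel_measurable lborel" for n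
      unfolding q_def using borel_measurable_continuous_onI[OF ch] by (simp add: measurable_compose_rev)
    show "integrable lborel (\<lambda>y. B * indicator C y)"
      by (intro integrable_mult_right integrable_real_indicator) (use emeasure_compact_finite[of C] in \<open>auto simp: C_def\<close>)
    show "AE y in lborel. norm (q n y) \<le> B * indicator C y" for n
      using mvt[of n] q0[of _ n] by (auto simp: indicator_def)
    have "(\<lambda>n. q n y) \<longlonglongrightarrow> dd h v y" for y
    proof -
      have "((\<lambda>t. h (y + t *\<^sub>R v)) has_real_derivative dd h v (y + 0 *\<^sub>R v)) (at 0)"
        by (rule dd_line_real[OF h]) simp
      then have "((\<lambda>t. (h (y + t *\<^sub>R v) - h y) / t) \<longlongrightarrow> dd h v y) (at 0)"
        by (simp add: DERIV_def)
      moreover have "filterlim s (at 0) sequentially"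
        unfolding filterlim_at using s LIMSEQ_Suc[OF lim_1_over_n] by (auto simp: s_def[abs_def] less_le eventually_sequentially)
      ultimately show ?thesis unfolding q_def by (rule filterlim_compose)
    qed
    then show "AE y in lborel. (\<lambda>n. q n y) \<longlonglongrightarrow> dd h v y" by auto
  qed
  then show "integral\<^sup>L lborel (dd h v) = 0"
    unfolding iq using LIMSEQ_unique tendsto_const by metis
qed

text \<open>A form of the density that is visibly smooth wherever the determinant is nonzero, and
  can be differentiated without distinguishing its sign.\<close>

lemma sqrt_abs_powr: "sqrt \<bar>t\<bar> = (t\<^sup>2) powr (1/4)"
proof (cases "t = 0")
  case False
  have "(t\<^sup>2) powr (1/4) = (\<bar>t\<bar> powr 2) powr (1/4)" using False by simp
  also have "\<dots> = \<bar>t\<bar> powr (1/2)" by (simp only: powr_powr) simp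
  finally show ?thesis by (simp add: powr_half_sqrt)
qed auto

context coord_metric
begin

definition rho :: "real ^ 'd \<Rightarrow> real" where
  "rho y = sqrt \<bar>det (gram (G y))\<bar>"

lemma rho_pos: "y \<in> N \<Longrightarrow> rho y > 0"
  unfolding rho_def using indef_inner.det_gram_nonzero[OF G_inner] by simp

lemma rho_smooth: "smooth_on N rho"
proof -
  have d: "smooth_on N (\<lambda>y. det (gram (G y)))"
    by (rule smooth_on_det[OF open_N]) (simp add: gram_def G_smooth)
  have "smooth_on N (\<lambda>y. ((det (gram (G y)))\<^sup>2) powr (1/4))"
  proof (rule smooth_on_powr[OF open_N])
    show "smooth_on N (\<lambda>y. (det (gram (G y)))\<^sup>2)"
      unfolding power2_eq_square by (rule smooth_on_mult[OF open_N d d])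
    show "(det (gram (G y)))\<^sup>2 > 0" if "y \<in> N" for y
      using indef_inner.det_gram_nonzero[OF G_inner[OF that]] by simp
  qed
  then show ?thesis unfolding rho_def[abs_def] sqrt_abs_powr .
qed

text \<open>\<open>\<Gamma>\<^sup>i\<^sub>i\<^sub>k = \<partial>\<^sub>k log \<surd>|det g|\<close>\<close>
lemma dd_rho:
  assumes y: "y \<in> N"
  shows "dd rho v y = rho y * tr (Gam y v)"
proof -
  interpret G: indef_inner "G y" by (rule G_inner[OF y])
  define M where "M = gram (G y)"
  have Mij: "M $ i $ j = G y (axis i 1) (axis j 1)" for i j by (simp add: M_def gram_def)
  define C where "C v = (\<chi> i k. Gam y v (axis i 1) $ k)" for v
  have "det M \<noteq> 0" by (simp add: M_def G.det_gram_nonzero)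
  then obtain M' where M': "M' ** M = mat 1" "M ** M' = mat 1"
    using invertible_det_nz[of M] unfolding invertible_def by blast
  \<comment> \<open>By metric compatibility the Gram matrix has derivative
    \<open>C M + M C^T\<close>. Writing this as \<open>C2 M\<close> fits the determinant formula,
    and since conjugation by \<open>M\<close> preserves the trace, \<open>C2\<close> has twice the
    trace of \<open>C\<close>.\<close>
  define C2 where "C2 v = C v + (M ** transpose (C v)) ** M'" for v
  have tr: "trace (C2 v) = 2 * tr (Gam y v)" for v
  proof -
    have "trace ((M ** transpose (C v)) ** M') = trace (M' ** (M ** transpose (C v)))" by (rule trace_mul_sym)
    also have "\<dots> = trace (transpose (C v))" by (simp add: matrix_mul_assoc M')
    also have "\<dots> = tr (Gam y v)" by (simp add: trace_def transpose_def C_def tr_def)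
    finally have 1: "trace ((M ** transpose (C v)) ** M') = tr (Gam y v)" .
    have "trace (C v) = tr (Gam y v)" by (simp add: trace_def C_def tr_def)
    then show ?thesis unfolding C2_def trace_add 1 by simp
  qed
  have C2M: "C2 v ** M = C v ** M + M ** transpose (C v)" for v
  proof -
    have "C2 v ** M = C v ** M + ((M ** transpose (C v)) ** M') ** M"
      by (simp add: C2_def matrix_matrix_mult_def vec_eq_iff distrib_right sum.distrib)
    then show ?thesis by (simp add: matrix_mul_assoc[symmetric] M')
  qed
  have entry: "((\<lambda>z. gram (G z) $ i $ j) has_derivative (\<lambda>v. \<Sum>k\<in>UNIV. C2 v $ i $ k * M $ k $ j)) (at y)" for i j
  proof -
    have "(\<Sum>k\<in>UNIV. C2 v $ i $ k * M $ k $ j) = dd (\<lambda>z. G z (axis i 1) (axis j 1)) v y" for v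
    proof -
      have "(\<Sum>k\<in>UNIV. C2 v $ i $ k * M $ k $ j) = (C2 v ** M) $ i $ j" by (simp add: matrix_matrix_mult_def)
      also have "\<dots> = (\<Sum>k\<in>UNIV. C v $ i $ k * M $ k $ j) + (\<Sum>k\<in>UNIV. M $ i $ k * C v $ j $ k)"
        unfolding C2M by (simp add: matrix_matrix_mult_def transpose_def)
      also have "(\<Sum>k\<in>UNIV. C v $ i $ k * M $ k $ j) = G y (Gam y v (axis i 1)) (axis j 1)"
        using linear_axis_sum[OF G.lin1, of "Gam y v (axis i 1)" "axis j 1"] by (simp add: Mij C_def)
      also have "(\<Sum>k\<in>UNIV. M $ i $ k * C v $ j $ k) = G y (axis i 1) (Gam y v (axis j 1))"
        using linear_axis_sum[OF G.lin2, of "axis i 1" "Gam y v (axis j 1)"] by (simp add: Mij C_def mult.commute)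
      finally show ?thesis by (simp add: compat[OF y])
    qed
    then show ?thesis using smooth_on_has_derivative[OF G_smooth y, of "axis i 1" "axis j 1"] by (simp add: gram_def)
  qed
  have d: "((\<lambda>z. det (gram (G z))) has_derivative (\<lambda>v. trace (C2 v) * det (gram (G y)))) (at y)"
    by (rule has_derivative_det_trace) (use entry in \<open>simp add: M_def\<close>)
  define D where "D = det (gram (G y))"
  have D: "D \<noteq> 0" using \<open>det M \<noteq> 0\<close> by (simp add: D_def M_def)
  have "((\<lambda>t. (t\<^sup>2) powr (1/4)) has_real_derivative (1/4) * (D\<^sup>2) powr (1/4 - 1) * (2 * D)) (at D)"
    using D by (auto intro!: derivative_eq_intros)
  moreover have "(1/4) * (D\<^sup>2) powr (1/4 - 1) * (2 * D) = (D\<^sup>2) powr (1/4) / (2 * D)"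
    using D unfolding powr_diff by (simp add: field_simps power2_eq_square)
  ultimately have "((\<lambda>t. (t\<^sup>2) powr (1/4)) has_real_derivative (D\<^sup>2) powr (1/4) / (2 * D)) (at D)"
    by (rule DERIV_cong)
  then have "((\<lambda>t. (t\<^sup>2) powr (1/4)) has_derivative (\<lambda>h. ((D\<^sup>2) powr (1/4) / (2 * D)) * h)) (at D)"
    unfolding has_field_derivative_def .
  from has_derivative_compose[OF d this[unfolded D_def]]
  have "(rho has_derivative (\<lambda>v. ((D\<^sup>2) powr (1/4) / (2 * D)) * (trace (C2 v) * D))) (at y)"
    unfolding rho_def[abs_def] sqrt_abs_powr D_def .
  then have "dd rho v y = ((D\<^sup>2) powr (1/4) / (2 * D)) * (trace (C2 v) * D)" by (rule dd_eq)
  also have "\<dots> = rho y * tr (Gam y v)"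
    using D unfolding rho_def sqrt_abs_powr tr D_def by simp
  finally show ?thesis .
qed

text \<open>The logarithmic derivative of the density supplies the trace of the Christoffel term in
  the covariant derivative of \<open>X\<close>.\<close>

lemma divergence_density:
  assumes X: "smooth_on N X" and y: "y \<in> N"
  shows "(\<Sum>i\<in>UNIV. dd (\<lambda>y. rho y * X y $ i) (axis i 1) y) = rho y * tr (grad X y)"
proof -
  have "dd (\<lambda>y. rho y * X y $ i) (axis i 1) y = rho y * dd X (axis i 1) y $ i + X y $ i * dd rho (axis i 1) y" for i
    using dd_bounded_bilinear[OF bounded_bilinear_mult rho_smooth smooth_on_vec_nth[OF open_N X, of i] y, where v = "axis i 1"]
    by (simp add: dd_vec_nth[OF X y])
  then have "(\<Sum>i\<in>UNIV. dd (\<lambda>y. rho y * X y $ i) (axis i 1) y) =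
    rho y * tr (\<lambda>v. dd X v y) + (\<Sum>i\<in>UNIV. X y $ i *\<^sub>R dd rho (axis i 1) y)"
    by (simp add: sum.distrib tr_def sum_distrib_left)
  also have "(\<Sum>i\<in>UNIV. X y $ i *\<^sub>R dd rho (axis i 1) y) = dd rho (X y) y"
    by (rule linear_axis_sum[OF smooth_on_linear_dd[OF rho_smooth y], symmetric])
  also have "\<dots> = rho y * tr (\<lambda>v. Gam y v (X y))"
    unfolding dd_rho[OF y] using Gam_sym[OF y] by (simp add: tr_def)
  finally show ?thesis
    unfolding grad_def tr_add by (simp add: distrib_left)
qed

lemma integral_divergence_density:
  assumes X: "smooth_on N X" and K: "compact K" "K \<subseteq> N" and zero: "\<And>y. y \<in> N \<Longrightarrow> y \<notin> K \<Longrightarrow> X y = 0"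
  shows "(\<integral>y. indicator N y *\<^sub>R (rho y * tr (grad X y)) \<partial>lborel) = 0"
proof -
  \<comment> \<open>The components of \<open>rho X\<close> extended by 0; smooth on the whole space
    because the compact support lies inside the open set \<open>N\<close>.\<close>
  define h where "h i y = (if y \<in> N then rho y * X y $ i else 0)" for i y
  have h0: "h i y = 0" if "y \<notin> K" for i y using zero that by (simp add: h_def)
  have hs: "smooth_on UNIV (h i)" for i
  proof (rule smooth_on_local)
    fix y
    have 1: "smooth_on N (h i)"
      by (rule smooth_on_cong[OF smooth_on_mult[OF open_N rho_smooth smooth_on_vec_nth[OF open_N X, of i]] open_N]) (simp add: h_def)
    have 2: "smooth_on (- K) (h i)" "open (- K)"
      using smooth_on_cong[OF smooth_on_const[of "- K" "0::real"], of "h i"] h0 compact_imp_closed[OF K(1)] by auto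
    show "\<exists>T. open T \<and> y \<in> T \<and> smooth_on T (h i)"
      using 1 2 K(2) open_N by (cases "y \<in> N") blast+
  qed
  have eq: "indicator N y *\<^sub>R (rho y * tr (grad X y)) = (\<Sum>i\<in>UNIV. dd (h i) (axis i 1) y)" for y
  proof (cases "y \<in> N")
    case True
    have "dd (h i) (axis i 1) y = dd (\<lambda>y. rho y * X y $ i) (axis i 1) y" for i
      by (rule dd_cong[OF open_N True]) (simp add: h_def)
    then show ?thesis using divergence_density[OF X True] True by simp
  next
    case False
    then have "y \<notin> K" using K(2) by blast
    then show ?thesis using False dd_zero_outside[OF compact_imp_closed[OF K(1)] h0] by simp
  qed
  show ?thesis
    unfolding eq using integrable_dd_compact_support[OF hs K(1) h0] integral_dd_compact_support[OF hs K(1) h0]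
    by simp
qed

end

section \<open>Global cutoff functions\<close>

context smooth_mfd
begin

lemma smooth_fun_continuous: "smooth_fun A UNIV f \<Longrightarrow> continuous_on UNIV f"
proof -
  assume f: "smooth_fun A UNIV f"
  have "isCont f p" for p
  proof -
    obtain c where c: "c \<in> A" "p \<in> fst c" using ex_chart by blast
    have "continuous_on (snd c ` fst c) (f \<circ> chart_inv c)"
      using smooth_on_continuous f c(1) unfolding smooth_fun_def by fastforce
    from continuous_on_compose[OF continuous_on_chart[OF c(1)] this]
    have "continuous_on (fst c) f"
      by (rule continuous_on_cong[THEN iffD1, rotated -1]) (auto simp: chart_inv_left[OF c(1)])
    then show ?thesis using open_dom[OF c(1)] c(2) continuous_on_eq_continuous_at by blast
  qed
  then show ?thesis by (simp add: continuous_at_imp_continuous_on)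
qed

lemma cutoff_fun:
  assumes W: "open W" "p \<in> W"
  obtains c \<psi> U C where "c \<in> A" "p \<in> U" "open U" "compact C" "C \<subseteq> fst c" "C \<subseteq> W"
    "smooth_fun A UNIV \<psi>" "\<And>q. \<psi> q \<ge> 0" "\<And>q. q \<in> U \<Longrightarrow> \<psi> q = 1" "\<And>q. q \<notin> C \<Longrightarrow> \<psi> q = 0"
proof -
  obtain c where c: "c \<in> A" "p \<in> fst c" using ex_chart by blast
  have o: "open (snd c ` (W \<inter> fst c))" by (rule open_chart_image[OF c(1) W(1)])
  have "snd c p \<in> snd c ` (W \<inter> fst c)" using c W by auto
  then obtain e where e: "e > 0" "cball (snd c p) e \<subseteq> snd c ` (W \<inter> fst c)"
    using o open_contains_cball by metis
  \<comment> \<open>\<open>cutoff\<close> equals 1 inside radius \<open>r\<close> and vanishes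
    beyond \<open>2 r\<close>, so half of \<open>e\<close> keeps the support within the closed ball
    of radius \<open>e\<close>.\<close>
  define r where "r = e / 2"
  have r: "r > 0" "2 * r = e" using e by (auto simp: r_def)
  define C where "C = chart_inv c ` cball (snd c p) e"
  define U where "U = chart_inv c ` ball (snd c p) r"
  define \<psi> where "\<psi> q = (if q \<in> fst c then cutoff (snd c p) r (snd c q) else 0)" for q
  have "cball (snd c p) e \<subseteq> snd c ` fst c" using e(2) by blast
  moreover have "ball (snd c p) r \<subseteq> cball (snd c p) e" using r by auto
  ultimately have sub: "cball (snd c p) e \<subseteq> snd c ` fst c" "ball (snd c p) r \<subseteq> snd c ` fst c" by blast+
  have C: "compact C" "C \<subseteq> fst c" "C \<subseteq> W"
  proof -
    show "compact C" unfolding C_def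
      by (rule compact_continuous_image[OF continuous_on_subset[OF continuous_on_chart_inv[OF c(1)] sub(1)]]) simp
    show "C \<subseteq> fst c" unfolding C_def using sub(1) chart_inv_in[OF c(1)] by blast
    show "C \<subseteq> W" unfolding C_def using e(2) chart_inv_left[OF c(1)] by auto
  qed
  have U: "open U" "p \<in> U"
    unfolding U_def using open_preimage(1)[OF c(1) _ sub(2)] chart_inv_left[OF c(1), OF c(2)] r
    by (auto intro!: image_eqI[of _ _ "snd c p"])
  have one: "\<psi> q = 1" if qU: "q \<in> U" for q
  proof -
    obtain x where x: "x \<in> ball (snd c p) r" "q = chart_inv c x" using qU unfolding U_def by auto
    then have "x \<in> snd c ` fst c" using sub(2) by blast
    then show ?thesis
      using cutoff_eq_1[OF r(1) x(1)] by (simp add: \<psi>_def x(2) chart_inv_in[OF c(1)] chart_inv_right[OF c(1)])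
  qed
  have zero: "\<psi> q = 0" if "q \<notin> C" for q
  proof (cases "q \<in> fst c")
    case True
    have "snd c q \<notin> cball (snd c p) e"
      using that chart_inv_left[OF c(1) True] unfolding C_def by (metis imageI)
    then have "snd c q \<notin> ball (snd c p) (2 * r)" using r(2) by auto
    then show ?thesis using cutoff_eq_0[OF r(1)] by (simp only: \<psi>_def if_True True)
  qed (simp add: \<psi>_def)
  have "smooth_fun A UNIV \<psi>"
  proof (rule smooth_fun_local)
    fix q
    have "smooth_fun A (fst c) \<psi>"
      unfolding smooth_fun_chart[OF c(1) open_dom[OF c(1)] order_refl]
      by (rule smooth_on_cong[OF smooth_on_mono[OF smooth_on_cutoff[OF r(1)]] open_img[OF c(1)]])
        (auto simp: \<psi>_def chart_inv_left[OF c(1)])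
    moreover have "open (- C)" using compact_imp_closed[OF C(1)] by auto
    then have "smooth_fun A (- C) \<psi>"
      using smooth_fun_cong[OF smooth_fun_const[of "- C" 0]] zero by auto
    ultimately show "\<exists>V. open V \<and> q \<in> V \<and> smooth_fun A V \<psi>"
      using open_dom[OF c(1)] C(2) \<open>open (- C)\<close> by (cases "q \<in> fst c") blast+
  qed
  moreover have "\<psi> q \<ge> 0" for q by (simp add: \<psi>_def cutoff_nonneg)
  ultimately show ?thesis using that[OF c(1) U(2,1) C] one zero by blast
qed

end

section \<open>The volume measure in charts\<close>

locale vol_mfd = lc_mfd A g nabla
  for A :: "('m::{t2_space, second_countable_topology}, 'd::finite) chart set" and g nabla +
  fixes \<mu> :: "'m measure"
  assumes volume: "volume_measure A g \<mu>"
begin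

lemma sets_\<mu>: "sets \<mu> = sets borel"
  using volume by (simp add: volume_measure_def)

lemma space_\<mu>: "space \<mu> = UNIV"
  using sets_eq_imp_space_eq[OF sets_\<mu>] by simp

context
  fixes c assumes c: "c \<in> A"
begin

interpretation C: coord_metric "snd c ` fst c" "cG c" "cGam c"
  by (rule coord_metric[OF c])

lemma emeasure_chart:
  assumes "S \<in> sets borel" "S \<subseteq> fst c"
  shows "emeasure \<mu> S = (\<integral>\<^sup>+ y\<in>snd c ` S. ennreal (C.rho y) \<partial>lborel)"
  using volume c assms unfolding volume_measure_def C.rho_def gram_def cG_def by blast

lemma rho_measurable: "C.rho \<in> borel_measurable (restrict_space lborel (snd c ` fst c))"
  using borel_measurable_continuous_on_restrict[OF smooth_on_continuous[OF C.rho_smooth]]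
  by (simp add: measurable_cong_sets[OF sets_restrict_space_cong[OF sets_lborel] refl])

lemma chart_inv_measurable:
  "chart_inv c \<in> measurable (restrict_space lborel (snd c ` fst c)) (restrict_space borel (fst c))"
proof (rule measurable_restrict_space2)
  show "chart_inv c \<in> space (restrict_space lborel (snd c ` fst c)) \<rightarrow> fst c"
    using chart_inv_in[OF c] by (auto simp: space_restrict_space)
  show "chart_inv c \<in> borel_measurable (restrict_space lborel (snd c ` fst c))"
    using borel_measurable_continuous_on_restrict[OF continuous_on_chart_inv[OF c]]
    by (simp add: measurable_cong_sets[OF sets_restrict_space_cong[OF sets_lborel] refl])
qed

text \<open>The formula for the volume of sets inside a chart determines the restricted measure. Its
  form as a push-forward of a density yields the change of variables for integrals.\<close>

lemma volume_chart:
  "restrict_space \<mu> (fst c) =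
    distr (density (restrict_space lborel (snd c ` fst c)) C.rho) (restrict_space borel (fst c)) (chart_inv c)"
  (is "?M = ?N")
proof (rule measure_eqI)
  show "sets ?M = sets ?N" by (simp add: sets_restrict_space_cong[OF sets_\<mu>])
  fix S assume "S \<in> sets ?M"
  then have S: "S \<in> sets borel" "S \<subseteq> fst c"
    using sets_restrict_space_iff[of "fst c" \<mu> S] open_dom[OF c] sets_\<mu> space_\<mu> by auto
  have Sr: "S \<in> sets (restrict_space borel (fst c))"
    using S open_dom[OF c] by (simp add: sets_restrict_space_iff)
  have pre: "chart_inv c -` S \<inter> snd c ` fst c = snd c ` S"
    using chart_inv_left[OF c] S(2) by force
  have m: "snd c ` S \<in> sets (restrict_space lborel (snd c ` fst c))"
    using measurable_sets[OF chart_inv_measurable Sr] pre by (simp add: space_restrict_space)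
  have "emeasure ?N S = emeasure (density (restrict_space lborel (snd c ` fst c)) C.rho) (snd c ` S)"
    using chart_inv_measurable Sr pre by (subst emeasure_distr) (auto simp: space_restrict_space)
  also have "\<dots> = (\<integral>\<^sup>+ y. ennreal (C.rho y) * indicator (snd c ` S) y \<partial>restrict_space lborel (snd c ` fst c))"
    using rho_measurable m by (subst emeasure_density) auto
  also have "\<dots> = (\<integral>\<^sup>+ y. ennreal (C.rho y) * indicator (snd c ` S) y * indicator (snd c ` fst c) y \<partial>lborel)"
    using open_img[OF c] by (subst nn_integral_restrict_space) auto
  also have "\<dots> = (\<integral>\<^sup>+ y\<in>snd c ` S. ennreal (C.rho y) \<partial>lborel)"
    using S(2) by (intro nn_integral_cong) (auto simp: indicator_def)
  finally show "emeasure ?M S = emeasure ?N S"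
    using S open_dom[OF c] sets_\<mu> space_\<mu> by (simp add: emeasure_restrict_space emeasure_chart[OF S])
qed

lemma integral_chart:
  fixes F :: "'m \<Rightarrow> real"
  assumes F: "F \<in> borel_measurable borel" and zero: "\<And>q. q \<notin> fst c \<Longrightarrow> F q = 0"
  shows "integral\<^sup>L \<mu> F = (\<integral>y. indicator (snd c ` fst c) y *\<^sub>R (C.rho y * F (chart_inv c y)) \<partial>lborel)"
proof -
  have Fr: "F \<in> borel_measurable (restrict_space borel (fst c))"
    using F by (rule measurable_restrict_space1)
  have "integral\<^sup>L \<mu> F = integral\<^sup>L \<mu> (\<lambda>q. indicator (fst c) q *\<^sub>R F q)"
    by (rule Bochner_Integration.integral_cong) (use zero in \<open>auto simp: indicator_def\<close>)
  also have "\<dots> = integral\<^sup>L (restrict_space \<mu> (fst c)) F"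
    using open_dom[OF c] sets_\<mu> space_\<mu> by (subst integral_restrict_space) auto
  also have "\<dots> = integral\<^sup>L (density (restrict_space lborel (snd c ` fst c)) C.rho) (\<lambda>y. F (chart_inv c y))"
    unfolding volume_chart by (rule integral_distr) (use chart_inv_measurable Fr in auto)
  also have "\<dots> = integral\<^sup>L (restrict_space lborel (snd c ` fst c)) (\<lambda>y. C.rho y *\<^sub>R F (chart_inv c y))"
  proof (rule integral_density)
    show "(\<lambda>y. F (chart_inv c y)) \<in> borel_measurable (restrict_space lborel (snd c ` fst c))"
      by (rule measurable_compose[OF chart_inv_measurable Fr])
    show "AE y in restrict_space lborel (snd c ` fst c). 0 \<le> C.rho y"
      by (simp add: C.rho_def)
  qed (rule rho_measurable)
  also have "\<dots> = (\<integral>y. indicator (snd c ` fst c) y *\<^sub>R (C.rho y *\<^sub>R F (chart_inv c y)) \<partial>lborel)"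
    using open_img[OF c] by (subst integral_restrict_space) auto
  finally show ?thesis by simp
qed

end

text \<open>Small coordinate balls have finite volume, since the density is bounded on their compact
  closures; finitely many of them cover \<open>K\<close>.\<close>

lemma emeasure_compact_finite_volume:
  assumes K: "compact K"
  shows "emeasure \<mu> K < \<infinity>"
proof -
  have "\<exists>V. open V \<and> p \<in> V \<and> emeasure \<mu> V < \<infinity>" for p
  proof -
    obtain c where c: "c \<in> A" "p \<in> fst c" using ex_chart by blast
    interpret C: coord_metric "snd c ` fst c" "cG c" "cGam c" by (rule coord_metric[OF c(1)])
    have "snd c p \<in> snd c ` fst c" using c by auto
    then obtain e where e: "e > 0" "cball (snd c p) e \<subseteq> snd c ` fst c"
      using open_img[OF c(1)] open_contains_cball by metis
    define V where "V = chart_inv c ` ball (snd c p) e"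
    have sub: "ball (snd c p) e \<subseteq> snd c ` fst c" using e(2) by (auto simp: subset_iff)
    note V = open_preimage[OF c(1) open_ball sub, folded V_def]
    have pV: "p \<in> V" unfolding V_def
      using chart_inv_left[OF c(1), OF c(2)] e(1) by (auto intro!: image_eqI[of _ _ "snd c p"])
    have "bounded (C.rho ` cball (snd c p) e)"
      by (intro compact_imp_bounded compact_continuous_image continuous_on_subset[OF smooth_on_continuous[OF C.rho_smooth] e(2)]) simp
    then obtain B where "\<forall>y\<in>cball (snd c p) e. norm (C.rho y) \<le> B" unfolding bounded_iff by auto
    then have B: "C.rho y \<le> B" if "y \<in> ball (snd c p) e" for y using that by (auto simp: abs_le_iff)
    have "emeasure \<mu> V = (\<integral>\<^sup>+ y\<in>ball (snd c p) e. ennreal (C.rho y) \<partial>lborel)"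
      using emeasure_chart[OF c(1), of V] V by simp
    also have "\<dots> \<le> (\<integral>\<^sup>+ y. ennreal B * indicator (ball (snd c p) e) y \<partial>lborel)"
      using B by (intro nn_integral_mono) (auto simp: indicator_def intro!: ennreal_leI)
    also have "\<dots> = ennreal B * emeasure lborel (ball (snd c p) e)"
      by (simp add: nn_integral_cmult_indicator)
    also have "\<dots> < \<infinity>"
      using emeasure_lborel_ball_finite[of "snd c p" e] by (simp add: ennreal_mult_less_top)
    finally show ?thesis using V(1) pV by blast
  qed
  then obtain V where V: "\<And>p. open (V p)" "\<And>p. p \<in> V p" "\<And>p. emeasure \<mu> (V p) < \<infinity>" by metis
  obtain P where P: "P \<subseteq> K" "finite P" "K \<subseteq> (\<Union>p\<in>P. V p)"
    by (rule compactE_image[OF K, of K V]) (use V in auto)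
  have "emeasure \<mu> K \<le> emeasure \<mu> (\<Union>p\<in>P. V p)"
    using P(2,3) V(1) sets_\<mu> by (intro emeasure_mono) auto
  also have "\<dots> \<le> (\<Sum>p\<in>P. emeasure \<mu> (V p))"
    using P(2) V(1) sets_\<mu> by (intro emeasure_subadditive_finite) auto
  also have "\<dots> < \<infinity>" using V(3) by (simp add: P(2))
  finally show ?thesis .
qed

lemma integrable_compact_support:
  "continuous_on UNIV f \<Longrightarrow> compact K \<Longrightarrow> (\<And>x. x \<notin> K \<Longrightarrow> f x = 0) \<Longrightarrow> integrable \<mu> (f :: 'm \<Rightarrow> real)"
  using integrable_continuous_compact_support[OF sets_\<mu>] emeasure_compact_finite_volume by blast

section \<open>The divergence of a global field and its integral\<close>

definition divergence :: "'m vfield \<Rightarrow> 'm \<Rightarrow> real" where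
  "divergence X p = endo_trace A p (cov_deriv_at A nabla X p)"

lemma divergence_chart:
  assumes X: "smooth_vf A UNIV X" and c: "c \<in> A" "p \<in> fst c"
  shows "divergence X p = tr (coord_metric.grad (cGam c) (coords c X) (snd c p))"
proof -
  interpret C: coord_metric "snd c ` fst c" "cG c" "cGam c" by (rule coord_metric[OF c(1)])
  have y: "snd c p \<in> snd c ` fst c" using c by auto
  note X' = smooth_coords[OF c(1) open_dom[OF c(1)] order_refl smooth_vf_mono[OF X subset_UNIV]]
  have k: "cov_deriv_at A nabla X p v = coord_vec A c p (C.grad (coords c X) (snd c p) (tcoords c v))"
    if "v \<in> tangent_space A p" for v
    using cov_deriv_at_coords[OF c X, of "tcoords c v"] tangent_coords[OF c(1), OF c(2) that] by simp
  have t: "tcoords c (cov_deriv_at A nabla X p (coord_vec A c p u)) = C.grad (coords c X) (snd c p) u" for u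
    by (simp add: cov_deriv_at_coords[OF c X] tcoords_coord_vec[OF c(1), OF c(2)])
  show ?thesis
    unfolding divergence_def
    unfolding t[symmetric]
  proof (rule endo_trace_chart[OF c])
    show "cov_deriv_at A nabla X p v \<in> tangent_space A p" if "v \<in> tangent_space A p" for v
      by (simp add: k[OF that] coord_vec_tangent[OF c(1), OF c(2)])
    show "linear (\<lambda>u. tcoords c (cov_deriv_at A nabla X p (coord_vec A c p u)))"
      unfolding t by (rule C.efieldD(1)[OF C.efield_grad[OF X'] y])
  qed
qed

lemma divergence_smooth:
  assumes X: "smooth_vf A UNIV X"
  shows "smooth_fun A UNIV (divergence X)"
proof (rule smooth_fun_local)
  fix p
  obtain c where c: "c \<in> A" "p \<in> fst c" using ex_chart by blast
  interpret C: coord_metric "snd c ` fst c" "cG c" "cGam c" by (rule coord_metric[OF c(1)])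
  note X' = smooth_coords[OF c(1) open_dom[OF c(1)] order_refl smooth_vf_mono[OF X subset_UNIV]]
  have "smooth_on (snd c ` fst c) (\<lambda>y. tr (C.grad (coords c X) y))"
    unfolding tr_def using C.efieldD(2)[OF C.efield_grad[OF X']]
    by (intro smooth_on_sum smooth_on_vec_nth open_img[OF c(1)]) auto
  then have "smooth_on (snd c ` fst c) (divergence X \<circ> chart_inv c)"
    by (rule smooth_on_cong[OF _ open_img[OF c(1)]])
      (simp add: divergence_chart[OF X c(1)] chart_inv_in[OF c(1)] chart_inv_right[OF c(1)])
  then have "smooth_fun A (fst c) (divergence X)"
    using smooth_fun_chart[OF c(1) open_dom[OF c(1)] order_refl] by blast
  then show "\<exists>V. open V \<and> p \<in> V \<and> smooth_fun A V (divergence X)"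
    using open_dom[OF c(1)] c(2) by blast
qed

lemma divergence_continuous: "smooth_vf A UNIV X \<Longrightarrow> continuous_on UNIV (divergence X)"
  by (rule smooth_fun_continuous[OF divergence_smooth])

lemma coords_zero_outside:
  assumes c: "c \<in> A" and K: "closed K" and zero: "\<And>q. q \<notin> K \<Longrightarrow> X q = 0" and p: "p \<in> fst c" "p \<notin> K"
  shows "dd (coords c X) v (snd c p) = 0" "coords c X (snd c p) = 0"
proof -
  have o: "open (snd c ` (- K \<inter> fst c))" using open_chart_image[OF c] K by auto
  have z: "coords c X y = 0" if "y \<in> snd c ` (- K \<inter> fst c)" for y
    using that zero chart_inv_left[OF c] by (auto simp: coords_def tcoords_simps)
  have y: "snd c p \<in> snd c ` (- K \<inter> fst c)" using p by auto
  show "coords c X (snd c p) = 0" by (rule z[OF y])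
  show "dd (coords c X) v (snd c p) = 0"
    using dd_cong[OF o y, of "coords c X" "\<lambda>_. 0" v] z by (simp add: dd_const)
qed

lemma divergence_zero_outside:
  assumes X: "smooth_vf A UNIV X" and K: "closed K" and zero: "\<And>q. q \<notin> K \<Longrightarrow> X q = 0" and p: "p \<notin> K"
  shows "divergence X p = 0"
proof -
  obtain c where c: "c \<in> A" "p \<in> fst c" using ex_chart by blast
  interpret C: coord_metric "snd c ` fst c" "cG c" "cGam c" by (rule coord_metric[OF c(1)])
  have y: "snd c p \<in> snd c ` fst c" using c by auto
  have "dd (coords c X) v (snd c p) = 0" "coords c X (snd c p) = 0" for v
    by (rule coords_zero_outside[OF c(1) K zero c(2) p]; assumption)+
  then show ?thesis
    unfolding divergence_chart[OF X c] tr_def C.grad_def by (simp add: C.Gam_simps[OF y])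
qed

lemma divergence_add:
  assumes X: "smooth_vf A UNIV X" and Y: "smooth_vf A UNIV Y"
  shows "divergence (X + Y) p = divergence X p + divergence Y p"
proof -
  obtain c where c: "c \<in> A" "p \<in> fst c" using ex_chart by blast
  interpret C: coord_metric "snd c ` fst c" "cG c" "cGam c" by (rule coord_metric[OF c(1)])
  have y: "snd c p \<in> snd c ` fst c" using c by auto
  note X' = smooth_coords[OF c(1) open_dom[OF c(1)] order_refl smooth_vf_mono[OF X subset_UNIV]]
  note Y' = smooth_coords[OF c(1) open_dom[OF c(1)] order_refl smooth_vf_mono[OF Y subset_UNIV]]
  have XY: "coords c (X + Y) = (\<lambda>y. coords c X y + coords c Y y)"
    by (simp add: coords_def fun_eq_iff tcoords_simps)
  have "C.grad (coords c (X + Y)) (snd c p) u = C.grad (coords c X) (snd c p) u + C.grad (coords c Y) (snd c p) u" for u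
    unfolding XY C.grad_def by (simp add: dd_add[OF X' Y' y] C.Gam_simps[OF y])
  then show ?thesis
    unfolding divergence_chart[OF X c] divergence_chart[OF Y c] divergence_chart[OF smooth_vf_add[OF X Y] c] tr_add[symmetric]
    by (simp add: tr_def)
qed

lemma divergence_theorem_chart:
  assumes X: "smooth_vf A UNIV X" and K: "compact K" "K \<subseteq> fst c" and c: "c \<in> A" and zero: "\<And>q. q \<notin> K \<Longrightarrow> X q = 0"
  shows "integral\<^sup>L \<mu> (divergence X) = 0"
proof -
  interpret C: coord_metric "snd c ` fst c" "cG c" "cGam c" by (rule coord_metric[OF c])
  note X' = smooth_coords[OF c open_dom[OF c] order_refl smooth_vf_mono[OF X subset_UNIV]]
  have cK: "compact (snd c ` K)"
    by (rule compact_continuous_image[OF continuous_on_subset[OF continuous_on_chart[OF c] K(2)] K(1)])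
  have z: "coords c X y = 0" if "y \<in> snd c ` fst c" "y \<notin> snd c ` K" for y
    using that coords_zero_outside(2)[where X = X, OF c compact_imp_closed[OF K(1)] zero] by auto
  have "integral\<^sup>L \<mu> (divergence X) =
      (\<integral>y. indicator (snd c ` fst c) y *\<^sub>R (C.rho y * divergence X (chart_inv c y)) \<partial>lborel)"
  proof (rule integral_chart[OF c borel_measurable_continuous_onI[OF divergence_continuous[OF X]]])
    fix q assume "q \<notin> fst c"
    then show "divergence X q = 0"
      using divergence_zero_outside[OF X compact_imp_closed[OF K(1)] zero, of q] K(2) by blast
  qed
  also have "\<dots> = (\<integral>y. indicator (snd c ` fst c) y *\<^sub>R (C.rho y * tr (C.grad (coords c X) y)) \<partial>lborel)"
    by (rule Bochner_Integration.integral_cong)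
      (auto simp: indicator_def divergence_chart[OF X c] chart_inv_left[OF c])
  also have "\<dots> = 0"
    by (rule C.integral_divergence_density[OF X' cK _ z]) (use K(2) in auto)
  finally show ?thesis .
qed

text \<open>A partition of unity by products of cutoff functions: \<open>X = \<psi>X + (1 - \<psi>)X\<close>, where the second
  summand is supported in the part of \<open>K\<close> not yet dealt with.\<close>
theorem divergence_theorem:
  assumes X: "smooth_vf A UNIV X" and K: "compact K" and zero: "\<And>q. q \<notin> K \<Longrightarrow> X q = 0"
  shows "integral\<^sup>L \<mu> (divergence X) = 0"
proof -
  have "\<exists>c U C \<psi>. c \<in> A \<and> p \<in> U \<and> open U \<and> compact C \<and> C \<subseteq> fst c \<and> smooth_fun A UNIV \<psi> \<and>
     (\<forall>q\<in>U. \<psi> q = 1) \<and> (\<forall>q. q \<notin> C \<longrightarrow> \<psi> q = 0)" for p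
    by (rule cutoff_fun[OF open_UNIV UNIV_I, of p]) blast
  then obtain ch U C \<psi> where ch: "\<And>p. ch p \<in> A" and U: "\<And>p. p \<in> U p" "\<And>p. open (U p)"
    and C: "\<And>p. compact (C p)" "\<And>p. C p \<subseteq> fst (ch p)"
    and \<psi>: "\<And>p. smooth_fun A UNIV (\<psi> p)" "\<And>p q. q \<in> U p \<Longrightarrow> \<psi> p q = 1" "\<And>p q. q \<notin> C p \<Longrightarrow> \<psi> p q = 0"
    by metis
  have "integral\<^sup>L \<mu> (divergence X) = 0"
    if "finite P" "smooth_vf A UNIV X" "compact K" "\<And>q. q \<notin> K \<Longrightarrow> X q = 0" "K \<subseteq> (\<Union>p\<in>P. U p)" for P X K
    using that
  proof (induction P arbitrary: X K)
    case empty
    have "X q = 0" if "q \<notin> {}" for q by (rule empty.prems(3)) (use empty.prems(4) in simp)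
    then have "divergence X p = 0" for p
      by (rule divergence_zero_outside[OF empty.prems(1) closed_empty]) simp_all
    then show ?case by simp
  next
    case (insert p P)
    define Y where "Y q = \<psi> p q *\<^sub>v X q" for q
    define Z where "Z q = (1 + (- 1) * \<psi> p q) *\<^sub>v X q" for q
    have Y: "smooth_vf A UNIV Y" unfolding Y_def[abs_def] by (rule smooth_vf_scale[OF \<psi>(1) insert.prems(1)])
    have Z: "smooth_vf A UNIV Z" unfolding Z_def[abs_def]
      by (intro smooth_vf_scale insert.prems(1) smooth_fun_add smooth_fun_mult smooth_fun_const \<psi>(1) open_UNIV)
    have XYZ: "X = Y + Z" by (auto simp: Y_def Z_def vscale_def fun_eq_iff algebra_simps)
    have Y0: "Y q = 0" if "q \<notin> C p \<inter> K" for q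
      unfolding Y_def using that \<psi>(3)[of q p] insert.prems(3)[of q] vscale_simps(1,3) by (metis IntI)
    have Z0: "Z q = 0" if "q \<notin> K - U p" for q
    proof (cases "q \<in> K")
      case True
      then show ?thesis using that \<psi>(2)[of q p] by (simp add: Z_def vscale_simps(1))
    qed (simp only: Z_def insert.prems(3) vscale_simps(3) not_False_eq_True)
    have cY: "compact (C p \<inter> K)" by (rule compact_Int[OF C(1) insert.prems(2)])
    have cZ: "compact (K - U p)" by (rule compact_diff[OF insert.prems(2) U(2)])
    have "integral\<^sup>L \<mu> (divergence Y) = 0"
      by (rule divergence_theorem_chart[OF Y cY _ ch Y0]) (use C(2) in auto)
    moreover have "integral\<^sup>L \<mu> (divergence Z) = 0"
      by (rule insert.IH[OF Z cZ Z0]) (use insert.prems(4) in auto)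
    moreover have "integrable \<mu> (divergence Y)"
      by (rule integrable_compact_support[OF divergence_continuous[OF Y] cY])
        (rule divergence_zero_outside[OF Y compact_imp_closed[OF cY] Y0])
    moreover have "integrable \<mu> (divergence Z)"
      by (rule integrable_compact_support[OF divergence_continuous[OF Z] cZ])
        (rule divergence_zero_outside[OF Z compact_imp_closed[OF cZ] Z0])
    moreover have "divergence X = (\<lambda>q. divergence Y q + divergence Z q)"
      unfolding XYZ using divergence_add[OF Y Z] by auto
    ultimately show ?case by simp
  qed
  moreover obtain P where "P \<subseteq> K" "finite P" "K \<subseteq> (\<Union>p\<in>P. U p)"
    by (rule compactE_image[OF K, of K U]) (use U in auto)
  ultimately show ?thesis using X K zero by blast
qed

text \<open>If the integral vanished, \<open>f\<close> would vanish almost everywhere. Then a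
  nonempty open part of a chart domain, on which \<open>f > 0\<close>, would have volume 0, and as
  the density is positive its coordinate image would be an open Lebesgue null set.\<close>

lemma integral_pos:
  fixes f :: "'m \<Rightarrow> real"
  assumes f: "continuous_on UNIV f" and K: "compact K" and zero: "\<And>q. q \<notin> K \<Longrightarrow> f q = 0"
    and nonneg: "\<And>q. f q \<ge> 0" and p: "f p > 0"
  shows "integral\<^sup>L \<mu> f > 0"
proof (rule ccontr)
  assume neg: "\<not> integral\<^sup>L \<mu> f > 0"
  have int: "integrable \<mu> f" by (rule integrable_compact_support[OF f K zero])
  have "integral\<^sup>L \<mu> f \<ge> 0" using nonneg by (simp add: integral_nonneg)
  then have "integral\<^sup>L \<mu> f = 0" using neg by simp
  then have "AE q in \<mu>. f q = 0"
    using integral_nonneg_eq_0_iff_AE[OF int] nonneg by simp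
  obtain c where c: "c \<in> A" "p \<in> fst c" using ex_chart by blast
  interpret C: coord_metric "snd c ` fst c" "cG c" "cGam c" by (rule coord_metric[OF c(1)])
  define V where "V = {q. f q > 0} \<inter> fst c"
  have V: "open V" "V \<subseteq> fst c" "p \<in> V"
    using open_Collect_less[OF continuous_on_const f, of 0] open_dom[OF c(1)] c(2) p by (auto simp: V_def)
  have "emeasure \<mu> V = 0"
  proof -
    have "AE q in \<mu>. q \<notin> V" using \<open>AE q in \<mu>. f q = 0\<close> by eventually_elim (auto simp: V_def)
    then show ?thesis
      using V(1) sets_\<mu> space_\<mu> by (subst (asm) AE_iff_measurable[OF _ refl]) auto
  qed
  then have "(\<integral>\<^sup>+ y\<in>snd c ` V. ennreal (C.rho y) \<partial>lborel) = 0"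
    using emeasure_chart[OF c(1), of V] V by simp
  moreover have oV: "open (snd c ` V)" by (rule open_image[OF c(1) V(1,2)])
  moreover have meas: "(\<lambda>y. ennreal (C.rho y) * indicator (snd c ` V) y) \<in> borel_measurable lborel"
  proof -
    have "(\<lambda>y. if y \<in> snd c ` V then C.rho y else 0) \<in> borel_measurable borel"
      using oV continuous_on_subset[OF smooth_on_continuous[OF C.rho_smooth] image_mono[OF V(2)]]
      by (intro borel_measurable_continuous_on_if) auto
    then have "(\<lambda>y. ennreal (if y \<in> snd c ` V then C.rho y else 0)) \<in> borel_measurable lborel" by simp
    moreover have "(\<lambda>y. ennreal (if y \<in> snd c ` V then C.rho y else 0)) = (\<lambda>y. ennreal (C.rho y) * indicator (snd c ` V) y)"
      by (auto simp: fun_eq_iff)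
    ultimately show ?thesis by simp
  qed
  ultimately have "AE y in lborel. ennreal (C.rho y) * indicator (snd c ` V) y = 0"
    by (subst (asm) nn_integral_0_iff_AE) auto
  then have "AE y in lborel. y \<notin> snd c ` V"
    by eventually_elim (use C.rho_pos V(2) in \<open>fastforce simp: indicator_def split: if_splits\<close>)
  then have "emeasure lborel (snd c ` V) = 0"
    using oV by (subst (asm) AE_iff_measurable[OF _ refl]) auto
  then have "snd c ` V \<in> null_sets lborel" using oV by (auto simp: null_sets_def)
  then have "negligible (snd c ` V)" by (simp add: negligible_iff_null_sets null_sets_completionI)
  moreover have "snd c ` V \<noteq> {}" using V(3) by auto
  ultimately show False using oV open_not_negligible by blast
qed

end

section \<open>The first variation of the energy\<close>

lemma dd_slice:
  fixes f :: "real \<times> 'a::euclidean_space \<Rightarrow> 'b::real_normed_vector"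
  assumes "smooth_on Q f" "(t, y) \<in> Q"
  shows "dd (\<lambda>y. f (t, y)) u y = dd f (0, u) (t, y)"
proof -
  have "((\<lambda>y. (t, y)) has_derivative (\<lambda>u. (0, u))) (at y)"
    by (intro has_derivative_Pair has_derivative_const has_derivative_ident)
  from dd_eq[OF has_derivative_compose[OF this smooth_on_has_derivative[OF assms]]]
  show ?thesis .
qed

lemma time_line:
  fixes f :: "real \<times> 'a::euclidean_space \<Rightarrow> 'b::real_normed_vector"
  assumes "smooth_on Q f" "(t, y) \<in> Q"
  shows "((\<lambda>s. f (s, y)) has_derivative (\<lambda>h. h *\<^sub>R dd f (1, 0) (t, y))) (at t)"
  using dd_line[of Q f "(0, y)" t "(1, 0)"] assms by simp

lemma smooth_on_snd:
  fixes f :: "'a::euclidean_space \<Rightarrow> 'b::real_normed_vector"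
  assumes "smooth_on N f" "open N" "open J"
  shows "smooth_on (J \<times> N) (\<lambda>z :: real \<times> 'a. f (snd z))"
  by (rule smooth_on_compose[OF assms(1) smooth_on_bounded_linear[OF bounded_linear_snd _ smooth_on_ident] _ assms(2)])
    (use assms in \<open>auto intro: open_Times\<close>)

text \<open>Tangent vectors are functionals, so the velocity at time 0 is taken separately for each
  function \<open>f\<close>.\<close>

definition variation_field :: "(real \<Rightarrow> 'm vfield) \<Rightarrow> 'm vfield" where
  "variation_field W p = (\<lambda>f. deriv (\<lambda>t. W t p f) 0)"

context lc_mfd
begin

lemma g_coord_vec: "c \<in> A \<Longrightarrow> p \<in> fst c \<Longrightarrow> g p (coord_vec A c p u) (coord_vec A c p v) = cG c (snd c p) u v"
  by (simp add: cG_def chart_inv_left)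

text \<open>The trace is moved from the chosen frame to the coordinate basis and its metric dual,
  which gives an expression that can be differentiated in time and space. The first summand of the
  energy density is the trace of \<open>g\<close> itself, which is the dimension in every
  signature.\<close>

lemma metric_trace_gradients:
  assumes V: "smooth_vf A UNIV V" and X: "smooth_vf A UNIV X" and c: "c \<in> A" "p \<in> fst c"
  shows "metric_trace A g p (\<lambda>u v. g p (cov_deriv_at A nabla V p u) (cov_deriv_at A nabla X p v)) =
    (\<Sum>j\<in>UNIV. cG c (snd c p) (coord_metric.grad (cGam c) (coords c V) (snd c p) (indef_inner.dual (cG c (snd c p)) j))
      (coord_metric.grad (cGam c) (coords c X) (snd c p) (axis j 1)))"
    and "metric_trace A g p (\<lambda>u v. g p (cov_deriv_at A nabla V p u) (cov_deriv_at A nabla X p v)) =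
      metric_trace A g p (\<lambda>u v. g p (cov_deriv_at A nabla X p u) (cov_deriv_at A nabla V p v))"
    and "metric_trace A g p (sasaki_pullback A g nabla V p) = real CARD('d) +
      (\<Sum>j\<in>UNIV. cG c (snd c p) (coord_metric.grad (cGam c) (coords c V) (snd c p) (indef_inner.dual (cG c (snd c p)) j))
      (coord_metric.grad (cGam c) (coords c V) (snd c p) (axis j 1)))"
proof -
  interpret C: coord_metric "snd c ` fst c" "cG c" "cGam c" by (rule coord_metric[OF c(1)])
  have y: "snd c p \<in> snd c ` fst c" using c by auto
  interpret G: indef_inner "cG c (snd c p)" by (rule cG_inner[OF c(1) y])
  have lin: "linear (C.grad (coords c Z) (snd c p))" if "smooth_vf A UNIV Z" for Z
    using C.efieldD(1)[OF C.efield_grad[OF smooth_coords[OF c(1) open_dom[OF c(1)] order_refl smooth_vf_mono[OF that subset_UNIV]]] y] .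
  have e: "g p (cov_deriv_at A nabla Z p (coord_vec A c p u)) (cov_deriv_at A nabla Z' p (coord_vec A c p v)) =
     cG c (snd c p) (C.grad (coords c Z) (snd c p) u) (C.grad (coords c Z') (snd c p) v)"
    if "smooth_vf A UNIV Z" "smooth_vf A UNIV Z'" for Z Z' u v
    by (simp add: cov_deriv_at_coords[OF c that(1)] cov_deriv_at_coords[OF c that(2)] g_coord_vec[OF c])
  have lin2: "linear (\<lambda>u. cG c (snd c p) (C.grad (coords c Z) (snd c p) u) w)"
    "linear (\<lambda>u. cG c (snd c p) w (C.grad (coords c Z) (snd c p) u))" if "smooth_vf A UNIV Z" for Z w
    using linear_compose[OF lin[OF that] G.lin1] linear_compose[OF lin[OF that] G.lin2] by (simp_all add: o_def)
  show "metric_trace A g p (\<lambda>u v. g p (cov_deriv_at A nabla V p u) (cov_deriv_at A nabla X p v)) =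
    (\<Sum>j\<in>UNIV. cG c (snd c p) (C.grad (coords c V) (snd c p) (G.dual j)) (C.grad (coords c X) (snd c p) (axis j 1)))"
    by (subst metric_trace_chart[OF c]) (simp_all add: e[OF V X] lin2[OF V] lin2[OF X])
  obtain E where "G.orthonormal E" and E: "\<And>B. metric_trace A g p B =
      (\<Sum>i\<in>UNIV. cG c (snd c p) (E i) (E i) * B (coord_vec A c p (E i)) (coord_vec A c p (E i)))"
    by (rule metric_trace_frame[OF c]) blast
  show "metric_trace A g p (\<lambda>u v. g p (cov_deriv_at A nabla V p u) (cov_deriv_at A nabla X p v)) =
      metric_trace A g p (\<lambda>u v. g p (cov_deriv_at A nabla X p u) (cov_deriv_at A nabla V p v))"
    unfolding E e[OF V X] e[OF X V] by (simp add: G.sym)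
  have s: "sasaki_pullback A g nabla V p (coord_vec A c p u) (coord_vec A c p v) =
      cG c (snd c p) u v + cG c (snd c p) (C.grad (coords c V) (snd c p) u) (C.grad (coords c V) (snd c p) v)" for u v
    by (simp add: sasaki_pullback_def e[OF V V] g_coord_vec[OF c])
  have "metric_trace A g p (sasaki_pullback A g nabla V p) =
    (\<Sum>j\<in>UNIV. cG c (snd c p) (G.dual j) (axis j 1) +
      cG c (snd c p) (C.grad (coords c V) (snd c p) (G.dual j)) (C.grad (coords c V) (snd c p) (axis j 1)))"
    unfolding s[symmetric]
    by (rule metric_trace_chart[OF c])
      (simp_all add: s linear_compose_add lin2[OF V] G.lin1 G.lin2)
  then show "metric_trace A g p (sasaki_pullback A g nabla V p) = real CARD('d) +
    (\<Sum>j\<in>UNIV. cG c (snd c p) (C.grad (coords c V) (snd c p) (G.dual j)) (C.grad (coords c V) (snd c p) (axis j 1)))"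
    by (simp add: G.dual_apply sum.distrib)
qed

end

section \<open>The energy density along a variation\<close>

locale energy_variation = vol_mfd A g nabla \<mu>
  for A :: "('m::{t2_space, second_countable_topology}, 'd::finite) chart set" and g nabla \<mu> +
  fixes r \<epsilon> :: real and K :: "'m set" and V :: "'m vfield" and W :: "real \<Rightarrow> 'm vfield"
  assumes variation: "length_variation A g r K \<epsilon> V W" and eps: "\<epsilon> > 0" and K: "compact K"
begin

definition I :: "real set" where "I = {-\<epsilon><..<\<epsilon>}"

lemma I: "open I" "0 \<in> I"
  using eps by (auto simp: I_def)

lemma W_0: "W 0 = V"
  and W_smooth: "t \<in> I \<Longrightarrow> smooth_vf A UNIV (W t)"
  and W_length: "t \<in> I \<Longrightarrow> g p (W t p) (W t p) = r"
  and W_outside: "t \<in> I \<Longrightarrow> p \<notin> K \<Longrightarrow> W t p = V p"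
  using variation unfolding length_variation_def I_def by auto

lemma W_joint:
  "c \<in> A \<Longrightarrow> open U \<Longrightarrow> smooth_fun A U f \<Longrightarrow> smooth_on (I \<times> snd c ` (U \<inter> fst c)) (\<lambda>(t, x). W t (chart_inv c x) f)"
  using variation unfolding length_variation_def I_def by blast

lemma V_smooth: "smooth_vf A UNIV V"
  using W_smooth[OF I(2)] W_0 by simp

definition density :: "real \<Rightarrow> 'm \<Rightarrow> real" where
  "density t p = metric_trace A g p (sasaki_pullback A g nabla (W t) p)"

text \<open>Time and position form one variable, so that time derivatives and spatial derivatives
  commute as second derivatives of a single smooth map. Accordingly \<open>gr\<close> differentiates
  in the purely spatial direction \<open>(0, u)\<close>.\<close>

definition Om :: "('m, 'd) chart \<Rightarrow> real \<times> (real ^ 'd) \<Rightarrow> real ^ 'd" where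
  "Om c z = coords c (W (fst z)) (snd z)"

definition gr :: "('m, 'd) chart \<Rightarrow> real \<times> (real ^ 'd) \<Rightarrow> real ^ 'd \<Rightarrow> real ^ 'd" where
  "gr c z u = dd (Om c) (0, u) z + cGam c (snd z) u (Om c z)"

definition eden :: "('m, 'd) chart \<Rightarrow> real \<times> (real ^ 'd) \<Rightarrow> real" where
  "eden c z = real CARD('d) +
    (\<Sum>j\<in>UNIV. cG c (snd z) (gr c z (indef_inner.dual (cG c (snd z)) j)) (gr c z (axis j 1)))"

context
  fixes c assumes c: "c \<in> A"
begin

interpretation C: coord_metric "snd c ` fst c" "cG c" "cGam c" by (rule coord_metric[OF c])

lemma open_Q: "open (I \<times> snd c ` fst c)"
  by (rule open_Times[OF I(1) open_img[OF c]])

lemma Om_smooth: "smooth_on (I \<times> snd c ` fst c) (Om c)"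
proof -
  have "smooth_on (I \<times> snd c ` fst c) (\<lambda>z. W (fst z) (chart_inv c (snd z)) (\<lambda>q. snd c q $ i))" for i
    using W_joint[OF c open_dom[OF c] smooth_fun_coordinate[OF c], of i] by (simp add: case_prod_unfold)
  then show ?thesis
    unfolding Om_def[abs_def] coords_def tcoords_def by (intro smooth_on_vec_lambda open_Q)
qed

lemma Q_pair: "t \<in> I \<Longrightarrow> y \<in> snd c ` fst c \<Longrightarrow> (t, y) \<in> I \<times> snd c ` fst c"
  by simp

lemma gr_grad:
  assumes "t \<in> I" "y \<in> snd c ` fst c"
  shows "gr c (t, y) u = C.grad (coords c (W t)) y u"
  using dd_slice[OF Om_smooth Q_pair[OF assms], of u] by (simp add: gr_def C.grad_def Om_def)

lemma gr_smooth:
  assumes a: "smooth_on (I \<times> snd c ` fst c) a"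
  shows "smooth_on (I \<times> snd c ` fst c) (\<lambda>z. gr c z (a z))"
  unfolding gr_def
proof (rule smooth_on_add[OF open_Q])
  have "bounded_linear (\<lambda>u. (0, u))"
    by (intro bounded_linear_Pair bounded_linear_zero bounded_linear_ident)
  from smooth_on_dd_apply[OF open_Q Om_smooth smooth_on_bounded_linear[OF this open_Q a]]
  show "smooth_on (I \<times> snd c ` fst c) (\<lambda>z. dd (Om c) (0, a z) z)" .
  show "smooth_on (I \<times> snd c ` fst c) (\<lambda>z. cGam c (snd z) (a z) (Om c z))"
  proof (rule smooth_on_apply2[where B = "\<lambda>z. cGam c (snd z)", OF open_Q _ _ _ a Om_smooth])
    show "smooth_on (I \<times> snd c ` fst c) (\<lambda>z. cGam c (snd z) u w)" for u w
      by (rule smooth_on_snd[OF cGam_smooth[OF c] open_img[OF c] I(1)])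
  qed (auto intro: C.Gam_linear1 C.Gam_linear2)
qed

lemma eden_smooth: "smooth_on (I \<times> snd c ` fst c) (eden c)"
  unfolding eden_def[abs_def]
proof (intro smooth_on_add smooth_on_sum smooth_on_const open_Q)
  fix j :: 'd
  have d: "smooth_on (I \<times> snd c ` fst c) (\<lambda>z. indef_inner.dual (cG c (snd z)) j)"
    by (rule smooth_on_snd[OF smooth_on_dual[OF open_img[OF c] cG_inner[OF c] cG_smooth[OF c]] open_img[OF c] I(1)])
  show "smooth_on (I \<times> snd c ` fst c) (\<lambda>z. cG c (snd z) (gr c z (indef_inner.dual (cG c (snd z)) j)) (gr c z (axis j 1)))"
  proof (rule smooth_on_apply2[where B = "\<lambda>z. cG c (snd z)", OF open_Q _ _ _ gr_smooth[OF d] gr_smooth[OF smooth_on_const[OF open_Q]]])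
    show "smooth_on (I \<times> snd c ` fst c) (\<lambda>z. cG c (snd z) u w)" for u w
      by (rule smooth_on_snd[OF cG_smooth[OF c] open_img[OF c] I(1)])
  qed (auto intro: C.G_linear)
qed

lemma density_chart:
  assumes t: "t \<in> I" and p: "p \<in> fst c"
  shows "density t p = eden c (t, snd c p)"
  unfolding density_def metric_trace_gradients(3)[OF W_smooth[OF t] W_smooth[OF t] c p] eden_def
  using p by (simp add: gr_grad[OF t])

lemma density_has_derivative:
  assumes t: "t \<in> I" and p: "p \<in> fst c"
  shows "((\<lambda>s. density s p) has_real_derivative dd (eden c) (1, 0) (t, snd c p)) (at t)"
proof (rule has_field_derivative_transform_within_open[OF _ I(1) t])
  have "(t, snd c p) \<in> I \<times> snd c ` fst c" using t p by auto
  from time_line[OF eden_smooth this]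
  show "((\<lambda>s. eden c (s, snd c p)) has_real_derivative dd (eden c) (1, 0) (t, snd c p)) (at t)"
    by (simp add: has_field_derivative_def mult.commute[of _ "dd _ _ _"])
qed (use density_chart p in simp)

lemma variation_field_chart:
  assumes p: "p \<in> fst c"
  shows "variation_field W p = coord_vec A c p (dd (Om c) (1, 0) (0, snd c p))"
proof
  fix f
  have y: "(0, snd c p) \<in> I \<times> snd c ` fst c" using I p by auto
  have tang: "W t p \<in> tangent_space A p" if "t \<in> I" for t
    using smooth_vf_tangent[OF W_smooth[OF that]] by simp
  show "variation_field W p f = coord_vec A c p (dd (Om c) (1, 0) (0, snd c p)) f"
  proof (cases "smooth_near A p f")
    case True
    obtain U where U: "open U" "p \<in> U" "U \<subseteq> fst c" "smooth_on (snd c ` U) (f \<circ> chart_inv c)"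
      using smooth_near_chart[OF c p True] by metis
    have yU: "snd c p \<in> snd c ` U" using U by auto
    have bl: "bounded_linear (\<lambda>v. dd (f \<circ> chart_inv c) v (snd c p))"
      using smooth_on_linear_dd[OF U(4) yU] linear_conv_bounded_linear by blast
    have "((\<lambda>t. dd (f \<circ> chart_inv c) (Om c (t, snd c p)) (snd c p)) has_derivative
        (\<lambda>h. dd (f \<circ> chart_inv c) (h *\<^sub>R dd (Om c) (1, 0) (0, snd c p)) (snd c p))) (at 0)"
      by (rule bounded_linear.has_derivative[OF bl time_line[OF Om_smooth y]])
    then have "((\<lambda>t. dd (f \<circ> chart_inv c) (Om c (t, snd c p)) (snd c p)) has_real_derivative
        dd (f \<circ> chart_inv c) (dd (Om c) (1, 0) (0, snd c p)) (snd c p)) (at 0)"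
      by (simp add: has_field_derivative_def dd_linear_combination(2)[OF U(4) yU] mult.commute[of _ "dd _ _ _"])
    then have "((\<lambda>t. W t p f) has_real_derivative dd (f \<circ> chart_inv c) (dd (Om c) (1, 0) (0, snd c p)) (snd c p)) (at 0)"
      by (rule has_field_derivative_transform_within_open[OF _ I])
        (use tangent_apply[OF c p tang, of _ f] True in \<open>simp add: Om_def coords_def chart_inv_left[OF c p]\<close>)
    then show ?thesis
      using True by (simp add: variation_field_def DERIV_imp_deriv coord_vec_dd)
  next
    case False
    have "((\<lambda>t. W t p f) has_real_derivative 0) (at 0)"
      by (rule has_field_derivative_transform_within_open[OF DERIV_const I])
        (use tangent_apply[OF c p tang, of _ f] False in simp)
    then show ?thesis
      using False by (simp add: variation_field_def DERIV_imp_deriv coord_vec_dd)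
  qed
qed

lemma coords_variation_field: "y \<in> snd c ` fst c \<Longrightarrow> coords c (variation_field W) y = dd (Om c) (1, 0) (0, y)"
  using variation_field_chart chart_inv_in[OF c] chart_inv_right[OF c] by (simp add: coords_def tcoords_coord_vec[OF c])

lemma variation_field_smooth_chart: "smooth_vf A (fst c) (variation_field W)"
  unfolding smooth_vf_chart[OF c open_dom[OF c] order_refl]
proof
  show "\<forall>p\<in>fst c. variation_field W p \<in> tangent_space A p"
    by (simp add: variation_field_chart coord_vec_tangent[OF c])
  have "bounded_linear (\<lambda>y::real^'d. (0::real, y))"
    by (intro bounded_linear_Pair bounded_linear_zero bounded_linear_ident)
  from smooth_on_compose[OF smooth_on_dd[OF Om_smooth] smooth_on_bounded_linear[OF this open_img[OF c] smooth_on_ident[OF open_img[OF c]]] open_img[OF c] open_Q]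
  have "smooth_on (snd c ` fst c) (\<lambda>y. dd (Om c) (1, 0) (0, y))" using I(2) by auto
  then show "smooth_on (snd c ` fst c) (coords c (variation_field W))"
    by (rule smooth_on_cong[OF _ open_img[OF c]]) (simp add: coords_variation_field)
qed

text \<open>Mixed derivatives of \<open>Om\<close> commute and the Christoffel symbols do not depend
  on time, so the time derivative of \<open>\<nabla>W\<close> is the covariant derivative of the
  velocity.\<close>

lemma gr_time_derivative:
  assumes y: "y \<in> snd c ` fst c"
  shows "((\<lambda>t. gr c (t, y) u) has_derivative (\<lambda>h. h *\<^sub>R C.grad (coords c (variation_field W)) y u)) (at 0)"
proof -
  have z: "(0, y) \<in> I \<times> snd c ` fst c" using I y by auto
  have bl: "bounded_linear (cGam c y u)" using C.Gam_linear2[OF y] linear_conv_bounded_linear by blast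
  have "dd (dd (Om c) (0, u)) (1, 0) (0, y) = dd (dd (Om c) (1, 0)) (0, u) (0, y)"
    by (rule dd_commute[OF open_Q Om_smooth z])
  also have "\<dots> = dd (\<lambda>y. dd (Om c) (1, 0) (0, y)) u y"
    by (rule dd_slice[OF smooth_on_dd[OF Om_smooth] z, symmetric])
  also have "\<dots> = dd (coords c (variation_field W)) u y"
    by (rule dd_cong[OF open_img[OF c] y]) (simp add: coords_variation_field)
  finally have 1: "dd (dd (Om c) (0, u)) (1, 0) (0, y) = dd (coords c (variation_field W)) u y" .
  have "((\<lambda>t. gr c (t, y) u) has_derivative
      (\<lambda>h. h *\<^sub>R dd (dd (Om c) (0, u)) (1, 0) (0, y) + cGam c y u (h *\<^sub>R dd (Om c) (1, 0) (0, y)))) (at 0)"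
    unfolding gr_def snd_conv
    by (rule has_derivative_add[OF time_line[OF smooth_on_dd[OF Om_smooth] z]
          bounded_linear.has_derivative[OF bl time_line[OF Om_smooth z]]])
  then show ?thesis
    by (simp add: 1 C.grad_def coords_variation_field[OF y] C.Gam_simps[OF y] scaleR_add_right)
qed

end

lemma variation_field_smooth: "smooth_vf A UNIV (variation_field W)"
proof (rule smooth_vf_local)
  fix p
  obtain c where "c \<in> A" "p \<in> fst c" using ex_chart by blast
  then show "\<exists>V. open V \<and> p \<in> V \<and> smooth_vf A V (variation_field W)"
    using variation_field_smooth_chart open_dom by blast
qed

lemma variation_field_outside: "p \<notin> K \<Longrightarrow> variation_field W p = 0"
proof
  fix f assume p: "p \<notin> K"
  have "((\<lambda>t. W t p f) has_real_derivative 0) (at 0)"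
    by (rule has_field_derivative_transform_within_open[OF DERIV_const I, of "V p f"]) (use W_outside p in simp)
  then show "variation_field W p f = 0 f" by (simp add: variation_field_def DERIV_imp_deriv)
qed

text \<open>Differentiate the constant squared length \<open>r\<close> in time at 0.\<close>

lemma variation_field_orthogonal: "g p (V p) (variation_field W p) = 0"
proof -
  obtain c where c: "c \<in> A" "p \<in> fst c" using ex_chart by blast
  have y: "snd c p \<in> snd c ` fst c" using c by auto
  interpret G: indef_inner "cG c (snd c p)" by (rule cG_inner[OF c(1) y])
  have z: "(0, snd c p) \<in> I \<times> snd c ` fst c" using I y by auto
  have tang: "W t p \<in> tangent_space A p" if "t \<in> I" for t
    using smooth_vf_tangent[OF W_smooth[OF that]] by simp
  have Om: "Om c (t, snd c p) = tcoords c (W t p)" for t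
    by (simp add: Om_def coords_def chart_inv_left[OF c])
  have "bilinear (cG c (snd c p))" using G.lin1 G.lin2 by (simp add: bilinear_def)
  then have bb: "bounded_bilinear (cG c (snd c p))" using bilinear_conv_bounded_bilinear by blast
  note d = time_line[OF Om_smooth[OF c(1)] z]
  have "((\<lambda>t. cG c (snd c p) (Om c (t, snd c p)) (Om c (t, snd c p))) has_derivative
     (\<lambda>h. cG c (snd c p) (Om c (0, snd c p)) (h *\<^sub>R dd (Om c) (1, 0) (0, snd c p)) +
        cG c (snd c p) (h *\<^sub>R dd (Om c) (1, 0) (0, snd c p)) (Om c (0, snd c p)))) (at 0)"
    by (rule bounded_bilinear.FDERIV[OF bb d d])
  moreover have "((\<lambda>t. cG c (snd c p) (Om c (t, snd c p)) (Om c (t, snd c p))) has_derivative (\<lambda>h. 0)) (at 0)"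
    by (rule has_derivative_transform_within_open[OF has_derivative_const I, of r])
      (use W_length tang in \<open>simp add: Om cG_coords[OF c, symmetric]\<close>)
  ultimately have "(\<lambda>h. cG c (snd c p) (Om c (0, snd c p)) (h *\<^sub>R dd (Om c) (1, 0) (0, snd c p)) +
        cG c (snd c p) (h *\<^sub>R dd (Om c) (1, 0) (0, snd c p)) (Om c (0, snd c p))) = (\<lambda>h. 0)"
    by (rule has_derivative_unique)
  from fun_cong[OF this, of 1]
  have "cG c (snd c p) (Om c (0, snd c p)) (dd (Om c) (1, 0) (0, snd c p)) = 0"
    using G.sym[of "dd (Om c) (1, 0) (0, snd c p)" "Om c (0, snd c p)"] by simp
  then show ?thesis
    using cG_coords[OF c, of "V p" "variation_field W p"] tang[OF I(2)]
      coord_vec_tangent[OF c(1), OF c(2), of "dd (Om c) (1, 0) (0, snd c p)"]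
    by (simp add: variation_field_chart[OF c] Om W_0 tcoords_coord_vec[OF c(1), OF c(2)])
qed

definition first_var :: "'m \<Rightarrow> real" where
  "first_var p = metric_trace A g p (\<lambda>u v. g p (cov_deriv_at A nabla V p u) (cov_deriv_at A nabla (variation_field W) p v))"

text \<open>The density is a symmetric quadratic expression in \<open>\<nabla>W\<close>, so the two
  Leibniz terms both equal \<open>first_var\<close>. The factor 2 cancels the 1/2 in the
  energy.\<close>

lemma density_derivative_0: "((\<lambda>t. density t p) has_real_derivative 2 * first_var p) (at 0)"
proof -
  obtain c where c: "c \<in> A" "p \<in> fst c" using ex_chart by blast
  interpret C: coord_metric "snd c ` fst c" "cG c" "cGam c" by (rule coord_metric[OF c(1)])
  have y: "snd c p \<in> snd c ` fst c" using c by auto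
  interpret G: indef_inner "cG c (snd c p)" by (rule cG_inner[OF c(1) y])
  let ?y = "snd c p" and ?w = "coords c (variation_field W)"
  have "bilinear (cG c ?y)" using G.lin1 G.lin2 by (simp add: bilinear_def)
  then have bb: "bounded_bilinear (cG c ?y)" using bilinear_conv_bounded_bilinear by blast
  have gr0: "gr c (0, ?y) u = C.grad (coords c V) ?y u" for u
    using gr_grad[OF c(1) I(2) y] by (simp add: W_0)
  have d: "((\<lambda>t. eden c (t, ?y)) has_derivative
    (\<lambda>h. \<Sum>j\<in>UNIV. cG c ?y (gr c (0, ?y) (G.dual j)) (h *\<^sub>R C.grad ?w ?y (axis j 1)) +
       cG c ?y (h *\<^sub>R C.grad ?w ?y (G.dual j)) (gr c (0, ?y) (axis j 1)))) (at 0)"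
    unfolding eden_def snd_conv
    by (rule has_derivative_eq_rhs, rule has_derivative_add[OF has_derivative_const has_derivative_sum],
        rule bounded_bilinear.FDERIV[OF bb gr_time_derivative[OF c(1) y] gr_time_derivative[OF c(1) y]]) simp
  have key: "(\<Sum>j\<in>UNIV. cG c ?y (gr c (0, ?y) (G.dual j)) (h *\<^sub>R C.grad ?w ?y (axis j 1)) +
       cG c ?y (h *\<^sub>R C.grad ?w ?y (G.dual j)) (gr c (0, ?y) (axis j 1))) = 2 * first_var p * h" for h
  proof -
    have "(\<Sum>j\<in>UNIV. cG c ?y (C.grad (coords c V) ?y (G.dual j)) (C.grad ?w ?y (axis j 1))) = first_var p"
      unfolding first_var_def by (rule metric_trace_gradients(1)[OF V_smooth variation_field_smooth c, symmetric])
    moreover have "(\<Sum>j\<in>UNIV. cG c ?y (C.grad ?w ?y (G.dual j)) (C.grad (coords c V) ?y (axis j 1))) = first_var p"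
      unfolding first_var_def metric_trace_gradients(2)[OF V_smooth variation_field_smooth c]
      by (rule metric_trace_gradients(1)[OF variation_field_smooth V_smooth c, symmetric])
    ultimately show ?thesis
      by (simp add: gr0 G.bsimps sum.distrib sum_distrib_left[symmetric])
  qed
  have "((\<lambda>t. eden c (t, ?y)) has_real_derivative 2 * first_var p) (at 0)"
    unfolding has_field_derivative_def by (rule has_derivative_eq_rhs[OF d]) (rule ext, rule key)
  then show ?thesis
    by (rule has_field_derivative_transform_within_open[OF _ I]) (simp add: density_chart[OF c(1) _ c(2)])
qed

section \<open>Differentiation under the integral sign\<close>

lemma density_continuous:
  assumes t: "t \<in> I"
  shows "continuous_on UNIV (density t)"
proof -
  have "isCont (density t) p" for p
  proof -
    obtain c where c: "c \<in> A" "p \<in> fst c" using ex_chart by blast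
    have "continuous_on (fst c) (\<lambda>q. eden c (t, snd c q))"
      by (rule continuous_on_compose2[OF smooth_on_continuous[OF eden_smooth[OF c(1)]]])
        (use t in \<open>auto intro!: continuous_intros continuous_on_chart[OF c(1)]\<close>)
    then have "continuous_on (fst c) (density t)"
      by (rule continuous_on_cong[THEN iffD1, rotated -1]) (simp_all add: density_chart[OF c(1) t])
    then show ?thesis using open_dom[OF c(1)] c(2) continuous_on_eq_continuous_at by blast
  qed
  then show ?thesis by (simp add: continuous_at_imp_continuous_on)
qed

lemma density_outside:
  assumes t: "t \<in> I" and p: "p \<notin> K"
  shows "density t p = density 0 p"
proof -
  obtain c where c: "c \<in> A" "p \<in> fst c" using ex_chart by blast
  interpret C: coord_metric "snd c ` fst c" "cG c" "cGam c" by (rule coord_metric[OF c(1)])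
  have o: "open (snd c ` (- K \<inter> fst c))"
    using open_chart_image[OF c(1)] compact_imp_closed[OF K] by auto
  have eq: "coords c (W t) y = coords c (W 0) y" if "y \<in> snd c ` (- K \<inter> fst c)" for y
    using that W_outside[OF t] by (auto simp: coords_def chart_inv_left[OF c(1)] W_0)
  have y: "snd c p \<in> snd c ` (- K \<inter> fst c)" using c p by auto
  have "C.grad (coords c (W t)) (snd c p) u = C.grad (coords c (W 0)) (snd c p) u" for u
    unfolding C.grad_def using dd_cong[OF o y eq] eq[OF y] by simp
  then show ?thesis
    unfolding density_def metric_trace_gradients(3)[OF W_smooth[OF t] W_smooth[OF t] c]
      metric_trace_gradients(3)[OF W_smooth[OF I(2)] W_smooth[OF I(2)] c] by simp
qed

text \<open>The dominating constant for the difference quotients: the time derivative is continuous,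
  hence bounded on a compact product, and the mean value estimate applies. The half interval is
  taken because the open interval of all times is not compact.\<close>

lemma density_derivative_bound:
  "\<exists>B. \<forall>p\<in>K. \<forall>t. \<bar>t\<bar> \<le> \<epsilon> / 2 \<longrightarrow> \<bar>density t p - density 0 p\<bar> \<le> B * \<bar>t\<bar>"
proof -
  \<comment> \<open>Defined without reference to a chart, so that its continuity can be checked
    locally and then used on all of \<open>K\<close>.\<close>
  define q where "q z = deriv (\<lambda>s. density s (snd z)) (fst z)" for z :: "real \<times> 'm"
  have q: "q (t, p) = dd (eden c) (1, 0) (t, snd c p)" if "c \<in> A" "p \<in> fst c" "t \<in> I" for c t p
    unfolding q_def by (simp add: DERIV_imp_deriv[OF density_has_derivative[OF that(1,3,2)]])
  have "isCont q (t, p)" if t: "t \<in> I" for t p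
  proof -
    obtain c where c: "c \<in> A" "p \<in> fst c" using ex_chart by blast
    have "continuous_on (I \<times> fst c) (\<lambda>z. dd (eden c) (1, 0) (fst z, snd c (snd z)))"
      by (rule continuous_on_compose2[OF smooth_on_continuous[OF smooth_on_dd[OF eden_smooth[OF c(1)]]]])
        (auto intro!: continuous_intros continuous_on_compose2[OF continuous_on_chart[OF c(1)]])
    then have "continuous_on (I \<times> fst c) q"
      by (rule continuous_on_cong[THEN iffD1, rotated -1]) (use q[OF c(1)] in auto)
    then show ?thesis
      using open_Times[OF I(1) open_dom[OF c(1)]] c(2) t continuous_on_eq_continuous_at[of "I \<times> fst c" q] by auto
  qed
  then have "continuous_on ({-\<epsilon>/2..\<epsilon>/2} \<times> K) q"
    using eps by (intro continuous_at_imp_continuous_on) (auto simp: I_def)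
  then have "bounded (q ` ({-\<epsilon>/2..\<epsilon>/2} \<times> K))"
    by (intro compact_imp_bounded compact_continuous_image compact_Times compact_Icc K)
  then obtain B where B: "\<forall>z\<in>{-\<epsilon>/2..\<epsilon>/2} \<times> K. norm (q z) \<le> B" unfolding bounded_iff by auto
  have "\<bar>density t p - density 0 p\<bar> \<le> B * \<bar>t\<bar>" if p: "p \<in> K" and t: "\<bar>t\<bar> \<le> \<epsilon> / 2" for p t
  proof -
    obtain c where c: "c \<in> A" "p \<in> fst c" using ex_chart by blast
    have "norm (density t p - density 0 p) \<le> B * norm (t - 0)"
    proof (rule field_differentiable_bound[where S = "{-\<epsilon>/2..\<epsilon>/2}" and f' = "\<lambda>s. q (s, p)"])
      fix s assume s: "s \<in> {-\<epsilon>/2..\<epsilon>/2}"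
      then have sI: "s \<in> I" using eps by (auto simp: I_def)
      show "((\<lambda>s. density s p) has_real_derivative q (s, p)) (at s within {-\<epsilon>/2..\<epsilon>/2})"
        unfolding q[OF c sI] by (rule has_field_derivative_at_within[OF density_has_derivative[OF c(1) sI c(2)]])
      show "norm (q (s, p)) \<le> B" using B s p by auto
    qed (use t eps in auto)
    then show ?thesis by simp
  qed
  then show ?thesis by blast
qed

text \<open>The difference quotients of the density vanish outside \<open>K\<close> and are bounded
  by a constant on \<open>K\<close>, which has finite volume; dominated convergence exchanges limit
  and integral. \<open>D\<close> has finite volume because its closure is compact.\<close>

theorem first_variation:
  assumes D: "open D" "compact (closure D)" "K \<subseteq> D"
  shows "((\<lambda>t. energy A g nabla \<mu> D (W t)) has_real_derivative integral\<^sup>L \<mu> first_var) (at 0)"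
proof -
  define S where "S = {-\<epsilon>/2<..<\<epsilon>/2}"
  have S: "open S" "0 \<in> S" "S \<subseteq> I" using eps by (auto simp: S_def I_def)
  have DS: "D \<in> sets \<mu>" using D(1) sets_\<mu> by simp
  have finD: "emeasure \<mu> D < \<infinity>"
  proof -
    have "emeasure \<mu> D \<le> emeasure \<mu> (closure D)" using sets_\<mu> by (intro emeasure_mono closure_subset) simp
    also have "\<dots> < \<infinity>" by (rule emeasure_compact_finite_volume[OF D(2)])
    finally show ?thesis .
  qed
  have meas: "density t \<in> borel_measurable \<mu>" if "t \<in> I" for t
    using borel_measurable_continuous_onI[OF density_continuous[OF that]] measurable_cong_sets[OF sets_\<mu> refl] by blast
  have int: "integrable \<mu> (\<lambda>p. indicator D p *\<^sub>R density t p)" if t: "t \<in> I" for t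
  proof -
    have "bounded (density t ` closure D)"
      by (intro compact_imp_bounded compact_continuous_image continuous_on_subset[OF density_continuous[OF t]] D(2)) simp
    then obtain B where B: "\<forall>p\<in>closure D. norm (density t p) \<le> B" unfolding bounded_iff by auto
    show ?thesis
    proof (rule integrableI_bounded_set[OF DS _ finD, where B = B])
      show "(\<lambda>p. indicator D p *\<^sub>R density t p) \<in> borel_measurable \<mu>"
        using DS meas[OF t] by measurable
      show "AE p in \<mu>. p \<in> D \<longrightarrow> norm (indicator D p *\<^sub>R density t p) \<le> B"
        using B closure_subset[of D] by auto
    qed auto
  qed
  have energy: "energy A g nabla \<mu> D (W t) = (1/2) * integral\<^sup>L \<mu> (\<lambda>p. indicator D p *\<^sub>R density t p)" for t
    by (simp add: energy_def set_lebesgue_integral_def density_def)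
  obtain B where B: "\<And>p t. p \<in> K \<Longrightarrow> \<bar>t\<bar> \<le> \<epsilon> / 2 \<Longrightarrow> \<bar>density t p - density 0 p\<bar> \<le> B * \<bar>t\<bar>"
    using density_derivative_bound by blast
  define Q where "Q t p = indicator D p *\<^sub>R ((density t p - density 0 p) / t)" for t p
  \<comment> \<open>\<open>first_var\<close> is a pointwise limit of measurable difference quotients
    along one sequence of admissible times, which is enough.\<close>
  have first_var_meas: "first_var \<in> borel_measurable \<mu>"
  proof (rule borel_measurable_LIMSEQ_real)
    define s where "s n = (\<epsilon> / 2) / real (Suc n)" for n
    have s: "s n \<in> I" "s n \<noteq> 0" for n
    proof -
      have "0 < s n" using eps by (simp add: s_def)
      moreover have "s n \<le> \<epsilon> / 2"
        using divide_left_mono[of 1 "real (Suc n)" "\<epsilon> / 2"] eps by (simp add: s_def)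
      ultimately show "s n \<in> I" "s n \<noteq> 0" using eps by (auto simp: I_def)
    qed
    show "(\<lambda>p. (density (s n) p - density 0 p) / s n / 2) \<in> borel_measurable \<mu>" for n
      using meas[OF s(1)[of n]] meas[OF I(2)] by measurable
    fix p
    have "((\<lambda>h. (density (0 + h) p - density 0 p) / h) \<longlongrightarrow> 2 * first_var p) (at 0)"
      using density_derivative_0[of p] by (simp add: DERIV_def)
    moreover have "filterlim s (at 0) sequentially"
      unfolding filterlim_at using s(2) tendsto_mult_left[OF LIMSEQ_Suc[OF lim_1_over_n], of "\<epsilon> / 2"]
      by (auto simp: s_def[abs_def])
    ultimately have "(\<lambda>n. (density (0 + s n) p - density 0 p) / s n) \<longlonglongrightarrow> 2 * first_var p"
      by (rule filterlim_compose)
    from tendsto_divide[OF this tendsto_const[of 2]]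
    show "(\<lambda>n. (density (s n) p - density 0 p) / s n / 2) \<longlonglongrightarrow> first_var p" by simp
  qed
  have zero_outside: "first_var p = 0" if "p \<notin> K" for p
  proof -
    have "((\<lambda>t. density t p) has_real_derivative 0) (at 0)"
      by (rule has_field_derivative_transform_within_open[OF DERIV_const I, of "density 0 p"])
        (use density_outside that in simp)
    from DERIV_unique[OF density_derivative_0[of p] this] show ?thesis by simp
  qed
  \<comment> \<open>Dominated convergence concerns sequences, so the limit at 0 is tested along
    arbitrary sequences within the half interval, where the uniform bound holds.\<close>
  have "((\<lambda>t. integral\<^sup>L \<mu> (Q t)) \<longlongrightarrow> integral\<^sup>L \<mu> (\<lambda>p. 2 * first_var p)) (at 0 within S)"
    unfolding tendsto_at_iff_sequentially
  proof (intro allI impI)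
    fix X :: "nat \<Rightarrow> real" assume X: "\<forall>i. X i \<in> S - {0}" and X0: "X \<longlonglongrightarrow> 0"
    have XI: "X i \<in> I" "X i \<noteq> 0" "\<bar>X i\<bar> \<le> \<epsilon> / 2" for i
    proof -
      have "X i \<in> S" "X i \<noteq> 0" using X by auto
      then show "X i \<in> I" "X i \<noteq> 0" "\<bar>X i\<bar> \<le> \<epsilon> / 2" using S(3) by (auto simp: S_def abs_le_iff)
    qed
    have "(\<lambda>i. integral\<^sup>L \<mu> (Q (X i))) \<longlonglongrightarrow> integral\<^sup>L \<mu> (\<lambda>p. 2 * first_var p)"
    proof (rule integral_dominated_convergence[where w = "\<lambda>p. B * indicator K p"])
      show "(\<lambda>p. 2 * first_var p) \<in> borel_measurable \<mu>" using first_var_meas by measurable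
      show "Q (X i) \<in> borel_measurable \<mu>" for i
        unfolding Q_def using DS meas[OF XI(1)[of i]] meas[OF I(2)] by measurable
      show "integrable \<mu> (\<lambda>p. B * indicator K p)"
        using emeasure_compact_finite_volume[OF K] borel_compact[OF K] sets_\<mu>
        by (intro integrable_mult_right integrable_real_indicator) auto
      show "AE p in \<mu>. norm (Q (X i) p) \<le> B * indicator K p" for i
      proof (rule AE_I2)
        fix p
        show "norm (Q (X i) p) \<le> B * indicator K p"
        proof (cases "p \<in> K")
          case True
          then have "\<bar>density (X i) p - density 0 p\<bar> / \<bar>X i\<bar> \<le> B"
            using B[OF True XI(3)[of i]] XI(2)[of i] by (simp add: divide_le_eq)
          then show ?thesis using True D(3) by (auto simp: Q_def)
        qed (simp add: Q_def density_outside[OF XI(1)])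
      qed
      show "AE p in \<mu>. (\<lambda>i. Q (X i) p) \<longlonglongrightarrow> 2 * first_var p"
      proof (rule AE_I2)
        fix p
        show "(\<lambda>i. Q (X i) p) \<longlonglongrightarrow> 2 * first_var p"
        proof (cases "p \<in> D")
          case True
          have "((\<lambda>h. (density (0 + h) p - density 0 p) / h) \<longlongrightarrow> 2 * first_var p) (at 0)"
            using density_derivative_0[of p] by (simp add: DERIV_def)
          moreover have "filterlim X (at 0) sequentially"
            unfolding filterlim_at using XI(2) X0 by auto
          ultimately have "(\<lambda>i. (density (0 + X i) p - density 0 p) / X i) \<longlonglongrightarrow> 2 * first_var p"
            by (rule filterlim_compose)
          then show ?thesis using True by (simp add: Q_def)
        next
          case False
          moreover have "first_var p = 0" by (rule zero_outside) (use False D(3) in blast)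
          ultimately show ?thesis by (simp add: Q_def)
        qed
      qed
    qed
    then show "((\<lambda>t. integral\<^sup>L \<mu> (Q t)) \<circ> X) \<longlonglongrightarrow> integral\<^sup>L \<mu> (\<lambda>p. 2 * first_var p)" by (simp add: o_def)
  qed
  then have "((\<lambda>t. integral\<^sup>L \<mu> (Q t)) \<longlongrightarrow> 2 * integral\<^sup>L \<mu> first_var) (at 0)"
    using at_within_open[OF S(2,1)] by simp
  from tendsto_mult[OF tendsto_const[of "1/2"] this]
  have "((\<lambda>t. (1/2) * integral\<^sup>L \<mu> (Q t)) \<longlongrightarrow> integral\<^sup>L \<mu> first_var) (at 0)" by simp
  moreover have "eventually (\<lambda>t. (1/2) * integral\<^sup>L \<mu> (Q t) =
      (energy A g nabla \<mu> D (W (0 + t)) - energy A g nabla \<mu> D (W 0)) / t) (at 0)"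
  proof (rule eventually_at_topological[THEN iffD2], intro exI[of _ I] conjI ballI impI)
    fix t assume t: "t \<in> I" "t \<noteq> 0"
    have "integral\<^sup>L \<mu> (Q t) = integral\<^sup>L \<mu> (\<lambda>p. (indicator D p *\<^sub>R density t p - indicator D p *\<^sub>R density 0 p) / t)"
      by (rule Bochner_Integration.integral_cong) (auto simp: Q_def indicator_def)
    also have "\<dots> = (integral\<^sup>L \<mu> (\<lambda>p. indicator D p *\<^sub>R density t p) - integral\<^sup>L \<mu> (\<lambda>p. indicator D p *\<^sub>R density 0 p)) / t"
      using int[OF t(1)] int[OF I(2)] by simp
    finally show "(1/2) * integral\<^sup>L \<mu> (Q t) =
      (energy A g nabla \<mu> D (W (0 + t)) - energy A g nabla \<mu> D (W 0)) / t"
      unfolding energy by (simp add: diff_divide_distrib)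
  qed (use I in auto)
  ultimately show ?thesis
    unfolding DERIV_def by (rule Lim_transform_eventually)
qed

end

section \<open>Paracontact metric manifolds\<close>

context coord_metric
begin

lemma smooth_on_covd:
  assumes F: "efield F"
  shows "smooth_on N (\<lambda>y. covd F y w v)"
proof -
  have k: "smooth_on N (\<lambda>z. d)" for d :: "real^'d" by (rule smooth_on_const[OF open_N])
  have "smooth_on N (\<lambda>y. F y (Gam y w v))"
    by (rule smooth_on_apply[OF open_N efieldD(1)[OF F] efieldD(2)[OF F] Gam_smooth])
  then show ?thesis
    unfolding covd_def
    by (intro smooth_on_diff smooth_on_add open_N smooth_on_dd efieldD(2)[OF F] smooth_on_Gam[OF open_N_N] k)
qed

lemma linear_dv:
  assumes F: "efield F" and x: "x \<in> N"
  shows "linear (dv F x)"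
  unfolding dv_def
  by (auto intro!: linearI simp: tr_add[symmetric] tr_scaleR[symmetric] linear_add[OF covd_linear(2)[OF F x]]
      linear_scale[OF covd_linear(2)[OF F x]])

lemma smooth_on_dv:
  assumes F: "efield F" and U: "open U" "U \<subseteq> N" and X: "smooth_on U X"
  shows "smooth_on U (\<lambda>y. dv F y (X y))"
proof (rule smooth_on_apply[OF U(1) _ _ X])
  show "linear (dv F y)" if "y \<in> U" for y using linear_dv[OF F] that U(2) by blast
  show "smooth_on U (\<lambda>y. dv F y v)" for v
    unfolding dv_def tr_def
    by (intro smooth_on_sum smooth_on_vec_nth smooth_on_mono[OF smooth_on_covd[OF F] U(2)] U(1))
qed

end

locale pc_mfd = vol_mfd A g nabla \<mu>
  for A :: "('m::{t2_space, second_countable_topology}, 'd::finite) chart set" and g nabla \<mu> +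
  fixes n :: nat and \<phi> :: "'m \<Rightarrow> 'm tvec \<Rightarrow> 'm tvec" and \<xi> :: "'m vfield" and \<eta> :: "'m \<Rightarrow> 'm tvec \<Rightarrow> real"
  assumes dim: "CARD('d) = 2 * n + 1"
    and paracontact: "paracontact_metric_structure A n \<phi> \<xi> \<eta> g"
begin

lemma eta_form: "one_form A \<eta>"
  and xi_smooth: "smooth_vf A UNIV \<xi>"
  and eta_xi: "\<eta> p (\<xi> p) = 1"
  and reeb_contraction: "v \<in> tangent_space A p \<Longrightarrow> ext_deriv A \<eta> p (\<xi> p) v = 0"
  and phi_tensor: "tensor11 A \<phi>"
  and eta_metric: "v \<in> tangent_space A p \<Longrightarrow> \<eta> p v = g p (\<xi> p) v"
  and deta_metric: "v \<in> tangent_space A p \<Longrightarrow> w \<in> tangent_space A p \<Longrightarrow> ext_deriv A \<eta> p v w = g p v (\<phi> p w)"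
  and phi_squared: "v \<in> tangent_space A p \<Longrightarrow> \<phi> p (\<phi> p v) = v - \<eta> p v *\<^sub>v \<xi> p"
  using paracontact unfolding paracontact_metric_structure_def contact_form_def reeb_field_def by simp_all

lemma xi_tangent: "\<xi> p \<in> tangent_space A p"
  using smooth_vf_tangent[OF xi_smooth] by simp

lemma xi_unit: "g p (\<xi> p) (\<xi> p) = 1"
  using eta_metric[OF xi_tangent] eta_xi by simp

lemma phi_smooth: "open U \<Longrightarrow> smooth_vf A U X \<Longrightarrow> smooth_vf A U (\<lambda>p. \<phi> p (X p))"
  using phi_tensor unfolding tensor11_def by blast

lemma phi_tangent:
  assumes "v \<in> tangent_space A p"
  shows "\<phi> p v \<in> tangent_space A p"
proof -
  obtain X where "local_extension A p v X" using ex_local_extension[OF assms] by blast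
  then obtain U where "open U" "p \<in> U" "smooth_vf A U X" "X p = v" unfolding local_extension_def by blast
  then show ?thesis using smooth_vf_tangent[OF phi_smooth, of U X p] by auto
qed

lemma phi_linear:
  assumes "u \<in> tangent_space A p" "v \<in> tangent_space A p"
  shows "\<phi> p (a *\<^sub>v u + b *\<^sub>v v) = a *\<^sub>v \<phi> p u + b *\<^sub>v \<phi> p v"
  using phi_tensor assms unfolding tensor11_def by blast

definition cphi :: "('m, 'd) chart \<Rightarrow> real ^ 'd \<Rightarrow> real ^ 'd \<Rightarrow> real ^ 'd" where
  "cphi c y v = tcoords c (\<phi> (chart_inv c y) (coord_vec A c (chart_inv c y) v))"

text \<open>The obstruction shared by the three assertions. In every chart it is the divergence of
  the symmetric part of \<open>\<nabla>\<xi>\<close>; the definition through the Ricci tensor spares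
  a proof that those local expressions agree.\<close>

definition delta :: "'m \<Rightarrow> 'm tvec \<Rightarrow> real" where
  "delta p v = ricci A nabla p (\<xi> p) v + 2 * real n * g p (\<xi> p) v"

context
  fixes c assumes c: "c \<in> A"
begin

interpretation C: coord_metric "snd c ` fst c" "cG c" "cGam c" by (rule coord_metric[OF c])

lemma xi_coords_smooth: "smooth_on (snd c ` fst c) (coords c \<xi>)"
  by (rule smooth_coords[OF c open_dom[OF c] order_refl smooth_vf_mono[OF xi_smooth subset_UNIV]])

lemma phi_coords: "p \<in> fst c \<Longrightarrow> v \<in> tangent_space A p \<Longrightarrow> tcoords c (\<phi> p v) = cphi c (snd c p) (tcoords c v)"
  by (simp add: cphi_def chart_inv_left[OF c] tangent_coords[OF c])

lemma cphi_efield: "C.efield (cphi c)"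
  unfolding C.efield_def
proof (intro conjI ballI allI)
  fix y assume y: "y \<in> snd c ` fst c"
  then have p: "chart_inv c y \<in> fst c" by (rule chart_inv_in[OF c])
  note t = coord_vec_tangent[OF c p]
  show "linear (cphi c y)"
  proof (rule linearI)
    show "cphi c y (u + v) = cphi c y u + cphi c y v" for u v
      using phi_linear[OF t t, of 1 u 1 v] by (simp add: cphi_def coord_vec_linear[OF c p] vscale_simps tcoords_simps)
    show "cphi c y (a *\<^sub>R v) = a *\<^sub>R cphi c y v" for a v
      using phi_linear[OF t t, of a v 0 v] by (simp add: cphi_def coord_vec_linear[OF c p] vscale_simps tcoords_simps)
  qed
next
  fix v
  from smooth_coords[OF c open_dom[OF c] order_refl phi_smooth[OF open_dom[OF c] cfield_const_smooth[OF c]]]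
  show "smooth_on (snd c ` fst c) (\<lambda>y. cphi c y v)"
    by (rule smooth_on_cong[OF _ open_img[OF c]]) (simp add: coords_def cphi_def cfield_def chart_inv_in[OF c])
qed

text \<open>Differentiating \<eta>(Y) and \<eta>(X) produces derivatives of the extensions, which
  cancel against \<eta> of the bracket. The remainder is the formula for fields with constant
  components.\<close>

lemma ext_deriv_coords:
  assumes p: "p \<in> fst c"
  shows "ext_deriv A \<eta> p (coord_vec A c p u) (coord_vec A c p v) =
    (dd (\<lambda>z. cG c z (coords c \<xi> z) v) u (snd c p) - dd (\<lambda>z. cG c z (coords c \<xi> z) u) v (snd c p)) / 2"
  unfolding ext_deriv_def
proof (rule tensor_at2_eqI[OF c p coord_vec_tangent[OF c p] coord_vec_tangent[OF c p]])
  fix X Y U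
  assume U: "open U" "p \<in> U" "U \<subseteq> fst c" and X: "smooth_vf A U X" and Y: "smooth_vf A U Y"
    and eq: "X p = coord_vec A c p u" "Y p = coord_vec A c p v"
  let ?y = "snd c p" and ?xi = "coords c \<xi>"
  have yU: "?y \<in> snd c ` U" and yN: "?y \<in> snd c ` fst c" using U by auto
  have sub: "snd c ` U \<subseteq> snd c ` fst c" using U by auto
  note o = open_image[OF c U(1,3)]
  interpret G: indef_inner "cG c ?y" by (rule cG_inner[OF c yN])
  have xiU: "smooth_on (snd c ` U) ?xi" by (rule smooth_on_mono[OF xi_coords_smooth sub])
  have Xy: "coords c X ?y = u" "coords c Y ?y = v"
    using eq by (simp_all add: coords_def chart_inv_left[OF c p] tcoords_coord_vec[OF c p])
  have eta: "\<eta> q (Z q) = cG c (snd c q) (?xi (snd c q)) (coords c Z (snd c q))"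
    if "q \<in> fst c" "Z q \<in> tangent_space A q" for q Z
    using that by (simp add: eta_metric cG_coords[OF c _ xi_tangent] coords_def chart_inv_left[OF c])
  have D: "Z p (\<lambda>q. \<eta> q (Z' q)) = cG c ?y (C.grad ?xi ?y (coords c Z ?y)) (coords c Z' ?y)
      + cG c ?y (?xi ?y) (C.grad (coords c Z') ?y (coords c Z ?y))"
    if Z: "smooth_vf A U Z" and Z': "smooth_vf A U Z'" for Z Z'
  proof -
    have sm: "smooth_fun A U (\<lambda>q. \<eta> q (Z' q))"
      using eta_form U(1) Z' unfolding one_form_def by blast
    have "Z p (\<lambda>q. \<eta> q (Z' q)) = dd ((\<lambda>q. \<eta> q (Z' q)) \<circ> chart_inv c) (coords c Z ?y) ?y"
      using vf_apply_coords[OF c U(1,3) Z sm yU] by (simp add: chart_inv_left[OF c p])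
    also have "\<dots> = dd (\<lambda>z. cG c z (?xi z) (coords c Z' z)) (coords c Z ?y) ?y"
    proof (rule dd_cong[OF o yU])
      fix z assume "z \<in> snd c ` U"
      then obtain q where q: "q \<in> U" "z = snd c q" by auto
      then show "((\<lambda>q. \<eta> q (Z' q)) \<circ> chart_inv c) z = cG c z (?xi z) (coords c Z' z)"
        using eta[of q Z'] U(3) smooth_vf_tangent[OF Z'] by (auto simp: chart_inv_left[OF c])
    qed
    also have "\<dots> = cG c ?y (C.grad ?xi ?y (coords c Z ?y)) (coords c Z' ?y)
      + cG c ?y (?xi ?y) (C.grad (coords c Z') ?y (coords c Z ?y))"
      by (rule C.dd_G[OF o sub xiU smooth_coords[OF c U(1,3) Z'] yU])
    finally show ?thesis .
  qed
  have L: "\<eta> p (lie_bracket A X Y p) = cG c ?y (?xi ?y) (dd (coords c Y) u ?y - dd (coords c X) v ?y)"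
    using eta[OF p, of "lie_bracket A X Y"] lie_bracket_coords[OF c U(1,3) X Y U(2)] coord_vec_tangent[OF c p]
    by (simp add: eq coords_at[OF c U(1,3) p] tcoords_coord_vec[OF c p])
  have K: "dd (\<lambda>z. cG c z (?xi z) a) b ?y = cG c ?y (C.grad ?xi ?y b) a + cG c ?y (?xi ?y) (cGam c ?y b a)" for a b
    using C.dd_G[OF C.open_N_N xi_coords_smooth smooth_on_const[OF open_img[OF c]] yN] by (simp add: C.grad_def dd_const)
  show "(X p (\<lambda>q. \<eta> q (Y q)) - Y p (\<lambda>q. \<eta> q (X q)) - \<eta> p (lie_bracket A X Y p)) / 2 =
    (dd (\<lambda>z. cG c z (?xi z) v) u ?y - dd (\<lambda>z. cG c z (?xi z) u) v ?y) / 2"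
    unfolding D[OF X Y] D[OF Y X] L K Xy by (simp add: C.grad_def G.bsimps Xy C.Gam_sym[OF yN, of u v])
qed

lemma coord_paracontact: "coord_paracontact (snd c ` fst c) (cG c) (cGam c) (coords c \<xi>) (cphi c)"
proof (rule coord_paracontact.intro[OF C.coord_metric_axioms])
  show "coord_paracontact_axioms (snd c ` fst c) (cG c) (coords c \<xi>) (cphi c)"
  proof (rule coord_paracontact_axioms.intro[OF xi_coords_smooth cphi_efield])
    fix y assume y: "y \<in> snd c ` fst c"
    define p where "p = chart_inv c y"
    have p: "p \<in> fst c" and yp: "snd c p = y" using chart_inv_in[OF c y] chart_inv_right[OF c y] by (auto simp: p_def)
    note t = coord_vec_tangent[OF c p]
    have xi: "coords c \<xi> y = tcoords c (\<xi> p)" by (simp add: coords_def p_def)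
    have ph: "cphi c y v = tcoords c (\<phi> p (coord_vec A c p v))" for v by (simp add: cphi_def p_def)
    have G: "cG c y (tcoords c u) (tcoords c v) = g p u v" if "u \<in> tangent_space A p" "v \<in> tangent_space A p" for u v
      using cG_coords[OF c p that] yp by simp
    show "cG c y (coords c \<xi> y) (coords c \<xi> y) = 1"
      unfolding xi using G[OF xi_tangent xi_tangent] xi_unit by simp
    show "cG c y u (cphi c y v) =
        (dd (\<lambda>z. cG c z (coords c \<xi> z) v) u y - dd (\<lambda>z. cG c z (coords c \<xi> z) u) v y) / 2" for u v
      using ext_deriv_coords[OF p, of u v] deta_metric[OF t t, of u v] G[OF t phi_tangent[OF t], of u v]
      by (simp add: ph yp tcoords_coord_vec[OF c p])
    show "cG c y (coords c \<xi> y) (cphi c y v) = 0" for v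
      using reeb_contraction[OF t, of v] deta_metric[OF xi_tangent t, of v] G[OF xi_tangent phi_tangent[OF t], of v]
      by (simp add: ph xi)
    show "cphi c y (cphi c y v) = v - cG c y (coords c \<xi> y) v *\<^sub>R coords c \<xi> y" for v
    proof -
      have "cphi c y (cphi c y v) = tcoords c (\<phi> p (\<phi> p (coord_vec A c p v)))"
        using phi_coords[OF p phi_tangent[OF t], of v] by (simp add: ph yp)
      then show ?thesis
        using G[OF xi_tangent t, of v] eta_metric[OF t, of v]
        by (simp add: phi_squared[OF t] tcoords_simps tcoords_coord_vec[OF c p] xi)
    qed
  qed
qed

interpretation P: coord_paracontact "snd c ` fst c" "cG c" "cGam c" "coords c \<xi>" "cphi c"
  by (rule coord_paracontact)

text \<open>After brackets are replaced by differences of covariant derivatives, the derivatives of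
  the extension \<open>X\<close> along \<xi> cancel, and \<open>h_coordinates\<close> identifies the
  rest.\<close>

lemma paracontact_h_coords:
  assumes p: "p \<in> fst c"
  shows "paracontact_h A \<phi> \<xi> p (coord_vec A c p u) = coord_vec A c p (cphi c (snd c p) (P.S (snd c p) u))"
  unfolding paracontact_h_def
proof (rule tensor_at1_eqI[OF c p coord_vec_tangent[OF c p]])
  fix X U
  assume U: "open U" "p \<in> U" "U \<subseteq> fst c" and X: "smooth_vf A U X" and eq: "X p = coord_vec A c p u"
  let ?y = "snd c p" and ?xi = "coords c \<xi>"
  have yU: "?y \<in> snd c ` U" and yN: "?y \<in> snd c ` fst c" using U by auto
  have sub: "snd c ` U \<subseteq> snd c ` fst c" using U by auto
  note o = open_image[OF c U(1,3)]
  have xiU: "smooth_vf A U \<xi>" by (rule smooth_vf_mono[OF xi_smooth subset_UNIV])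
  have phiX: "smooth_vf A U (\<lambda>q. \<phi> q (X q))" by (rule phi_smooth[OF U(1) X])
  have Xy: "coords c X ?y = u" using eq by (simp add: coords_def chart_inv_left[OF c p] tcoords_coord_vec[OF c p])
  have phiX_coords: "coords c (\<lambda>q. \<phi> q (X q)) z = cphi c z (coords c X z)" if "z \<in> snd c ` U" for z
    using that U(3) phi_coords smooth_vf_tangent[OF X] by (auto simp: coords_def chart_inv_left[OF c])
  have br: "C.bracket Z Z' ?y = C.grad Z' ?y (Z ?y) - C.grad Z ?y (Z' ?y)" for Z Z'
    using C.bracket_nab[OF o sub yU] by (simp add: C.nab_def C.grad_def)
  note L = coords_lie_bracket[OF c U(1,3)]
  have t1: "lie_bracket A \<xi> (\<lambda>q. \<phi> q (X q)) p \<in> tangent_space A p" and t2: "lie_bracket A \<xi> X p \<in> tangent_space A p"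
    using smooth_vf_tangent[OF lie_bracket_smooth[OF c U(1,3)] U(2)] xiU phiX X by blast+
  have tc: "tcoords c (Z p) = coords c Z ?y" for Z by (simp add: coords_def chart_inv_left[OF c p])
  have "tcoords c ((1/2) *\<^sub>v (lie_bracket A \<xi> (\<lambda>q. \<phi> q (X q)) p - \<phi> p (lie_bracket A \<xi> X p))) =
    (1/2) *\<^sub>R (C.bracket ?xi (\<lambda>z. cphi c z (coords c X z)) ?y - cphi c ?y (C.bracket ?xi (coords c X) ?y))"
    unfolding tcoords_simps phi_coords[OF p t2] tc L[OF xiU phiX yU] L[OF xiU X yU]
    using C.nab_cong(2)[OF o yU refl phiX_coords] by simp
  also have "C.bracket ?xi (\<lambda>z. cphi c z (coords c X z)) ?y =
      C.covd (cphi c) ?y (?xi ?y) u + cphi c ?y (C.grad (coords c X) ?y (?xi ?y)) - C.grad ?xi ?y (cphi c ?y u)"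
    unfolding br C.nab_apply[OF o sub cphi_efield smooth_coords[OF c U(1,3) X] yU] Xy ..
  also have "cphi c ?y (C.bracket ?xi (coords c X) ?y) = cphi c ?y (C.grad (coords c X) ?y (?xi ?y)) - cphi c ?y (C.grad ?xi ?y u)"
    unfolding br Xy linear_diff[OF C.efieldD(1)[OF cphi_efield yN]] ..
  also have "(1/2) *\<^sub>R (C.covd (cphi c) ?y (?xi ?y) u + cphi c ?y (C.grad (coords c X) ?y (?xi ?y)) - C.grad ?xi ?y (cphi c ?y u)
      - (cphi c ?y (C.grad (coords c X) ?y (?xi ?y)) - cphi c ?y (C.grad ?xi ?y u))) = cphi c ?y (P.S ?y u)"
    unfolding P.h_coordinates[OF yN, symmetric] by (simp add: algebra_simps)
  finally show "(1/2) *\<^sub>v (lie_bracket A \<xi> (\<lambda>q. \<phi> q (X q)) p - \<phi> p (lie_bracket A \<xi> X p)) =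
      coord_vec A c p (cphi c ?y (P.S ?y u))"
    by (rule tangent_tcoords_eqI[OF c p, rotated]) (intro tangent_closed t1 phi_tangent t2)
qed

lemma delta_coords:
  assumes p: "p \<in> fst c"
  shows "delta p (coord_vec A c p w) = C.dv P.S (snd c p) w"
proof -
  have y: "snd c p \<in> snd c ` fst c" using p by auto
  have "\<xi> p = coord_vec A c p (coords c \<xi> (snd c p))"
    using tangent_coords[OF c p xi_tangent] by (simp add: coords_def chart_inv_left[OF c p])
  then show ?thesis
    unfolding delta_def using P.ric_xi[OF y, of w] dim
    by (simp add: ricci_coords[OF c p] g_coord_vec[OF c p])
qed

lemma trace_h_squared_coords:
  assumes p: "p \<in> fst c"
  shows "endo_trace A p (\<lambda>v. paracontact_h A \<phi> \<xi> p (paracontact_h A \<phi> \<xi> p v)) = delta p (\<xi> p)"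
proof -
  have y: "snd c p \<in> snd c ` fst c" using p by auto
  let ?h = "\<lambda>v. cphi c (snd c p) (P.S (snd c p) v)"
  have h: "paracontact_h A \<phi> \<xi> p (paracontact_h A \<phi> \<xi> p (coord_vec A c p u)) = coord_vec A c p (?h (?h u))" for u
    by (simp add: paracontact_h_coords[OF p])
  have lin: "linear ?h"
    using linear_compose[OF C.efieldD(1)[OF P.S_efield y] C.efieldD(1)[OF cphi_efield y]] by (simp add: o_def)
  have "endo_trace A p (\<lambda>v. paracontact_h A \<phi> \<xi> p (paracontact_h A \<phi> \<xi> p v)) =
    tr (\<lambda>u. tcoords c (paracontact_h A \<phi> \<xi> p (paracontact_h A \<phi> \<xi> p (coord_vec A c p u))))"
  proof (rule endo_trace_chart[OF c p])
    fix v assume "v \<in> tangent_space A p"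
    then show "paracontact_h A \<phi> \<xi> p (paracontact_h A \<phi> \<xi> p v) \<in> tangent_space A p"
      using h[of "tcoords c v"] tangent_coords[OF c p] coord_vec_tangent[OF c p] by simp
  next
    show "linear (\<lambda>u. tcoords c (paracontact_h A \<phi> \<xi> p (paracontact_h A \<phi> \<xi> p (coord_vec A c p u))))"
      unfolding h tcoords_coord_vec[OF c p] using linear_compose[OF lin lin] by (simp add: o_def)
  qed
  also have "\<dots> = C.dv P.S (snd c p) (coords c \<xi> (snd c p))"
    unfolding h tcoords_coord_vec[OF c p] by (rule P.dv_S_xi[OF y, symmetric])
  also have "\<dots> = delta p (\<xi> p)"
    unfolding delta_coords[OF p, symmetric] coords_at[OF c open_dom[OF c] order_refl p] tangent_coords[OF c p xi_tangent] ..
  finally show ?thesis .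
qed

text \<open>The traced Lie derivative is the vector \<Lambda>. Pairing it with \<open>w\<close>
  gives \<open>ric(\<xi>, w)\<close> plus the divergence of the adjoint of
  \<open>\<nabla>\<xi>\<close>; their \<eta> terms have opposite signs, so the sum is
  \<open>2 * delta\<close>, and nondegeneracy finishes.\<close>

lemma lie_trace_coords:
  assumes p: "p \<in> fst c"
  shows "(\<forall>f. metric_trace A g p (\<lambda>v w. lie_deriv_connection A nabla \<xi> p v w f) = 0) \<longleftrightarrow>
    (\<forall>w. delta p (coord_vec A c p w) = 0)"
proof -
  have y: "snd c p \<in> snd c ` fst c" using p by auto
  let ?y = "snd c p"
  interpret G: indef_inner "cG c ?y" by (rule cG_inner[OF c y])
  obtain E where E: "G.orthonormal E"
    "\<And>B. metric_trace A g p B = (\<Sum>i\<in>UNIV. cG c ?y (E i) (E i) * B (coord_vec A c p (E i)) (coord_vec A c p (E i)))"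
    by (rule metric_trace_frame[OF c p]) blast
  define Lie where "Lie e = C.curv ?y (coords c \<xi> ?y) e e + C.covd (C.grad (coords c \<xi>)) ?y e e" for e
  define \<Lambda> where "\<Lambda> = (\<Sum>i\<in>UNIV. cG c ?y (E i) (E i) *\<^sub>R Lie (E i))"
  have lin: "linear (\<lambda>v. coord_vec A c p v f)" for f
    by (rule linearI) (simp_all add: coord_vec_linear[OF c p] vscale_def)
  have "metric_trace A g p (\<lambda>v w. lie_deriv_connection A nabla \<xi> p v w f) = coord_vec A c p \<Lambda> f" for f
    unfolding E(2) lie_deriv_connection_coords[OF c p xi_smooth] \<Lambda>_def linear_sum[OF lin] linear_scale[OF lin] Lie_def
    by (simp add: coords_at[OF c open_dom[OF c] order_refl p])
  then have "(\<forall>f. metric_trace A g p (\<lambda>v w. lie_deriv_connection A nabla \<xi> p v w f) = 0) \<longleftrightarrow> coord_vec A c p \<Lambda> = 0"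
    by (auto simp: fun_eq_iff)
  also have "\<dots> \<longleftrightarrow> \<Lambda> = 0"
    using tcoords_coord_vec[OF c p, of \<Lambda>] coord_vec_linear(4)[OF c p] by (metis tcoords_simps(4))
  also have "\<dots> \<longleftrightarrow> (\<forall>w. cG c ?y \<Lambda> w = 0)"
    using G.nondegenerate by (auto simp: G.bsimps)
  also have "\<dots> \<longleftrightarrow> (\<forall>w. delta p (coord_vec A c p w) = 0)"
  proof -
    have "cG c ?y \<Lambda> w = 2 * delta p (coord_vec A c p w)" for w
    proof -
      have "cG c ?y \<Lambda> w = (\<Sum>i\<in>UNIV. cG c ?y (E i) (E i) * cG c ?y (Lie (E i)) w)"
        by (simp add: \<Lambda>_def G.left_sum G.bsimps)
      also have "\<dots> = C.ric ?y (coords c \<xi> ?y) w + C.dv P.grad_adj ?y w"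
        unfolding Lie_def
        by (rule C.contracted_lie_derivative[OF E(1) y C.efield_grad[OF xi_coords_smooth] P.grad_adj_efield P.grad_adjoint])
      also have "\<dots> = 2 * delta p (coord_vec A c p w)"
        unfolding P.ric_xi[OF y] P.dv_grad_adj[OF y] delta_coords[OF p] by simp
      finally show ?thesis .
    qed
    then show ?thesis by simp
  qed
  finally show ?thesis .
qed

text \<open>Integration by parts before integrating. Moving \<open>\<nabla>\<xi>\<close> across the
  metric produces its adjoint \<open>\<nabla>\<xi> + 2 \<phi>\<close>, which explains the field
  whose divergence appears; by the product rule the other part of that divergence is the adjoint's
  own divergence, evaluated on \<open>w\<close>.\<close>

lemma gradient_pairing_coords:
  assumes p: "p \<in> fst c" and w: "smooth_vf A UNIV w"
  shows "metric_trace A g p (\<lambda>u v. g p (cov_deriv_at A nabla \<xi> p u) (cov_deriv_at A nabla w p v)) =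
    divergence (nabla w \<xi> + (\<lambda>q. 2 *\<^sub>v \<phi> q (w q))) p - delta p (w p) - 2 * real n * g p (\<xi> p) (w p)"
proof -
  let ?y = "snd c p" and ?w = "coords c w"
  let ?X = "nabla w \<xi> + (\<lambda>q. 2 *\<^sub>v \<phi> q (w q))"
  have y: "?y \<in> snd c ` fst c" using p by auto
  interpret G: indef_inner "cG c ?y" by (rule cG_inner[OF c y])
  have wc: "smooth_vf A (fst c) w" and xic: "smooth_vf A (fst c) \<xi>"
    using smooth_vf_mono[OF w] smooth_vf_mono[OF xi_smooth] by auto
  have X: "smooth_vf A UNIV ?X"
    by (intro smooth_vf_add smooth_vf_scale smooth_fun_const phi_smooth nabla_smooth open_UNIV w xi_smooth)
  have wp: "w p = coord_vec A c p (?w ?y)"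
    using tangent_coords[OF c p smooth_vf_tangent[OF w UNIV_I]] by (simp add: coords_at[OF c open_dom[OF c] order_refl p])
  have xip: "\<xi> p = coord_vec A c p (coords c \<xi> ?y)"
    using tangent_coords[OF c p xi_tangent] by (simp add: coords_at[OF c open_dom[OF c] order_refl p])
  have Xc: "coords c ?X z = P.grad_adj z (?w z)" if zN: "z \<in> snd c ` fst c" for z
  proof -
    obtain q where q: "q \<in> fst c" "z = snd c q" using zN by auto
    have "coords c ?X z = coords c (nabla w \<xi>) z + 2 *\<^sub>R cphi c z (?w z)"
      using phi_coords[OF q(1) smooth_vf_tangent[OF w UNIV_I]]
      by (simp add: coords_def q(2) chart_inv_left[OF c q(1)] tcoords_simps)
    then show ?thesis
      using coords_nabla[OF c open_dom[OF c] order_refl wc xic zN]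
      by (simp add: C.nab_def C.grad_def P.grad_adj_def P.S_def scaleR_2)
  qed
  have sw: "smooth_on (snd c ` fst c) ?w" by (rule smooth_coords[OF c open_dom[OF c] order_refl wc])
  have "C.grad (coords c ?X) ?y u = C.covd P.grad_adj ?y u (?w ?y) + P.grad_adj ?y (C.grad ?w ?y u)" for u
    using C.nab_apply[OF C.open_N_N P.grad_adj_efield sw y, of u] dd_cong[OF open_img[OF c] y Xc, where v = u] Xc[OF y]
    by (simp add: C.grad_def)
  then have "divergence ?X p = C.dv P.grad_adj ?y (?w ?y) + tr (\<lambda>u. P.grad_adj ?y (C.grad ?w ?y u))"
    unfolding divergence_chart[OF X c p] C.dv_def tr_add[symmetric] by (simp add: tr_def)
  moreover have "C.dv P.grad_adj ?y (?w ?y) = delta p (w p) + 2 * real n * g p (\<xi> p) (w p)"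
    unfolding P.dv_grad_adj[OF y] wp delta_coords[OF p] unfolding xip g_coord_vec[OF c p] using dim by simp
  moreover have "metric_trace A g p (\<lambda>u v. g p (cov_deriv_at A nabla \<xi> p u) (cov_deriv_at A nabla w p v)) =
      tr (\<lambda>u. P.grad_adj ?y (C.grad ?w ?y u))"
    unfolding metric_trace_gradients(1)[OF xi_smooth w c p] P.grad_adjoint[OF y] G.dual_apply tr_def ..
  ultimately show ?thesis by simp
qed

lemma delta_smooth_chart:
  assumes U: "open U" "U \<subseteq> fst c" and X: "smooth_vf A U X"
  shows "smooth_fun A U (\<lambda>p. delta p (X p))"
  unfolding smooth_fun_chart[OF c U]
proof -
  have sub: "snd c ` U \<subseteq> snd c ` fst c" using U by auto
  from C.smooth_on_dv[OF P.S_efield open_image[OF c U] sub smooth_coords[OF c U X]]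
  show "smooth_on (snd c ` U) ((\<lambda>p. delta p (X p)) \<circ> chart_inv c)"
  proof (rule smooth_on_cong[OF _ open_image[OF c U]])
    fix y assume "y \<in> snd c ` U"
    then obtain q where q: "q \<in> U" "y = snd c q" by auto
    then have qc: "q \<in> fst c" using U by auto
    have "X q = coord_vec A c q (coords c X y)"
      using tangent_coords[OF c qc smooth_vf_tangent[OF X q(1)]] coords_at[OF c U qc] q by simp
    then show "C.dv P.S y (coords c X y) = ((\<lambda>p. delta p (X p)) \<circ> chart_inv c) y"
      using delta_coords[OF qc] q by (simp add: chart_inv_left[OF c qc])
  qed
qed

lemma delta_linear:
  assumes p: "p \<in> fst c"
  shows "linear (\<lambda>w. delta p (coord_vec A c p w))"
  unfolding delta_coords[OF p] by (rule C.linear_dv[OF P.S_efield]) (use p in auto)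

end

section \<open>The assertions in terms of the global 1-form\<close>

lemma delta_smooth: "smooth_vf A UNIV X \<Longrightarrow> smooth_fun A UNIV (\<lambda>p. delta p (X p))"
  by (rule smooth_fun_local) (metis ex_chart delta_smooth_chart open_dom order_refl smooth_vf_mono subset_UNIV)

lemma delta_scale:
  assumes "v \<in> tangent_space A p"
  shows "delta p (a *\<^sub>v v) = a * delta p v"
proof -
  obtain c where c: "c \<in> A" "p \<in> fst c" using ex_chart by blast
  show ?thesis
    using linear_scale[OF delta_linear[OF c], of a "tcoords c v"]
    by (simp add: coord_vec_linear[OF c(1), OF c(2)] tangent_coords[OF c(1), OF c(2) assms])
qed

lemma delta_diff:
  assumes "u \<in> tangent_space A p" "v \<in> tangent_space A p"
  shows "delta p (u - v) = delta p u - delta p v"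
proof -
  obtain c where c: "c \<in> A" "p \<in> fst c" using ex_chart by blast
  show ?thesis
    using linear_diff[OF delta_linear[OF c], of "tcoords c u" "tcoords c v"]
    by (simp add: coord_vec_linear[OF c(1), OF c(2)] tangent_coords[OF c(1), OF c(2)] assms)
qed

lemma delta_zero_iff_coords:
  "c \<in> A \<Longrightarrow> p \<in> fst c \<Longrightarrow> (\<forall>w. delta p (coord_vec A c p w) = 0) \<longleftrightarrow> (\<forall>v\<in>tangent_space A p. delta p v = 0)"
  by (auto simp: tangent_space_chart)

lemma ricci_operator_iff:
  "(\<forall>p. ricci_operator A g nabla p (\<xi> p) = (- 2 * real n) *\<^sub>v \<xi> p) \<longleftrightarrow> (\<forall>p. \<forall>v\<in>tangent_space A p. delta p v = 0)"
proof -
  have "ricci_operator A g nabla p (\<xi> p) = (- 2 * real n) *\<^sub>v \<xi> p \<longleftrightarrow> (\<forall>v\<in>tangent_space A p. delta p v = 0)" for p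
    unfolding ricci_operator_eq_iff[OF xi_tangent tangent_closed(2)[OF xi_tangent]]
    by (auto simp: delta_def g_scale[OF xi_tangent xi_tangent])
  then show ?thesis by simp
qed

lemma infinitesimal_harmonic_iff:
  "infinitesimal_harmonic A g nabla \<xi> \<longleftrightarrow> (\<forall>p. \<forall>v\<in>tangent_space A p. delta p v = 0)"
proof -
  have "(\<forall>f. metric_trace A g p (\<lambda>v w. lie_deriv_connection A nabla \<xi> p v w f) = 0) \<longleftrightarrow>
      (\<forall>v\<in>tangent_space A p. delta p v = 0)" for p
  proof -
    obtain c where c: "c \<in> A" "p \<in> fst c" using ex_chart by blast
    show ?thesis using lie_trace_coords[OF c] delta_zero_iff_coords[OF c] by simp
  qed
  then show ?thesis unfolding infinitesimal_harmonic_def using xi_smooth by simp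
qed

lemma trace_h_squared:
  "endo_trace A p (\<lambda>v. paracontact_h A \<phi> \<xi> p (paracontact_h A \<phi> \<xi> p v)) = delta p (\<xi> p)"
  using ex_chart trace_h_squared_coords by blast

text \<open>In the pointwise pairing formula the \<eta> term drops out because the velocity is
  orthogonal to \<xi>, and the divergence integrates to 0 because its field vanishes outside the
  compact set \<open>K\<close>.\<close>

lemma energy_derivative:
  assumes "energy_variation A g nabla \<mu> r \<epsilon> K \<xi> W"
  shows "integral\<^sup>L \<mu> (energy_variation.first_var A g nabla \<xi> W) = - integral\<^sup>L \<mu> (\<lambda>p. delta p (variation_field W p))"
proof -
  interpret E: energy_variation A g nabla \<mu> r \<epsilon> K \<xi> W by (rule assms)
  let ?w = "variation_field W"
  let ?X = "nabla ?w \<xi> + (\<lambda>q. 2 *\<^sub>v \<phi> q (?w q))"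
  note w = E.variation_field_smooth and w0 = E.variation_field_outside
  have X: "smooth_vf A UNIV ?X"
    by (intro smooth_vf_add smooth_vf_scale smooth_fun_const phi_smooth nabla_smooth open_UNIV w xi_smooth)
  have phi0: "\<phi> p 0 = 0" for p
    using phi_linear[OF tangent_closed(4) tangent_closed(4), of p 0 0] by (simp add: vscale_simps)
  have X0: "?X p = 0" if "p \<notin> K" for p
  proof -
    have o: "open (- K)" using compact_imp_closed[OF E.K] by auto
    have "nabla ?w \<xi> p = 0"
      by (rule nabla_zero1[OF o smooth_vf_mono[OF xi_smooth] smooth_vf_mono[OF w]]) (use w0 that in auto)
    then show ?thesis using w0[OF that] by (simp add: phi0 vscale_simps)
  qed
  have eq: "E.first_var p = divergence ?X p - delta p (?w p)" for p
  proof -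
    obtain c where c: "c \<in> A" "p \<in> fst c" using ex_chart by blast
    show ?thesis
      unfolding E.first_var_def gradient_pairing_coords[OF c w] E.variation_field_orthogonal by simp
  qed
  have i1: "integrable \<mu> (divergence ?X)"
    by (rule integrable_compact_support[OF divergence_continuous[OF X] E.K])
      (rule divergence_zero_outside[OF X compact_imp_closed[OF E.K] X0])
  have i2: "integrable \<mu> (\<lambda>p. delta p (?w p))"
  proof (rule integrable_compact_support[OF smooth_fun_continuous[OF delta_smooth[OF w]] E.K])
    fix p assume "p \<notin> K"
    then show "delta p (?w p) = 0" using w0 delta_scale[OF tangent_closed(4), of p 0] by (simp add: vscale_simps)
  qed
  have "integral\<^sup>L \<mu> E.first_var = integral\<^sup>L \<mu> (\<lambda>p. divergence ?X p - delta p (?w p))"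
    by (rule Bochner_Integration.integral_cong[OF refl eq])
  also have "\<dots> = integral\<^sup>L \<mu> (divergence ?X) - integral\<^sup>L \<mu> (\<lambda>p. delta p (?w p))"
    by (rule Bochner_Integration.integral_diff[OF i1 i2])
  also have "integral\<^sup>L \<mu> (divergence ?X) = 0" by (rule divergence_theorem[OF X E.K X0])
  finally show ?thesis by simp
qed

text \<open>A field \<open>Y \<bottom> \<xi>\<close> of compact support is the variation field of the normalization of \<open>\<xi> + tY\<close>.\<close>
lemma normalized_variation:
  assumes Y: "smooth_vf A UNIV Y" and K: "compact K" and Y0: "\<And>p. p \<notin> K \<Longrightarrow> Y p = 0"
    and orth: "\<And>p. g p (\<xi> p) (Y p) = 0"
  obtains \<epsilon> W where "\<epsilon> > 0" "length_variation A g 1 K \<epsilon> \<xi> W" "variation_field W = Y"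
proof -
  define \<gamma> where "\<gamma> p = g p (Y p) (Y p)" for p
  have Yt: "Y p \<in> tangent_space A p" for p using smooth_vf_tangent[OF Y] by simp
  have \<gamma>s: "smooth_fun A UNIV \<gamma>" unfolding \<gamma>_def[abs_def] by (rule g_smooth[OF open_UNIV Y Y])
  have \<gamma>0: "\<gamma> p = 0" if "p \<notin> K" for p
    using g_scale[OF Yt Yt Yt, of p 0] Y0[OF that] by (simp add: \<gamma>_def vscale_simps)
  have "bounded (\<gamma> ` K)"
    by (intro compact_imp_bounded compact_continuous_image continuous_on_subset[OF smooth_fun_continuous[OF \<gamma>s]] K) simp
  then obtain B0 where B0: "\<forall>p\<in>K. norm (\<gamma> p) \<le> B0" unfolding bounded_iff by auto
  define B where "B = max B0 0"
  have B: "\<bar>\<gamma> p\<bar> \<le> B" "B \<ge> 0" for p using B0 \<gamma>0[of p] unfolding B_def by (cases "p \<in> K"; fastforce)+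
  \<comment> \<open>\<gamma> may be negative, as the metric is indefinite. With \<open>B\<close> a
    bound for its absolute value and \<open>\<epsilon> \<le> 1\<close>, this choice gives
    \<open>t^2 B \<le> \<epsilon> B < 1\<close>, so the squared length stays positive.\<close>
  define \<epsilon> where "\<epsilon> = 1 / (1 + B)"
  have e: "\<epsilon> > 0" "\<epsilon> \<le> 1" "\<epsilon> * B < 1" using B(2) by (auto simp: \<epsilon>_def divide_less_eq)
  have pos: "1 + t * t * \<gamma> p > 0" if t: "t \<in> {-\<epsilon><..<\<epsilon>}" for t p
  proof -
    have "\<bar>t * t * \<gamma> p\<bar> = (\<bar>t\<bar> * \<bar>t\<bar>) * \<bar>\<gamma> p\<bar>" by (simp add: abs_mult)
    also have "\<dots> \<le> (\<epsilon> * 1) * B"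
      by (intro mult_mono B) (use t e in auto)
    finally have "\<bar>t * t * \<gamma> p\<bar> < 1" using e(3) by simp
    then show ?thesis by (simp add: abs_less_iff)
  qed
  \<comment> \<open>As \<open>Y\<close> is orthogonal to the unit field \<xi>, the squared length of
    \<open>\<xi> + t Y\<close> is \<open>1 + t^2 \<gamma>\<close>. It is even in \<open>t\<close>,
    so the normalising factor is stationary at 0 and the velocity is exactly
    \<open>Y\<close>.\<close>
  define \<alpha> where "\<alpha> t p = (1 + t * t * \<gamma> p) powr (- 1/2)" for t p
  define W where "W t p = \<alpha> t p *\<^sub>v (\<xi> p + t *\<^sub>v Y p)" for t p
  have \<alpha>_sq: "\<alpha> t p * \<alpha> t p * (1 + t * t * \<gamma> p) = 1" if "t \<in> {-\<epsilon><..<\<epsilon>}" for t p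
  proof -
    have "\<alpha> t p * \<alpha> t p = (1 + t * t * \<gamma> p) powr (- 1)" unfolding \<alpha>_def powr_add[symmetric] by simp
    then show ?thesis using pos[OF that, of p] by (simp add: powr_minus)
  qed
  have sf: "smooth_on (snd c ` (U \<inter> fst c)) (\<lambda>x. f (chart_inv c x))" if "smooth_fun A U f" "c \<in> A" for U f c
    using that unfolding smooth_fun_def o_def by blast
  have "length_variation A g 1 K \<epsilon> \<xi> W"
    unfolding length_variation_def
  proof (intro conjI ballI allI impI)
    show "W 0 = \<xi>" by (auto simp: W_def \<alpha>_def vscale_simps fun_eq_iff vscale_def)
    fix t assume t: "t \<in> {-\<epsilon><..<\<epsilon>}"
    have "smooth_fun A UNIV (\<alpha> t)"
      unfolding smooth_fun_def o_def \<alpha>_def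
      by (intro ballI smooth_on_powr smooth_on_add smooth_on_mult smooth_on_const open_chart_image open_UNIV sf[OF \<gamma>s] pos[OF t])
    then show "smooth_vf A UNIV (W t)"
      unfolding W_def
      using smooth_vf_scale[OF _ smooth_vf_add[OF xi_smooth smooth_vf_scale[OF smooth_fun_const[OF open_UNIV] Y]]]
      by (simp add: plus_fun_def)
    show "g p (W t p) (W t p) = 1" for p
    proof -
      have tY: "t *\<^sub>v Y p \<in> tangent_space A p" and s: "\<xi> p + t *\<^sub>v Y p \<in> tangent_space A p"
        by (intro tangent_closed xi_tangent Yt)+
      have g2: "g p u (a *\<^sub>v v) = a * g p u v" "g p u (v + w) = g p u v + g p u w"
        if "u \<in> tangent_space A p" "v \<in> tangent_space A p" "w \<in> tangent_space A p" for u v w a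
        using that g_scale[of v p w u] g_add[of v p w u] g_sym tangent_closed by metis+
      have "g p (\<xi> p + t *\<^sub>v Y p) (\<xi> p + t *\<^sub>v Y p) = 1 + t * t * \<gamma> p"
        using xi_unit orth g_sym[OF Yt xi_tangent xi_tangent]
        by (simp add: g_add[OF xi_tangent tY s] g2[OF xi_tangent xi_tangent tY] g2[OF tY xi_tangent tY]
            g_scale[OF Yt xi_tangent xi_tangent] g_scale[OF Yt Yt tY] g_scale[OF Yt tY tY] g2(1)[OF xi_tangent Yt Yt] g2(1)[OF Yt Yt Yt] \<gamma>_def)
      then show ?thesis
        using \<alpha>_sq[OF t, of p] tangent_closed(2)[OF s]
        by (simp add: W_def g_scale[OF s tangent_closed(2)[OF s] tangent_closed(2)[OF s]] g2(1)[OF s s s] mult.assoc)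
    qed
    show "W t p = \<xi> p" if "p \<notin> K" for p
      using Y0[OF that] \<gamma>0[OF that] by (auto simp: W_def \<alpha>_def vscale_simps fun_eq_iff vscale_def)
  next
    fix c U f assume c: "c \<in> A" and Uf: "open U \<and> smooth_fun A U f"
    let ?N = "snd c ` (U \<inter> fst c)"
    have oN: "open ?N" using open_chart_image[OF c] Uf by blast
    have oI: "open {-\<epsilon><..<\<epsilon>}" by simp
    have Q: "open ({-\<epsilon><..<\<epsilon>} \<times> ?N)" by (rule open_Times[OF oI oN])
    have s1: "smooth_fun A U (\<lambda>p. \<xi> p f)" "smooth_fun A U (\<lambda>p. Y p f)"
      using xi_smooth Y Uf unfolding smooth_vf_def by blast+
    have s2: "smooth_fun A U \<gamma>" by (rule smooth_fun_mono[OF \<gamma>s]) simp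
    have t: "smooth_on ({-\<epsilon><..<\<epsilon>} \<times> ?N) fst"
      using smooth_on_bounded_linear[OF bounded_linear_fst Q smooth_on_ident[OF Q]] by simp
    note j = smooth_on_snd[OF sf[OF _ c] oN oI]
    have "smooth_on ({-\<epsilon><..<\<epsilon>} \<times> ?N) (\<lambda>z. (1 + fst z * fst z * \<gamma> (chart_inv c (snd z))) powr (- 1/2) *
        (\<xi> (chart_inv c (snd z)) f + fst z * Y (chart_inv c (snd z)) f))"
      by (intro smooth_on_mult smooth_on_powr smooth_on_add smooth_on_const Q t j[OF s1(1)] j[OF s1(2)] j[OF s2])
        (use pos in auto)
    then show "smooth_on ({-\<epsilon><..<\<epsilon>} \<times> ?N) (\<lambda>(t, x). W t (chart_inv c x) f)"
      by (simp add: W_def \<alpha>_def vscale_def case_prod_unfold)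
  qed
  moreover have "variation_field W p f = Y p f" for p f
  proof -
    have "((\<lambda>t. W t p f) has_real_derivative Y p f) (at 0)"
      unfolding W_def \<alpha>_def vscale_def plus_fun_apply
      by (auto intro!: derivative_eq_intros)
    then show ?thesis by (simp add: variation_field_def DERIV_imp_deriv)
  qed
  then have "variation_field W = Y" by (simp add: fun_eq_iff)
  ultimately show ?thesis using that e(1) by blast
qed

lemma harmonic_of_delta_zero:
  assumes "\<forall>p. \<forall>v\<in>tangent_space A p. delta p v = 0"
  shows "H_paracontact A g nabla \<mu> \<xi>"
  unfolding H_paracontact_def harmonic_vf_def
proof (intro conjI exI[of _ 1] allI impI)
  fix D K \<epsilon> W
  assume *: "open D \<and> compact (closure D) \<and> compact K \<and> K \<subseteq> D \<and> 0 < \<epsilon> \<and> length_variation A g 1 K \<epsilon> \<xi> W"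
  then have ev: "energy_variation A g nabla \<mu> 1 \<epsilon> K \<xi> W"
    by (intro energy_variation.intro vol_mfd_axioms energy_variation_axioms.intro) auto
  interpret E: energy_variation A g nabla \<mu> 1 \<epsilon> K \<xi> W by (rule ev)
  have "integral\<^sup>L \<mu> E.first_var = 0"
    unfolding energy_derivative[OF ev] using assms smooth_vf_tangent[OF E.variation_field_smooth] by simp
  then show "((\<lambda>t. energy A g nabla \<mu> D (W t)) has_real_derivative 0) (at 0)"
    using E.first_variation[of D] * by simp
qed (use xi_smooth xi_unit in auto)

text \<open>If \<open>delta\<close> were nonzero on \<open>v\<close>, removing the component along
  \<xi> would not change its value, so some field orthogonal to \<xi> would give
  \<open>delta\<close> a fixed sign near \<open>p\<close>. Cut off, that field is the velocity of an
  admissible variation along which the energy has nonzero derivative.\<close>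

lemma delta_zero_of_harmonic:
  assumes H: "H_paracontact A g nabla \<mu> \<xi>" and xi: "\<And>p. delta p (\<xi> p) = 0" and v: "v \<in> tangent_space A p"
  shows "delta p v = 0"
proof (rule ccontr)
  assume ne: "delta p v \<noteq> 0"
  obtain c where c: "c \<in> A" "p \<in> fst c" using ex_chart by blast
  interpret C: coord_metric "snd c ` fst c" "cG c" "cGam c" by (rule coord_metric[OF c(1)])
  define s where "s = sgn (delta p v)"
  \<comment> \<open>The field with the constant components of \<open>v\<close>, projected to the
    orthogonal complement of \<xi>.\<close>
  define z where "z y = tcoords c v - cG c y (coords c \<xi> y) (tcoords c v) *\<^sub>R coords c \<xi> y" for y
  define Z where "Z = cfield c z"
  note k = smooth_on_const[OF open_img[OF c(1)]]
  have "smooth_on (snd c ` fst c) z"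
    unfolding z_def[abs_def]
    by (intro smooth_on_diff smooth_on_scaleR open_img[OF c(1)] k xi_coords_smooth[OF c(1)]
        C.smooth_on_G[OF C.open_N_N xi_coords_smooth[OF c(1)] k])
  then have Zs: "smooth_vf A (fst c) Z"
    unfolding Z_def by (rule smooth_cfield[OF c(1) open_dom[OF c(1)] order_refl])
  have Z0: "Z q = 0" if "q \<notin> fst c" for q using that by (simp add: Z_def cfield_def)
  have Zt: "Z q \<in> tangent_space A q" for q
    using smooth_vf_tangent[OF Zs] Z0 tangent_closed(4) by (cases "q \<in> fst c") auto
  have Zorth: "g q (\<xi> q) (Z q) = 0" for q
  proof (cases "q \<in> fst c")
    case True
    have y: "snd c q \<in> snd c ` fst c" using True by auto
    interpret G: indef_inner "cG c (snd c q)" by (rule cG_inner[OF c(1) y])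
    have "coords c \<xi> (snd c q) = tcoords c (\<xi> q)" by (rule coords_at[OF c(1) open_dom[OF c(1)] order_refl True])
    moreover have "cG c (snd c q) (tcoords c (\<xi> q)) (tcoords c (\<xi> q)) = 1"
      using cG_coords[OF c(1) True xi_tangent xi_tangent] xi_unit by simp
    ultimately show ?thesis
      using cG_coords[OF c(1) True xi_tangent Zt]
      by (simp add: Z_def cfield_def True tcoords_coord_vec[OF c(1) True] z_def G.bsimps)
  next
    case False
    then show ?thesis
      using Z0 g_scale[OF xi_tangent xi_tangent xi_tangent, of q 0] g_sym[OF tangent_closed(4) xi_tangent xi_tangent, of q]
      by (simp add: vscale_simps)
  qed
  have "Z p = v - cG c (snd c p) (coords c \<xi> (snd c p)) (tcoords c v) *\<^sub>v \<xi> p"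
    using c(2) by (simp add: Z_def cfield_def z_def coord_vec_linear[OF c(1)] tangent_coords[OF c(1) c(2)] v xi_tangent
        coords_at[OF c(1) open_dom[OF c(1)] order_refl c(2)])
  then have "delta p (Z p) = delta p v"
    using delta_diff[OF v tangent_closed(2)[OF xi_tangent]] delta_scale[OF xi_tangent] xi by simp
  then have sp: "s * delta p (Z p) > 0" using ne by (simp add: s_def sgn_real_def)
  define F where "F q = s * delta q (Z q)" for q
  have Fs: "smooth_fun A (fst c) F"
    unfolding F_def by (intro smooth_fun_mult smooth_fun_const open_dom[OF c(1)] delta_smooth_chart[OF c(1)] order_refl Zs)
  have Fc: "continuous_on (fst c) F"
  proof -
    have "continuous_on (snd c ` fst c) (F \<circ> chart_inv c)"
      using smooth_on_continuous smooth_fun_chart[OF c(1) open_dom[OF c(1)] order_refl] Fs by blast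
    from continuous_on_compose[OF continuous_on_chart[OF c(1)] this]
    show ?thesis by (rule continuous_on_cong[THEN iffD1, rotated -1]) (auto simp: chart_inv_left[OF c(1)])
  qed
  define O1 where "O1 = F -` {0<..} \<inter> fst c"
  have O1: "open O1" "p \<in> O1"
    using continuous_open_preimage[OF Fc open_dom[OF c(1)] open_greaterThan, of 0] sp c(2)
    by (simp_all add: O1_def F_def Int_commute)
  \<comment> \<open>Two nested cutoffs: the first provides an open \<open>D\<close> with compact
    closure inside the region where \<open>F > 0\<close>, the second a function with compact support
    \<open>K\<close> inside \<open>D\<close>, as required of a variation.\<close>
  obtain c1 \<psi>1 D C1 where D: "p \<in> D" "open D" and C1: "compact C1" "C1 \<subseteq> O1"
    and \<psi>1: "\<And>q. q \<in> D \<Longrightarrow> \<psi>1 q = (1::real)" "\<And>q. q \<notin> C1 \<Longrightarrow> \<psi>1 q = 0"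
    by (rule cutoff_fun[OF O1]) blast
  have DC: "D \<subseteq> C1" using \<psi>1 by force
  have cD: "compact (closure D)"
  proof -
    have "closure D \<subseteq> C1" by (rule closure_minimal[OF DC compact_imp_closed[OF C1(1)]])
    then show ?thesis using compact_Int_closed[OF C1(1) closed_closure[of D]] by (simp add: inf.absorb2)
  qed
  obtain c2 \<psi> U K where U: "p \<in> U" and K: "compact K" "K \<subseteq> D" and \<psi>: "smooth_fun A UNIV \<psi>" "\<And>q. \<psi> q \<ge> 0"
    "\<And>q. q \<in> U \<Longrightarrow> \<psi> q = 1" "\<And>q. q \<notin> K \<Longrightarrow> \<psi> q = 0"
    by (rule cutoff_fun[OF D(2,1)]) blast
  have KO: "K \<subseteq> O1" using K(2) DC C1(2) by blast
  define Y where "Y q = (\<psi> q * s) *\<^sub>v Z q" for q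
  have Y0: "Y q = 0" if "q \<notin> K" for q using \<psi>(4)[OF that] by (simp add: Y_def vscale_simps)
  have Ys: "smooth_vf A UNIV Y"
  proof (rule smooth_vf_local)
    fix q
    have o: "open (- K)" using compact_imp_closed[OF K(1)] by auto
    have "smooth_vf A (fst c) Y"
      unfolding Y_def
      by (intro smooth_vf_scale smooth_fun_mult smooth_fun_const open_dom[OF c(1)] smooth_fun_mono[OF \<psi>(1)] Zs) simp
    moreover have "smooth_vf A (- K) Y"
      by (rule smooth_vf_cong[OF smooth_vf_zero[OF o]]) (use Y0 in simp)
    moreover have "K \<subseteq> fst c" using KO by (auto simp: O1_def)
    ultimately show "\<exists>V. open V \<and> q \<in> V \<and> smooth_vf A V Y"
      using open_dom[OF c(1)] o by (cases "q \<in> fst c") blast+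
  qed
  have Yorth: "g q (\<xi> q) (Y q) = 0" for q
    using g_sym[OF xi_tangent tangent_closed(2)[OF Zt] xi_tangent] g_scale[OF Zt xi_tangent xi_tangent] g_sym[OF Zt xi_tangent xi_tangent] Zorth
    by (simp add: Y_def)
  obtain \<epsilon> W where eW: "\<epsilon> > 0" "length_variation A g 1 K \<epsilon> \<xi> W" "variation_field W = Y"
    by (rule normalized_variation[OF Ys K(1) Y0 Yorth])
  have ev: "energy_variation A g nabla \<mu> 1 \<epsilon> K \<xi> W"
    by (intro energy_variation.intro vol_mfd_axioms energy_variation_axioms.intro eW(1,2) K(1))
  interpret E: energy_variation A g nabla \<mu> 1 \<epsilon> K \<xi> W by (rule ev)
  obtain r where r: "\<forall>q. g q (\<xi> q) (\<xi> q) = r"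
    "\<forall>D K \<epsilon> W. open D \<and> compact (closure D) \<and> compact K \<and> K \<subseteq> D \<and> 0 < \<epsilon> \<and> length_variation A g r K \<epsilon> \<xi> W \<longrightarrow>
      ((\<lambda>t. energy A g nabla \<mu> D (W t)) has_real_derivative 0) (at 0)"
    using H unfolding H_paracontact_def harmonic_vf_def by blast
  have "r = 1" using r(1) xi_unit by simp
  then have "((\<lambda>t. energy A g nabla \<mu> D (W t)) has_real_derivative 0) (at 0)"
    using r(2) D(2) cD K eW by blast
  from DERIV_unique[OF this E.first_variation[OF D(2) cD K(2)]]
  have int0: "integral\<^sup>L \<mu> (\<lambda>q. delta q (Y q)) = 0"
    using energy_derivative[OF ev] eW(3) by simp
  have dY: "delta q (Y q) = \<psi> q * F q" for q
    by (simp add: Y_def delta_scale[OF Zt] F_def)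
  have "integral\<^sup>L \<mu> (\<lambda>q. delta q (Y q)) > 0"
  proof (rule integral_pos[OF smooth_fun_continuous[OF delta_smooth[OF Ys]] K(1)])
    show "delta q (Y q) = 0" if "q \<notin> K" for q using \<psi>(4)[OF that] by (simp add: dY)
    show "delta q (Y q) \<ge> 0" for q
    proof (cases "q \<in> K")
      case True
      then have "F q > 0" using KO by (auto simp: O1_def)
      then show ?thesis using \<psi>(2)[of q] by (simp add: dY)
    qed (simp add: dY \<psi>(4))
    show "delta p (Y p) > 0" using \<psi>(3)[OF U] sp by (simp add: dY F_def)
  qed
  then show False using int0 by simp
qed

end

theorem theorem5p1:
  fixes A :: "('m::{t2_space, second_countable_topology}, 'd::finite) chart set"
    and n :: nat
    and \<phi> :: "'m \<Rightarrow> 'm tvec \<Rightarrow> 'm tvec"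
    and \<xi> :: "'m vfield"
    and \<eta> :: "'m \<Rightarrow> 'm tvec \<Rightarrow> real"
    and g :: "'m \<Rightarrow> 'm tvec \<Rightarrow> 'm tvec \<Rightarrow> real"
    and nabla :: "'m vfield \<Rightarrow> 'm vfield \<Rightarrow> 'm vfield"
    and \<mu> :: "'m measure"
  assumes manifold: "smooth_manifold A"
    and dim: "CARD('d) = 2 * n + 1"
    and paracontact: "paracontact_metric_structure A n \<phi> \<xi> \<eta> g"
    and connection: "levi_civita A g nabla"
    and volume: "volume_measure A g \<mu>"
  shows "((\<forall>p. ricci_operator A g nabla p (\<xi> p) = (- 2 * real n) *\<^sub>v \<xi> p) \<longleftrightarrow>
            infinitesimal_harmonic A g nabla \<xi>) \<and>
         (infinitesimal_harmonic A g nabla \<xi> \<longleftrightarrow>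
            H_paracontact A g nabla \<mu> \<xi> \<and>
            (\<forall>p. endo_trace A p (\<lambda>v. paracontact_h A \<phi> \<xi> p (paracontact_h A \<phi> \<xi> p v)) = 0))"
proof -
  have metric: "semi_riemannian_metric A g"
    using paracontact by (simp add: paracontact_metric_structure_def)
  interpret pc_mfd A g nabla \<mu> n \<phi> \<xi> \<eta>
    using manifold metric connection volume dim paracontact by unfold_locales
  \<comment> \<open>After rewriting, the third assertion says that \<open>delta\<close> vanishes at
    \<xi> and that \<xi> is critical; the latter gives vanishing on all tangent vectors only in the
    presence of the former.\<close>
  show ?thesis
    unfolding ricci_operator_iff infinitesimal_harmonic_iff trace_h_squared
    using harmonic_of_delta_zero delta_zero_of_harmonic xi_tangent by blast
qed

end
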